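(* Consider the spectral problem $$\lambda\Delta\psi=-\mu\Delta\psi+\nu\Delta^2\psi+J(\psi_0,(2+\Delta)\psi),\qquad 0\neq\psi=\sum_{n,m\ge1}a_{n,m}\sin\frac{nx}{2}\sin\frac{my}{2}\in H^4, \qquad ( * )$$ where $\psi_0=\sin x\sin y$ and $\lambda,\nu,\mu$ are real. (i) Let $\nu>0$, $\mu\ge0$ and $\lambda+\mu+\frac12\nu>0$. Then the spectral problem $( * )$ has at most three linearly independent eigenfunctions. These eigenfunctions are contained in the set $E_1\cup E_2\cup E_3$. (ii) Assume that $( * )$ admits a critical solution $(\lambda,\psi,\nu,\mu)=(0,\psi_c,\nu_c,\mu_c)$ with $\nu_c>0$, $\mu_c\ge0$ and $\psi_c\in E_i$ for an integer $1\le i\le3$. Then, provided that $\epsilon>0$ is sufficiently small, there exist a function $\psi_i\in H^4$ and a real number $\delta$ (both depending on $\epsilon$) so that the system $$-\frac{\partial\Delta\psi}{\partial t}+J(\psi,\Delta\psi)+(-\mu\Delta+\nu\Delta^2)(\psi-\sin x\sin y)=0\ \text{ in }\Omega,\qquad \psi|_{\partial\Omega}=\Delta\psi|_{\partial\Omega}=0,$$ has a steady-state solution $(\psi,\nu,\mu)$ branching off the bifurcation point $(\psi_0,\nu_c,\mu_c)$ in the direction of $\psi_c$: $$\psi=\psi_0+\epsilon\psi_c+\epsilon^2\psi_i,\qquad \nu=\nu_c+\epsilon\delta\nu_c,\qquad \mu=\mu_c+\epsilon\delta\mu_c.$$ Here $\delta$ and $\psi_i$ are uniformly bounded functions of $\epsilon$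 for small $\epsilon>0$ (with $\psi_i$ bounded in the $H^4$ norm), and $\psi_i$ is in the orthogonal complement of the eigenfunction space $\mathrm{span}\{\psi_c\}$, that is, $\psi_i\in H^4$ and $(\psi_i,\psi_c)=0$.
   Context: $\Omega=(0,2\pi)\times(0,2\pi)$. All functions and coefficients are real. $J(\varphi,\phi)=\partial_x\varphi\,\partial_y\phi-\partial_y\varphi\,\partial_x\phi$. The basic flow is $\psi_0=\sin x\sin y$; it is a steady-state solution of the system in (ii) for all $\nu,\mu$. $H^4$ is the Hilbert space of functions $\psi=\sum_{n,m\ge1}a_{n,m}\sin\frac{nx}{2}\sin\frac{my}{2}$ with $$\|\psi\|_{H^4}=\Big(\sum_{n,m\ge1}\Big(1+\big(\tfrac{n^2+m^2}{4}\big)^2\Big)^2|a_{n,m}|^2\Big)^{1/2}<\infty .$$ Functions in $H^4$ satisfy the free slip boundary condition $\psi|_{\partial\Omega}=\Delta\psi|_{\partial\Omega}=0$ by virtue of the sine expansion. $E_1$, $E_2$, $E_3$ are the subspaces of those $\psi\in H^4$ whose expansion contains only modes with, respectively: $n$ and $m$ both odd ($E_1$); $n$ odd and $m$ even ($E_2$); $n$ even and $m$ odd ($E_3$) (always $n,m\ge1$). $(\varphi,\phi)=\frac1{\pi^2}\int_0^{2\pi}\int_0^{2\pi}\varphi\phi\,dx\,dy$ is the $L_2$ inner product. An eigenfunction is a nonzero $\psi\in H^4$ satisfying the equation in $( * )$; a critical solution is one with $\lambda=0$. *)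

theory Defs
  imports "HOL-Analysis.Analysis" "HOL-Library.Function_Algebras"
begin

section \<open>Functions on the square and weak derivatives\<close>

type_synonym plane_fun = "real \<times> real \<Rightarrow> real"

definition Omega :: "(real \<times> real) set" where
  "Omega = {0<..<2*pi} \<times> {0<..<2*pi}"

text \<open>As usual for derivatives of order one, continuously differentiable test
  functions with compact support are used; this gives the same weak derivatives as
  smooth ones.\<close>

definition test_function :: "plane_fun \<Rightarrow> bool" where
  "test_function \<eta> \<longleftrightarrow>
     (\<forall>z. \<eta> differentiable (at z)) \<and>
     (\<forall>e. continuous_on UNIV (\<lambda>z. frechet_derivative \<eta> (at z) e)) \<and>
     compact (closure {z. \<eta> z \<noteq> 0}) \<and> closure {z. \<eta> z \<noteq> 0} \<subseteq> Omega"

definition locally_integrable :: "plane_fun \<Rightarrow> bool" where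
  "locally_integrable f \<longleftrightarrow> (\<forall>K. compact K \<and> K \<subseteq> Omega \<longrightarrow> set_integrable lborel K f)"

definition has_weak_derivative :: "real \<times> real \<Rightarrow> plane_fun \<Rightarrow> plane_fun \<Rightarrow> bool" where
  "has_weak_derivative e f g \<longleftrightarrow>
     locally_integrable f \<and> locally_integrable g \<and>
     (\<forall>\<eta>. test_function \<eta> \<longrightarrow>
        (LINT z:Omega|lborel. f z * frechet_derivative \<eta> (at z) e) =
        - (LINT z:Omega|lborel. g z * \<eta> z))"

text \<open>A weak derivative is determined only almost everywhere in \<open>Omega\<close>. The choice
  below picks one representative, so its values are meaningful only in almost-everywhere
  statements on \<open>Omega\<close>, and only if a weak derivative exists. For a function in
  \<open>H4\<close> (below) all the derivatives of order at most four that occur do exist.\<close>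

definition weak_derivative :: "real \<times> real \<Rightarrow> plane_fun \<Rightarrow> plane_fun" where
  "weak_derivative e f = (SOME g. has_weak_derivative e f g)"

definition partial_x :: "plane_fun \<Rightarrow> plane_fun" where
  "partial_x = weak_derivative (1, 0)"

definition partial_y :: "plane_fun \<Rightarrow> plane_fun" where
  "partial_y = weak_derivative (0, 1)"

definition laplacian :: "plane_fun \<Rightarrow> plane_fun" where
  "laplacian f = (\<lambda>z. partial_x (partial_x f) z + partial_y (partial_y f) z)"

definition Jacobian :: "plane_fun \<Rightarrow> plane_fun \<Rightarrow> plane_fun" where
  "Jacobian f g = (\<lambda>z. partial_x f z * partial_y g z - partial_y f z * partial_x g z)"

definition L2_inner :: "plane_fun \<Rightarrow> plane_fun \<Rightarrow> real" where
  "L2_inner f g = (1 / pi\<^sup>2) * (LINT z:Omega|lborel. f z * g z)"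

text \<open>Boundary values are those of a continuous extension to the closed square, which
  is necessary because \<open>laplacian f\<close> is given only almost everywhere in \<open>Omega\<close>.\<close>

definition vanishes_on_boundary :: "plane_fun \<Rightarrow> bool" where
  "vanishes_on_boundary f \<longleftrightarrow>
     (\<exists>g. continuous_on (closure Omega) g \<and>
          (AE z in lborel. z \<in> Omega \<longrightarrow> g z = f z) \<and>
          (\<forall>z \<in> frontier Omega. g z = 0))"


section \<open>The space \<open>H4\<close>\<close>

text \<open>A sine series with square summable weighted coefficients converges absolutely at
  every point of the plane. Elements of \<open>H4\<close> are taken to be its sum on the whole plane
  (the odd \<open>4\<pi>\<close>-periodic extension of the function on the square), so that equality of
  functions in HOL is equality on the square.\<close>

definition modes :: "(nat \<times> nat) set" where
  "modes = {1..} \<times> {1..}"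

definition sine_mode :: "nat \<times> nat \<Rightarrow> plane_fun" where
  "sine_mode = (\<lambda>(n, m) (x, y). sin (real n * x / 2) * sin (real m * y / 2))"

definition H4_weight :: "nat \<times> nat \<Rightarrow> real" where
  "H4_weight = (\<lambda>(n, m). 1 + (((real n)\<^sup>2 + (real m)\<^sup>2) / 4)\<^sup>2)"

definition sine_expansion :: "plane_fun \<Rightarrow> (nat \<times> nat \<Rightarrow> real) \<Rightarrow> bool" where
  "sine_expansion \<psi> a \<longleftrightarrow>
     (\<lambda>k. (H4_weight k)\<^sup>2 * \<bar>a k\<bar>\<^sup>2) summable_on modes \<and>
     (\<forall>z. ((\<lambda>k. a k * sine_mode k z) has_sum \<psi> z) modes)"

definition H4 :: "plane_fun set" where
  "H4 = {\<psi>. \<exists>a. sine_expansion \<psi> a}"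

text \<open>The coefficients are unique on \<open>modes\<close>; the values elsewhere play no role.\<close>

definition sine_coeff :: "plane_fun \<Rightarrow> nat \<times> nat \<Rightarrow> real" where
  "sine_coeff \<psi> = (SOME a. sine_expansion \<psi> a)"

definition H4_norm :: "plane_fun \<Rightarrow> real" where
  "H4_norm \<psi> = sqrt (\<Sum>\<^sub>\<infinity>k\<in>modes. (H4_weight k)\<^sup>2 * \<bar>sine_coeff \<psi> k\<bar>\<^sup>2)"

definition E1 :: "plane_fun set" where
  "E1 = {\<psi> \<in> H4. \<forall>(n, m) \<in> modes. sine_coeff \<psi> (n, m) \<noteq> 0 \<longrightarrow> odd n \<and> odd m}"

definition E2 :: "plane_fun set" where
  "E2 = {\<psi> \<in> H4. \<forall>(n, m) \<in> modes. sine_coeff \<psi> (n, m) \<noteq> 0 \<longrightarrow> odd n \<and> even m}"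

definition E3 :: "plane_fun set" where
  "E3 = {\<psi> \<in> H4. \<forall>(n, m) \<in> modes. sine_coeff \<psi> (n, m) \<noteq> 0 \<longrightarrow> even n \<and> odd m}"


section \<open>The spectral problem and steady states\<close>

definition psi0 :: plane_fun where
  "psi0 = (\<lambda>(x, y). sin x * sin y)"

definition spectral_equation :: "real \<Rightarrow> real \<Rightarrow> real \<Rightarrow> plane_fun \<Rightarrow> bool" where
  "spectral_equation lam \<nu> \<mu> \<psi> \<longleftrightarrow>
     (AE z in lborel. z \<in> Omega \<longrightarrow>
        lam * laplacian \<psi> z =
          - \<mu> * laplacian \<psi> z + \<nu> * laplacian (laplacian \<psi>) z
          + Jacobian psi0 (\<lambda>w. 2 * \<psi> w + laplacian \<psi> w) z)"

definition eigenfunction :: "real \<Rightarrow> real \<Rightarrow> real \<Rightarrow> plane_fun \<Rightarrow> bool" where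
  "eigenfunction lam \<nu> \<mu> \<psi> \<longleftrightarrow>
     \<psi> \<in> H4 \<and> \<psi> \<noteq> (\<lambda>_. 0) \<and> spectral_equation lam \<nu> \<mu> \<psi>"

definition critical_solution :: "real \<Rightarrow> real \<Rightarrow> plane_fun \<Rightarrow> bool" where
  "critical_solution \<nu> \<mu> \<psi> \<longleftrightarrow> eigenfunction 0 \<nu> \<mu> \<psi>"

text \<open>For a time-independent \<open>\<psi>\<close> the term \<open>- \<partial>\<Delta>\<psi>/\<partial>t\<close> of the evolution equation is zero.\<close>

definition steady_state :: "real \<Rightarrow> real \<Rightarrow> plane_fun \<Rightarrow> bool" where
  "steady_state \<nu> \<mu> \<psi> \<longleftrightarrow>
     \<psi> \<in> H4 \<and>
     (AE z in lborel. z \<in> Omega \<longrightarrow>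
        Jacobian \<psi> (laplacian \<psi>) z
        + (- \<mu> * laplacian (\<lambda>w. \<psi> w - psi0 w) z
           + \<nu> * laplacian (laplacian (\<lambda>w. \<psi> w - psi0 w)) z) = 0) \<and>
     vanishes_on_boundary \<psi> \<and> vanishes_on_boundary (laplacian \<psi>)"

text \<open>Real-valued functions as a real vector space, for linear independence and span.\<close>

interpretation plane_vs: vector_space "\<lambda>(c::real) (f::plane_fun) z. c * f z"
  by unfold_locales (auto simp: fun_eq_iff algebra_simps)

end

theory Submission
  imports Defs
begin

text \<open>The Jacobian with \<open>\<psi>\<^sub>0\<close> is a skew operator \<open>B\<close> and the linear problem is
  \<open>(\<lambda> + \<mu>) \<kappa> + \<nu> \<kappa>\<^sup>2 + B (2 - \<kappa>)\<close>, where \<open>\<kappa> = (n\<^sup>2 + m\<^sup>2) / 4\<close> represents \<open>- \<Delta>\<close>. Testing an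
  eigenfunction with \<open>(2 - \<kappa>) \<psi>\<close> removes \<open>B\<close>, so an eigenfunction without modes \<open>\<kappa> < 2\<close> vanishes.
  Those modes are \<open>(1,1)\<close>, \<open>(1,2)\<close>, \<open>(2,1)\<close>, one in each of \<open>E1\<close>, \<open>E2\<close>, \<open>E3\<close>, and \<open>B\<close> preserves parities.

  For the bifurcation, dropping the single mode \<open>\<kappa> < 2\<close> of the parity class from \<open>B (2 - \<kappa>)\<close> leaves an
  operator of the form (identity minus skew) up to a diagonal conjugation, which is invertible, so
  that the critical linearisation is a rank-one perturbation of an isomorphism. A reflection that changes the
  sign of \<open>B\<close> and fixes that mode maps the critical solution to (a multiplier of) the adjoint one, and
  the energy identity for the difference of the two gives transversality with respect to
  the factor \<open>1 + \<epsilon> \<delta>\<close> of \<open>(\<nu>, \<mu>)\<close>. The branch is then a fixed point of a contraction.\<close>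

text \<open>The unknown is chosen so that nothing unbounded is left: for \<open>u = diss * c\<close>
  in l2, membership of the function in \<open>H4\<close> is automatic, all operators are bounded,
  and the derivative of the equation by the common factor of \<nu> and \<mu> is \<open>u\<close>
  itself. Only two kinds of operators are ever inverted, identity minus skew (by a contraction) and
  a rank-one correction of it. In part (ii) the (even, even) modes have to be carried along, since
  two modes of one class multiply into them. This does no harm: they start at (2,2), where
  \<open>kap\<close> is exactly 2, so the enlarged class still has a single mode below 2. The
  analytic obstacle is that derivatives are weak and picked by \<open>SOME\<close>, so the equations
  hold almost everywhere only. They are compared with equations for coefficients through convergence
  in mean, and the way back needs completeness of the sines among integrable functions, since the
  Jacobian is controlled in mean only.\<close>

lemma summable_on_mult_squares:
  fixes f g :: "'a \<Rightarrow> real"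
  assumes "(\<lambda>k. (f k)\<^sup>2) summable_on A" "(\<lambda>k. (g k)\<^sup>2) summable_on A"
  shows "(\<lambda>k. f k * g k) summable_on A"
proof -
  have "(\<lambda>k. (f k)\<^sup>2 + (g k)\<^sup>2) summable_on A"
    using assms by (rule summable_on_add)
  moreover have "norm (f k * g k) \<le> (f k)\<^sup>2 + (g k)\<^sup>2" for k
  proof -
    have "0 \<le> (\<bar>f k\<bar> - \<bar>g k\<bar>)\<^sup>2" by simp
    then have "2 * (\<bar>f k\<bar> * \<bar>g k\<bar>) \<le> (f k)\<^sup>2 + (g k)\<^sup>2"
      by (simp add: power2_diff)
    moreover have "0 \<le> \<bar>f k\<bar> * \<bar>g k\<bar>" by simp
    ultimately have "\<bar>f k\<bar> * \<bar>g k\<bar> \<le> (f k)\<^sup>2 + (g k)\<^sup>2" by linarith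
    then show ?thesis by (simp add: abs_mult)
  qed
  ultimately have "(\<lambda>k. norm (f k * g k)) summable_on A"
    by (intro summable_on_comparison_test[of _ _ "\<lambda>k. norm (f k * g k)"]) auto
  then show ?thesis
    by (rule abs_summable_summable)
qed

lemma summable_on_square_add:
  fixes f g :: "'a \<Rightarrow> real"
  assumes "(\<lambda>k. (f k)\<^sup>2) summable_on A" "(\<lambda>k. (g k)\<^sup>2) summable_on A"
  shows "(\<lambda>k. (f k + g k)\<^sup>2) summable_on A"
proof -
  have "(\<lambda>k. ((f k)\<^sup>2 + (g k)\<^sup>2) + 2 * (f k * g k)) summable_on A"
    by (intro summable_on_add summable_on_cmult_right assms summable_on_mult_squares)
  then show ?thesis by (simp add: power2_sum algebra_simps)
qed

section \<open>The Hilbert space of square summable families\<close>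

typedef 'a l2 = "{f :: 'a \<Rightarrow> real. (\<lambda>k. (f k)\<^sup>2) summable_on UNIV}"
  morphisms coord Abs_l2
  by (rule exI[of _ "\<lambda>_. 0"]) simp

setup_lifting type_definition_l2

lemma summable_coord_square: "(\<lambda>k. (coord u k)\<^sup>2) summable_on UNIV"
  using coord[of u] by simp

lemma coord_Abs_l2: "(\<lambda>k. (f k)\<^sup>2) summable_on UNIV \<Longrightarrow> coord (Abs_l2 f) = f"
  by (simp add: Abs_l2_inverse)

lemma l2_eqI: "(\<And>k. coord u k = coord v k) \<Longrightarrow> u = v"
  by (simp add: coord_inject[symmetric] fun_eq_iff)

instantiation l2 :: (type) real_vector
begin

lift_definition zero_l2 :: "'a l2" is "\<lambda>_. 0" by simp
lift_definition plus_l2 :: "'a l2 \<Rightarrow> 'a l2 \<Rightarrow> 'a l2" is "\<lambda>f g k. f k + g k"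
  by (rule summable_on_square_add)
lift_definition scaleR_l2 :: "real \<Rightarrow> 'a l2 \<Rightarrow> 'a l2" is "\<lambda>c f k. c * f k"
  by (simp add: power_mult_distrib summable_on_cmult_right)
lift_definition uminus_l2 :: "'a l2 \<Rightarrow> 'a l2" is "\<lambda>f k. - f k" by simp
lift_definition minus_l2 :: "'a l2 \<Rightarrow> 'a l2 \<Rightarrow> 'a l2" is "\<lambda>f g k. f k - g k"
  using summable_on_square_add[of _ UNIV "\<lambda>k. - _ k"] by fastforce

instance
  by standard (transfer; simp add: fun_eq_iff algebra_simps)+

end

lemma coord_simps [simp]:
  "coord 0 k = 0" "coord (u + v) k = coord u k + coord v k"
  "coord (u - v) k = coord u k - coord v k" "coord (- u) k = - coord u k"
  "coord (c *\<^sub>R u) k = c * coord u k"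
  by (transfer; simp)+

lemma summable_coord_mult: "(\<lambda>k. coord u k * coord v k) summable_on UNIV"
  by (intro summable_on_mult_squares summable_coord_square)

instantiation l2 :: (type) real_inner
begin

definition inner_l2 :: "'a l2 \<Rightarrow> 'a l2 \<Rightarrow> real" where
  "inner_l2 u v = (\<Sum>\<^sub>\<infinity>k. coord u k * coord v k)"
definition norm_l2 :: "'a l2 \<Rightarrow> real" where "norm_l2 u = sqrt (inner u u)"
definition dist_l2 :: "'a l2 \<Rightarrow> 'a l2 \<Rightarrow> real" where "dist_l2 u v = norm (u - v)"
definition sgn_l2 :: "'a l2 \<Rightarrow> 'a l2" where "sgn_l2 u = u /\<^sub>R norm u"
definition uniformity_l2 :: "('a l2 \<times> 'a l2) filter" where
  "uniformity_l2 = (INF e\<in>{0<..}. principal {(u, v). dist u v < e})"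
definition open_l2 :: "'a l2 set \<Rightarrow> bool" where
  "open_l2 U = (\<forall>x\<in>U. \<forall>\<^sub>F (x', y) in uniformity. x' = x \<longrightarrow> y \<in> U)"

instance
proof
  fix u v w :: "'a l2" and r :: real
  show "inner u v = inner v u"
    by (simp add: inner_l2_def mult.commute)
  show "inner (u + v) w = inner u w + inner v w"
    by (simp add: inner_l2_def distrib_right infsum_add summable_coord_mult)
  show "inner (r *\<^sub>R u) v = r * inner u v"
    by (simp add: inner_l2_def mult.assoc infsum_cmult_right')
  show "0 \<le> inner u u"
    by (simp add: inner_l2_def infsum_nonneg)
  show "(inner u u = 0) = (u = 0)"
  proof
    assume "inner u u = 0"
    then have "(\<lambda>k. coord u k * coord u k) summable_on UNIV" "(\<Sum>\<^sub>\<infinity>k. coord u k * coord u k) \<le> 0"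
      by (auto simp: inner_l2_def summable_coord_mult)
    then have "coord u k * coord u k = 0" for k
      by (intro nonneg_infsum_le_0D[of _ UNIV]) auto
    then show "u = 0" by (intro l2_eqI) simp
  qed (simp add: inner_l2_def)
qed (auto simp: norm_l2_def dist_l2_def sgn_l2_def uniformity_l2_def open_l2_def)

end

lemma norm_l2_square: "(norm u)\<^sup>2 = (\<Sum>\<^sub>\<infinity>k. (coord u k)\<^sup>2)"
  unfolding power2_norm_eq_inner inner_l2_def by (simp add: power2_eq_square)

lemma sum_coord_le_norm: "finite F \<Longrightarrow> (\<Sum>k\<in>F. (coord u k)\<^sup>2) \<le> (norm u)\<^sup>2"
  unfolding norm_l2_square by (rule finite_sum_le_infsum) (auto simp: summable_coord_square)

lemma abs_coord_le_norm: "\<bar>coord u k\<bar> \<le> norm u"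
  using sum_coord_le_norm[of "{k}" u] by (simp add: power2_le_iff_abs_le)

lemma bounded_linear_coord: "bounded_linear (\<lambda>u. coord u k)"
  by (rule bounded_linear_intro[of _ 1]) (auto simp: abs_coord_le_norm)

lemma norm_l2_leI:
  assumes "\<And>F. finite F \<Longrightarrow> (\<Sum>k\<in>F. (coord u k)\<^sup>2) \<le> c\<^sup>2" "0 \<le> c"
  shows "norm u \<le> c"
proof -
  have "(\<Sum>\<^sub>\<infinity>k. (coord u k)\<^sup>2) \<le> c\<^sup>2"
    by (rule infsum_le_finite_sums) (use assms summable_coord_square in auto)
  then show ?thesis
    using assms(2) by (simp flip: norm_l2_square add: abs_le_square_iff)
qed

lemma square_summable_leI:
  fixes f :: "'a \<Rightarrow> real"
  assumes "\<And>F. finite F \<Longrightarrow> (\<Sum>k\<in>F. (f k)\<^sup>2) \<le> c\<^sup>2"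
  shows "(\<lambda>k. (f k)\<^sup>2) summable_on UNIV"
  by (rule nonneg_bdd_above_summable_on) (auto intro!: bdd_aboveI[of _ "c\<^sup>2"] assms)

instance l2 :: (type) complete_space
proof
  fix X :: "nat \<Rightarrow> 'a l2" assume X: "Cauchy X"
  have "Cauchy (\<lambda>n. coord (X n) k)" for k
    using bounded_linear.Cauchy[OF bounded_linear_coord X] .
  then have "\<forall>k. \<exists>l. (\<lambda>n. coord (X n) k) \<longlonglongrightarrow> l"
    using Cauchy_convergent_iff by (auto simp: convergent_def)
  then obtain x where x: "\<And>k. (\<lambda>n. coord (X n) k) \<longlonglongrightarrow> x k"
    by (auto dest!: choice)
  \<comment> \<open>Uniform in F, so it serves twice: e = 1 puts the pointwise limit into l2,
    arbitrary e gives convergence in norm.\<close>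
  have bound: "\<exists>N. \<forall>n\<ge>N. \<forall>F. finite F \<longrightarrow> (\<Sum>k\<in>F. (coord (X n) k - x k)\<^sup>2) \<le> e\<^sup>2" if "e > 0" for e
  proof -
    obtain N where N: "\<And>m n. m \<ge> N \<Longrightarrow> n \<ge> N \<Longrightarrow> norm (X m - X n) < e"
      using X \<open>e > 0\<close> unfolding Cauchy_def dist_norm by blast
    have "(\<Sum>k\<in>F. (coord (X n) k - x k)\<^sup>2) \<le> e\<^sup>2" if "n \<ge> N" "finite F" for n F
    proof (rule tendsto_upperbound)
      show "(\<lambda>m. \<Sum>k\<in>F. (coord (X n) k - coord (X m) k)\<^sup>2) \<longlonglongrightarrow> (\<Sum>k\<in>F. (coord (X n) k - x k)\<^sup>2)"
        by (intro tendsto_intros x)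
      show "\<forall>\<^sub>F m in sequentially. (\<Sum>k\<in>F. (coord (X n) k - coord (X m) k)\<^sup>2) \<le> e\<^sup>2"
        unfolding eventually_sequentially
      proof (intro exI allI impI)
        fix m assume "m \<ge> N"
        have "(\<Sum>k\<in>F. (coord (X n) k - coord (X m) k)\<^sup>2) \<le> (norm (X n - X m))\<^sup>2"
          using sum_coord_le_norm[OF that(2), of "X n - X m"] by simp
        also have "\<dots> \<le> e\<^sup>2" using N[OF that(1) \<open>m \<ge> N\<close>] by (intro power_mono) auto
        finally show "(\<Sum>k\<in>F. (coord (X n) k - coord (X m) k)\<^sup>2) \<le> e\<^sup>2" .
      qed
    qed simp
    then show ?thesis by blast
  qed
  obtain N where "\<And>F. finite F \<Longrightarrow> (\<Sum>k\<in>F. (coord (X N) k - x k)\<^sup>2) \<le> 1\<^sup>2"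
    using bound[of 1] by auto
  then have "(\<lambda>k. (coord (X N) k - x k)\<^sup>2) summable_on UNIV"
    by (rule square_summable_leI)
  then have "(\<lambda>k. (- (coord (X N) k - x k) + coord (X N) k)\<^sup>2) summable_on UNIV"
    by (intro summable_on_square_add) (simp_all add: summable_coord_square power2_commute)
  then have cx: "coord (Abs_l2 x) = x" by (intro coord_Abs_l2) simp
  have "X \<longlonglongrightarrow> Abs_l2 x"
  proof (rule metric_LIMSEQ_I)
    fix e :: real assume "e > 0"
    obtain N where N: "\<And>n F. n \<ge> N \<Longrightarrow> finite F \<Longrightarrow> (\<Sum>k\<in>F. (coord (X n) k - x k)\<^sup>2) \<le> (e/2)\<^sup>2"
      using bound[of "e/2"] \<open>e > 0\<close> by auto
    have "norm (X n - Abs_l2 x) \<le> e / 2" if "n \<ge> Suc N" for n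
      by (rule norm_l2_leI) (use N that \<open>e > 0\<close> in \<open>auto simp: cx\<close>)
    then show "\<exists>no. \<forall>n\<ge>no. dist (X n) (Abs_l2 x) < e"
      unfolding dist_norm using \<open>e > 0\<close> by (intro exI[of _ "Suc N"]) force
  qed
  then show "convergent X" by (auto simp: convergent_def)
qed

instance l2 :: (type) banach ..

section \<open>Equations in Hilbert space\<close>

text \<open>For small \<open>t\<close> the map \<open>w \<mapsto> (1 - t) w + t (S w + h)\<close> is a contraction,
  because \<open>S w\<close> is orthogonal to \<open>w\<close>.\<close>

lemma skew_perturbation_solvable:
  fixes S :: "'a :: {real_inner, complete_space} \<Rightarrow> 'a"
  assumes S: "bounded_linear S" and V: "closed V" "subspace V" "S ` V \<subseteq> V"
    and skew: "\<And>w. w \<in> V \<Longrightarrow> inner w (S w) = 0" and h: "h \<in> V"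
  shows "\<exists>w\<in>V. w - S w = h"
proof -
  interpret S: bounded_linear S by (rule S)
  obtain C where C: "\<And>x. norm (S x) \<le> norm x * C" and "C > 0"
    using S.pos_bounded by blast
  \<comment> \<open>The minimiser of \<open>(1 - t)^2 + t^2 C^2\<close>, the squared Lipschitz
    constant obtained from Pythagoras; the minimum is \<open>1 - t\<close>, below 1 however large C
    is.\<close>
  define t where "t = 1 / (1 + C\<^sup>2)"
  define c where "c = sqrt ((1 - t)\<^sup>2 + t\<^sup>2 * C\<^sup>2)"
  have t: "0 < t" "t * (1 + C\<^sup>2) = 1"
    unfolding t_def by (auto simp: add_pos_nonneg intro!: divide_pos_pos)
      (metis add_pos_nonneg less_irrefl nonzero_eq_divide_eq zero_le_power2 zero_less_one)
  have "(1 - t)\<^sup>2 + t\<^sup>2 * C\<^sup>2 = 1 - 2 * t + t * (t * (1 + C\<^sup>2))"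
    by (simp add: power2_eq_square algebra_simps)
  also have "\<dots> = 1 - t" by (simp add: t(2))
  finally have c2: "(1 - t)\<^sup>2 + t\<^sup>2 * C\<^sup>2 = 1 - t" .
  have c: "0 \<le> c" "c < 1" "c\<^sup>2 = (1 - t)\<^sup>2 + t\<^sup>2 * C\<^sup>2"
  proof -
    show "0 \<le> c" by (simp add: c_def)
    show "c < 1" unfolding c_def c2 using t(1) by simp
    show "c\<^sup>2 = (1 - t)\<^sup>2 + t\<^sup>2 * C\<^sup>2" by (simp add: c_def)
  qed
  define f where "f w = (1 - t) *\<^sub>R w + t *\<^sub>R (S w + h)" for w
  have "\<exists>!w\<in>V. f w = w"
  proof (rule Banach_fix)
    show "complete V" using V(1) by (simp add: complete_eq_closed)
    show "V \<noteq> {}" using h by auto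
    show "f ` V \<subseteq> V"
      using V h by (auto simp: f_def intro!: subspace_add subspace_scale)
    show "dist (f x) (f y) \<le> c * dist x y" if "x \<in> V" "y \<in> V" for x y
    proof -
      define v where "v = x - y"
      have v: "v \<in> V" unfolding v_def by (rule subspace_diff[OF V(2) that])
      have "f x - f y = (1 - t) *\<^sub>R v + t *\<^sub>R S v"
        by (simp add: f_def v_def S.diff algebra_simps)
      moreover have "(norm ((1 - t) *\<^sub>R v + t *\<^sub>R S v))\<^sup>2 = (1 - t)\<^sup>2 * (norm v)\<^sup>2 + t\<^sup>2 * (norm (S v))\<^sup>2"
        unfolding power2_norm_eq_inner
        by (simp add: inner_simps skew[OF v] inner_commute[of "S v" v] power2_eq_square)
      moreover have "\<dots> \<le> (1 - t)\<^sup>2 * (norm v)\<^sup>2 + t\<^sup>2 * (norm v * C)\<^sup>2"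
        by (intro add_left_mono mult_left_mono power_mono C) auto
      moreover have "\<dots> = (c * norm v)\<^sup>2"
        by (simp add: power_mult_distrib c(3) algebra_simps)
      ultimately have "(norm (f x - f y))\<^sup>2 \<le> (c * norm v)\<^sup>2" by simp
      then show ?thesis
        unfolding dist_norm v_def[symmetric] using c(1) by (simp add: power2_le_iff_abs_le)
    qed
  qed (use c in auto)
  then obtain w where w: "w \<in> V" "f w = w" by blast
  have "t *\<^sub>R (w - S w - h) = 0"
    using w(2) by (simp add: f_def algebra_simps)
  then have "w - S w = h" using t(1) by simp
  then show ?thesis using w(1) by blast
qed

text \<open>Pairing with w removes \<open>S w\<close>, so the inverse of identity minus S is bounded
  by 1 whatever the size of S.\<close>

lemma skew_perturbation_norm:
  assumes "inner w (S w) = 0" and "w - S w = h"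
  shows "norm w \<le> norm h"
proof -
  have "(norm w)\<^sup>2 = inner w (w - S w)"
    by (simp add: inner_diff_right assms(1) power2_norm_eq_inner)
  also have "\<dots> \<le> norm w * norm h"
    using norm_cauchy_schwarz assms(2) by metis
  finally have "norm w * norm w \<le> norm w * norm h" by (simp add: power2_eq_square)
  then show ?thesis by (cases "w = 0") auto
qed

text \<open>At e = 0 the equation reads \<open>f = - q u u\<close>; for small e the right side is a
  contraction with factor 1/2 of a ball in V whose radius depends only on q and u. U and d are the
  solution maps of a bordered linear problem, known through their bounds and their compatibility
  with differences on V.\<close>

lemma small_quadratic_fixed_point:
  fixes q :: "'a :: banach \<Rightarrow> 'a \<Rightarrow> 'a" and U :: "'a \<Rightarrow> 'a" and d :: "'a \<Rightarrow> real"
  assumes V: "closed V" "subspace V" and q: "bounded_bilinear q"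
    and qV: "\<And>u v. u \<in> V \<Longrightarrow> v \<in> V \<Longrightarrow> q u v \<in> V"
    and U: "\<And>f. f \<in> V \<Longrightarrow> U f \<in> V" "\<And>f. f \<in> V \<Longrightarrow> norm (U f) \<le> K * norm f"
      "\<And>f g. f \<in> V \<Longrightarrow> g \<in> V \<Longrightarrow> U (f - g) = U f - U g"
    and d: "\<And>f. f \<in> V \<Longrightarrow> \<bar>d f\<bar> \<le> K * norm f"
      "\<And>f g. f \<in> V \<Longrightarrow> g \<in> V \<Longrightarrow> d (f - g) = d f - d g"
    and u: "u \<in> V"
  shows "\<exists>e0>0. \<exists>r. \<forall>e. 0 < e \<and> e < e0 \<longrightarrow>
    (\<exists>f\<in>V. norm f \<le> r \<and> f = - (e * d f) *\<^sub>R U f - q (u + e *\<^sub>R U f) (u + e *\<^sub>R U f))"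
proof -
  interpret q: bounded_bilinear q by (rule q)
  obtain Q where Q: "\<And>x y. norm (q x y) \<le> norm x * norm y * Q" and "Q > 0"
    using q.pos_bounded by blast
  define K' where "K' = \<bar>K\<bar>"
  have K': "K' \<ge> 0" by (simp add: K'_def)
  have UK: "norm (U f) \<le> K' * norm f" and dK: "\<bar>d f\<bar> \<le> K' * norm f" if "f \<in> V" for f
  proof -
    have "K * norm f \<le> K' * norm f" by (intro mult_right_mono) (auto simp: K'_def)
    then show "norm (U f) \<le> K' * norm f" "\<bar>d f\<bar> \<le> K' * norm f"
      using U(2)[OF that] d(1)[OF that] by linarith+
  qed
  define m where "m = norm u + 1"
  have m: "m > 0" by (simp add: m_def add_nonneg_pos)
  \<comment> \<open>\<open>Q * m^2\<close> bounds the quadratic part, because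
    \<open>u + e U f\<close> stays in the ball of radius m; the summand 1 is room for the term with
    factor e.\<close>
  define r where "r = Q * m\<^sup>2 + 1"
  have r: "r > 0" using \<open>Q > 0\<close> by (simp add: r_def add_nonneg_pos)
  \<comment> \<open>The sum dominates the three quantities that must stay below 1 after
    multiplication by e: one for the norm of \<open>e U f\<close>, one for the self-map, one for the
    Lipschitz constant 1/2. Hence the threshold \<open>1 / s\<close>.\<close>
  define s where "s = 1 + K' * r + K'\<^sup>2 * r\<^sup>2 + 2 * (2 * K'\<^sup>2 * r + 2 * Q * K' * m)"
  have s1: "s > 0" "K' * r \<le> s" "K'\<^sup>2 * r\<^sup>2 \<le> s" "2 * (2 * K'\<^sup>2 * r + 2 * Q * K' * m) \<le> s"
    unfolding s_def using K' r \<open>Q > 0\<close> m by (auto intro!: add_nonneg_nonneg add_pos_nonneg)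
  have main: "\<exists>f\<in>V. norm f \<le> r \<and> f = - (e * d f) *\<^sub>R U f - q (u + e *\<^sub>R U f) (u + e *\<^sub>R U f)"
    if e: "0 < e" "e < 1 / s" for e
  proof -
    have es: "e * s \<le> 1" using e s1(1) by (simp add: field_simps)
    have le1: "e * x \<le> 1" if "x \<le> s" for x
      using mult_left_mono[OF that, of e] e es by linarith
    define W where "W = V \<inter> cball 0 r"
    define N where "N f = - (e * d f) *\<^sub>R U f - q (u + e *\<^sub>R U f) (u + e *\<^sub>R U f)" for f
    have w: "norm (u + e *\<^sub>R U f) \<le> m" if "f \<in> W" for f
    proof -
      have f: "f \<in> V" "norm f \<le> r" using that by (auto simp: W_def)
      have "norm (U f) \<le> K' * r" using UK[OF f(1)] f(2) K' mult_left_mono by fastforce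
      then have "e * norm (U f) \<le> e * (K' * r)" using e by simp
      also have "\<dots> \<le> 1" by (rule le1) (rule s1)
      finally have "norm (e *\<^sub>R U f) \<le> 1" using e by simp
      then show ?thesis unfolding m_def using norm_triangle_ineq[of u "e *\<^sub>R U f"] by linarith
    qed
    have "\<exists>!f\<in>W. N f = f"
    proof (rule Banach_fix)
      show "complete W" using V(1) by (simp add: complete_eq_closed W_def closed_Int)
      show "W \<noteq> {}" using subspace_0[OF V(2)] r by (auto simp: W_def intro!: exI[of _ 0])
      show "(0::real) \<le> 1 / 2" "(1 / 2 :: real) < 1" by auto
      show "N ` W \<subseteq> W"
      proof (intro image_subsetI)
        fix f assume "f \<in> W"
        then have f: "f \<in> V" "norm f \<le> r" by (auto simp: W_def)
        have "N f \<in> V"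
          unfolding N_def
          by (intro subspace_diff[OF V(2)] subspace_scale[OF V(2)] subspace_add[OF V(2)] qV u U(1) f(1))
        moreover have "norm (N f) \<le> e * \<bar>d f\<bar> * norm (U f) + norm (q (u + e *\<^sub>R U f) (u + e *\<^sub>R U f))"
          unfolding N_def using e(1)
          by (intro order_trans[OF norm_triangle_ineq4]) (simp add: abs_mult)
        moreover have "e * \<bar>d f\<bar> * norm (U f) \<le> 1"
        proof -
          have "\<bar>d f\<bar> \<le> K' * r" "norm (U f) \<le> K' * r"
            using UK[OF f(1)] dK[OF f(1)] mult_left_mono[OF f(2) K'] by linarith+
          then have "\<bar>d f\<bar> * norm (U f) \<le> (K' * r) * (K' * r)"
            using K' r by (intro mult_mono) auto
          then have "e * (\<bar>d f\<bar> * norm (U f)) \<le> e * (K'\<^sup>2 * r\<^sup>2)"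
            using e(1) by (simp add: power2_eq_square algebra_simps)
          also have "\<dots> \<le> 1" by (rule le1) (rule s1)
          finally show ?thesis by (simp add: mult.assoc)
        qed
        moreover have "norm (q (u + e *\<^sub>R U f) (u + e *\<^sub>R U f)) \<le> m * m * Q"
          using w[OF \<open>f \<in> W\<close>] \<open>Q > 0\<close> m
          by (intro order_trans[OF Q] mult_right_mono mult_mono) auto
        ultimately show "N f \<in> W"
          by (auto simp: W_def r_def power2_eq_square algebra_simps)
      qed
      show "dist (N f) (N g) \<le> 1 / 2 * dist f g" if "f \<in> W" "g \<in> W" for f g
      proof -
        have fg: "f \<in> V" "norm f \<le> r" "g \<in> V" "norm g \<le> r" using that by (auto simp: W_def)
        have dV: "f - g \<in> V" using fg V(2) by (simp add: subspace_diff)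
        define n where "n = norm (f - g)"
        have n0: "n \<ge> 0" by (simp add: n_def)
        have Un: "norm (U f - U g) \<le> K' * n" and dn: "\<bar>d f - d g\<bar> \<le> K' * n"
          using UK[OF dV] dK[OF dV] U(3)[OF fg(1,3)] d(2)[OF fg(1,3)] by (simp_all add: n_def)
        define a where "a = u + e *\<^sub>R U f"
        define b where "b = u + e *\<^sub>R U g"
        have ab: "a - b = e *\<^sub>R (U f - U g)" by (simp add: a_def b_def algebra_simps)
        \<comment> \<open>Both products are telescoped, so that each summand contains exactly one
          difference; \<open>a - b\<close> brings the factor e with it.\<close>
        have "N f - N g = - (e *\<^sub>R ((d f - d g) *\<^sub>R U f + d g *\<^sub>R (U f - U g))) - (q (a - b) a + q b (a - b))"
          unfolding N_def a_def[symmetric] b_def[symmetric]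
          by (simp add: q.diff_left q.diff_right algebra_simps)
        then have "norm (N f - N g) \<le> norm (e *\<^sub>R ((d f - d g) *\<^sub>R U f + d g *\<^sub>R (U f - U g)))
            + norm (q (a - b) a + q b (a - b))"
          by (metis norm_triangle_ineq4 norm_minus_cancel)
        also have "norm (e *\<^sub>R ((d f - d g) *\<^sub>R U f + d g *\<^sub>R (U f - U g))) \<le> e * (2 * K'\<^sup>2 * r * n)"
        proof -
          have "norm ((d f - d g) *\<^sub>R U f) \<le> (K' * n) * (K' * r)"
            using dn UK[OF fg(1)] mult_left_mono[OF fg(2) K'] K' n0 r
            by (simp, intro mult_mono) auto
          moreover have "norm (d g *\<^sub>R (U f - U g)) \<le> (K' * r) * (K' * n)"
            using Un dK[OF fg(3)] mult_left_mono[OF fg(4) K'] K' n0 r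
            by (simp, intro mult_mono) auto
          ultimately have "norm ((d f - d g) *\<^sub>R U f + d g *\<^sub>R (U f - U g)) \<le> 2 * K'\<^sup>2 * r * n"
            by (intro order_trans[OF norm_triangle_ineq]) (simp add: power2_eq_square algebra_simps)
          then show ?thesis using e(1) by simp
        qed
        also have "norm (q (a - b) a + q b (a - b)) \<le> e * (2 * Q * K' * m * n)"
        proof -
          have nab: "norm (a - b) \<le> e * (K' * n)" unfolding ab using Un e(1) by simp
          have am: "norm a \<le> m" "norm b \<le> m" using w that by (auto simp: a_def b_def)
          have "norm (q (a - b) a) \<le> (e * (K' * n)) * m * Q"
            using nab am \<open>Q > 0\<close> m e(1) K' n0
            by (intro order_trans[OF Q] mult_right_mono mult_mono) auto
          moreover have "norm (q b (a - b)) \<le> m * (e * (K' * n)) * Q"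
            using nab am \<open>Q > 0\<close> m e(1) K' n0
            by (intro order_trans[OF Q] mult_right_mono mult_mono) auto
          ultimately show ?thesis
            by (intro order_trans[OF norm_triangle_ineq]) (simp add: algebra_simps)
        qed
        finally have "norm (N f - N g) \<le> (e * (2 * (2 * K'\<^sup>2 * r + 2 * Q * K' * m))) / 2 * n"
          by (simp add: algebra_simps)
        also have "\<dots> \<le> 1 / 2 * n"
          using le1[OF s1(4)] n0 by (intro mult_right_mono divide_right_mono) auto
        finally show ?thesis by (simp add: dist_norm n_def)
      qed
    qed
    then show ?thesis unfolding W_def N_def by (auto simp: eq_commute)
  qed
  show ?thesis
    using s1(1) main by (intro exI[of _ "1 / s"] conjI exI[of _ r] allI impI) auto
qed

text \<open>Here \<open>R P\<close> is skew, whereas \<open>P R\<close> is the operator of interest.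
  Solving \<open>w - R P w = R f\<close> and setting \<open>u = f + P w\<close> gives
  \<open>R u = w\<close>, hence \<open>u - P R u = f\<close>; the bound is carried over in the same
  way. G is picked by choice, and uniqueness makes it respect differences.\<close>

lemma skew_factor_solvable:
  fixes P R :: "'a :: {real_inner, complete_space} \<Rightarrow> 'a"
  assumes P: "bounded_linear P" "P ` V \<subseteq> V" and R: "bounded_linear R" "R ` V \<subseteq> V"
    and V: "closed V" "subspace V"
    and skew: "\<And>w. w \<in> V \<Longrightarrow> inner w (R (P w)) = 0"
  obtains G K where "\<And>f. f \<in> V \<Longrightarrow> G f \<in> V" "\<And>f. f \<in> V \<Longrightarrow> G f - P (R (G f)) = f"
    "\<And>f. f \<in> V \<Longrightarrow> norm (G f) \<le> K * norm f"
    "\<And>u. u \<in> V \<Longrightarrow> G (u - P (R u)) = u"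
    "\<And>f g. f \<in> V \<Longrightarrow> g \<in> V \<Longrightarrow> G (f - g) = G f - G g"
proof -
  interpret P: bounded_linear P by (rule P)
  interpret R: bounded_linear R by (rule R)
  obtain C1 where C1: "\<And>x. norm (P x) \<le> norm x * C1" "C1 > 0" using P.pos_bounded by blast
  obtain C2 where C2: "\<And>x. norm (R x) \<le> norm x * C2" "C2 > 0" using R.pos_bounded by blast
  have inv: "P v \<in> V" "R v \<in> V" if "v \<in> V" for v using that P(2) R(2) by auto
  have ex: "\<exists>u\<in>V. u - P (R u) = f" if f: "f \<in> V" for f
  proof -
    have "\<exists>w\<in>V. w - (\<lambda>w. R (P w)) w = R f"
    proof (rule skew_perturbation_solvable)
      show "bounded_linear (\<lambda>w. R (P w))"
        using bounded_linear_compose[OF R(1) P(1)] by (simp add: o_def)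
    qed (use V skew inv f in auto)
    then obtain w where w: "w \<in> V" "w = R f + R (P w)" by (auto simp: algebra_simps)
    have "R (f + P w) = w" using w(2) by (simp add: R.add)
    then show ?thesis
      using w inv f V(2) by (intro bexI[of _ "f + P w"]) (auto simp: subspace_add)
  qed
  have bound: "norm u \<le> (1 + C1 * C2) * norm (u - P (R u))" if "u \<in> V" for u
  proof -
    define f where "f = u - P (R u)"
    have "R u - R (P (R u)) = R f" by (simp add: f_def R.diff)
    then have "norm (R u) \<le> norm (R f)"
      using skew_perturbation_norm[of "R u" "\<lambda>w. R (P w)" "R f"] skew inv that by auto
    also have "\<dots> \<le> norm f * C2" by (rule C2)
    finally have "norm (R u) * C1 \<le> (norm f * C2) * C1"
      using C1(2) by (intro mult_right_mono) auto
    moreover have "u = f + P (R u)" by (simp add: f_def)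
    then have "norm u \<le> norm f + norm (P (R u))" by (metis norm_triangle_ineq)
    ultimately have "norm u \<le> norm f + norm f * C2 * C1"
      using C1(1)[of "R u"] by linarith
    then show ?thesis by (simp add: f_def algebra_simps)
  qed
  have uniq: "u = v" if "u \<in> V" "v \<in> V" "u - P (R u) = v - P (R v)" for u v
  proof -
    have "(u - v) - P (R (u - v)) = 0" using that(3) by (simp add: P.diff R.diff algebra_simps)
    then show ?thesis using bound[OF subspace_diff[OF V(2) that(1,2)]] by simp
  qed
  define G where "G f = (SOME u. u \<in> V \<and> u - P (R u) = f)" for f
  have G: "G f \<in> V \<and> G f - P (R (G f)) = f" if "f \<in> V" for f
    unfolding G_def by (rule someI_ex) (use ex[OF that] in blast)
  show ?thesis
  proof
    show "G f \<in> V" "G f - P (R (G f)) = f" if "f \<in> V" for f using G[OF that] by auto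
    show "norm (G f) \<le> (1 + C1 * C2) * norm f" if "f \<in> V" for f
      using bound[of "G f"] G[OF that] by simp
    show "G (u - P (R u)) = u" if "u \<in> V" for u
    proof (rule uniq)
      have f: "u - P (R u) \<in> V" by (rule subspace_diff[OF V(2) that]) (intro inv that)
      show "G (u - P (R u)) \<in> V" "G (u - P (R u)) - P (R (G (u - P (R u)))) = u - P (R u)"
        using G[OF f] by blast+
    qed (rule that)
    show "G (f - g) = G f - G g" if "f \<in> V" "g \<in> V" for f g
    proof (rule uniq)
      have "(G f - G g) - P (R (G f - G g)) = (G f - P (R (G f))) - (G g - P (R (G g)))"
        by (simp add: P.diff R.diff)
      then show "G (f - g) - P (R (G (f - g))) = (G f - G g) - P (R (G f - G g))"
        using G[of f] G[of g] G[of "f - g"] that V(2) by (simp add: subspace_diff)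
    qed (use G that V(2) in \<open>auto simp: subspace_diff\<close>)
  qed
qed

text \<open>\<open>A' + c b\<close> is singular with kernel vector uc, and one extra unknown d
  restores solvability. For \<open>y = G uc\<close> transversality gives
  \<open>c y \<noteq> 0\<close>, since otherwise y would be mapped to uc. Then
  \<open>d f = c (G f) / c y\<close> cancels the rank-one term on \<open>G f - d f y\<close>, and a
  multiple of uc adjusts the normalisation \<open>l = 0\<close> without disturbing the
  equation.\<close>

lemma bordered_right_inverse:
  fixes A' :: "'a :: real_normed_vector \<Rightarrow> 'a" and c l :: "'a \<Rightarrow> real"
  assumes V: "subspace V" and A': "linear A'" and c: "bounded_linear c" and l: "bounded_linear l"
    and G: "\<And>f. f \<in> V \<Longrightarrow> G f \<in> V" "\<And>f. f \<in> V \<Longrightarrow> A' (G f) = f"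
      "\<And>f. f \<in> V \<Longrightarrow> norm (G f) \<le> K * norm f" "\<And>u. u \<in> V \<Longrightarrow> G (A' u) = u"
      "\<And>f g. f \<in> V \<Longrightarrow> g \<in> V \<Longrightarrow> G (f - g) = G f - G g"
    and uc: "uc \<in> V" "A' uc + c uc *\<^sub>R b = 0" "l uc \<noteq> 0"
    and transversal: "\<And>y. y \<in> V \<Longrightarrow> A' y + c y *\<^sub>R b \<noteq> uc"
  obtains U d K' where "\<And>f. f \<in> V \<Longrightarrow> U f \<in> V"
    "\<And>f. f \<in> V \<Longrightarrow> A' (U f) + c (U f) *\<^sub>R b + d f *\<^sub>R uc = f"
    "\<And>f. f \<in> V \<Longrightarrow> l (U f) = 0"
    "\<And>f. f \<in> V \<Longrightarrow> norm (U f) \<le> K' * norm f"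
    "\<And>f. f \<in> V \<Longrightarrow> \<bar>d f\<bar> \<le> K' * norm f"
    "\<And>f g. f \<in> V \<Longrightarrow> g \<in> V \<Longrightarrow> U (f - g) = U f - U g"
    "\<And>f g. f \<in> V \<Longrightarrow> g \<in> V \<Longrightarrow> d (f - g) = d f - d g"
proof -
  interpret A': linear A' by (rule A')
  interpret c: bounded_linear c by (rule c)
  interpret l: bounded_linear l by (rule l)
  obtain Cc where Cc: "\<And>x. \<bar>c x\<bar> \<le> norm x * Cc" "Cc > 0"
    using c.pos_bounded by (auto simp del: mult.commute)
  obtain Cl where Cl: "\<And>x. \<bar>l x\<bar> \<le> norm x * Cl" "Cl > 0"
    using l.pos_bounded by (auto simp del: mult.commute)
  define y where "y = G uc"
  have y: "y \<in> V" "A' y = uc" using G uc by (auto simp: y_def)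
  have cy: "c y \<noteq> 0" using transversal[OF y(1)] y(2) by auto
  define d where "d f = c (G f) / c y" for f
  define u1 where "u1 f = G f - d f *\<^sub>R y" for f
  define U where "U f = u1 f - (l (u1 f) / l uc) *\<^sub>R uc" for f
  define K1 where "K1 = \<bar>K\<bar> * Cc / \<bar>c y\<bar>"
  define K2 where "K2 = \<bar>K\<bar> + K1 * norm y"
  define K3 where "K3 = K2 + K2 * Cl / \<bar>l uc\<bar> * norm uc"
  have pos: "K1 \<ge> 0" "K2 \<ge> 0" "K3 \<ge> 0"
  proof -
    show "K1 \<ge> 0" using Cc(2) by (simp add: K1_def)
    then show "K2 \<ge> 0" by (simp add: K2_def)
    then show "K3 \<ge> 0" using Cl(2) by (simp add: K3_def)
  qed
  have GK: "norm (G f) \<le> \<bar>K\<bar> * norm f" if "f \<in> V" for f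
    using G(3)[OF that] mult_right_mono[of K "\<bar>K\<bar>" "norm f"] by (auto intro: order_trans)
  have dK: "\<bar>d f\<bar> \<le> K1 * norm f" if "f \<in> V" for f
  proof -
    have "\<bar>c (G f)\<bar> \<le> (\<bar>K\<bar> * norm f) * Cc"
      using Cc GK[OF that] mult_right_mono[of "norm (G f)" "\<bar>K\<bar> * norm f" Cc]
      by (meson less_imp_le order_trans)
    then show ?thesis by (simp add: d_def K1_def abs_divide divide_right_mono algebra_simps)
  qed
  have u1K: "norm (u1 f) \<le> K2 * norm f" if "f \<in> V" for f
  proof -
    have "norm (u1 f) \<le> norm (G f) + \<bar>d f\<bar> * norm y"
      unfolding u1_def by (metis norm_scaleR norm_triangle_ineq4)
    also have "\<dots> \<le> \<bar>K\<bar> * norm f + (K1 * norm f) * norm y"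
      by (intro add_mono mult_right_mono GK dK that) auto
    finally show ?thesis by (simp add: K2_def algebra_simps)
  qed
  have UK: "norm (U f) \<le> K3 * norm f" if "f \<in> V" for f
  proof -
    have "\<bar>l (u1 f)\<bar> \<le> (K2 * norm f) * Cl"
      using Cl u1K[OF that] mult_right_mono[of "norm (u1 f)" "K2 * norm f" Cl]
      by (meson less_imp_le order_trans)
    then have l1: "\<bar>l (u1 f) / l uc\<bar> \<le> (K2 * norm f) * Cl / \<bar>l uc\<bar>"
      by (simp add: abs_divide divide_right_mono)
    have "norm (U f) \<le> norm (u1 f) + \<bar>l (u1 f) / l uc\<bar> * norm uc"
      unfolding U_def by (metis norm_scaleR norm_triangle_ineq4)
    also have "\<dots> \<le> K2 * norm f + ((K2 * norm f) * Cl / \<bar>l uc\<bar>) * norm uc"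
      by (intro add_mono mult_right_mono u1K l1 that) auto
    finally show ?thesis by (simp add: K3_def algebra_simps)
  qed
  have u1V: "u1 f \<in> V" if "f \<in> V" for f
    unfolding u1_def using G(1)[OF that] y(1) V by (simp add: subspace_diff subspace_scale)
  have ddiff: "d (f - g) = d f - d g" if "f \<in> V" "g \<in> V" for f g
    by (simp add: d_def G(5)[OF that] c.diff diff_divide_distrib)
  have u1diff: "u1 (f - g) = u1 f - u1 g" if "f \<in> V" "g \<in> V" for f g
    by (simp add: u1_def ddiff[OF that] G(5)[OF that] algebra_simps)
  show ?thesis
  proof
    show "U f \<in> V" if "f \<in> V" for f
      unfolding U_def using u1V[OF that] uc(1) V by (simp add: subspace_diff subspace_scale)
    show "A' (U f) + c (U f) *\<^sub>R b + d f *\<^sub>R uc = f" if "f \<in> V" for f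
    proof -
      define t where "t = l (u1 f) / l uc"
      have "c (u1 f) = 0" using cy by (simp add: u1_def d_def c.diff c.scaleR)
      moreover have "A' (u1 f) = f - d f *\<^sub>R uc"
        by (simp add: u1_def A'.diff A'.scale G(2)[OF that] y(2))
      moreover have "A' (U f) + c (U f) *\<^sub>R b
          = A' (u1 f) + c (u1 f) *\<^sub>R b - t *\<^sub>R (A' uc + c uc *\<^sub>R b)"
        by (simp add: U_def t_def[symmetric] A'.diff A'.scale c.diff c.scaleR algebra_simps)
      ultimately show ?thesis by (simp add: uc(2))
    qed
    show "l (U f) = 0" for f
      using uc(3) by (simp add: U_def l.diff l.scaleR)
    show "norm (U f) \<le> (K1 + K3) * norm f" "\<bar>d f\<bar> \<le> (K1 + K3) * norm f" if "f \<in> V" for f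
      using UK[OF that] dK[OF that] pos by (simp_all add: distrib_right add_increasing add_increasing2)
    show "U (f - g) = U f - U g" if "f \<in> V" "g \<in> V" for f g
      by (simp add: U_def u1diff[OF that] l.diff diff_divide_distrib algebra_simps)
    show "d (f - g) = d f - d g" if "f \<in> V" "g \<in> V" for f g
      by (rule ddiff[OF that])
  qed
qed

section \<open>Weights and operators on the lattice\<close>

text \<open>\<open>kap k\<close> is the eigenvalue of \<open>- \<Delta>\<close> on the mode \<open>k\<close>; \<open>jap k\<close> is comparable with its square
  root for \<open>k \<noteq> 0\<close> but is also bounded below at \<open>k = 0\<close>. Coefficients of sine series are extended oddly from
  positive modes to all of \<open>\<int> \<times> \<int>\<close>, which turns products of series into convolutions without
  boundary terms.\<close>

definition jap :: "int \<times> int \<Rightarrow> real" where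
  "jap k = 1 + \<bar>real_of_int (fst k)\<bar> + \<bar>real_of_int (snd k)\<bar>"

definition kap :: "int \<times> int \<Rightarrow> real" where
  "kap k = ((real_of_int (fst k))\<^sup>2 + (real_of_int (snd k))\<^sup>2) / 4"

text \<open>A multiplier that gains n orders, expressed by a weighted supremum. On the
  two-dimensional lattice order 2 implies square summability, and order 0 means bounded.\<close>

definition decays :: "nat \<Rightarrow> (int \<times> int \<Rightarrow> real) \<Rightarrow> bool" where
  "decays n d \<longleftrightarrow> (\<exists>C. \<forall>k. jap k ^ n * \<bar>d k\<bar> \<le> C)"

lemma jap_ge_1: "1 \<le> jap k"
  by (simp add: jap_def)

lemma fst_le_jap: "\<bar>real_of_int (fst k)\<bar> \<le> jap k" and snd_le_jap: "\<bar>real_of_int (snd k)\<bar> \<le> jap k"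
  by (simp_all add: jap_def)

lemma kap_le_jap: "kap k \<le> (jap k)\<^sup>2"
proof -
  have "(real_of_int (fst k))\<^sup>2 \<le> (jap k)\<^sup>2" "(real_of_int (snd k))\<^sup>2 \<le> (jap k)\<^sup>2"
    using fst_le_jap snd_le_jap by (metis abs_ge_zero power2_abs power_mono)+
  then show ?thesis by (simp add: kap_def) (smt (verit) zero_le_power2)
qed

lemma kap_nonneg: "0 \<le> kap k"
  by (simp add: kap_def)

text \<open>Off the origin \<open>a + b \<ge> 1\<close> gives \<open>jap \<le> 2 (a + b)\<close>,
  and \<open>(a + b)^2 \<le> 2 (a^2 + b^2) = 8 kap\<close>; hence the 32.\<close>

lemma jap_le_kap: "k \<noteq> 0 \<Longrightarrow> (jap k)\<^sup>2 \<le> 32 * kap k"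
proof -
  assume "k \<noteq> 0"
  define a where "a = \<bar>real_of_int (fst k)\<bar>"
  define b where "b = \<bar>real_of_int (snd k)\<bar>"
  have "1 \<le> \<bar>fst k\<bar> + \<bar>snd k\<bar>" using \<open>k \<noteq> 0\<close> by (cases k) (auto simp: zero_prod_def)
  then have "1 \<le> a + b" unfolding a_def b_def by (metis of_int_1_le_iff of_int_abs of_int_add)
  then have "(jap k)\<^sup>2 \<le> (2 * (a + b))\<^sup>2"
    by (intro power_mono) (auto simp: jap_def a_def b_def)
  also have "\<dots> \<le> 8 * (a\<^sup>2 + b\<^sup>2)"
    using sum_squares_bound[of a b] by (simp add: power2_eq_square algebra_simps)
  finally show ?thesis by (simp add: kap_def a_def b_def)
qed

lemma decaysI: "(\<And>k. jap k ^ n * \<bar>d k\<bar> \<le> C) \<Longrightarrow> decays n d"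
  by (auto simp: decays_def)

lemma decays_mono: assumes "decays n d" "m \<le> n" shows "decays m d"
proof -
  obtain C where C: "\<And>k. jap k ^ n * \<bar>d k\<bar> \<le> C" using assms by (auto simp: decays_def)
  have "jap k ^ m * \<bar>d k\<bar> \<le> C" for k
    by (rule order_trans[OF mult_right_mono C])
      (use assms(2) power_increasing[OF assms(2) jap_ge_1] in auto)
  then show ?thesis by (rule decaysI)
qed

lemma decays_dominated:
  assumes "decays n e" "\<And>k. \<bar>d k\<bar> \<le> c * \<bar>e k\<bar>"
  shows "decays n d"
proof -
  obtain C where C: "\<And>k. jap k ^ n * \<bar>e k\<bar> \<le> C" using assms by (auto simp: decays_def)
  have j: "0 \<le> jap k" for k using jap_ge_1[of k] by simp
  have "jap k ^ n * \<bar>d k\<bar> \<le> \<bar>c\<bar> * C" for k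
  proof -
    have "\<bar>d k\<bar> \<le> \<bar>c\<bar> * \<bar>e k\<bar>" using assms(2)[of k] by (smt (verit) mult_right_mono abs_ge_zero)
    then have "jap k ^ n * \<bar>d k\<bar> \<le> jap k ^ n * (\<bar>c\<bar> * \<bar>e k\<bar>)"
      using j by (intro mult_left_mono) auto
    also have "\<dots> = \<bar>c\<bar> * (jap k ^ n * \<bar>e k\<bar>)" by simp
    also have "\<dots> \<le> \<bar>c\<bar> * C" by (intro mult_left_mono C) auto
    finally show ?thesis .
  qed
  then show ?thesis by (rule decaysI)
qed

lemma decays_add: assumes "decays n d" "decays n e" shows "decays n (\<lambda>k. d k + e k)"
proof -
  obtain C D where CD: "\<And>k. jap k ^ n * \<bar>d k\<bar> \<le> C" "\<And>k. jap k ^ n * \<bar>e k\<bar> \<le> D"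
    using assms by (auto simp: decays_def)
  have "jap k ^ n * \<bar>d k + e k\<bar> \<le> C + D" for k
  proof -
    have "jap k ^ n * \<bar>d k + e k\<bar> \<le> jap k ^ n * (\<bar>d k\<bar> + \<bar>e k\<bar>)"
      using jap_ge_1[of k] by (intro mult_left_mono) auto
    then show ?thesis using CD[of k] by (simp add: distrib_left)
  qed
  then show ?thesis by (rule decaysI)
qed

lemma decays_cmult: "decays n d \<Longrightarrow> decays n (\<lambda>k. c * d k)"
  by (rule decays_dominated[of n d _ "\<bar>c\<bar>"]) (auto simp: abs_mult)

lemma decays_reduce:
  assumes "decays (m + n) d" "\<And>k. \<bar>e k\<bar> \<le> c * jap k ^ m"
  shows "decays n (\<lambda>k. e k * d k)"
proof -
  obtain C where C: "\<And>k. jap k ^ (m + n) * \<bar>d k\<bar> \<le> C" using assms by (auto simp: decays_def)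
  have j: "0 \<le> jap k" for k using jap_ge_1[of k] by simp
  have "jap k ^ n * \<bar>e k * d k\<bar> \<le> \<bar>c\<bar> * C" for k
  proof -
    have "\<bar>e k\<bar> \<le> \<bar>c\<bar> * jap k ^ m"
      using assms(2)[of k] j by (smt (verit) mult_right_mono zero_le_power)
    then have "\<bar>e k\<bar> * (jap k ^ n * \<bar>d k\<bar>) \<le> (\<bar>c\<bar> * jap k ^ m) * (jap k ^ n * \<bar>d k\<bar>)"
      using j by (intro mult_right_mono) auto
    also have "\<dots> = \<bar>c\<bar> * (jap k ^ (m + n) * \<bar>d k\<bar>)" by (simp add: power_add)
    also have "\<dots> \<le> \<bar>c\<bar> * C" by (intro mult_left_mono C) auto
    finally show ?thesis by (simp add: abs_mult algebra_simps)
  qed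
  then show ?thesis by (rule decaysI)
qed

lemma decays_fst: "decays (Suc n) d \<Longrightarrow> decays n (\<lambda>k. real_of_int (fst k) * d k)"
  and decays_snd: "decays (Suc n) d \<Longrightarrow> decays n (\<lambda>k. real_of_int (snd k) * d k)"
  using decays_reduce[of 1 n d _ 1] fst_le_jap snd_le_jap by auto

lemma decays_inverse_jap: "decays n (\<lambda>k. 1 / jap k ^ n)"
proof (rule decaysI)
  fix k
  have "jap k > 0" using jap_ge_1[of k] by simp
  then show "jap k ^ n * \<bar>1 / jap k ^ n\<bar> \<le> 1" by simp
qed

section \<open>Summability on the lattice and diagonal multipliers\<close>

lemma summable_int_inverse_square: "(\<lambda>i::int. 1 / (1 + (real_of_int i)\<^sup>2)) summable_on UNIV"
proof -
  have s: "(\<lambda>n::nat. 1 / (1 + (real n)\<^sup>2)) summable_on UNIV"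
  proof (rule summable_nonneg_imp_summable_on)
    have "summable (\<lambda>n. 1 / (real n)\<^sup>2)"
      using inverse_power_summable[of 2, where 'a=real] by (simp add: inverse_eq_divide)
    then have "summable (\<lambda>n. 1 / (real (Suc n))\<^sup>2)"
      by (subst summable_Suc_iff)
    then have "summable (\<lambda>n. 1 / (1 + (real (Suc n))\<^sup>2))"
      by (rule summable_comparison_test'[of _ 0]) (auto intro!: divide_left_mono simp: add_pos_nonneg)
    then show "summable (\<lambda>n. 1 / (1 + (real n)\<^sup>2))" by (subst (asm) summable_Suc_iff)
  qed (auto intro!: add_nonneg_nonneg)
  have "(\<lambda>i::int. 1 / (1 + (real_of_int i)\<^sup>2)) summable_on (range int)"
    using s by (subst summable_on_reindex) (auto simp: o_def)
  moreover have "(\<lambda>i::int. 1 / (1 + (real_of_int i)\<^sup>2)) summable_on (range (\<lambda>n. - int n))"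
    using s by (subst summable_on_reindex) (auto simp: o_def inj_def)
  ultimately have "(\<lambda>i::int. 1 / (1 + (real_of_int i)\<^sup>2)) summable_on (range int \<union> range (\<lambda>n. - int n))"
    by (rule summable_on_union)
  moreover have "range int \<union> range (\<lambda>n. - int n) = UNIV"
    by (auto intro: int_cases2)
  ultimately show ?thesis by simp
qed

text \<open>\<open>jap^4 \<ge> (1 + i^2) (1 + j^2)\<close>, so the lattice sum is dominated by a
  product of two one-dimensional sums. Every loss of two orders between square summability and
  absolute summability comes from here.\<close>

lemma summable_inverse_jap: "(\<lambda>k. (1 / (jap k)\<^sup>2)\<^sup>2) summable_on UNIV"
proof -
  define h where "h = (\<lambda>i::int. 1 / (1 + (real_of_int i)\<^sup>2))"
  have h0: "h i \<ge> 0" for i by (simp add: h_def)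
  have "(\<lambda>(i, j). h i * h j) summable_on (UNIV \<times> UNIV)"
  proof (rule summable_on_SigmaI)
    show "((\<lambda>y. case (x, y) of (i, j) \<Rightarrow> h i * h j) has_sum (h x * (\<Sum>\<^sub>\<infinity>j. h j))) UNIV" for x
      using summable_int_inverse_square unfolding h_def[symmetric] by (auto intro!: has_sum_cmult_right)
    show "(\<lambda>x. h x * (\<Sum>\<^sub>\<infinity>j. h j)) summable_on UNIV"
      using summable_int_inverse_square unfolding h_def[symmetric] by (intro summable_on_cmult_left)
  qed (auto simp: h0)
  then have "(\<lambda>k. h (fst k) * h (snd k)) summable_on UNIV" unfolding case_prod_unfold by simp
  then show ?thesis
  proof (rule summable_on_comparison_test)
    fix k :: "int \<times> int"
    define a where "a = \<bar>real_of_int (fst k)\<bar>"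
    define b where "b = \<bar>real_of_int (snd k)\<bar>"
    have ab: "a \<ge> 0" "b \<ge> 0" by (auto simp: a_def b_def)
    have "1 + a\<^sup>2 \<le> (jap k)\<^sup>2" "1 + b\<^sup>2 \<le> (jap k)\<^sup>2"
      using ab by (auto simp: jap_def a_def[symmetric] b_def[symmetric] power2_eq_square algebra_simps)
    then have "(1 + a\<^sup>2) * (1 + b\<^sup>2) \<le> ((jap k)\<^sup>2)\<^sup>2"
      unfolding power2_eq_square[of "(jap k)\<^sup>2"] by (intro mult_mono) auto
    then have "1 / ((jap k)\<^sup>2)\<^sup>2 \<le> 1 / ((1 + a\<^sup>2) * (1 + b\<^sup>2))"
      by (intro divide_left_mono) (auto intro!: mult_pos_pos add_pos_nonneg simp: jap_def)
    then show "(1 / (jap k)\<^sup>2)\<^sup>2 \<le> h (fst k) * h (snd k)"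
      by (simp add: h_def a_def b_def power_divide)
  qed auto
qed

lemma decays_square_summable:
  assumes "decays 2 d" shows "(\<lambda>k. (d k)\<^sup>2) summable_on UNIV"
proof -
  obtain C where C: "\<And>k. jap k ^ 2 * \<bar>d k\<bar> \<le> C" using assms by (auto simp: decays_def)
  show ?thesis
  proof (rule summable_on_comparison_test[OF summable_on_cmult_right[OF summable_inverse_jap, of "C\<^sup>2"]])
    fix k
    have "jap k > 0" using jap_ge_1[of k] by simp
    then have "\<bar>d k\<bar> \<le> C * (1 / (jap k)\<^sup>2)" using C[of k] by (simp add: field_simps)
    then show "(d k)\<^sup>2 \<le> C\<^sup>2 * (1 / (jap k)\<^sup>2)\<^sup>2"
      by (metis abs_ge_zero power2_abs power_mono power_mult_distrib)
  qed auto
qed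

lemma decays_mult_abs_summable:
  assumes "decays 2 d" shows "(\<lambda>k. \<bar>d k * coord u k\<bar>) summable_on UNIV"
proof -
  have "(\<lambda>k. d k * coord u k) summable_on UNIV"
    by (intro summable_on_mult_squares decays_square_summable assms summable_coord_square)
  then show ?thesis by (subst (asm) summable_on_iff_abs_summable_on_real) simp
qed

lemma decays_mult_abs_sum_le:
  assumes "decays 2 d"
  obtains C where "\<And>u. (\<Sum>\<^sub>\<infinity>k. \<bar>d k * coord u k\<bar>) \<le> C * norm u"
proof -
  define w where "w = Abs_l2 d"
  have w: "coord w = d" unfolding w_def by (rule coord_Abs_l2[OF decays_square_summable[OF assms]])
  have "(\<Sum>\<^sub>\<infinity>k. \<bar>d k * coord u k\<bar>) \<le> norm w * norm u" for u
  proof (rule infsum_le_finite_sums)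
    show "(\<lambda>k. \<bar>d k * coord u k\<bar>) summable_on UNIV" by (rule decays_mult_abs_summable[OF assms])
    show "(\<Sum>k\<in>F. \<bar>d k * coord u k\<bar>) \<le> norm w * norm u" if "finite F" for F
    proof -
      have L2: "L2_set (coord v) F \<le> norm v" for v :: "(int \<times> int) l2"
        unfolding L2_set_def using sum_coord_le_norm[OF that, of v] by (rule real_le_lsqrt[rotated 1]) auto
      have "(\<Sum>k\<in>F. \<bar>d k * coord u k\<bar>) \<le> L2_set (coord w) F * L2_set (coord u) F"
        using L2_set_mult_ineq[of "coord w" "coord u" F] by (simp add: w abs_mult)
      also have "\<dots> \<le> norm w * norm u" by (intro mult_mono L2) (auto simp: L2_set_nonneg)
      finally show ?thesis .
    qed
  qed
  then show ?thesis using that by blast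
qed

text \<open>Meaningful for bounded d, which the lemmas below express by \<open>decays 0\<close>; for
  other d the product may leave l2, and the value of \<open>Abs_l2\<close> is then
  unspecified.\<close>

definition mult_op :: "(int \<times> int \<Rightarrow> real) \<Rightarrow> (int \<times> int) l2 \<Rightarrow> (int \<times> int) l2" where
  "mult_op d u = Abs_l2 (\<lambda>k. d k * coord u k)"

lemma decays_0_bound: assumes "decays 0 d" obtains C where "C \<ge> 0" "\<And>k. \<bar>d k\<bar> \<le> C"
  using assms unfolding decays_def by (auto intro: order_trans[OF abs_ge_zero])

lemma coord_mult_op:
  assumes "decays 0 d" shows "coord (mult_op d u) = (\<lambda>k. d k * coord u k)"
proof -
  obtain C where C: "C \<ge> 0" "\<And>k. \<bar>d k\<bar> \<le> C" using decays_0_bound[OF assms] by blast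
  have "(\<lambda>k. C\<^sup>2 * (coord u k)\<^sup>2) summable_on UNIV"
    by (intro summable_on_cmult_right summable_coord_square)
  then have "(\<lambda>k. (d k * coord u k)\<^sup>2) summable_on UNIV"
  proof (rule summable_on_comparison_test)
    fix k show "(d k * coord u k)\<^sup>2 \<le> C\<^sup>2 * (coord u k)\<^sup>2"
      using power_mono[OF C(2)[of k], of 2] by (auto simp: power_mult_distrib intro!: mult_right_mono)
  qed auto
  then show ?thesis unfolding mult_op_def by (rule coord_Abs_l2)
qed

lemma bounded_linear_mult_op:
  assumes "decays 0 d" shows "bounded_linear (mult_op d)"
proof -
  obtain C where C: "C \<ge> 0" "\<And>k. \<bar>d k\<bar> \<le> C" using decays_0_bound[OF assms] by blast
  show ?thesis
  proof (rule bounded_linear_intro[of _ C])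
    show "norm (mult_op d u) \<le> norm u * C" for u
    proof (rule norm_l2_leI)
      fix F :: "(int \<times> int) set" assume "finite F"
      have "(\<Sum>k\<in>F. (coord (mult_op d u) k)\<^sup>2) \<le> (\<Sum>k\<in>F. C\<^sup>2 * (coord u k)\<^sup>2)"
      proof (rule sum_mono)
        fix k show "(coord (mult_op d u) k)\<^sup>2 \<le> C\<^sup>2 * (coord u k)\<^sup>2"
          using power_mono[OF C(2)[of k], of 2]
          by (auto simp: coord_mult_op[OF assms] power_mult_distrib intro!: mult_right_mono)
      qed
      also have "\<dots> \<le> C\<^sup>2 * (norm u)\<^sup>2"
        unfolding sum_distrib_left[symmetric] by (intro mult_left_mono sum_coord_le_norm \<open>finite F\<close>) auto
      finally show "(\<Sum>k\<in>F. (coord (mult_op d u) k)\<^sup>2) \<le> (norm u * C)\<^sup>2"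
        by (simp add: power_mult_distrib mult.commute)
    qed (use C in auto)
  qed (auto intro!: l2_eqI simp: coord_mult_op[OF assms] algebra_simps)
qed

section \<open>Translations and the skew operator\<close>

definition shift_op :: "int \<times> int \<Rightarrow> (int \<times> int) l2 \<Rightarrow> (int \<times> int) l2" where
  "shift_op h u = Abs_l2 (\<lambda>k. coord u (k - h))"

lemma bij_minus_const: "bij_betw (\<lambda>k. k - h) UNIV (UNIV :: (int \<times> int) set)"
  by (rule bij_betwI[of _ _ _ "\<lambda>k. k + h"]) auto

lemma coord_shift_op: "coord (shift_op h u) k = coord u (k - h)"
proof -
  have "(\<lambda>k. (coord u (k - h))\<^sup>2) summable_on UNIV"
    using summable_on_reindex_bij_betw[OF bij_minus_const[of h], of "\<lambda>k. (coord u k)\<^sup>2"]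
    by (simp add: summable_coord_square)
  then show ?thesis unfolding shift_op_def by (subst coord_Abs_l2) auto
qed

lemma norm_shift_op: "norm (shift_op h u) = norm u"
proof -
  have "(norm (shift_op h u))\<^sup>2 = (norm u)\<^sup>2"
    unfolding norm_l2_square coord_shift_op
    by (rule infsum_reindex_bij_betw[OF bij_minus_const[of h], of "\<lambda>k. (coord u k)\<^sup>2"])
  then show ?thesis by simp
qed

lemma bounded_linear_shift_op: "bounded_linear (shift_op h)"
  by (rule bounded_linear_intro[of _ 1]) (auto intro!: l2_eqI simp: coord_shift_op norm_shift_op)

lemma inner_shift_op: "inner (shift_op h u) v = inner u (shift_op (- h) v)"
proof -
  have "inner (shift_op h u) v = (\<Sum>\<^sub>\<infinity>k. coord u (k - h) * coord v ((k - h) + h))"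
    by (simp add: inner_l2_def coord_shift_op)
  also have "\<dots> = (\<Sum>\<^sub>\<infinity>l. coord u l * coord v (l + h))"
    by (rule infsum_reindex_bij_betw[OF bij_minus_const[of h], of "\<lambda>l. coord u l * coord v (l + h)"])
  finally show ?thesis by (simp add: inner_l2_def coord_shift_op)
qed

text \<open>\<open>vort_coeff g\<close> are the coefficients of \<open>J(\<psi>\<^sub>0, \<phi>)\<close> if \<open>g\<close> are those of \<open>\<phi>\<close>, and
  \<open>conv_coeff a b\<close> (below) those of the Jacobian of two series.\<close>

definition diag_steps :: "(int \<times> int) set" where
  "diag_steps = {(2, 2), (2, -2), (-2, 2), (-2, -2)}"

text \<open>The coefficients of psi0 at the four steps h are \<open>sgn h1 * sgn h2\<close>. Both
  entries have modulus 2, so multiplying the cross product \<open>h1 k2 - h2 k1\<close> by this sign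
  exchanges h1 and h2 and gives \<open>h2 k2 - h1 k1\<close>.\<close>

definition step_coeff :: "int \<times> int \<Rightarrow> int \<times> int \<Rightarrow> real" where
  "step_coeff h k = real_of_int (snd h * snd k - fst h * fst k) / 16"

definition vort_coeff :: "(int \<times> int \<Rightarrow> real) \<Rightarrow> int \<times> int \<Rightarrow> real" where
  "vort_coeff g k = (\<Sum>h\<in>diag_steps. step_coeff h k * g (k - h))"

definition vort_op :: "(int \<times> int \<Rightarrow> real) \<Rightarrow> (int \<times> int) l2 \<Rightarrow> (int \<times> int) l2" where
  "vort_op d u = (\<Sum>h\<in>diag_steps. shift_op h (mult_op (\<lambda>l. step_coeff h l * d l) u))"

lemma finite_diag_steps [simp]: "finite diag_steps"
  by (simp add: diag_steps_def)

text \<open>The entries of a step have equal modulus, so the linear form vanishes on the step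
  itself. The factor can therefore be read before or after the translation, and each summand of
  \<open>vort_op\<close> is a shift of a multiplier.\<close>

lemma step_coeff_shift: "h \<in> diag_steps \<Longrightarrow> step_coeff h (k - h) = step_coeff h k"
  by (auto simp: diag_steps_def step_coeff_def field_simps)

lemma decays_step_coeff: "decays 1 d \<Longrightarrow> decays 0 (\<lambda>l. step_coeff h l * d l)"
proof -
  assume d: "decays 1 d"
  have "decays 0 (\<lambda>l. (real_of_int (snd h) / 16) * (real_of_int (snd l) * d l)
          + (- real_of_int (fst h) / 16) * (real_of_int (fst l) * d l))"
    by (intro decays_add decays_cmult decays_fst decays_snd) (use d in auto)
  then show ?thesis by (simp add: step_coeff_def algebra_simps diff_divide_distrib)
qed

lemma coord_sum: "coord (\<Sum>i\<in>I. f i) k = (\<Sum>i\<in>I. coord (f i) k)"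
  by (rule linear_sum[OF bounded_linear.linear[OF bounded_linear_coord]])

lemma coord_vort_op:
  assumes "decays 1 d"
  shows "coord (vort_op d u) k = vort_coeff (\<lambda>l. d l * coord u l) k"
  unfolding vort_op_def vort_coeff_def coord_sum
  by (intro sum.cong refl)
    (simp add: coord_shift_op coord_mult_op[OF decays_step_coeff[OF assms]] step_coeff_shift)

lemma bounded_linear_vort_op: "decays 1 d \<Longrightarrow> bounded_linear (vort_op d)"
  unfolding vort_op_def
  by (intro bounded_linear_sum bounded_linear_compose[OF bounded_linear_shift_op]
      bounded_linear_mult_op decays_step_coeff)

text \<open>The term of step h from u to v is minus the term of step -h from v to u, and the set of
  steps is symmetric. This is the antisymmetry of \<open>J(psi0, .)\<close> in L2 with the weight d
  on both sides; for u = v the pairing is 0.\<close>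

lemma inner_vort_op_skew:
  assumes d: "decays 1 d"
  shows "inner (vort_op d u) (mult_op d v) = - inner (vort_op d v) (mult_op d u)"
proof -
  have d0: "decays 0 d" using decays_mono[OF d] by simp
  note c = coord_mult_op[OF decays_step_coeff[OF d]] coord_mult_op[OF d0]
  define F where "F u v h = inner (shift_op h (mult_op (\<lambda>l. step_coeff h l * d l) u)) (mult_op d v)" for u v h
  have F: "F u v h = - F v u (- h)" if "h \<in> diag_steps" for h
  proof -
    have sc: "step_coeff (- h) (k + h) = - step_coeff h k" for k
      using that by (auto simp: diag_steps_def step_coeff_def field_simps)
    have "F u v h = (\<Sum>\<^sub>\<infinity>k. (step_coeff h k * d k * coord u k) * (d (k + h) * coord v (k + h)))"
      unfolding F_def inner_shift_op by (simp add: inner_l2_def coord_shift_op c)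
    also have "\<dots> = (\<Sum>\<^sub>\<infinity>k. - ((step_coeff (- h) (k + h) * d (k + h) * coord v (k + h)) * (d k * coord u k)))"
      by (intro infsum_cong) (simp add: sc)
    also have "\<dots> = - F v u (- h)"
      unfolding F_def by (simp add: inner_l2_def coord_shift_op c infsum_uminus)
    finally show ?thesis .
  qed
  have "inner (vort_op d u) (mult_op d v) = (\<Sum>h\<in>diag_steps. F u v h)"
    by (simp add: vort_op_def F_def inner_sum_left)
  also have "\<dots> = (\<Sum>h\<in>diag_steps. - F v u (- h))" using F by (intro sum.cong) auto
  also have "\<dots> = - (\<Sum>h\<in>diag_steps. F v u (- h))" by (simp add: sum_negf)
  also have "(\<Sum>h\<in>diag_steps. F v u (- h)) = (\<Sum>h\<in>diag_steps. F v u h)"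
    by (rule sum.reindex_bij_witness[of _ uminus uminus]) (auto simp: diag_steps_def)
  also have "\<dots> = inner (vort_op d v) (mult_op d u)"
    by (simp add: vort_op_def F_def inner_sum_left)
  finally show ?thesis .
qed

section \<open>The bilinear term\<close>

text \<open>With odd coefficients a, a sine series is -1/4 times the sum of
  \<open>a k * exp (i k.z / 2)\<close> over the whole lattice. Of the factor 1/16 one quarter stems
  from this normalisation and one quarter from two derivatives at half-integer frequencies; for
  \<open>q = k - p\<close> the cross product \<open>p1 q2 - p2 q1\<close> is
  \<open>p1 k2 - p2 k1\<close>.\<close>

definition conv_coeff :: "(int \<times> int \<Rightarrow> real) \<Rightarrow> (int \<times> int \<Rightarrow> real) \<Rightarrow> int \<times> int \<Rightarrow> real" where
  "conv_coeff a b k =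
     (\<Sum>\<^sub>\<infinity>p. real_of_int (fst p * snd k - snd p * fst k) / 16 * (a p * b (k - p)))"

text \<open>The contribution of one frequency p of the first factor, as a vector in l2: a translate
  of the differentiated second factor. Its norm is controlled by
  \<open>jap p * d p * coord u p\<close>, so the sum over p converges absolutely in norm, as in
  Young's inequality for l1 and l2.\<close>

definition conv_term where
  "conv_term d e u v p = (d p * coord u p / 16) *\<^sub>R
     (real_of_int (fst p) *\<^sub>R shift_op p (mult_op (\<lambda>l. real_of_int (snd l) * e l) v)
      - real_of_int (snd p) *\<^sub>R shift_op p (mult_op (\<lambda>l. real_of_int (fst l) * e l) v))"

definition conv_op :: "(int \<times> int \<Rightarrow> real) \<Rightarrow> (int \<times> int \<Rightarrow> real) \<Rightarrow>
    (int \<times> int) l2 \<Rightarrow> (int \<times> int) l2 \<Rightarrow> (int \<times> int) l2" where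
  "conv_op d e u v = (\<Sum>\<^sub>\<infinity>p. conv_term d e u v p)"

lemma coord_conv_term:
  assumes "decays 1 e"
  shows "coord (conv_term d e u v p) k =
    real_of_int (fst p * snd k - snd p * fst k) / 16 * ((d p * coord u p) * (e (k - p) * coord v (k - p)))"
proof -
  have e: "decays 0 (\<lambda>l. real_of_int (fst l) * e l)" "decays 0 (\<lambda>l. real_of_int (snd l) * e l)"
    using decays_fst[of 0 e] decays_snd[of 0 e] assms by auto
  show ?thesis
    unfolding conv_term_def coord_simps coord_shift_op coord_mult_op[OF e(1)] coord_mult_op[OF e(2)]
    by (simp add: field_simps)
qed

lemma norm_conv_term:
  assumes e: "decays 1 e"
  obtains C where "C \<ge> 0" "\<And>u v p. norm (conv_term d e u v p) \<le> C * norm v * \<bar>(jap p * d p) * coord u p\<bar>"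
proof -
  have e': "decays 0 (\<lambda>l. real_of_int (fst l) * e l)" "decays 0 (\<lambda>l. real_of_int (snd l) * e l)"
    using decays_fst[of 0 e] decays_snd[of 0 e] assms by auto
  obtain C1 where C1: "C1 > 0" "\<And>v. norm (mult_op (\<lambda>l. real_of_int (fst l) * e l) v) \<le> norm v * C1"
    using bounded_linear.pos_bounded[OF bounded_linear_mult_op[OF e'(1)]] by blast
  obtain C2 where C2: "C2 > 0" "\<And>v. norm (mult_op (\<lambda>l. real_of_int (snd l) * e l) v) \<le> norm v * C2"
    using bounded_linear.pos_bounded[OF bounded_linear_mult_op[OF e'(2)]] by blast
  show ?thesis
  proof (rule that[of "C1 + C2"])
    fix u v p
    have j: "\<bar>real_of_int (fst p)\<bar> \<le> jap p" "\<bar>real_of_int (snd p)\<bar> \<le> jap p" "0 \<le> jap p"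
      using fst_le_jap snd_le_jap jap_ge_1[of p] by auto
    define X where "X = real_of_int (fst p) *\<^sub>R shift_op p (mult_op (\<lambda>l. real_of_int (snd l) * e l) v)
      - real_of_int (snd p) *\<^sub>R shift_op p (mult_op (\<lambda>l. real_of_int (fst l) * e l) v)"
    have "norm X \<le> \<bar>real_of_int (fst p)\<bar> * (norm v * C2) + \<bar>real_of_int (snd p)\<bar> * (norm v * C1)"
      unfolding X_def
      by (rule order_trans[OF norm_triangle_ineq4])
        (auto simp: norm_shift_op intro!: add_mono mult_left_mono C1 C2)
    also have "\<dots> \<le> jap p * (norm v * C2) + jap p * (norm v * C1)"
      using j C1(1) C2(1) by (intro add_mono mult_right_mono) auto
    finally have X: "norm X \<le> jap p * norm v * (C1 + C2)" by (simp add: algebra_simps)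
    have "norm (conv_term d e u v p) = \<bar>d p * coord u p / 16\<bar> * norm X"
      by (simp add: conv_term_def X_def)
    also have "\<dots> \<le> \<bar>d p * coord u p\<bar> * (jap p * norm v * (C1 + C2))"
      using X by (intro mult_mono) auto
    also have "\<dots> = (C1 + C2) * norm v * \<bar>(jap p * d p) * coord u p\<bar>"
      using j(3) by (simp add: abs_mult)
    finally show "norm (conv_term d e u v p) \<le> (C1 + C2) * norm v * \<bar>(jap p * d p) * coord u p\<bar>" .
  qed (use C1 C2 in auto)
qed

lemma decays_jap: "decays (Suc n) d \<Longrightarrow> decays n (\<lambda>k. jap k * d k)"
  by (rule decays_reduce[of 1 n d jap 1]) (use jap_ge_1 order_trans[OF zero_le_one jap_ge_1] in auto)

text \<open>Of the three orders of d one pays for the derivative of the first factor and two for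
  absolute summability against a square summable family; e pays for the derivative of the second
  factor.\<close>

lemma conv_term_abs_summable:
  assumes d: "decays 3 d" and e: "decays 1 e"
  shows "conv_term d e u v abs_summable_on UNIV"
proof -
  obtain C where C: "C \<ge> 0"
    "\<And>u v p. norm (conv_term d e u v p) \<le> C * norm v * \<bar>(jap p * d p) * coord u p\<bar>"
    using norm_conv_term[OF e] by blast
  have d2: "decays 2 (\<lambda>k. jap k * d k)" using decays_jap[of 2 d] d by (simp add: numeral_3_eq_3 numeral_2_eq_2)
  have "(\<lambda>p. (C * norm v) * \<bar>(jap p * d p) * coord u p\<bar>) summable_on UNIV"
    by (intro summable_on_cmult_right decays_mult_abs_summable d2)
  then show ?thesis
    by (rule summable_on_comparison_test) (use C in auto)
qed

lemma coord_conv_op: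
  assumes d: "decays 3 d" and e: "decays 1 e"
  shows "coord (conv_op d e u v) k = conv_coeff (\<lambda>l. d l * coord u l) (\<lambda>l. e l * coord v l) k"
proof -
  have "conv_term d e u v summable_on UNIV"
    by (rule abs_summable_summable[OF conv_term_abs_summable[OF d e]])
  then have "(conv_term d e u v has_sum conv_op d e u v) UNIV"
    unfolding conv_op_def by simp
  then have "((\<lambda>p. coord (conv_term d e u v p) k) has_sum coord (conv_op d e u v) k) UNIV"
    by (rule has_sum_bounded_linear[OF bounded_linear_coord])
  then have "(\<Sum>\<^sub>\<infinity>p. coord (conv_term d e u v p) k) = coord (conv_op d e u v) k"
    by (rule infsumI)
  then show ?thesis by (simp add: conv_coeff_def coord_conv_term[OF e])
qed

lemma bounded_bilinear_conv_op:
  assumes d: "decays 3 d" and e: "decays 1 e"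
  shows "bounded_bilinear (conv_op d e)"
proof -
  obtain C where C: "C \<ge> 0"
    "\<And>u v p. norm (conv_term d e u v p) \<le> C * norm v * \<bar>(jap p * d p) * coord u p\<bar>"
    using norm_conv_term[OF e] by blast
  have d2: "decays 2 (\<lambda>k. jap k * d k)" using decays_jap[of 2 d] d by (simp add: numeral_3_eq_3 numeral_2_eq_2)
  obtain K where K: "\<And>u. (\<Sum>\<^sub>\<infinity>k. \<bar>jap k * d k * coord u k\<bar>) \<le> K * norm u"
    using decays_mult_abs_sum_le[OF d2] by blast
  have s: "conv_term d e u v summable_on UNIV" for u v
    by (rule abs_summable_summable[OF conv_term_abs_summable[OF d e]])
  have t: "conv_term d e (u + u') v = (\<lambda>p. conv_term d e u v p + conv_term d e u' v p)"
     "conv_term d e u (v + v') = (\<lambda>p. conv_term d e u v p + conv_term d e u v' p)"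
     "conv_term d e (r *\<^sub>R u) v = (\<lambda>p. r *\<^sub>R conv_term d e u v p)"
     "conv_term d e u (r *\<^sub>R v) = (\<lambda>p. r *\<^sub>R conv_term d e u v p)" for u u' v v' r
    by (auto intro!: ext l2_eqI simp: coord_conv_term[OF e] algebra_simps)
  show ?thesis
  proof
    fix u u' v v' :: "(int \<times> int) l2" and r :: real
    show "conv_op d e (u + u') v = conv_op d e u v + conv_op d e u' v"
      unfolding conv_op_def by (simp add: t infsum_add s)
    show "conv_op d e u (v + v') = conv_op d e u v + conv_op d e u v'"
      unfolding conv_op_def by (simp add: t infsum_add s)
    show "conv_op d e (r *\<^sub>R u) v = r *\<^sub>R conv_op d e u v"
      unfolding conv_op_def by (simp add: t infsum_scaleR_right)
    show "conv_op d e u (r *\<^sub>R v) = r *\<^sub>R conv_op d e u v"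
      unfolding conv_op_def by (simp add: t infsum_scaleR_right)
    show "\<exists>K. \<forall>u v. norm (conv_op d e u v) \<le> norm u * norm v * K"
    proof (intro exI allI)
      fix u v
      have "norm (conv_op d e u v) \<le> (\<Sum>\<^sub>\<infinity>p. norm (conv_term d e u v p))"
        unfolding conv_op_def by (rule norm_infsum_bound[OF conv_term_abs_summable[OF d e]])
      also have "\<dots> \<le> (\<Sum>\<^sub>\<infinity>p. (C * norm v) * \<bar>(jap p * d p) * coord u p\<bar>)"
        by (intro infsum_mono conv_term_abs_summable[OF d e] C(2) summable_on_cmult_right
            decays_mult_abs_summable d2)
      also have "\<dots> = (C * norm v) * (\<Sum>\<^sub>\<infinity>p. \<bar>(jap p * d p) * coord u p\<bar>)"
        by (simp add: infsum_cmult_right')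
      also have "\<dots> \<le> (C * norm v) * (K * norm u)"
        using C(1) by (intro mult_left_mono K) auto
      finally show "norm (conv_op d e u v) \<le> norm u * norm v * (C * K)"
        by (simp add: algebra_simps)
    qed
  qed
qed

lemma bij_const_minus: "bij_betw (\<lambda>k. h - k) UNIV (UNIV :: (int \<times> int) set)"
  by (rule bij_betwI[of _ _ _ "\<lambda>k. h - k"]) auto

text \<open>Substituting \<open>k - p\<close> for p exchanges the factors and reverses the cross
  product.\<close>

lemma conv_coeff_anti: "conv_coeff a b k = - conv_coeff b a k"
proof -
  have "conv_coeff a b k = (\<Sum>\<^sub>\<infinity>p. real_of_int (fst (k - p) * snd k - snd (k - p) * fst k) / 16
      * (a (k - p) * b (k - (k - p))))"
    unfolding conv_coeff_def
    by (rule infsum_reindex_bij_betw[OF bij_const_minus[of k], symmetric])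
  also have "\<dots> = (\<Sum>\<^sub>\<infinity>p. - (real_of_int (fst p * snd k - snd p * fst k) / 16 * (b p * a (k - p))))"
    by (intro infsum_cong) (simp add: field_simps)
  finally show ?thesis by (simp add: infsum_uminus conv_coeff_def)
qed

text \<open>For positive entries of j this is the odd extension of a single sine mode;
  \<open>odd_delta (2, 2)\<close> represents psi0.\<close>

definition odd_delta :: "int \<times> int \<Rightarrow> int \<times> int \<Rightarrow> real" where
  "odd_delta j k = (if \<bar>fst k\<bar> = fst j \<and> \<bar>snd k\<bar> = snd j then sgn (real_of_int (fst k)) * sgn (real_of_int (snd k)) else 0)"

lemma conv_coeff_odd_delta: "conv_coeff (odd_delta (2, 2)) g k = vort_coeff g k"
proof -
  have "conv_coeff (odd_delta (2, 2)) g k = (\<Sum>\<^sub>\<infinity>p\<in>diag_steps.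
      real_of_int (fst p * snd k - snd p * fst k) / 16 * (odd_delta (2, 2) p * g (k - p)))"
    unfolding conv_coeff_def
    by (rule infsum_cong_neutral) (auto simp: odd_delta_def diag_steps_def abs_if split: if_splits)
  also have "\<dots> = vort_coeff g k"
    unfolding vort_coeff_def infsum_finite[OF finite_diag_steps]
    by (intro sum.cong refl) (auto simp: diag_steps_def odd_delta_def step_coeff_def)
  finally show ?thesis .
qed

section \<open>Odd sequences and parity classes\<close>

definition odd2 :: "(int \<times> int \<Rightarrow> real) \<Rightarrow> bool" where
  "odd2 a \<longleftrightarrow> (\<forall>i j. a (- i, j) = - a (i, j) \<and> a (i, - j) = - a (i, j))"

definition even2 :: "(int \<times> int \<Rightarrow> real) \<Rightarrow> bool" where
  "even2 a \<longleftrightarrow> (\<forall>i j. a (- i, j) = a (i, j) \<and> a (i, - j) = a (i, j))"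

lemma odd2_axis: "odd2 a \<Longrightarrow> fst k = 0 \<or> snd k = 0 \<Longrightarrow> a k = 0"
  unfolding odd2_def by (cases k) (metis add.inverse_neutral equal_neg_zero fst_conv snd_conv)

lemma odd2_mult: "even2 d \<Longrightarrow> odd2 a \<Longrightarrow> odd2 (\<lambda>k. d k * a k)"
  by (auto simp: odd2_def even2_def)

lemma odd2_odd_delta: "odd2 (odd_delta j)"
  by (auto simp: odd2_def odd_delta_def sgn_minus)

text \<open>When the summation index is reflected along with k, three factors change sign: the cross
  product, the coefficient from a and the one from b.\<close>

lemma odd2_conv_coeff:
  assumes a: "odd2 a" and b: "odd2 b" shows "odd2 (conv_coeff a b)"
proof -
  have "conv_coeff a b (- i, j) = - conv_coeff a b (i, j)" for i j
  proof -
    have bij: "bij_betw (\<lambda>k::int\<times>int. (- fst k, snd k)) UNIV UNIV"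
      by (rule bij_betwI[of _ _ _ "\<lambda>k. (- fst k, snd k)"]) auto
    have "conv_coeff a b (- i, j) = (\<Sum>\<^sub>\<infinity>p. real_of_int (- fst p * j - snd p * (- i)) / 16
        * (a (- fst p, snd p) * b (- i + fst p, j - snd p)))"
      unfolding conv_coeff_def
      by (subst infsum_reindex_bij_betw[OF bij, symmetric]) simp
    also have "\<dots> = (\<Sum>\<^sub>\<infinity>p. - (real_of_int (fst p * j - snd p * i) / 16 * (a p * b ((i, j) - p))))"
    proof (intro infsum_cong)
      fix p :: "int \<times> int"
      have "b (fst p - i, j - snd p) = - b (i - fst p, j - snd p)" "a (- fst p, snd p) = - a (fst p, snd p)"
        using a b[unfolded odd2_def, rule_format, of "i - fst p" "j - snd p"] by (auto simp: odd2_def)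
      moreover have "(i, j) - p = (i - fst p, j - snd p)" "(fst p, snd p) = p" by (cases p; simp)+
      ultimately show "real_of_int (- fst p * j - snd p * (- i)) / 16 * (a (- fst p, snd p) * b (- i + fst p, j - snd p))
          = - (real_of_int (fst p * j - snd p * i) / 16 * (a p * b ((i, j) - p)))"
        by (simp add: field_simps)
    qed
    finally show ?thesis by (simp add: infsum_uminus conv_coeff_def)
  qed
  moreover have "conv_coeff a b (i, - j) = - conv_coeff a b (i, j)" for i j
  proof -
    have bij: "bij_betw (\<lambda>k::int\<times>int. (fst k, - snd k)) UNIV UNIV"
      by (rule bij_betwI[of _ _ _ "\<lambda>k. (fst k, - snd k)"]) auto
    have "conv_coeff a b (i, - j) = (\<Sum>\<^sub>\<infinity>p. real_of_int (fst p * (- j) + snd p * i) / 16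
        * (a (fst p, - snd p) * b (i - fst p, - j + snd p)))"
      unfolding conv_coeff_def
      by (subst infsum_reindex_bij_betw[OF bij, symmetric]) simp
    also have "\<dots> = (\<Sum>\<^sub>\<infinity>p. - (real_of_int (fst p * j - snd p * i) / 16 * (a p * b ((i, j) - p))))"
    proof (intro infsum_cong)
      fix p :: "int \<times> int"
      have "b (i - fst p, snd p - j) = - b (i - fst p, j - snd p)" "a (fst p, - snd p) = - a (fst p, snd p)"
        using a b[unfolded odd2_def, rule_format, of "i - fst p" "j - snd p"] by (auto simp: odd2_def)
      moreover have "(i, j) - p = (i - fst p, j - snd p)" "(fst p, snd p) = p" by (cases p; simp)+
      ultimately show "real_of_int (fst p * (- j) + snd p * i) / 16 * (a (fst p, - snd p) * b (i - fst p, - j + snd p))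
          = - (real_of_int (fst p * j - snd p * i) / 16 * (a p * b ((i, j) - p)))"
        by (simp add: field_simps)
    qed
    finally show ?thesis by (simp add: infsum_uminus conv_coeff_def)
  qed
  ultimately show ?thesis by (simp add: odd2_def)
qed

lemma odd2_vort_coeff: "odd2 g \<Longrightarrow> odd2 (vort_coeff g)"
  using odd2_conv_coeff[OF odd2_odd_delta[of "(2, 2)"]] by (simp add: conv_coeff_odd_delta[abs_def, symmetric])

text \<open>\<open>parity_space s t\<close> contains the modes with \<open>s n + t m\<close> even: for
  \<open>(s, t) = (1, 1), (0, 1), (1, 0)\<close> these are the modes of \<open>E1\<close>, \<open>E2\<close>, \<open>E3\<close> together with
  the (even, even) modes, which the quadratic term produces.\<close>

definition parity_space :: "int \<Rightarrow> int \<Rightarrow> (int \<times> int) l2 set" where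
  "parity_space s t = {u. odd2 (coord u) \<and> (\<forall>k. odd (s * fst k + t * snd k) \<longrightarrow> coord u k = 0)}"

lemma subspace_parity_space: "subspace (parity_space s t)"
  by (rule subspaceI) (auto simp: parity_space_def odd2_def)

lemma closed_parity_space: "closed (parity_space s t)"
proof -
  have c: "continuous_on UNIV (\<lambda>u. coord u k)" for k :: "int \<times> int"
    using linear_continuous_on[OF bounded_linear_coord] .
  have "parity_space s t = (\<Inter>i. \<Inter>j. {u. coord u (- i, j) = - coord u (i, j)})
      \<inter> (\<Inter>i. \<Inter>j. {u. coord u (i, - j) = - coord u (i, j)})
      \<inter> (\<Inter>k\<in>{k. odd (s * fst k + t * snd k)}. {u. coord u k = 0})"
    by (auto simp: parity_space_def odd2_def)
  moreover have "closed \<dots>"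
    by (intro closed_Int closed_INT ballI closed_Collect_eq c continuous_on_minus continuous_on_const)
  ultimately show ?thesis by simp
qed

lemma mult_op_parity_space:
  assumes "decays 0 d" "even2 d" "u \<in> parity_space s t" shows "mult_op d u \<in> parity_space s t"
  using assms odd2_mult[of d "coord u"] by (auto simp: parity_space_def coord_mult_op)

text \<open>The admissible modes form a subgroup of the lattice, so a convolution of two sequences
  supported there stays there.\<close>

lemma conv_coeff_parity:
  assumes "\<And>k. odd (s * fst k + t * snd k) \<Longrightarrow> a k = 0" "\<And>k. odd (s * fst k + t * snd k) \<Longrightarrow> b k = 0"
    and k: "odd (s * fst k + t * snd k)"
  shows "conv_coeff a b k = 0"
proof -
  have "a p * b (k - p) = 0" for p :: "int \<times> int"
  proof (cases "odd (s * fst p + t * snd p)")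
    case False
    have "s * fst (k - p) + t * snd (k - p) = (s * fst k + t * snd k) - (s * fst p + t * snd p)"
      by (simp add: algebra_simps)
    then have "odd (s * fst (k - p) + t * snd (k - p))" using k False by (metis odd_add diff_add_cancel)
    then show ?thesis using assms(2) by simp
  qed (use assms(1) in simp)
  then show ?thesis by (simp only: conv_coeff_def mult_zero_right infsum_0_simp)
qed

lemma conv_op_parity_space:
  assumes "decays 3 d" "decays 1 e" "even2 d" "even2 e" "u \<in> parity_space s t" "v \<in> parity_space s t"
  shows "conv_op d e u v \<in> parity_space s t"
proof -
  have "odd2 (coord (conv_op d e u v))"
    unfolding coord_conv_op[OF assms(1,2), abs_def]
    by (intro odd2_conv_coeff odd2_mult assms) (use assms in \<open>auto simp: parity_space_def\<close>)
  moreover have "coord (conv_op d e u v) k = 0" if "odd (s * fst k + t * snd k)" for k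
    unfolding coord_conv_op[OF assms(1,2)]
    by (rule conv_coeff_parity[OF _ _ that]) (use assms in \<open>auto simp: parity_space_def\<close>)
  ultimately show ?thesis by (auto simp: parity_space_def)
qed

lemma vort_op_parity_space:
  assumes "decays 1 d" "even2 d" "u \<in> parity_space s t"
  shows "vort_op d u \<in> parity_space s t"
proof -
  have "odd2 (coord (vort_op d u))"
    unfolding coord_vort_op[OF assms(1), abs_def]
    by (intro odd2_vort_coeff odd2_mult assms) (use assms in \<open>auto simp: parity_space_def\<close>)
  moreover have "coord (vort_op d u) k = 0" if "odd (s * fst k + t * snd k)" for k
    unfolding coord_vort_op[OF assms(1)] conv_coeff_odd_delta[symmetric]
  proof (rule conv_coeff_parity[OF _ _ that])
    show "odd_delta (2, 2) l = 0" if "odd (s * fst l + t * snd l)" for l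
    proof -
      have "\<not> (\<bar>fst l\<bar> = 2 \<and> \<bar>snd l\<bar> = 2)"
        using that by (metis dvd_abs_iff dvd_refl dvd_add dvd_mult)
      then show ?thesis by (auto simp: odd_delta_def)
    qed
  qed (use assms in \<open>auto simp: parity_space_def\<close>)
  ultimately show ?thesis by (auto simp: parity_space_def)
qed

section \<open>The linearised operator\<close>

definition diss :: "real \<Rightarrow> real \<Rightarrow> int \<times> int \<Rightarrow> real" where
  "diss mu nu k = mu * kap k + nu * (kap k)\<^sup>2"

lemma even2_kap: "even2 kap"
  by (simp add: even2_def kap_def)

lemma kap_pos: "k \<noteq> 0 \<Longrightarrow> 0 < kap k"
  using jap_le_kap[of k] jap_ge_1[of k] by (smt (verit) one_le_power)

lemma diss_pos: "0 \<le> mu \<Longrightarrow> 0 < nu \<Longrightarrow> k \<noteq> 0 \<Longrightarrow> 0 < diss mu nu k"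
  unfolding diss_def using kap_pos[of k] by (intro add_nonneg_pos) auto

lemma diss_0: "diss mu nu 0 = 0"
  by (simp add: diss_def kap_def)

lemma diss_nonneg: "0 \<le> mu \<Longrightarrow> 0 < nu \<Longrightarrow> 0 \<le> diss mu nu k"
  using diss_pos[of mu nu k] diss_0 by (cases "k = 0") auto

text \<open>The viscous term alone gives the four orders off the origin, with 1024 the square of the
  constant in \<open>jap_le_kap\<close>; at the origin the quotient is 0.\<close>

lemma decays_inverse_diss:
  assumes "0 \<le> mu" "0 < nu" shows "decays 4 (\<lambda>k. 1 / diss mu nu k)"
proof (rule decaysI)
  fix k
  show "jap k ^ 4 * \<bar>1 / diss mu nu k\<bar> \<le> 1024 / nu"
  proof (cases "k = 0")
    case True then show ?thesis using assms by (simp add: diss_0)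
  next
    case False
    have "jap k ^ 4 = ((jap k)\<^sup>2)\<^sup>2" by simp
    also have "\<dots> \<le> (32 * kap k)\<^sup>2" by (intro power_mono jap_le_kap False) simp
    finally have "nu * jap k ^ 4 \<le> 1024 * (nu * (kap k)\<^sup>2)"
      using assms by (simp add: power_mult_distrib)
    also have "\<dots> \<le> 1024 * diss mu nu k"
      using assms kap_nonneg[of k] by (simp add: diss_def)
    finally show ?thesis using diss_pos[OF assms False] assms
      by (simp add: field_simps)
  qed
qed

text \<open>The unknown is \<open>u = diss \<cdot> c\<close> for coefficients \<open>c\<close>; the critical equation becomes
  \<open>u + vort_op resp u = 0\<close>, and \<open>resp = exc - damp\<close> separates the modes \<open>kap < 2\<close>. At \<open>k = 0\<close>
  these quotients are \<open>0\<close>, which is harmless because odd sequences vanish there.\<close>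

definition resp :: "real \<Rightarrow> real \<Rightarrow> int \<times> int \<Rightarrow> real" where
  "resp mu nu k = (2 - kap k) / diss mu nu k"

definition damp :: "real \<Rightarrow> real \<Rightarrow> int \<times> int \<Rightarrow> real" where
  "damp mu nu k = max 0 (kap k - 2) / diss mu nu k"

definition exc :: "real \<Rightarrow> real \<Rightarrow> int \<times> int \<Rightarrow> real" where
  "exc mu nu k = max 0 (2 - kap k) / diss mu nu k"

lemma even2_diss: "even2 (\<lambda>k. f (kap k) / diss mu nu k)"
  using even2_kap by (simp add: even2_def diss_def)

lemma decays_kap_bounded:
  assumes "0 \<le> mu" "0 < nu" "\<And>x. x \<ge> 0 \<Longrightarrow> \<bar>f x\<bar> \<le> 2 + x"
  shows "decays 2 (\<lambda>k. f (kap k) / diss mu nu k)"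
proof -
  have "\<bar>f (kap k)\<bar> \<le> 3 * jap k ^ 2" for k
  proof -
    have "1 \<le> (jap k)\<^sup>2" using jap_ge_1[of k] by (simp add: one_le_power)
    then show ?thesis using assms(3)[OF kap_nonneg[of k]] kap_le_jap[of k] by linarith
  qed
  moreover have "decays (2 + 2) (\<lambda>k. 1 / diss mu nu k)"
    using decays_inverse_diss[OF assms(1,2)] by simp
  ultimately have "decays 2 (\<lambda>k. f (kap k) * (1 / diss mu nu k))"
    by (intro decays_reduce[of 2 2 _ _ 3]) auto
  then show ?thesis by simp
qed

lemma decays_resp: "0 \<le> mu \<Longrightarrow> 0 < nu \<Longrightarrow> decays 2 (resp mu nu)"
  and decays_damp: "0 \<le> mu \<Longrightarrow> 0 < nu \<Longrightarrow> decays 2 (damp mu nu)"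
  and decays_exc: "0 \<le> mu \<Longrightarrow> 0 < nu \<Longrightarrow> decays 2 (exc mu nu)"
  unfolding resp_def[abs_def] damp_def[abs_def] exc_def[abs_def]
  by (rule decays_kap_bounded; simp)+

lemma even2_damp: "even2 (damp mu nu)"
  unfolding damp_def[abs_def] by (rule even2_diss)

lemma resp_split: "resp mu nu k = exc mu nu k - damp mu nu k"
  by (simp add: resp_def exc_def damp_def max_def diff_divide_distrib)

text \<open>Taking the root halves the order. It is applied to the damping multiplier, whose half
  \<open>D\<close> must still absorb the one derivative in \<open>vort_op D\<close>.\<close>

lemma decays_sqrt:
  assumes "decays 2 d" "\<And>k. d k \<ge> 0" shows "decays 1 (\<lambda>k. sqrt (d k))"
proof -
  obtain C where C: "\<And>k. jap k ^ 2 * \<bar>d k\<bar> \<le> C" using assms by (auto simp: decays_def)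
  show ?thesis
  proof (rule decaysI)
    fix k
    have "jap k ^ 1 * \<bar>sqrt (d k)\<bar> = sqrt (jap k ^ 2 * \<bar>d k\<bar>)"
      using assms(2)[of k] jap_ge_1[of k] by (simp add: real_sqrt_mult)
    also have "\<dots> \<le> sqrt C" by (intro real_sqrt_le_mono C)
    finally show "jap k ^ 1 * \<bar>sqrt (d k)\<bar> \<le> sqrt C" .
  qed
qed

section \<open>Adjoints, mirror symmetries and low modes\<close>

lemma inner_mult_op:
  assumes "decays 0 d" shows "inner (mult_op d u) v = inner u (mult_op d v)"
  by (simp add: inner_l2_def coord_mult_op[OF assms] algebra_simps)

lemma vort_coeff_linear:
  "vort_coeff (\<lambda>l. f l + g l) k = vort_coeff f k + vort_coeff g k"
  "vort_coeff (\<lambda>l. f l - g l) k = vort_coeff f k - vort_coeff g k"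
  "vort_coeff (\<lambda>l. c * f l) k = c * vort_coeff f k"
  by (simp_all add: vort_coeff_def sum.distrib sum_subtractf sum_distrib_left algebra_simps)

text \<open>Multiplying coefficients by \<open>\<sigma>\<close> and permuting them by \<open>\<rho>\<close> turns \<open>J(\<psi>\<^sub>0, \<cdot>)\<close> into its
  negative; this exchanges the linearised operator with (a conjugate of) its adjoint.\<close>

lemma mirror:
  fixes \<rho> :: "int \<times> int \<Rightarrow> int \<times> int" and \<sigma> :: "int \<times> int \<Rightarrow> real"
  assumes mn: "0 \<le> mu" "0 < nu" and bij: "bij \<rho>" and \<sigma>: "\<And>k. \<bar>\<sigma> k\<bar> = 1" and kap: "\<And>k. kap (\<rho> k) = kap k"
    and anti: "\<And>g k. vort_coeff (\<lambda>l. \<sigma> l * g (\<rho> l)) k = - (\<sigma> k * vort_coeff g (\<rho> k))"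
    and u: "u + vort_op (resp mu nu) u = 0"
  obtains v where "coord v = (\<lambda>k. \<sigma> k * coord u (\<rho> k))" "vort_op (resp mu nu) v = v"
    "inner v (mult_op (resp mu nu) v) = inner u (mult_op (resp mu nu) u)"
proof -
  have d1: "decays 1 (resp mu nu)" and d0: "decays 0 (resp mu nu)"
    by (rule decays_mono[OF decays_resp[OF mn]]; simp)+
  have \<sigma>2: "\<sigma> k * \<sigma> k = 1" for k using \<sigma>[of k] by (auto simp: abs_if split: if_splits)
  define v where "v = Abs_l2 (\<lambda>k. \<sigma> k * coord u (\<rho> k))"
  have "(\<lambda>k. (coord u (\<rho> k))\<^sup>2) summable_on UNIV"
    using summable_on_reindex_bij_betw[OF bij, of "\<lambda>k. (coord u k)\<^sup>2"] by (simp add: summable_coord_square)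
  then have v: "coord v = (\<lambda>k. \<sigma> k * coord u (\<rho> k))"
    unfolding v_def by (intro coord_Abs_l2) (simp add: power_mult_distrib \<sigma>2[folded power2_eq_square])
  have r: "resp mu nu (\<rho> k) = resp mu nu k" for k by (simp add: resp_def diss_def kap)
  have u': "vort_coeff (\<lambda>l. resp mu nu l * coord u l) k = - coord u k" for k
  proof -
    have "coord (u + vort_op (resp mu nu) u) k = 0" by (simp add: u)
    then show ?thesis by (simp add: coord_vort_op[OF d1] eq_neg_iff_add_eq_0 add.commute)
  qed
  show ?thesis
  proof
    show "coord v = (\<lambda>k. \<sigma> k * coord u (\<rho> k))" by (rule v)
    show "vort_op (resp mu nu) v = v"
    proof (rule l2_eqI)
      fix k
      have "coord (vort_op (resp mu nu) v) k
          = vort_coeff (\<lambda>l. \<sigma> l * (\<lambda>l. resp mu nu l * coord u l) (\<rho> l)) k"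
        by (simp add: coord_vort_op[OF d1] v r algebra_simps)
      also have "\<dots> = coord v k" using anti[of "\<lambda>l. resp mu nu l * coord u l" k] by (simp add: v u')
      finally show "coord (vort_op (resp mu nu) v) k = coord v k" .
    qed
    have "inner v (mult_op (resp mu nu) v) = (\<Sum>\<^sub>\<infinity>k. coord u (\<rho> k) * (resp mu nu (\<rho> k) * coord u (\<rho> k)))"
      unfolding inner_l2_def coord_mult_op[OF d0] v
    proof (intro infsum_cong)
      fix k
      have "\<sigma> k * coord u (\<rho> k) * (resp mu nu k * (\<sigma> k * coord u (\<rho> k)))
          = (\<sigma> k * \<sigma> k) * (coord u (\<rho> k) * (resp mu nu k * coord u (\<rho> k)))"
        by (simp only: ac_simps)
      then show "\<sigma> k * coord u (\<rho> k) * (resp mu nu k * (\<sigma> k * coord u (\<rho> k)))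
          = coord u (\<rho> k) * (resp mu nu (\<rho> k) * coord u (\<rho> k))"
        by (simp only: \<sigma>2 r mult_1_left)
    qed
    also have "\<dots> = (\<Sum>\<^sub>\<infinity>k. coord u k * (resp mu nu k * coord u k))"
      by (rule infsum_reindex_bij_betw[OF bij])
    finally show "inner v (mult_op (resp mu nu) v) = inner u (mult_op (resp mu nu) u)"
      by (simp add: inner_l2_def coord_mult_op[OF d0])
  qed
qed

lemma odd2_orbit: "odd2 a \<Longrightarrow> a k = sgn (real_of_int (fst k)) * sgn (real_of_int (snd k)) * a (\<bar>fst k\<bar>, \<bar>snd k\<bar>)"
proof -
  assume a: "odd2 a"
  obtain i j where k: "k = (i, j)" by (cases k)
  have n: "a (- i, j) = - a (i, j)" "a (i, - j) = - a (i, j)" "a (- i, - j) = a (i, j)" for i j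
    using a by (auto simp: odd2_def)
  consider "i = 0 \<or> j = 0" | "i \<noteq> 0" "j \<noteq> 0" by blast
  then show ?thesis
  proof cases
    case 1 then show ?thesis using odd2_axis[OF a, of k] by (auto simp: k)
  next
    case 2
    then show ?thesis by (cases "i > 0"; cases "j > 0") (auto simp: k n abs_if)
  qed
qed

lemma low_mode_bounds:
  assumes "kap k \<le> 2" shows "\<bar>fst k\<bar> \<le> 2" "\<bar>snd k\<bar> \<le> 2"
proof -
  have le: "(fst k)\<^sup>2 + (snd k)\<^sup>2 \<le> 8" using assms unfolding kap_def
    by (simp flip: of_int_power of_int_add)
  have "x\<^sup>2 \<ge> 9" if "3 \<le> \<bar>x\<bar>" for x :: int
    using power_mono[OF that, of 2] by simp
  then show "\<bar>fst k\<bar> \<le> 2" "\<bar>snd k\<bar> \<le> 2"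
    using le zero_le_power2[of "fst k"] zero_le_power2[of "snd k"] by (smt (verit))+
qed

lemma kap_abs: "kap k = kap (\<bar>fst k\<bar>, \<bar>snd k\<bar>)"
  by (simp add: kap_def)

lemma low_mode_cases:
  assumes "fst k \<noteq> 0" "snd k \<noteq> 0" "kap k \<le> 2"
  shows "(\<bar>fst k\<bar>, \<bar>snd k\<bar>) \<in> {(1,1), (1,2), (2,1), (2,2)}"
  using low_mode_bounds[OF assms(3)] assms(1,2) by (auto simp: abs_if split: if_splits)

text \<open>Off the axes \<open>n^2 + m^2 = 8\<close> leaves only the modes of psi0 itself, which
  belong to none of the three classes.\<close>

lemma kap_eq_2:
  assumes "fst k \<noteq> 0" "snd k \<noteq> 0" "kap k = 2"
  shows "even (fst k)" "even (snd k)"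
proof -
  have "(\<bar>fst k\<bar>, \<bar>snd k\<bar>) \<in> {(1,1), (1,2), (2,1), (2,2)}" using assms by (intro low_mode_cases) auto
  moreover have "kap (\<bar>fst k\<bar>, \<bar>snd k\<bar>) = 2" using assms kap_abs by simp
  moreover have "x = (2, 2)" if "x \<in> {(1,1), (1,2), (2,1), (2,2)}" "kap x = 2" for x
    using that by (auto simp: kap_def)
  ultimately have "(\<bar>fst k\<bar>, \<bar>snd k\<bar>) = (2, 2)" by blast
  then show "even (fst k)" "even (snd k)" by (metis Pair_inject dvd_abs_iff dvd_refl)+
qed

text \<open>In the three cases \<open>(2 - t, 2 - s)\<close> is (1,1), (1,2), (2,1). Of the four
  positive modes with \<open>kap\<close> at most 2, parity and the strict inequality leave just this
  one.\<close>

lemma low_mode: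
  assumes st: "(s, t) \<in> {(1, 1), (0, 1), (1, 0)}" and u: "u \<in> parity_space s t"
    and k: "coord u k \<noteq> 0" "kap k < 2"
  shows "\<bar>fst k\<bar> = 2 - t" "\<bar>snd k\<bar> = 2 - s"
proof -
  have "fst k \<noteq> 0" "snd k \<noteq> 0" using odd2_axis[of "coord u" k] u k(1) by (auto simp: parity_space_def)
  then have c: "(\<bar>fst k\<bar>, \<bar>snd k\<bar>) \<in> {(1,1), (1,2), (2,1), (2,2)}" using k(2) by (intro low_mode_cases) auto
  have "\<not> odd (s * fst k + t * snd k)" using u k(1) unfolding parity_space_def by blast
  then have e: "even (s * \<bar>fst k\<bar> + t * \<bar>snd k\<bar>)" by simp
  have n: "\<not> (\<bar>fst k\<bar> = 2 \<and> \<bar>snd k\<bar> = 2)"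
  proof
    assume "\<bar>fst k\<bar> = 2 \<and> \<bar>snd k\<bar> = 2"
    then have "kap k = kap (2, 2)" using kap_abs[of k] by simp
    then show False using k(2) by (simp add: kap_def)
  qed
  have st': "s = 1 \<and> t = 1 \<or> s = 0 \<and> t = 1 \<or> s = 1 \<and> t = 0" using st by simp
  have c': "\<bar>fst k\<bar> = 1 \<and> \<bar>snd k\<bar> = 1 \<or> \<bar>fst k\<bar> = 1 \<and> \<bar>snd k\<bar> = 2 \<or> \<bar>fst k\<bar> = 2 \<and> \<bar>snd k\<bar> = 1"
    using c n by simp
  have "\<bar>fst k\<bar> = 2 - t \<and> \<bar>snd k\<bar> = 2 - s"
    using st' c' e by (elim disjE conjE) (simp_all del: even_abs_add_iff)
  then show "\<bar>fst k\<bar> = 2 - t" "\<bar>snd k\<bar> = 2 - s" by auto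
qed

text \<open>Skewness makes \<open>vort_op (resp mu nu) u\<close> orthogonal to
  \<open>mult_op (resp mu nu) u\<close>, and the critical equation replaces the former by
  \<open>- u\<close>.\<close>

lemma energy_zero:
  assumes mn: "0 \<le> mu" "0 < nu" and u: "u + vort_op (resp mu nu) u = 0"
  shows "inner u (mult_op (resp mu nu) u) = 0"
proof -
  have d1: "decays 1 (resp mu nu)" by (rule decays_mono[OF decays_resp[OF mn]]) simp
  have "vort_op (resp mu nu) u = - u" using u by (simp add: eq_neg_iff_add_eq_0 add.commute)
  then show ?thesis using inner_vort_op_skew[OF d1, of u u] by simp
qed

text \<open>\<open>resp\<close> is negative above 2, so without low modes the form is a sum of
  non-positive terms and vanishes term by term. At \<open>kap = 2\<close> the multiplier is 0 and
  the form gives no information.\<close>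

lemma energy_negative:
  assumes mn: "0 \<le> mu" "0 < nu" and z: "inner z (mult_op (resp mu nu) z) = 0"
    and low: "\<And>k. kap k < 2 \<Longrightarrow> coord z k = 0" and k: "kap k \<noteq> 2"
  shows "coord z k = 0"
proof (cases "kap k < 2")
  case False
  then have k2: "2 < kap k" using k by simp
  have d0: "decays 0 (resp mu nu)" by (rule decays_mono[OF decays_resp[OF mn]]) simp
  define F where "F k = coord z k * coord (mult_op (resp mu nu) z) k" for k
  have F: "F k = resp mu nu k * (coord z k)\<^sup>2" for k
    by (simp add: F_def coord_mult_op[OF d0] power2_eq_square)
  have le: "F k \<le> 0" for k
  proof (cases "kap k < 2")
    case False
    then show ?thesis unfolding F resp_def using diss_nonneg[OF mn, of k]
      by (intro mult_nonpos_nonneg divide_nonpos_nonneg) auto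
  qed (simp add: F low)
  have s: "F summable_on UNIV" unfolding F_def by (rule summable_coord_mult)
  have "(\<Sum>\<^sub>\<infinity>k. - F k) = 0" using z by (simp add: infsum_uminus F_def inner_l2_def)
  then have "- F k = 0"
    by (intro nonneg_infsum_le_0D[of "\<lambda>k. - F k" UNIV]) (use le s in \<open>auto simp: summable_on_uminus\<close>)
  moreover have "k \<noteq> 0" using k2 by (auto simp: kap_def)
  then have "resp mu nu k < 0" unfolding resp_def using k2 diss_pos[OF mn, of k]
    by (intro divide_neg_pos) auto
  ultimately show ?thesis by (simp add: F)
qed (simp add: low)

text \<open>Exchanging x and y leaves psi0 fixed and reverses orientation, hence the sign of the
  Jacobian.\<close>

lemma swap_vort_coeff: "vort_coeff (\<lambda>l. g (prod.swap l)) k = - vort_coeff g (prod.swap k)"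
  by (cases k) (simp add: vort_coeff_def diag_steps_def step_coeff_def field_simps)

text \<open>For even i this is the sign that the reflection of x to \<pi> - x produces on
  \<open>sin (i x / 2)\<close>; this reflection fixes psi0 and reverses orientation, and the sign is
  1 at 2 and -2. Odd i continue the alternation under steps of 2, so that the sign rule below holds
  for all sequences.\<close>

definition quarter_sign :: "int \<Rightarrow> real" where
  "quarter_sign i = (if i mod 4 = 2 \<or> i mod 4 = 3 then 1 else - 1)"

lemma quarter_sign_shift: "quarter_sign (i - 2) = - quarter_sign i" "quarter_sign (i + 2) = - quarter_sign i"
  unfolding quarter_sign_def by (auto; presburger)+

lemma sign_vort_coeff:
  "vort_coeff (\<lambda>l. quarter_sign (fst l) * g l) k = - (quarter_sign (fst k) * vort_coeff g k)"
  "vort_coeff (\<lambda>l. quarter_sign (snd l) * g l) k = - (quarter_sign (snd k) * vort_coeff g k)"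
  by (cases k; simp add: vort_coeff_def diag_steps_def step_coeff_def quarter_sign_shift field_simps)+

text \<open>This excludes a Jordan chain of length two at the critical solution. Write B for
  \<open>vort_op (resp mu nu)\<close>. Pairing \<open>y + B y = u\<close> with the mirror image v,
  for which \<open>B v = v\<close>, shows that u and v are orthogonal for the form of
  \<open>resp\<close>; each is also isotropic. So the form vanishes on \<open>u - v\<close>, which
  has no mode below 2, and u = v follows, against \<open>B u = - u\<close>.\<close>

lemma transversal:
  assumes mn: "0 \<le> mu" "0 < nu" and st: "(s, t) \<in> {(1, 1), (0, 1), (1, 0)}"
    and u: "u \<in> parity_space s t" "u + vort_op (resp mu nu) u = 0" "u \<noteq> 0"
    and ee: "\<And>k. even (fst k) \<Longrightarrow> even (snd k) \<Longrightarrow> coord u k = 0"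
  shows "y + vort_op (resp mu nu) y \<noteq> u"
proof
  assume y: "y + vort_op (resp mu nu) y = u"
  have d1: "decays 1 (resp mu nu)" and d0: "decays 0 (resp mu nu)"
    by (rule decays_mono[OF decays_resp[OF mn]]; simp)+
  have odd: "odd2 (coord u)" using u(1) by (simp add: parity_space_def)
  have axis: "coord u k = 0" if "fst k = 0 \<or> snd k = 0" for k using odd2_axis[OF odd that] .
  \<comment> \<open>The mirror image depends on the class: exchange of x and y for (odd, odd),
    otherwise the sign attached to the index that is even in the class. Each fixes the single low
    mode.\<close>
  obtain v where v: "vort_op (resp mu nu) v = v"
      "inner v (mult_op (resp mu nu) v) = inner u (mult_op (resp mu nu) u)"
      "\<And>k. kap k < 2 \<Longrightarrow> coord v k = coord u k" "\<And>k. kap k = 2 \<Longrightarrow> coord v k = 0"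
  proof -
    have z2: "coord u k = 0" if "kap k = 2" for k using kap_eq_2[OF _ _ that] ee axis by blast
    have sgn1: "\<bar>quarter_sign i\<bar> = 1" for i by (simp add: quarter_sign_def)
    have q2: "quarter_sign i = 1" if "\<bar>i\<bar> = 2" for i
    proof -
      have "i = 2 \<or> i = - 2" using that by linarith
      then show ?thesis by (auto simp: quarter_sign_def)
    qed
    consider "s = 1" "t = 1" | "s = 0" "t = 1" | "s = 1" "t = 0" using st by auto
    then show ?thesis
    proof cases
      case 1
      have ks: "kap (prod.swap k) = kap k" for k by (simp add: kap_def add.commute)
      obtain v where v: "coord v = (\<lambda>k. 1 * coord u (prod.swap k))" "vort_op (resp mu nu) v = v"
          "inner v (mult_op (resp mu nu) v) = inner u (mult_op (resp mu nu) u)"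
        by (rule mirror[OF mn, of prod.swap "\<lambda>_. 1", OF _ _ _ _ u(2)])
          (auto simp: ks bij_swap swap_vort_coeff)
      have "coord v k = coord u k" if "kap k < 2" for k
      proof (cases "coord u k = 0 \<and> coord u (prod.swap k) = 0")
        case False
        then have "\<bar>fst k\<bar> = 1 \<and> \<bar>snd k\<bar> = 1"
          using low_mode[OF st u(1), of k] low_mode[OF st u(1), of "prod.swap k"] that ks[of k] 1 by auto
        then show ?thesis
          using odd2_orbit[OF odd, of k] odd2_orbit[OF odd, of "prod.swap k"] by (simp add: v(1))
      qed (simp add: v(1))
      moreover have "coord v k = 0" if "kap k = 2" for k using z2[of "prod.swap k"] ks that by (simp add: v(1))
      ultimately show ?thesis using that v by blast
    next
      case 2
      obtain v where v: "coord v = (\<lambda>k. quarter_sign (snd k) * coord u (id k))" "vort_op (resp mu nu) v = v"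
          "inner v (mult_op (resp mu nu) v) = inner u (mult_op (resp mu nu) u)"
        by (rule mirror[OF mn, of id "\<lambda>k. quarter_sign (snd k)", OF _ _ _ _ u(2)])
          (auto simp: sgn1 sign_vort_coeff)
      have "coord v k = coord u k" if "kap k < 2" for k
        using low_mode[OF st u(1), of k] that 2 q2[of "snd k"] by (cases "coord u k = 0") (auto simp: v(1))
      then show ?thesis using that v z2 by auto
    next
      case 3
      obtain v where v: "coord v = (\<lambda>k. quarter_sign (fst k) * coord u (id k))" "vort_op (resp mu nu) v = v"
          "inner v (mult_op (resp mu nu) v) = inner u (mult_op (resp mu nu) u)"
        by (rule mirror[OF mn, of id "\<lambda>k. quarter_sign (fst k)", OF _ _ _ _ u(2)])
          (auto simp: sgn1 sign_vort_coeff)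
      have "coord v k = coord u k" if "kap k < 2" for k
        using low_mode[OF st u(1), of k] that 3 q2[of "fst k"] by (cases "coord u k = 0") (auto simp: v(1))
      then show ?thesis using that v z2 by auto
    qed
  qed
  have z2: "coord u k = 0" if "kap k = 2" for k using kap_eq_2[OF _ _ that] ee axis by blast
  let ?E = "mult_op (resp mu nu)"
  interpret E: bounded_linear ?E by (rule bounded_linear_mult_op[OF d0])
  have "inner u (?E v) = inner y (?E v) + inner (vort_op (resp mu nu) y) (?E v)"
    by (simp add: y[symmetric] inner_add_left)
  also have "\<dots> = inner y (?E v) - inner v (?E y)"
    using inner_vort_op_skew[OF d1, of y v] v(1) by simp
  also have "\<dots> = 0" by (metis inner_commute inner_mult_op[OF d0] diff_self)
  finally have uv: "inner u (?E v) = 0" .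
  have "inner (u - v) (?E (u - v)) = inner u (?E u) + inner v (?E v) - 2 * inner u (?E v)"
  proof -
    have "inner v (?E u) = inner u (?E v)" by (metis inner_commute inner_mult_op[OF d0])
    then show ?thesis by (simp add: E.diff inner_diff_left inner_diff_right)
  qed
  also have "\<dots> = 0" using energy_zero[OF mn u(2)] v(2) uv by simp
  finally have z: "inner (u - v) (?E (u - v)) = 0" .
  have "u = v"
  proof (rule l2_eqI)
    fix k show "coord u k = coord v k"
      using energy_negative[OF mn z, of k] v(3,4) z2 by (cases "kap k = 2") auto
  qed
  then have "u + u = 0" using u(2) v(1) by simp
  then have "2 *\<^sub>R u = 0" by (simp add: scaleR_2)
  then show False using u(3) by simp
qed

text \<open>For \<open>w = uc + \<epsilon> u\<close> and parameters scaled by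
  \<open>1 + \<epsilon> \<delta>\<close> the steady-state equation at
  \<open>psi0 + \<epsilon> w\<close> reads
  \<open>\<epsilon> (w + B w) + \<epsilon>^2 (\<delta> w + Q w w) = 0\<close> in the variable
  \<open>diss * c\<close>, with B the linear and Q the quadratic term. The critical equation removes
  the order \<epsilon>, and division by \<open>\<epsilon>^2\<close> leaves the equation shown. The
  inner product is, up to a factor, the L2 product of the functions.\<close>

lemma bifurcating_coefficients:
  assumes mn: "0 \<le> mu" "0 < nu" and st: "(s, t) \<in> {(1, 1), (0, 1), (1, 0)}"
    and uc: "uc \<in> parity_space s t" "uc + vort_op (resp mu nu) uc = 0" "uc \<noteq> 0"
    and ee: "\<And>k. even (fst k) \<Longrightarrow> even (snd k) \<Longrightarrow> coord uc k = 0"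
  defines "d \<equiv> \<lambda>k. 1 / diss mu nu k" and "e \<equiv> \<lambda>k. - kap k / diss mu nu k"
  shows "\<exists>e0>0. \<exists>C. \<forall>\<epsilon>. 0 < \<epsilon> \<and> \<epsilon> < e0 \<longrightarrow> (\<exists>u\<in>parity_space s t. \<exists>\<delta>. norm u \<le> C \<and> \<bar>\<delta>\<bar> \<le> C \<and>
    inner (mult_op d u) (mult_op d uc) = 0 \<and>
    u + vort_op (resp mu nu) u + \<delta> *\<^sub>R (uc + \<epsilon> *\<^sub>R u) + conv_op d e (uc + \<epsilon> *\<^sub>R u) (uc + \<epsilon> *\<^sub>R u) = 0)"
proof -
  let ?V = "parity_space s t"
  \<comment> \<open>Half of the damping multiplier on each side: \<open>P R\<close> is, up to sign,
    the damped part of the linearisation, while \<open>R P\<close> is skew.\<close>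
  define D where "D = (\<lambda>k. sqrt (damp mu nu k))"
  have damp0: "damp mu nu k \<ge> 0" for k unfolding damp_def using diss_nonneg[OF mn] by simp
  have D1: "decays 1 D" unfolding D_def by (rule decays_sqrt[OF decays_damp[OF mn] damp0])
  have D0: "decays 0 D" by (rule decays_mono[OF D1]) simp
  have eD: "even2 D" using even2_damp[of mu nu] by (simp add: D_def even2_def)
  have r1: "decays 1 (resp mu nu)" by (rule decays_mono[OF decays_resp[OF mn]]) simp
  have x1: "decays 1 (exc mu nu)" by (rule decays_mono[OF decays_exc[OF mn]]) simp
  have d: "decays 3 d" "decays 0 d" unfolding d_def by (rule decays_mono[OF decays_inverse_diss[OF mn]]; simp)+
  have e: "decays 1 e" unfolding e_def
    by (rule decays_mono[OF decays_kap_bounded[OF mn, of uminus]]) simp_all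
  have de: "even2 d" "even2 e"
    using even2_diss[of "\<lambda>_. 1" mu nu] even2_diss[of uminus mu nu] by (auto simp: d_def e_def)
  define P where "P = vort_op D"
  define R where "R = mult_op D"
  have P: "bounded_linear P" "P ` ?V \<subseteq> ?V" and R: "bounded_linear R" "R ` ?V \<subseteq> ?V"
    unfolding P_def R_def using bounded_linear_vort_op[OF D1] bounded_linear_mult_op[OF D0]
      vort_op_parity_space[OF D1 eD] mult_op_parity_space[OF D0 eD] by auto
  have skew: "inner w (R (P w)) = 0" for w
  proof -
    have "inner w (R (P w)) = inner (P w) (R w)"
      unfolding R_def by (metis inner_commute inner_mult_op[OF D0])
    then show ?thesis using inner_vort_op_skew[OF D1, of w w] by (simp add: P_def R_def)
  qed
  obtain G K where G: "\<And>f. f \<in> ?V \<Longrightarrow> G f \<in> ?V" "\<And>f. f \<in> ?V \<Longrightarrow> G f - P (R (G f)) = f"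
    "\<And>f. f \<in> ?V \<Longrightarrow> norm (G f) \<le> K * norm f"
    "\<And>u. u \<in> ?V \<Longrightarrow> G (u - P (R u)) = u"
    "\<And>f g. f \<in> ?V \<Longrightarrow> g \<in> ?V \<Longrightarrow> G (f - g) = G f - G g"
    using skew_factor_solvable[OF P R closed_parity_space subspace_parity_space skew] by blast
  define A' where "A' u = u - P (R u)" for u
  have A': "linear A'" unfolding A'_def
    by (intro linear_compose_sub linear_id[unfolded id_def]
        bounded_linear.linear[OF bounded_linear_compose[OF P(1) R(1)]])
  define k0 where "k0 = (2 - t, 2 - s)"
  define c where "c u = coord u k0" for u
  define b where "b = vort_op (exc mu nu) (Abs_l2 (odd_delta k0))"
  have k0: "fst k0 > 0" "snd k0 > 0" using st by (auto simp: k0_def)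
  have od: "coord (Abs_l2 (odd_delta k0)) = odd_delta k0"
  proof (rule coord_Abs_l2, rule finite_nonzero_values_imp_summable_on)
    have "{k. odd_delta k0 k \<noteq> 0} \<subseteq> {- fst k0..fst k0} \<times> {- snd k0..snd k0}"
      by (auto simp: odd_delta_def abs_if split: if_splits)
    then show "finite {k \<in> UNIV. (odd_delta k0 k)\<^sup>2 \<noteq> 0}" by (auto intro: finite_subset)
  qed
  \<comment> \<open>The rank-one splitting: the excited part sees only the orbit of k0, where
    oddness makes every coefficient a signed copy of \<open>c u\<close>.\<close>
  have A: "u + vort_op (resp mu nu) u = A' u + c u *\<^sub>R b" if u: "u \<in> ?V" for u
  proof (rule l2_eqI)
    fix k
    have odd: "odd2 (coord u)" using u by (simp add: parity_space_def)
    have x: "exc mu nu l * coord u l = c u * (exc mu nu l * odd_delta k0 l)" for l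
    proof (cases "kap l < 2")
      case True
      show ?thesis
      proof (cases "(\<bar>fst l\<bar>, \<bar>snd l\<bar>) = k0")
        case True then show ?thesis using odd2_orbit[OF odd, of l] by (auto simp: c_def odd_delta_def)
      next
        case False
        then have "coord u l = 0" using low_mode[OF st u _ True] by (auto simp: k0_def)
        moreover have "odd_delta k0 l = 0" using False by (auto simp: odd_delta_def)
        ultimately show ?thesis by simp
      qed
    qed (simp add: exc_def)
    have D2: "D l * (D l * y) = damp mu nu l * y" for l y
      using damp0[of l] by (simp add: D_def mult.assoc[symmetric])
    have "vort_coeff (\<lambda>l. resp mu nu l * coord u l) k
        = vort_coeff (\<lambda>l. exc mu nu l * coord u l - damp mu nu l * coord u l) k"
      by (simp add: resp_split algebra_simps)
    also have "\<dots> = c u * vort_coeff (\<lambda>l. exc mu nu l * odd_delta k0 l) k - vort_coeff (\<lambda>l. D l * (D l * coord u l)) k"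
      by (simp add: x D2 vort_coeff_linear)
    finally show "coord (u + vort_op (resp mu nu) u) k = coord (A' u + c u *\<^sub>R b) k"
      by (simp add: coord_vort_op[OF r1] A'_def P_def R_def coord_vort_op[OF D1] coord_mult_op[OF D0]
          b_def coord_vort_op[OF x1] od)
  qed
  define l where "l u = inner (mult_op d u) (mult_op d uc)" for u
  have l: "bounded_linear l" unfolding l_def
    by (intro bounded_linear_inner_left_comp bounded_linear_mult_op d)
  have luc: "l uc \<noteq> 0"
  proof
    assume "l uc = 0"
    then have "mult_op d uc = 0" by (simp add: l_def)
    then have z: "d k * coord uc k = 0" for k by (metis coord_mult_op[OF d(2)] coord_simps(1))
    have "coord uc k = 0" for k
    proof (cases "k = 0")
      case True then show ?thesis using ee[of k] by simp
    next
      case False then show ?thesis using z[of k] diss_pos[OF mn False] by (simp add: d_def)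
    qed
    then show False using uc(3) by (metis coord_simps(1) l2_eqI)
  qed
  have "A' uc + c uc *\<^sub>R b = 0" using A[OF uc(1)] uc(2) by simp
  moreover have "A' y + c y *\<^sub>R b \<noteq> uc" if "y \<in> ?V" for y
    using transversal[OF mn st uc ee, of y] A[OF that] by simp
  moreover have "bounded_linear c" unfolding c_def by (rule bounded_linear_coord)
  ultimately obtain U dl K' where U: "\<And>f. f \<in> ?V \<Longrightarrow> U f \<in> ?V"
    "\<And>f. f \<in> ?V \<Longrightarrow> A' (U f) + c (U f) *\<^sub>R b + dl f *\<^sub>R uc = f"
    "\<And>f. f \<in> ?V \<Longrightarrow> l (U f) = 0"
    "\<And>f. f \<in> ?V \<Longrightarrow> norm (U f) \<le> K' * norm f"
    "\<And>f. f \<in> ?V \<Longrightarrow> \<bar>dl f\<bar> \<le> K' * norm f"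
    "\<And>f g. f \<in> ?V \<Longrightarrow> g \<in> ?V \<Longrightarrow> U (f - g) = U f - U g"
    "\<And>f g. f \<in> ?V \<Longrightarrow> g \<in> ?V \<Longrightarrow> dl (f - g) = dl f - dl g"
    using bordered_right_inverse[OF subspace_parity_space[of s t] A' _ l G[folded A'_def] uc(1) _ luc, of c b]
    by blast
  \<comment> \<open>The unknown f stands for the linear part including the term
    \<open>\<delta> uc\<close>, so that \<open>u = U f\<close> and \<open>\<delta> = dl f\<close>;
    the terms left over form the quadratic right side.\<close>
  have "\<exists>e0>0. \<exists>r. \<forall>\<epsilon>. 0 < \<epsilon> \<and> \<epsilon> < e0 \<longrightarrow> (\<exists>f\<in>?V. norm f \<le> r \<and>
      f = - (\<epsilon> * dl f) *\<^sub>R U f - conv_op d e (uc + \<epsilon> *\<^sub>R U f) (uc + \<epsilon> *\<^sub>R U f))"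
    by (rule small_quadratic_fixed_point[OF closed_parity_space[of s t] subspace_parity_space[of s t]
          bounded_bilinear_conv_op[OF d(1) e] conv_op_parity_space[OF d(1) e de] U(1) U(4) U(6) U(5) U(7) uc(1)])
  then obtain e0 r where e0: "e0 > 0" and r: "\<And>\<epsilon>. 0 < \<epsilon> \<Longrightarrow> \<epsilon> < e0 \<Longrightarrow> \<exists>f\<in>?V. norm f \<le> r \<and>
      f = - (\<epsilon> * dl f) *\<^sub>R U f - conv_op d e (uc + \<epsilon> *\<^sub>R U f) (uc + \<epsilon> *\<^sub>R U f)" by blast
  show ?thesis
  proof (rule exI[of _ e0], intro conjI e0, rule exI[of _ "\<bar>K'\<bar> * r"], intro allI impI)
    fix \<epsilon> assume "0 < \<epsilon> \<and> \<epsilon> < e0"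
    then obtain f where f: "f \<in> ?V" "norm f \<le> r"
      "f = - (\<epsilon> * dl f) *\<^sub>R U f - conv_op d e (uc + \<epsilon> *\<^sub>R U f) (uc + \<epsilon> *\<^sub>R U f)"
      using r by blast
    have b: "K' * norm f \<le> \<bar>K'\<bar> * r"
      using mult_right_mono[OF abs_ge_self norm_ge_zero, of K' f] mult_left_mono[OF f(2), of "\<bar>K'\<bar>"] by (auto intro: order_trans)
    show "\<exists>u\<in>?V. \<exists>\<delta>. norm u \<le> \<bar>K'\<bar> * r \<and> \<bar>\<delta>\<bar> \<le> \<bar>K'\<bar> * r \<and>
      inner (mult_op d u) (mult_op d uc) = 0 \<and>
      u + vort_op (resp mu nu) u + \<delta> *\<^sub>R (uc + \<epsilon> *\<^sub>R u) + conv_op d e (uc + \<epsilon> *\<^sub>R u) (uc + \<epsilon> *\<^sub>R u) = 0"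
    proof (intro bexI[of _ "U f"] exI[of _ "dl f"] conjI)
      show "norm (U f) \<le> \<bar>K'\<bar> * r" "\<bar>dl f\<bar> \<le> \<bar>K'\<bar> * r"
        using U(4)[OF f(1)] U(5)[OF f(1)] b by linarith+
      show "inner (mult_op d (U f)) (mult_op d uc) = 0" using U(3)[OF f(1)] by (simp add: l_def)
      have "U f + vort_op (resp mu nu) (U f) + dl f *\<^sub>R uc = f"
        using U(2)[OF f(1)] A[OF U(1)[OF f(1)]] by simp
      then have "U f + vort_op (resp mu nu) (U f) + dl f *\<^sub>R uc
          = - (\<epsilon> * dl f) *\<^sub>R U f - conv_op d e (uc + \<epsilon> *\<^sub>R U f) (uc + \<epsilon> *\<^sub>R U f)"
        using f(3) by simp
      then show "U f + vort_op (resp mu nu) (U f) + dl f *\<^sub>R (uc + \<epsilon> *\<^sub>R U f)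
          + conv_op d e (uc + \<epsilon> *\<^sub>R U f) (uc + \<epsilon> *\<^sub>R U f) = 0"
        by (simp add: algebra_simps eq_neg_iff_add_eq_0)
    qed (rule U(1)[OF f(1)])
  qed
qed

section \<open>Weak derivatives\<close>

text \<open>Restriction turns set integrals and conditional almost-everywhere statements into plain
  ones over a finite measure space.\<close>

definition square_measure :: "(real \<times> real) measure" where
  "square_measure = restrict_space lborel Omega"

lemma borel_measurable_lborel: "borel_measurable lborel = borel_measurable borel"
  by (rule measurable_cong_sets) simp_all

lemma Omega_box: "Omega = box (0, 0) (2 * pi, 2 * pi)"
  by (auto simp: Omega_def mem_box Basis_prod_def)

lemma open_Omega: "open Omega"
  unfolding Omega_box by (rule open_box)

lemma Omega_borel [measurable]: "Omega \<in> sets borel"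
  using open_Omega by simp

lemma space_square_measure [simp]: "space square_measure = Omega"
  by (simp add: square_measure_def space_restrict_space)

lemma finite_square_measure: "finite_measure square_measure"
proof (rule finite_measureI)
  show "emeasure square_measure (space square_measure) \<noteq> \<infinity>"
    using emeasure_lborel_box_finite[of "(0, 0)" "(2 * pi, 2 * pi)"]
    by (simp add: square_measure_def emeasure_restrict_space space_restrict_space Omega_box)
qed

interpretation square_measure: finite_measure square_measure
  by (rule finite_square_measure)

lemma integrable_square_measure:
  fixes f :: plane_fun
  shows "integrable square_measure f \<longleftrightarrow> set_integrable lborel Omega f"
  unfolding square_measure_def set_integrable_def by (subst integrable_restrict_space) auto

lemma integral_square_measure:
  fixes f :: plane_fun
  shows "(LINT z:Omega|lborel. f z) = integral\<^sup>L square_measure f"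
  unfolding square_measure_def set_lebesgue_integral_def by (subst integral_restrict_space) auto

lemma AE_square_measure: "(AE z in square_measure. P z) \<longleftrightarrow> (AE z in lborel. z \<in> Omega \<longrightarrow> P z)"
  unfolding square_measure_def by (subst AE_restrict_space_iff) auto

lemma borel_measurable_square_measure [measurable]:
  "f \<in> borel_measurable borel \<Longrightarrow> f \<in> borel_measurable square_measure"
  unfolding square_measure_def by (rule measurable_restrict_space1) simp

lemma integrable_square_mult_bounded:
  fixes f g :: plane_fun
  assumes f: "integrable square_measure f" and g: "g \<in> borel_measurable square_measure"
    and B: "\<And>z. \<bar>g z\<bar> \<le> B"
  shows "integrable square_measure (\<lambda>z. f z * g z)"
proof (rule Bochner_Integration.integrable_bound[of _ "\<lambda>z. B * f z"])
  show "integrable square_measure (\<lambda>z. B * f z)" using f by simp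
  show "(\<lambda>z. f z * g z) \<in> borel_measurable square_measure" using f g by measurable
  show "AE z in square_measure. norm (f z * g z) \<le> norm (B * f z)"
  proof (rule AE_I2)
    fix z
    have "\<bar>g z\<bar> \<le> \<bar>B\<bar>" using B[of z] by linarith
    then show "norm (f z * g z) \<le> norm (B * f z)"
      by (simp add: abs_mult mult.commute[of "\<bar>f z\<bar>"] mult_right_mono)
  qed
qed

lemma integrable_square_bounded:
  fixes g :: plane_fun
  assumes "g \<in> borel_measurable square_measure" "\<And>z. \<bar>g z\<bar> \<le> B"
  shows "integrable square_measure g"
  using integrable_square_mult_bounded[of "\<lambda>_. 1" g B] assms by simp

lemma locally_integrable_if_integrable:
  assumes "integrable square_measure f" shows "locally_integrable f"
  unfolding locally_integrable_def
proof safe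
  fix K assume "compact K" "K \<subseteq> Omega"
  then show "set_integrable lborel K f"
    using set_integrable_subset[of lborel Omega f K] assms
    by (simp add: integrable_square_measure borel_compact)
qed

text \<open>A compact exhaustion of Omega, since local integrability speaks about compact subsets
  only.\<close>

definition inner_box :: "nat \<Rightarrow> (real \<times> real) set" where
  "inner_box n = cbox (1 / real (Suc n), 1 / real (Suc n)) (2 * pi - 1 / real (Suc n), 2 * pi - 1 / real (Suc n))"

lemma inner_box_subset: "inner_box n \<subseteq> Omega"
proof -
  obtain p where p: "p = 1 / real (Suc n)" "p > 0" by simp
  then show ?thesis unfolding inner_box_def Omega_def p(1)[symmetric] by (auto simp: cbox_Pair_eq)
qed

lemma eventually_in_inner_box: "z \<in> Omega \<Longrightarrow> \<forall>\<^sub>F n in sequentially. z \<in> inner_box n"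
proof -
  assume z: "z \<in> Omega"
  obtain x y where xy: "z = (x, y)" "0 < x" "x < 2 * pi" "0 < y" "y < 2 * pi"
    using z by (auto simp: Omega_def)
  have lim: "(\<lambda>n. 1 / real (Suc n)) \<longlonglongrightarrow> 0" by (rule LIMSEQ_Suc[OF lim_1_over_n])
  define m where "m = min (min x (2 * pi - x)) (min y (2 * pi - y))"
  have "m > 0" using xy by (simp add: m_def)
  then have "\<forall>\<^sub>F n in sequentially. 1 / real (Suc n) < m" using lim by (rule order_tendstoD(2)[rotated])
  then show ?thesis
    by eventually_elim (auto simp: inner_box_def cbox_Pair_eq xy(1) m_def)
qed

text \<open>The truncations to the inner boxes are integrable, hence measurable, and converge
  pointwise on Omega. This gives measurability of weak derivatives, which are known only as some
  choice.\<close>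

lemma locally_integrable_measurable:
  assumes "locally_integrable f" shows "f \<in> borel_measurable square_measure"
proof -
  have "(\<lambda>z. indicator (inner_box n) z * f z) \<in> borel_measurable borel" for n
  proof -
    have "set_integrable lborel (inner_box n) f"
      using assms inner_box_subset[of n] unfolding locally_integrable_def by (auto simp: inner_box_def)
    then show ?thesis unfolding set_integrable_def by (auto dest: borel_measurable_integrable)
  qed
  then have "(\<lambda>z. indicator Omega z * f z) \<in> borel_measurable borel"
  proof (rule borel_measurable_LIMSEQ_real[rotated])
    fix z
    show "(\<lambda>n. indicator (inner_box n) z * f z) \<longlonglongrightarrow> indicator Omega z * f z"
    proof (cases "z \<in> Omega")
      case True
      have "\<forall>\<^sub>F n in sequentially. indicator (inner_box n) z * f z = indicator Omega z * f z"
        using eventually_in_inner_box[OF True] by eventually_elim (simp add: True)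
      then show ?thesis by (rule tendsto_eventually)
    next
      case False
      then have "z \<notin> inner_box n" for n using inner_box_subset by auto
      then show ?thesis using False by simp
    qed
  qed
  then have "(\<lambda>z. indicator Omega z *\<^sub>R f z) \<in> borel_measurable lborel"
    by (simp only: real_scaleR_def borel_measurable_lborel)
  then show ?thesis
    unfolding square_measure_def
    by (rule borel_measurable_restrict_space_iff[THEN iffD2, rotated]) simp
qed

section \<open>Test functions and the fundamental lemma of the calculus of variations\<close>

lemma test_functionI:
  assumes d: "\<And>z. (\<eta> has_derivative (\<lambda>e. fst e * p z + snd e * q z)) (at z)"
    and pq: "continuous_on UNIV p" "continuous_on UNIV q"
    and K: "compact K" "K \<subseteq> Omega" "\<And>z. z \<notin> K \<Longrightarrow> \<eta> z = 0"
  shows "test_function \<eta>"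
  unfolding test_function_def
proof (intro conjI allI)
  show "\<eta> differentiable at z" for z using d differentiable_def by blast
  have "(\<lambda>z. frechet_derivative \<eta> (at z) e) = (\<lambda>z. fst e * p z + snd e * q z)" for e
    by (simp add: frechet_derivative_at[OF d, symmetric])
  then show "continuous_on UNIV (\<lambda>z. frechet_derivative \<eta> (at z) e)" for e
    using pq by (simp only:) (intro continuous_intros)
  have sub: "closure {z. \<eta> z \<noteq> 0} \<subseteq> K"
    using K by (intro closure_minimal) (auto intro: compact_imp_closed)
  then show "closure {z. \<eta> z \<noteq> 0} \<subseteq> Omega" using K by blast
  show "compact (closure {z. \<eta> z \<noteq> 0})"
    using sub K(1) compact_Int_closed[of K "closure {z. \<eta> z \<noteq> 0}"] by (simp add: Int_absorb1)
qed

lemma test_function_props: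
  assumes "test_function \<eta>"
  shows "continuous_on UNIV \<eta>" "continuous_on UNIV (\<lambda>z. frechet_derivative \<eta> (at z) e)"
    "z \<notin> Omega \<Longrightarrow> \<eta> z = 0" "z \<notin> Omega \<Longrightarrow> frechet_derivative \<eta> (at z) e = 0"
    "\<exists>B. \<forall>z. \<bar>\<eta> z\<bar> \<le> B" "\<exists>B. \<forall>z. \<bar>frechet_derivative \<eta> (at z) e\<bar> \<le> B"
proof -
  let ?S = "closure {z. \<eta> z \<noteq> 0}"
  have diff: "\<eta> differentiable (at z)" for z using assms unfolding test_function_def by blast
  show c: "continuous_on UNIV \<eta>"
    by (intro differentiable_imp_continuous_on) (auto simp: differentiable_on_def intro: diff differentiable_at_withinI)
  show dc: "continuous_on UNIV (\<lambda>z. frechet_derivative \<eta> (at z) e)" for e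
    using assms unfolding test_function_def by blast
  have S: "compact ?S" "?S \<subseteq> Omega" using assms unfolding test_function_def by blast+
  have out: "\<eta> z = 0" if "z \<notin> ?S" for z using that closure_subset[of "{z. \<eta> z \<noteq> 0}"] by auto
  have dout: "frechet_derivative \<eta> (at z) e = 0" if "z \<notin> ?S" for z e
  proof -
    have "(\<eta> has_derivative (\<lambda>_. 0)) (at z)"
    proof (rule has_derivative_transform_within_open)
      show "((\<lambda>_. 0) has_derivative (\<lambda>_. 0)) (at z)" by simp
      show "open (- ?S)" by (intro open_Compl closed_closure)
      show "z \<in> - ?S" using that by simp
      show "0 = \<eta> x" if "x \<in> - ?S" for x using out[of x] that by simp
    qed
    then show ?thesis by (metis frechet_derivative_at)
  qed
  show "z \<notin> Omega \<Longrightarrow> \<eta> z = 0" "z \<notin> Omega \<Longrightarrow> frechet_derivative \<eta> (at z) e = 0"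
    using out dout S by blast+
  have bdd: "\<exists>B. \<forall>z. \<bar>f z\<bar> \<le> B" if "continuous_on UNIV f" "\<And>z. z \<notin> ?S \<Longrightarrow> f z = 0" for f :: plane_fun
  proof -
    have "bounded (f ` ?S)"
      by (intro compact_imp_bounded compact_continuous_image S continuous_on_subset[OF that(1)]) auto
    then obtain B where B: "\<And>z. z \<in> ?S \<Longrightarrow> \<bar>f z\<bar> \<le> B" unfolding bounded_iff by auto
    have "\<bar>f z\<bar> \<le> max B 0" for z using B[of z] that(2)[of z] by (cases "z \<in> ?S") auto
    then show ?thesis by blast
  qed
  show "\<exists>B. \<forall>z. \<bar>\<eta> z\<bar> \<le> B" "\<exists>B. \<forall>z. \<bar>frechet_derivative \<eta> (at z) e\<bar> \<le> B"
    by (rule bdd; use c dc out dout in blast)+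
qed

text \<open>The square of a positive part is continuously differentiable across its zero, which is
  the regularity that test functions have here.\<close>

definition bump_weight :: "real \<Rightarrow> real \<Rightarrow> real \<Rightarrow> real" where
  "bump_weight a b x = (max 0 (x - a))\<^sup>2 * (max 0 (b - x))\<^sup>2"

text \<open>The quotient stays in [0, 1] and tends to 1 exactly where the weight is positive, so it
  converges boundedly to the indicator of the open interval.\<close>

definition bump :: "real \<Rightarrow> real \<Rightarrow> nat \<Rightarrow> real \<Rightarrow> real" where
  "bump a b n x = bump_weight a b x / (bump_weight a b x + 1 / real (Suc n))"

lemma max_0_square_derivative: "((\<lambda>x. (max 0 x)\<^sup>2) has_real_derivative 2 * max 0 x) (at x)"
proof -
  consider "x > 0" | "x < 0" | "x = 0" by linarith
  then show ?thesis
  proof cases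
    case 1
    have "((\<lambda>x. x\<^sup>2) has_real_derivative 2 * max 0 x) (at x)"
      using 1 by (auto intro!: derivative_eq_intros)
    then show ?thesis
      by (rule DERIV_cong_ev[THEN iffD1, rotated 3])
        (use 1 in \<open>auto intro!: eventually_mono[OF eventually_nhds_in_open[of "{0<..}"]]\<close>)
  next
    case 2
    have "((\<lambda>x. 0) has_real_derivative 2 * max 0 x) (at x)" using 2 by simp
    then show ?thesis
      by (rule DERIV_cong_ev[THEN iffD1, rotated 3])
        (use 2 in \<open>auto intro!: eventually_mono[OF eventually_nhds_in_open[of "{..<0}"]]\<close>)
  next
    case 3
    have "((\<lambda>h::real. (max 0 h)\<^sup>2 / h) \<longlongrightarrow> 0) (at 0)"
    proof (rule Lim_null_comparison)
      show "\<forall>\<^sub>F h in at 0. norm ((max 0 h)\<^sup>2 / h) \<le> \<bar>h::real\<bar>"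
        by (intro always_eventually allI) (auto simp: max_def power2_eq_square)
      show "((\<lambda>h::real. \<bar>h\<bar>) \<longlongrightarrow> 0) (at 0)" by (intro tendsto_eq_intros refl) auto
    qed
    then show ?thesis using 3 by (simp add: DERIV_def)
  qed
qed

lemma bump_weight_derivative:
  "(bump_weight a b has_real_derivative
     (2 * max 0 (x - a) * (max 0 (b - x))\<^sup>2 - (max 0 (x - a))\<^sup>2 * (2 * max 0 (b - x)))) (at x)"
proof -
  have 1: "((\<lambda>x. (max 0 (x - a))\<^sup>2) has_real_derivative 2 * max 0 (x - a) * 1) (at x)"
    by (rule DERIV_chain2[OF max_0_square_derivative]) (auto intro!: derivative_eq_intros)
  have 2: "((\<lambda>x. (max 0 (b - x))\<^sup>2) has_real_derivative 2 * max 0 (b - x) * (- 1)) (at x)"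
    by (rule DERIV_chain2[OF max_0_square_derivative]) (auto intro!: derivative_eq_intros)
  show ?thesis unfolding bump_weight_def[abs_def]
    by (rule DERIV_cong[OF DERIV_mult[OF 1 2]]) (simp add: algebra_simps)
qed

lemma bump_weight_nonneg: "0 \<le> bump_weight a b x"
  by (simp add: bump_weight_def)

lemma bump_C1:
  obtains b' where "\<And>x. (bump a b n has_real_derivative b' x) (at x)" "continuous_on UNIV b'"
proof -
  define w' where "w' x = 2 * max 0 (x - a) * (max 0 (b - x))\<^sup>2 - (max 0 (x - a))\<^sup>2 * (2 * max 0 (b - x))" for x
  define w where "w = bump_weight a b"
  define s where "s = 1 / real (Suc n)"
  have pos: "w x + s > 0" for x using bump_weight_nonneg[of a b x] by (simp add: w_def s_def add_nonneg_pos)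
  then have ne: "w x + s \<noteq> 0" for x by (metis less_irrefl)
  have w': "(w has_real_derivative w' x) (at x)" for x
    unfolding w_def w'_def by (rule bump_weight_derivative)
  have wc: "continuous_on UNIV w" by (intro DERIV_continuous_on[of UNIV w w']) (auto intro: DERIV_subset w')
  have "(bump a b n has_real_derivative (w' x * (w x + s) - w x * w' x) / ((w x + s) * (w x + s))) (at x)" for x
  proof -
    have "((\<lambda>x. w x / (w x + s)) has_real_derivative (w' x * (w x + s) - w x * w' x) / ((w x + s) * (w x + s))) (at x)"
      using ne by (auto intro!: derivative_eq_intros w')
    then show ?thesis unfolding bump_def[abs_def] w_def s_def .
  qed
  moreover have "continuous_on UNIV (\<lambda>x. (w' x * (w x + s) - w x * w' x) / ((w x + s) * (w x + s)))"
    using ne unfolding w'_def by (intro continuous_intros wc) auto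
  ultimately show ?thesis by (rule that)
qed

lemma bump_bounds: "0 \<le> bump a b n x" "bump a b n x \<le> 1"
proof -
  have "bump_weight a b x + 1 / real (Suc n) > 0" using bump_weight_nonneg[of a b x] by (simp add: add_nonneg_pos)
  then show "0 \<le> bump a b n x" "bump a b n x \<le> 1"
    unfolding bump_def using bump_weight_nonneg[of a b x] by (auto simp: divide_simps)
qed

lemma bump_outside: "x \<notin> {a<..<b} \<Longrightarrow> bump a b n x = 0"
  by (auto simp: bump_def bump_weight_def)

lemma bump_limit: "(\<lambda>n. bump a b n x) \<longlonglongrightarrow> indicator {a<..<b} x"
proof (cases "x \<in> {a<..<b}")
  case True
  then have pos: "bump_weight a b x > 0" by (auto simp: bump_weight_def)
  have "(\<lambda>n. bump a b n x) \<longlonglongrightarrow> bump_weight a b x / (bump_weight a b x + 0)"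
    unfolding bump_def using pos by (intro tendsto_intros LIMSEQ_Suc[OF lim_1_over_n]) auto
  then show ?thesis using True pos by simp
qed (simp add: bump_outside)

lemma bump_continuous: "continuous_on UNIV (bump a b n)"
  by (rule bump_C1[of a b n]) (metis DERIV_continuous_on DERIV_subset subset_UNIV UNIV_I)

lemma test_function_bump:
  assumes "0 < a" "b < 2 * pi" "0 < c" "d < 2 * pi"
  shows "test_function (\<lambda>z. bump a b n (fst z) * bump c d n (snd z))"
proof -
  obtain p where p: "\<And>x. (bump a b n has_real_derivative p x) (at x)" "continuous_on UNIV p"
    using bump_C1 by blast
  obtain q where q: "\<And>x. (bump c d n has_real_derivative q x) (at x)" "continuous_on UNIV q"
    using bump_C1 by blast
  note cont = bump_continuous[of a b n] bump_continuous[of c d n]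
  show ?thesis
  proof (rule test_functionI)
    fix z :: "real \<times> real"
    have 1: "((\<lambda>z. bump a b n (fst z)) has_derivative (\<lambda>e. p (fst z) * fst e)) (at z)"
      using has_derivative_compose[OF has_derivative_fst[OF has_derivative_ident] p(1)[unfolded has_field_derivative_def], of z UNIV]
      by simp
    have 2: "((\<lambda>z. bump c d n (snd z)) has_derivative (\<lambda>e. q (snd z) * snd e)) (at z)"
      using has_derivative_compose[OF has_derivative_snd[OF has_derivative_ident] q(1)[unfolded has_field_derivative_def], of z UNIV]
      by simp
    show "((\<lambda>z. bump a b n (fst z) * bump c d n (snd z)) has_derivative
        (\<lambda>e. fst e * (p (fst z) * bump c d n (snd z)) + snd e * (bump a b n (fst z) * q (snd z)))) (at z)"
      by (rule has_derivative_eq_rhs[OF has_derivative_mult[OF 1 2]]) (auto simp: algebra_simps)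
    show "continuous_on UNIV (\<lambda>z. p (fst z) * bump c d n (snd z))" "continuous_on UNIV (\<lambda>z. bump a b n (fst z) * q (snd z))"
      by (intro continuous_intros continuous_on_compose2[OF p(2)] continuous_on_compose2[OF q(2)]
          continuous_on_compose2[OF cont(1)] continuous_on_compose2[OF cont(2)]; auto)+
    show "compact (cbox (a, c) (b, d))" by simp
    show "cbox (a, c) (b, d) \<subseteq> Omega" using assms by (auto simp: Omega_def cbox_Pair_eq)
    show "bump a b n (fst z) * bump c d n (snd z) = 0" if "z \<notin> cbox (a, c) (b, d)" for z
      using that bump_outside[of "fst z" a b n] bump_outside[of "snd z" c d n]
      by (cases z) (auto simp: cbox_Pair_eq)
  qed
qed

text \<open>Products of bumps converge boundedly to indicators of boxes; boxes are stable under
  intersection and generate the Borel sets, so the integral of u over each Borel subset of a fixed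
  box Q vanishes. The hypothesis speaks about bumps only, so that the lemma serves the completeness
  of the sines as well.\<close>

lemma zero_AE_if_bump_integrals_zero:
  assumes u: "locally_integrable u"
    and zero: "\<And>a b c d n. 0 < a \<Longrightarrow> b < 2 * pi \<Longrightarrow> 0 < c \<Longrightarrow> d < 2 * pi \<Longrightarrow>
      integral\<^sup>L square_measure (\<lambda>z. u z * (bump a b n (fst z) * bump c d n (snd z))) = 0"
  shows "AE z in square_measure. u z = 0"
proof -
  have box0: "(LINT z:box (a, c) (b, d)|lborel. u z) = 0"
    if abcd: "0 < a" "b < 2 * pi" "0 < c" "d < 2 * pi" for a b c d
  proof -
    let ?K = "cbox (a, c) (b, d)"
    have sub: "?K \<subseteq> Omega" using abcd by (auto simp: Omega_def cbox_Pair_eq)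
    have int: "set_integrable lborel ?K u" using u sub by (auto simp: locally_integrable_def)
    have m: "(\<lambda>z. indicator ?K z * u z) \<in> borel_measurable borel"
      using int unfolding set_integrable_def by (auto dest: borel_measurable_integrable)
    have mb: "(\<lambda>z::real \<times> real. bump a b n (fst z)) \<in> borel_measurable borel"
      "(\<lambda>z::real \<times> real. bump a b n (snd z)) \<in> borel_measurable borel" for a b n
      by (intro borel_measurable_continuous_onI continuous_on_compose2[OF bump_continuous] continuous_intros; simp)+
    have indicator_box: "(indicator {a<..<b} (fst z) * indicator {c<..<d} (snd z) :: real)
        = indicator (box (a, c) (b, d)) z" for z
      by (cases z) (auto simp: indicator_def mem_box Basis_prod_def)
    have eq: "indicator Omega z * (u z * (bump a b n (fst z) * bump c d n (snd z)))
        = (indicator ?K z * u z) * (bump a b n (fst z) * bump c d n (snd z))" for z n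
    proof (cases "z \<in> ?K")
      case True then show ?thesis using sub by (auto simp: indicator_def)
    next
      case False
      then have "bump a b n (fst z) * bump c d n (snd z) = 0"
        using bump_outside[of "fst z" a b n] bump_outside[of "snd z" c d n]
        by (cases z) (auto simp: cbox_Pair_eq)
      then show ?thesis by simp
    qed
    have "(\<lambda>n. \<integral>z. (indicator ?K z * u z) * (bump a b n (fst z) * bump c d n (snd z)) \<partial>lborel)
       \<longlonglongrightarrow> (\<integral>z. (indicator ?K z * u z) * (indicator {a<..<b} (fst z) * indicator {c<..<d} (snd z)) \<partial>lborel)"
    proof (rule integral_dominated_convergence[where w = "\<lambda>z. \<bar>indicator ?K z * u z\<bar>"])
      show "integrable lborel (\<lambda>z. \<bar>indicator ?K z * u z\<bar>)"
        using int unfolding set_integrable_def by (intro integrable_abs) simp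
      show "AE z in lborel. (\<lambda>n. (indicator ?K z * u z) * (bump a b n (fst z) * bump c d n (snd z)))
          \<longlonglongrightarrow> (indicator ?K z * u z) * (indicator {a<..<b} (fst z) * indicator {c<..<d} (snd z))"
        by (intro AE_I2 tendsto_intros bump_limit)
      show "AE z in lborel. norm ((indicator ?K z * u z) * (bump a b n (fst z) * bump c d n (snd z)))
          \<le> \<bar>indicator ?K z * u z\<bar>" for n
      proof (rule AE_I2)
        fix z :: "real \<times> real"
        have "bump a b n (fst z) * bump c d n (snd z) \<le> 1"
          using bump_bounds by (intro mult_le_one) auto
        then show "norm ((indicator ?K z * u z) * (bump a b n (fst z) * bump c d n (snd z))) \<le> \<bar>indicator ?K z * u z\<bar>"
          using bump_bounds by (simp add: abs_mult mult_left_le)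
      qed
      show "(\<lambda>z. indicator ?K z * u z * (bump a b n (fst z) * bump c d n (snd z))) \<in> borel_measurable lborel" for n
        unfolding borel_measurable_lborel by (intro borel_measurable_times m mb)
      show "(\<lambda>z. indicator ?K z * u z * (indicator {a<..<b} (fst z) * indicator {c<..<d} (snd z))) \<in> borel_measurable lborel"
        unfolding borel_measurable_lborel indicator_box by (intro borel_measurable_times m) simp
    qed
    moreover have "(\<integral>z. (indicator ?K z * u z) * (bump a b n (fst z) * bump c d n (snd z)) \<partial>lborel) = 0" for n
      using zero[OF abcd, of n]
      unfolding integral_square_measure[symmetric] set_lebesgue_integral_def by (simp add: eq)
    ultimately have "(\<integral>z. (indicator ?K z * u z) * (indicator {a<..<b} (fst z) * indicator {c<..<d} (snd z)) \<partial>lborel) = 0"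
      by (simp add: LIMSEQ_const_iff)
    moreover have "(indicator ?K z * u z) * (indicator {a<..<b} (fst z) * indicator {c<..<d} (snd z))
        = indicator (box (a, c) (b, d)) z * u z" for z
      by (cases z) (auto simp: indicator_def mem_box Basis_prod_def cbox_Pair_eq)
    ultimately show ?thesis by (simp add: set_lebesgue_integral_def)
  qed
  have AE_n: "AE z in lborel. z \<in> inner_box n \<longrightarrow> u z = 0" for n
  proof -
    \<comment> \<open>The index \<open>Suc (Suc n)\<close> puts Q between \<open>inner_box n\<close>
      and \<open>inner_box (Suc n)\<close>: it covers the former, and u is integrable on the
      latter.\<close>
    define p where "p = 1 / real (Suc (Suc n))"
    define q where "q = 2 * pi - p"
    define Q where "Q = box (p, p) (q, q)"
    have pq: "p > 0" "q < 2 * pi" by (simp_all add: p_def q_def)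
    have nQ: "inner_box n \<subseteq> Q"
    proof -
      have "p < 1 / real (Suc n)" unfolding p_def by (intro divide_strict_left_mono) auto
      then show ?thesis unfolding inner_box_def Q_def q_def
        by (auto simp: mem_box Basis_prod_def cbox_Pair_eq)
    qed
    have "set_integrable lborel (inner_box (Suc n)) u"
      using u inner_box_subset[of "Suc n"] unfolding locally_integrable_def by (auto simp: inner_box_def)
    moreover have "Q \<subseteq> inner_box (Suc n)"
      unfolding Q_def inner_box_def p_def q_def by (rule box_subset_cbox)
    ultimately have int: "set_integrable lborel Q u"
      using set_integrable_subset[of lborel "inner_box (Suc n)" u Q] by (simp add: Q_def)
    have intA: "set_integrable lborel (Q \<inter> A) u" if "A \<in> sets borel" for A
      using int by (rule set_integrable_subset) (use that in \<open>auto simp: Q_def\<close>)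
    have boxQ: "(LINT z:Q \<inter> box l r|lborel. u z) = 0" for l r
    proof -
      obtain l1 l2 r1 r2 where lr: "l = (l1, l2)" "r = (r1, r2)" by (cases l, cases r)
      have "Q \<inter> box l r = box (max p l1, max p l2) (min q r1, min q r2)"
        unfolding Q_def lr by (auto simp: mem_box Basis_prod_def)
      then show ?thesis using pq box0[of "max p l1" "min q r1" "max p l2" "min q r2"] by simp
    qed
    have zeroA: "(LINT z:Q \<inter> A|lborel. u z) = 0" if "A \<in> sets borel" for A
    proof -
      have "Int_stable (range (\<lambda>(a, b). box a b :: (real \<times> real) set))"
        by (auto simp: Int_stable_def box_Int_box)
      moreover have "range (\<lambda>(a, b). box a b :: (real \<times> real) set) \<subseteq> Pow UNIV" by simp
      moreover have "A \<in> sigma_sets UNIV (range (\<lambda>(a, b). box a b))" using that by (simp add: borel_eq_box)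
      ultimately show ?thesis
      proof (induction rule: sigma_sets_induct_disjoint)
        case (basic A)
        then show ?case using boxQ by auto
      next
        case empty
        show ?case by (simp add: set_lebesgue_integral_def)
      next
        case (compl A)
        have A: "A \<in> sets borel" using compl(1) by (simp add: borel_eq_box)
        have "(LINT z:(Q \<inter> A) \<union> (Q \<inter> (UNIV - A))|lborel. u z)
            = (LINT z:Q \<inter> A|lborel. u z) + (LINT z:Q \<inter> (UNIV - A)|lborel. u z)"
          by (rule set_integral_Un) (use A in \<open>auto intro!: intA\<close>)
        moreover have "(Q \<inter> A) \<union> (Q \<inter> (UNIV - A)) = Q \<inter> box (p, p) (q, q)" by (auto simp: Q_def)
        ultimately show ?case using compl(2) boxQ by simp
      next
        case (union A)
        have A: "A i \<in> sets borel" for i using union(2) by (auto simp: borel_eq_box)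
        have "(LINT z:(\<Union>i. Q \<inter> A i)|lborel. u z) = (\<Sum>i. LINT z:Q \<inter> A i|lborel. u z)"
        proof (rule lebesgue_integral_countable_add)
          show "Q \<inter> A i \<in> sets lborel" for i using A by (simp add: Q_def)
          show "Q \<inter> A i \<inter> (Q \<inter> A j) = {}" if "i \<noteq> j" for i j
            using union(1) that by (auto simp: disjoint_family_on_def)
          show "set_integrable lborel (\<Union>i. Q \<inter> A i) u"
            using int by (rule set_integrable_subset) (use A in \<open>auto simp: Q_def\<close>)
        qed
        moreover have "(LINT z:Q \<inter> A i|lborel. u z) = 0" for i by (rule union(3))
        moreover have "Q \<inter> (\<Union>i. A i) = (\<Union>i. Q \<inter> A i)" by blast
        ultimately show ?case by (simp only: suminf_zero)
      qed
    qed
    have m: "(\<lambda>z. indicator Q z * u z) \<in> borel_measurable borel"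
      using int unfolding set_integrable_def by (auto dest: borel_measurable_integrable)
    \<comment> \<open>The integrals over the sets where u is positive and where it is negative
      combine to the integral of its modulus.\<close>
    define P where "P = {z. indicator Q z * u z > 0}"
    define N where "N = {z. indicator Q z * u z < 0}"
    have PN: "P \<in> sets borel" "N \<in> sets borel" unfolding P_def N_def using m by measurable
    have "(\<integral>z. indicator (Q \<inter> P) z * u z - indicator (Q \<inter> N) z * u z \<partial>lborel) = 0"
      using zeroA[OF PN(1)] zeroA[OF PN(2)] intA[OF PN(1)] intA[OF PN(2)]
      by (simp add: set_lebesgue_integral_def set_integrable_def)
    moreover have "indicator (Q \<inter> P) z * u z - indicator (Q \<inter> N) z * u z = \<bar>indicator Q z * u z\<bar>" for z
      by (auto simp: indicator_def P_def N_def)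
    ultimately have "(\<integral>z. \<bar>indicator Q z * u z\<bar> \<partial>lborel) = 0" by simp
    moreover have "integrable lborel (\<lambda>z. \<bar>indicator Q z * u z\<bar>)"
      using int unfolding set_integrable_def by (intro integrable_abs) simp
    ultimately have "AE z in lborel. \<bar>indicator Q z * u z\<bar> = 0"
      by (subst (asm) integral_nonneg_eq_0_iff_AE) auto
    then show ?thesis
      by eventually_elim (use nQ in \<open>auto simp: indicator_def\<close>)
  qed
  then have "AE z in lborel. \<forall>n. z \<in> inner_box n \<longrightarrow> u z = 0"
    unfolding AE_all_countable using AE_n by blast
  then have "AE z in lborel. z \<in> Omega \<longrightarrow> u z = 0"
  proof eventually_elim
    case (elim z)
    show ?case
    proof
      assume "z \<in> Omega"
      then obtain n where "z \<in> inner_box n"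
        using eventually_in_inner_box[of z] by (auto simp: eventually_sequentially)
      then show "u z = 0" using elim by blast
    qed
  qed
  then show ?thesis by (simp add: AE_square_measure)
qed

lemma locally_integrable_diff:
  "locally_integrable f \<Longrightarrow> locally_integrable g \<Longrightarrow> locally_integrable (\<lambda>z. f z - g z)"
  by (auto simp: locally_integrable_def)

lemma locally_integrable_mult_test:
  assumes f: "locally_integrable f" and t: "test_function \<eta>"
  shows "integrable square_measure (\<lambda>z. f z * \<eta> z)"
proof -
  let ?S = "closure {z. \<eta> z \<noteq> 0}"
  have S: "compact ?S" "?S \<subseteq> Omega" using t unfolding test_function_def by blast+
  obtain B where B: "\<And>z. \<bar>\<eta> z\<bar> \<le> B" using test_function_props(5)[OF t] by blast
  have "set_integrable lborel ?S f" using f S by (auto simp: locally_integrable_def)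
  then have i: "integrable lborel (\<lambda>z. indicator ?S z * f z)" by (simp add: set_integrable_def)
  have "integrable square_measure (\<lambda>z. indicator ?S z * f z)"
    unfolding square_measure_def
    using integrable_mult_indicator[OF _ i, of Omega] by (subst integrable_restrict_space) auto
  then have "integrable square_measure (\<lambda>z. (indicator ?S z * f z) * \<eta> z)"
    by (rule integrable_square_mult_bounded[OF _ _ B])
      (intro borel_measurable_square_measure borel_measurable_continuous_onI test_function_props(1)[OF t])
  moreover have "(indicator ?S z * f z) * \<eta> z = f z * \<eta> z" for z
    using closure_subset[of "{z. \<eta> z \<noteq> 0}"] by (cases "\<eta> z = 0") (auto simp: indicator_def)
  ultimately show ?thesis by simp
qed

lemma weak_derivative_unique:
  assumes g: "has_weak_derivative e f g" and g': "has_weak_derivative e f g'"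
  shows "AE z in square_measure. g z = g' z"
proof -
  have l: "locally_integrable g" "locally_integrable g'" using g g' by (auto simp: has_weak_derivative_def)
  have "AE z in square_measure. g z - g' z = 0"
  proof (rule zero_AE_if_bump_integrals_zero[OF locally_integrable_diff[OF l]])
    fix a b c d :: real and n
    assume "0 < a" "b < 2 * pi" "0 < c" "d < 2 * pi"
    then have t: "test_function (\<lambda>z. bump a b n (fst z) * bump c d n (snd z))" by (rule test_function_bump)
    note i = l[THEN locally_integrable_mult_test[OF _ t]]
    have "integral\<^sup>L square_measure (\<lambda>z. g z * (bump a b n (fst z) * bump c d n (snd z)))
        = integral\<^sup>L square_measure (\<lambda>z. g' z * (bump a b n (fst z) * bump c d n (snd z)))"
    proof -
      have "integral\<^sup>L square_measure (\<lambda>z. h z * (bump a b n (fst z) * bump c d n (snd z)))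
        = - integral\<^sup>L square_measure (\<lambda>z. f z *
            frechet_derivative (\<lambda>z. bump a b n (fst z) * bump c d n (snd z)) (at z) e)"
        if "has_weak_derivative e f h" for h
        using that t unfolding has_weak_derivative_def integral_square_measure by simp
      from this[OF g] this[OF g'] show ?thesis by simp
    qed
    then show "integral\<^sup>L square_measure (\<lambda>z. (g z - g' z) * (bump a b n (fst z) * bump c d n (snd z))) = 0"
      using i by (simp add: left_diff_distrib)
  qed
  then show ?thesis by eventually_elim simp
qed

lemma has_weak_derivative_weak_derivative:
  "has_weak_derivative e f g \<Longrightarrow> has_weak_derivative e f (weak_derivative e f)"
  unfolding weak_derivative_def by (rule someI[where P = "has_weak_derivative e f"])

text \<open>Transfers any explicitly constructed derivative to the one picked by
  \<open>SOME\<close>, together with the measurability that the choice itself does not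
  reveal.\<close>

lemma weak_derivative_AE:
  assumes "has_weak_derivative e f g"
  shows "AE z in square_measure. weak_derivative e f z = g z"
    and "weak_derivative e f \<in> borel_measurable square_measure"
proof -
  note w = has_weak_derivative_weak_derivative[OF assms]
  show "AE z in square_measure. weak_derivative e f z = g z"
    by (rule weak_derivative_unique[OF w assms])
  show "weak_derivative e f \<in> borel_measurable square_measure"
    using w unfolding has_weak_derivative_def by (intro locally_integrable_measurable) blast
qed

section \<open>Convergence in mean\<close>

text \<open>Convergence in L1 of the square. It passes to the limit against bounded functions such
  as modes and test functions, and products of a bounded and an integrable factor remain within
  it.\<close>

definition mean_limit :: "(nat \<Rightarrow> plane_fun) \<Rightarrow> plane_fun \<Rightarrow> bool" where
  "mean_limit s f \<longleftrightarrow> (\<forall>n. integrable square_measure (s n)) \<and> integrable square_measure f \<and>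
     (\<lambda>n. integral\<^sup>L square_measure (\<lambda>z. \<bar>s n z - f z\<bar>)) \<longlonglongrightarrow> 0"

lemma mean_limit_add:
  assumes "mean_limit s f" "mean_limit t g" shows "mean_limit (\<lambda>n z. s n z + t n z) (\<lambda>z. f z + g z)"
proof -
  let ?I = "integral\<^sup>L square_measure"
  have i: "integrable square_measure (s n)" "integrable square_measure f"
      "integrable square_measure (t n)" "integrable square_measure g" for n
    using assms by (auto simp: mean_limit_def)
  have "(\<lambda>n. ?I (\<lambda>z. \<bar>s n z + t n z - (f z + g z)\<bar>)) \<longlonglongrightarrow> 0"
  proof (rule Lim_null_comparison)
    show "(\<lambda>n. ?I (\<lambda>z. \<bar>s n z - f z\<bar>) + ?I (\<lambda>z. \<bar>t n z - g z\<bar>)) \<longlonglongrightarrow> 0"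
      using assms tendsto_add[of _ 0 _ _ 0] by (fastforce simp: mean_limit_def)
    have "?I (\<lambda>z. \<bar>s n z + t n z - (f z + g z)\<bar>) \<le> ?I (\<lambda>z. \<bar>s n z - f z\<bar> + \<bar>t n z - g z\<bar>)" for n
      by (rule integral_mono) (use i in auto)
    then show "\<forall>\<^sub>F n in sequentially. norm (?I (\<lambda>z. \<bar>s n z + t n z - (f z + g z)\<bar>))
        \<le> ?I (\<lambda>z. \<bar>s n z - f z\<bar>) + ?I (\<lambda>z. \<bar>t n z - g z\<bar>)"
      using i by (auto simp: integral_nonneg_AE)
  qed
  then show ?thesis using i by (simp add: mean_limit_def)
qed

lemma mean_limit_cmult:
  assumes "mean_limit s f" shows "mean_limit (\<lambda>n z. c * s n z) (\<lambda>z. c * f z)"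
proof -
  have "\<bar>c * x - c * y\<bar> = \<bar>c\<bar> * \<bar>x - y\<bar>" for x y :: real
    by (simp add: abs_mult[symmetric] right_diff_distrib)
  then show ?thesis using assms tendsto_mult_left[of _ 0 sequentially "\<bar>c\<bar>"] by (auto simp: mean_limit_def)
qed

lemma mean_limit_unique:
  assumes "mean_limit s f" "mean_limit s g" shows "AE z in square_measure. f z = g z"
proof -
  have "mean_limit (\<lambda>n z. s n z + (- 1) * s n z) (\<lambda>z. f z + (- 1) * g z)"
    by (intro mean_limit_add mean_limit_cmult assms)
  then have "integrable square_measure (\<lambda>z. f z - g z)"
    "(\<lambda>n::nat. integral\<^sup>L square_measure (\<lambda>z. \<bar>f z - g z\<bar>)) \<longlonglongrightarrow> 0"
    by (auto simp: mean_limit_def abs_minus_commute)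
  then have "integral\<^sup>L square_measure (\<lambda>z. \<bar>f z - g z\<bar>) = 0" by (simp add: LIMSEQ_const_iff)
  then have "AE z in square_measure. \<bar>f z - g z\<bar> = 0"
    using \<open>integrable square_measure (\<lambda>z. f z - g z)\<close>
    by (subst (asm) integral_nonneg_eq_0_iff_AE) auto
  then show ?thesis by eventually_elim simp
qed

lemma mean_limit_AE:
  assumes s: "mean_limit s f" and g: "AE z in square_measure. g z = f z" "g \<in> borel_measurable square_measure"
  shows "mean_limit s g"
proof -
  have i: "integrable square_measure f" "\<And>n. integrable square_measure (s n)"
    using s by (auto simp: mean_limit_def)
  have ig: "integrable square_measure g"
    by (rule integrable_cong_AE_imp[OF i(1) g(2)]) (use g(1) in eventually_elim, simp)
  have "integral\<^sup>L square_measure (\<lambda>z. \<bar>s n z - g z\<bar>) = integral\<^sup>L square_measure (\<lambda>z. \<bar>s n z - f z\<bar>)" for n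
  proof (rule integral_cong_AE)
    show "AE z in square_measure. \<bar>s n z - g z\<bar> = \<bar>s n z - f z\<bar>" using g(1) by eventually_elim simp
  qed (use i ig in measurable)
  then show ?thesis using s ig by (simp add: mean_limit_def)
qed

lemma mean_limit_integral:
  assumes s: "mean_limit s f" and h: "h \<in> borel_measurable square_measure" "\<And>z. \<bar>h z\<bar> \<le> B"
  shows "(\<lambda>n. integral\<^sup>L square_measure (\<lambda>z. s n z * h z)) \<longlonglongrightarrow> integral\<^sup>L square_measure (\<lambda>z. f z * h z)"
proof -
  let ?I = "integral\<^sup>L square_measure"
  have i: "integrable square_measure f" "\<And>n. integrable square_measure (s n)"
    using s by (auto simp: mean_limit_def)
  note ih = integrable_square_mult_bounded[OF i(1) h] integrable_square_mult_bounded[OF i(2) h]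
  have "(\<lambda>n. ?I (\<lambda>z. s n z * h z) - ?I (\<lambda>z. f z * h z)) \<longlonglongrightarrow> 0"
  proof (rule Lim_null_comparison)
    show "(\<lambda>n. \<bar>B\<bar> * ?I (\<lambda>z. \<bar>s n z - f z\<bar>)) \<longlonglongrightarrow> 0"
      using s tendsto_mult_left[of _ 0 sequentially "\<bar>B\<bar>"] by (auto simp: mean_limit_def)
    have "\<bar>?I (\<lambda>z. s n z * h z) - ?I (\<lambda>z. f z * h z)\<bar> \<le> \<bar>B\<bar> * ?I (\<lambda>z. \<bar>s n z - f z\<bar>)" for n
    proof -
      have "\<bar>?I (\<lambda>z. s n z * h z) - ?I (\<lambda>z. f z * h z)\<bar> = \<bar>?I (\<lambda>z. (s n z - f z) * h z)\<bar>"
        using ih by (simp add: left_diff_distrib)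
      also have "\<dots> \<le> ?I (\<lambda>z. \<bar>(s n z - f z) * h z\<bar>)" by (rule integral_abs_bound)
      also have "\<dots> \<le> ?I (\<lambda>z. \<bar>B\<bar> * \<bar>s n z - f z\<bar>)"
      proof (rule integral_mono)
        show "integrable square_measure (\<lambda>z. \<bar>(s n z - f z) * h z\<bar>)"
          using ih by (intro integrable_abs) (simp add: left_diff_distrib)
        show "integrable square_measure (\<lambda>z. \<bar>B\<bar> * \<bar>s n z - f z\<bar>)" using i by simp
        fix z
        have "\<bar>h z\<bar> \<le> \<bar>B\<bar>" using h(2)[of z] by linarith
        then show "\<bar>(s n z - f z) * h z\<bar> \<le> \<bar>B\<bar> * \<bar>s n z - f z\<bar>"
          by (simp add: abs_mult mult.commute[of "\<bar>B\<bar>"] mult_left_mono)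
      qed
      finally show ?thesis by simp
    qed
    then show "\<forall>\<^sub>F n in sequentially. norm (?I (\<lambda>z. s n z * h z) - ?I (\<lambda>z. f z * h z))
        \<le> \<bar>B\<bar> * ?I (\<lambda>z. \<bar>s n z - f z\<bar>)" by simp
  qed
  then show ?thesis by (simp add: LIM_zero_iff)
qed

lemma mean_limit_uniform:
  assumes "\<And>n. integrable square_measure (s n)" "f \<in> borel_measurable square_measure"
    and "\<And>n z. \<bar>s n z - f z\<bar> \<le> e n" "e \<longlonglongrightarrow> 0"
  shows "mean_limit s f"
proof -
  let ?I = "integral\<^sup>L square_measure"
  have d: "integrable square_measure (\<lambda>z. s n z - f z)" for n
    by (rule integrable_square_bounded[OF _ assms(3)]) (use assms(1,2) in measurable)
  have "integrable square_measure (\<lambda>z. s 0 z - (s 0 z - f z))"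
    by (intro Bochner_Integration.integrable_diff assms d)
  then have f: "integrable square_measure f" by simp
  have "(\<lambda>n. ?I (\<lambda>z. \<bar>s n z - f z\<bar>)) \<longlonglongrightarrow> 0"
  proof (rule Lim_null_comparison)
    show "(\<lambda>n. e n * measure square_measure Omega) \<longlonglongrightarrow> 0"
      using tendsto_mult_right[OF assms(4)] by auto
    have "?I (\<lambda>z. \<bar>s n z - f z\<bar>) \<le> ?I (\<lambda>z. e n)" for n
      by (rule integral_mono) (use d assms(3) in auto)
    then show "\<forall>\<^sub>F n in sequentially. norm (?I (\<lambda>z. \<bar>s n z - f z\<bar>)) \<le> e n * measure square_measure Omega"
      by (auto simp: integral_nonneg_AE mult.commute)
  qed
  then show ?thesis using assms f by (simp add: mean_limit_def)
qed

text \<open>A subsequence with distances \<open>2 ^ -j\<close> converges almost everywhere; Fatou's lemma gives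
  convergence in mean of the whole sequence to the same limit.\<close>

lemma mean_limit_exists:
  assumes s: "\<And>n. integrable square_measure (s n)"
    and cauchy: "\<And>e. e > 0 \<Longrightarrow> \<exists>N. \<forall>m\<ge>N. \<forall>n\<ge>N. integral\<^sup>L square_measure (\<lambda>z. \<bar>s m z - s n z\<bar>) \<le> e"
  shows "\<exists>f. mean_limit s f"
proof -
  let ?I = "integral\<^sup>L square_measure"
  have "\<forall>j. \<exists>N. \<forall>m\<ge>N. \<forall>n\<ge>N. ?I (\<lambda>z. \<bar>s m z - s n z\<bar>) \<le> (1/2) ^ j"
    using cauchy by simp
  then obtain N where N: "\<And>j m n. m \<ge> N j \<Longrightarrow> n \<ge> N j \<Longrightarrow> ?I (\<lambda>z. \<bar>s m z - s n z\<bar>) \<le> (1/2) ^ j"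
    by metis
  \<comment> \<open>Partial sums of the thresholds give a nondecreasing index sequence with
    \<open>N j \<le> r i\<close> for all \<open>j \<le> i\<close>.\<close>
  define r where "r j = (\<Sum>i\<le>j. N i)" for j
  have rN: "N j \<le> r j" for j unfolding r_def by (rule member_le_sum) auto
  have rS: "r j \<le> r (Suc j)" for j by (simp add: r_def)
  have rN': "N j \<le> r i" if "j \<le> i" for i j
    using rN[of j] lift_Suc_mono_le[of r, OF rS that] by linarith
  define d where "d j z = s (r (Suc j)) z - s (r j) z" for j z
  have di: "integrable square_measure (d j)" for j unfolding d_def by (intro Bochner_Integration.integrable_diff s)
  have dI: "?I (\<lambda>z. \<bar>d j z\<bar>) \<le> (1/2) ^ j" for j unfolding d_def by (intro N rN') auto
  have sumI: "summable (\<lambda>j. ?I (\<lambda>z. norm (d j z)))"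
    by (rule summable_comparison_test'[of "\<lambda>j. (1/2) ^ j" 0]) (use dI in \<open>auto simp: integral_nonneg_AE\<close>)
  have ae: "AE z in square_measure. summable (\<lambda>j. norm (d j z))"
  proof -
    have "(\<integral>\<^sup>+ z. (\<Sum>j. ennreal (norm (d j z))) \<partial>square_measure) = (\<Sum>j. \<integral>\<^sup>+ z. ennreal (norm (d j z)) \<partial>square_measure)"
      by (rule nn_integral_suminf) (use di in measurable)
    also have "\<dots> = (\<Sum>j. ennreal (?I (\<lambda>z. norm (d j z))))"
      by (intro suminf_cong nn_integral_eq_integral integrable_norm di) auto
    also have "\<dots> \<noteq> \<infinity>"
      using sumI by (subst suminf_ennreal2) (auto simp: integral_nonneg_AE)
    finally have "AE z in square_measure. (\<Sum>j. ennreal (norm (d j z))) \<noteq> \<infinity>"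
      by (intro nn_integral_PInf_AE) (use di in measurable)
    then show ?thesis
      by eventually_elim (auto intro: summable_suminf_not_top)
  qed
  define f where "f z = s (r 0) z + (\<Sum>j. d j z)" for z
  have f: "integrable square_measure f"
    unfolding f_def by (intro Bochner_Integration.integrable_add s integrable_suminf di ae sumI)
  have tel: "s (r 0) z + (\<Sum>i<j. d i z) = s (r j) z" for j z
    unfolding d_def by (induction j) auto
  have lim: "AE z in square_measure. (\<lambda>j. s (r j) z) \<longlonglongrightarrow> f z"
    using ae
  proof eventually_elim
    case (elim z)
    have "(\<lambda>j. s (r 0) z + (\<Sum>i<j. d i z)) \<longlonglongrightarrow> f z"
      unfolding f_def using summable_LIMSEQ[OF summable_norm_cancel[OF elim]] by (intro tendsto_intros)
    then show ?case by (simp add: tel)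
  qed
  have bound: "?I (\<lambda>z. \<bar>s n z - f z\<bar>) \<le> (1/2) ^ j" if "n \<ge> N j" for n j
  proof -
    have "ennreal (?I (\<lambda>z. \<bar>s n z - f z\<bar>)) = (\<integral>\<^sup>+ z. ennreal \<bar>s n z - f z\<bar> \<partial>square_measure)"
      using s f by (intro nn_integral_eq_integral[symmetric]) auto
    also have "\<dots> = (\<integral>\<^sup>+ z. liminf (\<lambda>i. ennreal \<bar>s n z - s (r i) z\<bar>) \<partial>square_measure)"
    proof (rule nn_integral_cong_AE)
      show "AE z in square_measure. ennreal \<bar>s n z - f z\<bar> = liminf (\<lambda>i. ennreal \<bar>s n z - s (r i) z\<bar>)"
        using lim
      proof eventually_elim
        case (elim z)
        have "(\<lambda>i. ennreal \<bar>s n z - s (r i) z\<bar>) \<longlonglongrightarrow> ennreal \<bar>s n z - f z\<bar>"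
          by (intro tendsto_ennrealI tendsto_intros elim)
        then show ?case by (metis lim_imp_Liminf sequentially_bot)
      qed
    qed
    also have "\<dots> \<le> liminf (\<lambda>i. \<integral>\<^sup>+ z. ennreal \<bar>s n z - s (r i) z\<bar> \<partial>square_measure)"
      by (rule nn_integral_liminf) (use s in measurable)
    also have "\<dots> = liminf (\<lambda>i. ennreal (?I (\<lambda>z. \<bar>s n z - s (r i) z\<bar>)))"
      using s by (intro arg_cong[where f=liminf] ext nn_integral_eq_integral) auto
    also have "\<dots> \<le> ennreal ((1/2) ^ j)"
    proof (rule Liminf_le)
      have "\<forall>\<^sub>F i in sequentially. ?I (\<lambda>z. \<bar>s n z - s (r i) z\<bar>) \<le> (1/2) ^ j"
        unfolding eventually_sequentially using N[OF that] rN' by blast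
      then show "\<forall>\<^sub>F i in sequentially. ennreal (?I (\<lambda>z. \<bar>s n z - s (r i) z\<bar>)) \<le> ennreal ((1/2) ^ j)"
        by eventually_elim (rule ennreal_leI)
    qed simp
    finally show ?thesis by (simp add: ennreal_le_iff)
  qed
  have "(\<lambda>n. ?I (\<lambda>z. \<bar>s n z - f z\<bar>)) \<longlonglongrightarrow> 0"
  proof (rule LIMSEQ_I)
    fix e :: real assume "e > 0"
    then obtain j where j: "(1/2) ^ j < e" using real_arch_pow_inv[of e "1/2"] by auto
    have "norm (?I (\<lambda>z. \<bar>s n z - f z\<bar>) - 0) < e" if "n \<ge> N j" for n
      using bound[OF that] j by (simp add: integral_nonneg_AE)
    then show "\<exists>N. \<forall>n\<ge>N. norm (?I (\<lambda>z. \<bar>s n z - f z\<bar>) - 0) < e" by blast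
  qed
  then show ?thesis using s f by (auto simp: mean_limit_def)
qed

section \<open>Trigonometric series\<close>

text \<open>\<open>wave 0\<close> is the sine and \<open>wave 1\<close> the cosine; \<alpha> is not
  reduced modulo 4, so two derivatives return the same function with a sign.\<close>

definition wave :: "nat \<Rightarrow> int \<Rightarrow> real \<Rightarrow> real" where
  "wave \<alpha> n x = sin (real_of_int n * x / 2 + real \<alpha> * pi / 2)"

definition tmode :: "nat \<Rightarrow> nat \<Rightarrow> int \<times> int \<Rightarrow> plane_fun" where
  "tmode \<alpha> \<beta> k z = wave \<alpha> (fst k) (fst z) * wave \<beta> (snd k) (snd z)"

text \<open>The integral of a product of two waves divided by \<pi>, for arbitrary integer
  frequencies. The second term reflects
  \<open>wave \<alpha> (- n) = - ((- 1)^\<alpha>) * wave \<alpha> n\<close>; at n = m = 0 the value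
  is 0 for sines and 2 for cosines.\<close>

definition delta_pair :: "nat \<Rightarrow> int \<Rightarrow> int \<Rightarrow> real" where
  "delta_pair \<alpha> n m = of_bool (n = m) - (- 1) ^ \<alpha> * of_bool (n = - m)"

lemma wave_derivative: "(wave \<alpha> n has_real_derivative real_of_int n / 2 * wave (Suc \<alpha>) n x) (at x)"
proof -
  have "((\<lambda>x. sin (real_of_int n * x / 2 + real \<alpha> * pi / 2)) has_real_derivative
      cos (real_of_int n * x / 2 + real \<alpha> * pi / 2) * (real_of_int n / 2)) (at x)"
    by (auto intro!: derivative_eq_intros)
  moreover have "wave (Suc \<alpha>) n x = cos (real_of_int n * x / 2 + real \<alpha> * pi / 2)"
    unfolding wave_def using sin_add[of "real_of_int n * x / 2 + real \<alpha> * pi / 2" "pi / 2"]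
    by (simp add: algebra_simps add_divide_distrib)
  ultimately show ?thesis by (simp add: wave_def[abs_def] mult.commute)
qed

lemma wave_Suc_Suc: "wave (Suc (Suc \<alpha>)) n x = - wave \<alpha> n x"
proof -
  have "real_of_int n * x / 2 + real (Suc (Suc \<alpha>)) * pi / 2 = (real_of_int n * x / 2 + real \<alpha> * pi / 2) + pi"
    by (simp add: algebra_simps add_divide_distrib)
  then show ?thesis unfolding wave_def by (simp only: sin_periodic_pi)
qed

lemma wave_0: "wave 0 n x = sin (real_of_int n * x / 2)"
  by (simp add: wave_def)

lemma wave_1: "wave (Suc 0) n x = cos (real_of_int n * x / 2)"
  by (simp add: wave_def sin_add)

lemma wave_bound: "\<bar>wave \<alpha> n x\<bar> \<le> 1"
  by (simp add: wave_def)

lemma continuous_wave: "continuous_on UNIV (wave \<alpha> n)"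
  unfolding wave_def[abs_def] by (intro continuous_intros) auto

lemma tmode_bound: "\<bar>tmode \<alpha> \<beta> k z\<bar> \<le> 1"
  unfolding tmode_def abs_mult by (intro mult_le_one wave_bound) auto

lemma continuous_tmode: "continuous_on A (tmode \<alpha> \<beta> k)"
  unfolding tmode_def[abs_def]
  by (intro continuous_intros continuous_on_compose2[OF continuous_wave]) auto

lemma tmode_measurable [measurable]: "tmode \<alpha> \<beta> k \<in> borel_measurable square_measure"
  by (intro borel_measurable_square_measure borel_measurable_continuous_onI continuous_tmode)

lemma wave_pairing:
  "(\<integral>x. (wave \<alpha> n x * wave \<alpha> m x) * indicator {0..2 * pi} x \<partial>lborel) = pi * delta_pair \<alpha> n m"
proof -
  define I where "I j \<beta> = (\<integral>x. cos (real_of_int j * x / 2 + real \<beta> * pi) * indicator {0..2 * pi} x \<partial>lborel)" for j :: int and \<beta> :: nat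
  have i: "integrable lborel (\<lambda>x. cos (real_of_int j * x / 2 + real \<beta> * pi) * indicator {0..2 * pi} x)" for j :: int and \<beta> :: nat
  proof -
    have "integrable lborel (\<lambda>x. indicator {0..2 * pi} x *\<^sub>R cos (real_of_int j * x / 2 + real \<beta> * pi))"
      by (intro borel_integrable_compact continuous_intros) auto
    then show ?thesis by (simp add: mult.commute)
  qed
  have I: "I j \<beta> = (- 1) ^ \<beta> * (2 * pi * of_bool (j = 0))" for j \<beta>
  proof (cases "j = 0")
    case True
    then show ?thesis unfolding I_def by (simp add: cos_npi)
  next
    case False
    have "I j \<beta> = 2 / real_of_int j * sin (real_of_int j * (2 * pi) / 2 + real \<beta> * pi)
        - 2 / real_of_int j * sin (real_of_int j * 0 / 2 + real \<beta> * pi)"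
      unfolding I_def
    proof (rule integral_FTC_Icc_real)
      show "DERIV (\<lambda>x. 2 / real_of_int j * sin (real_of_int j * x / 2 + real \<beta> * pi)) x :> cos (real_of_int j * x / 2 + real \<beta> * pi)" for x
        using False by (auto intro!: derivative_eq_intros)
      show "isCont (\<lambda>x. cos (real_of_int j * x / 2 + real \<beta> * pi)) x" for x by (intro continuous_intros) auto
    qed auto
    moreover have "sin (real_of_int j * (2 * pi) / 2 + real \<beta> * pi) = 0"
      using sin_times_pi_eq_0[of "real_of_int j + real \<beta>"] by (simp add: algebra_simps)
    ultimately show ?thesis using False by simp
  qed
  have "wave \<alpha> n x * wave \<alpha> m x = (cos (real_of_int (n - m) * x / 2 + real 0 * pi)
      - cos (real_of_int (n + m) * x / 2 + real \<alpha> * pi)) / 2" for x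
    unfolding wave_def sin_times_sin by (simp add: algebra_simps add_divide_distrib diff_divide_distrib)
  note w = this
  have "(wave \<alpha> n x * wave \<alpha> m x) * indicator {0..2 * pi} x =
      (cos (real_of_int (n - m) * x / 2 + real 0 * pi) * indicator {0..2 * pi} x
      - cos (real_of_int (n + m) * x / 2 + real \<alpha> * pi) * indicator {0..2 * pi} x) / 2" for x
    by (simp only: w left_diff_distrib times_divide_eq_left)
  then have "(\<integral>x. (wave \<alpha> n x * wave \<alpha> m x) * indicator {0..2 * pi} x \<partial>lborel) = (I (n - m) 0 - I (n + m) \<alpha>) / 2"
    by (simp only: integral_divide_zero Bochner_Integration.integral_diff[OF i i] I_def)
  also have "\<dots> = pi * delta_pair \<alpha> n m"
    unfolding I delta_pair_def by (auto simp: eq_neg_iff_add_eq_0 field_simps)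
  finally show ?thesis .
qed

lemma integral_square_product:
  fixes f g :: "real \<Rightarrow> real"
  assumes f: "continuous_on UNIV f" "\<And>x. \<bar>f x\<bar> \<le> B" and g: "continuous_on UNIV g" "\<And>x. \<bar>g x\<bar> \<le> C"
  shows "integral\<^sup>L square_measure (\<lambda>z. f (fst z) * g (snd z)) =
    (\<integral>x. f x * indicator {0..2 * pi} x \<partial>lborel) * (\<integral>x. g x * indicator {0..2 * pi} x \<partial>lborel)"
proof -
  let ?J = "{0<..<2 * pi}"
  have end_pts: "(\<integral>x. indicator ?J x * f x \<partial>lborel) = (\<integral>x. f x * indicator {0..2 * pi} x \<partial>lborel)"
    if f: "continuous_on UNIV f" for f :: "real \<Rightarrow> real"
  proof (rule integral_cong_AE)
    have "AE x in lborel. x \<noteq> 0" "AE x in lborel. x \<noteq> 2 * pi" by (rule AE_lborel_singleton)+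
    then show "AE x in lborel. indicator ?J x * f x = f x * indicator {0..2 * pi} x"
      by eventually_elim (auto simp: indicator_def)
    have fm: "f \<in> borel_measurable borel" using f by (rule borel_measurable_continuous_onI)
    have im: "indicator ?J \<in> borel_measurable borel" "indicator {0..2 * pi} \<in> borel_measurable borel"
      by (rule borel_measurable_indicator; simp)+
    show "(\<lambda>x. indicator ?J x * f x) \<in> borel_measurable lborel"
      "(\<lambda>x. f x * indicator {0..2 * pi} x) \<in> borel_measurable lborel"
      unfolding borel_measurable_lborel by (rule borel_measurable_times[OF im(1) fm] borel_measurable_times[OF fm im(2)])+
  qed
  define G where "G z = (indicator ?J (fst z) * f (fst z)) * (indicator ?J (snd z) * g (snd z))" for z
  have G: "indicator Omega z * (f (fst z) * g (snd z)) = G z" for z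
    by (cases z) (auto simp: G_def Omega_def indicator_def)
  have "integrable square_measure (\<lambda>z. f (fst z) * g (snd z))"
  proof (rule integrable_square_bounded)
    show "(\<lambda>z. f (fst z) * g (snd z)) \<in> borel_measurable square_measure"
      by (intro borel_measurable_square_measure borel_measurable_continuous_onI continuous_intros
          continuous_on_compose2[OF f(1)] continuous_on_compose2[OF g(1)]) auto
    show "\<bar>f (fst z) * g (snd z)\<bar> \<le> \<bar>B\<bar> * \<bar>C\<bar>" for z
      unfolding abs_mult using f(2)[of "fst z"] g(2)[of "snd z"] by (intro mult_mono) auto
  qed
  then have "integrable lborel G"
    by (simp add: integrable_square_measure set_integrable_def G)
  then have int: "integrable (lborel \<Otimes>\<^sub>M lborel) G" by (simp add: lborel_prod)
  have "integral\<^sup>L square_measure (\<lambda>z. f (fst z) * g (snd z)) = integral\<^sup>L lborel G"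
    unfolding integral_square_measure[symmetric] set_lebesgue_integral_def by (simp add: G)
  also have "\<dots> = integral\<^sup>L (lborel \<Otimes>\<^sub>M lborel) G" by (simp add: lborel_prod)
  also have "\<dots> = (\<integral>x. (\<integral>y. G (x, y) \<partial>lborel) \<partial>lborel)"
    by (rule lborel_pair.integral_fst'[OF int, symmetric])
  also have "\<dots> = (\<integral>x. indicator ?J x * f x \<partial>lborel) * (\<integral>x. indicator ?J x * g x \<partial>lborel)"
    by (simp add: G_def)
  finally show ?thesis by (simp add: end_pts f(1) g(1))
qed

lemma tmode_pairing:
  "integral\<^sup>L square_measure (\<lambda>z. tmode \<alpha> \<beta> k z * tmode \<alpha> \<beta> l z) =
     pi\<^sup>2 * (delta_pair \<alpha> (fst k) (fst l) * delta_pair \<beta> (snd k) (snd l))"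
proof -
  define f where "f x = wave \<alpha> (fst k) x * wave \<alpha> (fst l) x" for x
  define g where "g x = wave \<beta> (snd k) x * wave \<beta> (snd l) x" for x
  have "tmode \<alpha> \<beta> k z * tmode \<alpha> \<beta> l z = f (fst z) * g (snd z)" for z
    by (simp add: tmode_def f_def g_def)
  moreover have "integral\<^sup>L square_measure (\<lambda>z. f (fst z) * g (snd z)) =
    (\<integral>x. f x * indicator {0..2 * pi} x \<partial>lborel) * (\<integral>x. g x * indicator {0..2 * pi} x \<partial>lborel)"
    by (rule integral_square_product[where B = 1 and C = 1])
      (auto simp: f_def[abs_def] g_def[abs_def] abs_mult intro!: continuous_intros continuous_wave mult_le_one wave_bound)
  ultimately show ?thesis unfolding f_def g_def wave_pairing by (simp add: power2_eq_square)
qed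

definition mode_box :: "nat \<Rightarrow> (int \<times> int) set" where
  "mode_box N = {1..int N} \<times> {1..int N}"

definition tsum :: "nat \<Rightarrow> nat \<Rightarrow> (int \<times> int \<Rightarrow> real) \<Rightarrow> nat \<Rightarrow> plane_fun" where
  "tsum \<alpha> \<beta> c N z = (\<Sum>k\<in>mode_box N. c k * tmode \<alpha> \<beta> k z)"

text \<open>The series is \<open>\<Sum> c\<^sub>k sin (k\<^sub>1 x / 2 + \<alpha> \<pi> / 2) sin (k\<^sub>2 y / 2 + \<beta> \<pi> / 2)\<close> over \<open>k\<^sub>1, k\<^sub>2 \<ge> 1\<close>, so that
  each differentiation raises \<open>\<alpha>\<close> or \<open>\<beta>\<close> by one.\<close>

definition has_series :: "nat \<Rightarrow> nat \<Rightarrow> (int \<times> int \<Rightarrow> real) \<Rightarrow> plane_fun \<Rightarrow> bool" where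
  "has_series \<alpha> \<beta> c f \<longleftrightarrow> mean_limit (tsum \<alpha> \<beta> c) f"

text \<open>Oddness of a sequence becomes this symmetry after multiplication by one frequency factor
  for each derivative. Values on the axes are 0 for cosines too, since the series runs over positive
  frequencies.\<close>

definition reflecting :: "nat \<Rightarrow> nat \<Rightarrow> (int \<times> int \<Rightarrow> real) \<Rightarrow> bool" where
  "reflecting \<alpha> \<beta> c \<longleftrightarrow> (\<forall>i j. c (- i, j) = - ((- 1) ^ \<alpha> * c (i, j)) \<and> c (i, - j) = - ((- 1) ^ \<beta> * c (i, j)))
     \<and> (\<forall>i. c (0, i) = 0 \<and> c (i, 0) = 0)"

text \<open>Square summability with a Sobolev weight of order n; order 4 corresponds to
  \<open>H4\<close>.\<close>

definition sq_weighted :: "nat \<Rightarrow> (int \<times> int \<Rightarrow> real) \<Rightarrow> bool" where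
  "sq_weighted n c \<longleftrightarrow> (\<lambda>k. (jap k ^ n * c k)\<^sup>2) summable_on UNIV"

lemma finite_mode_box [simp]: "finite (mode_box N)"
  by (simp add: mode_box_def)

lemma mode_box_mono: "M \<le> N \<Longrightarrow> mode_box M \<subseteq> mode_box N"
  by (auto simp: mode_box_def)

lemma sq_weighted_dominated:
  assumes c: "sq_weighted (m + n) c" and d: "\<And>k. \<bar>d k\<bar> \<le> C * (jap k ^ m * \<bar>c k\<bar>)"
  shows "sq_weighted n d"
  unfolding sq_weighted_def
proof (rule summable_on_comparison_test)
  show "(\<lambda>k. C\<^sup>2 * (jap k ^ (m + n) * c k)\<^sup>2) summable_on UNIV"
    using c unfolding sq_weighted_def by (rule summable_on_cmult_right)
  fix k
  have j: "0 \<le> jap k" using jap_ge_1[of k] by simp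
  have "\<bar>jap k ^ n * d k\<bar> \<le> jap k ^ n * (C * (jap k ^ m * \<bar>c k\<bar>))"
    unfolding abs_mult using j d[of k] by (simp add: mult_left_mono)
  also have "\<dots> = C * (jap k ^ (m + n) * \<bar>c k\<bar>)" by (simp add: power_add)
  finally have "\<bar>jap k ^ n * d k\<bar>\<^sup>2 \<le> (C * (jap k ^ (m + n) * \<bar>c k\<bar>))\<^sup>2"
    by (intro power_mono) auto
  then show "(jap k ^ n * d k)\<^sup>2 \<le> C\<^sup>2 * (jap k ^ (m + n) * c k)\<^sup>2"
    by (simp add: power_mult_distrib)
qed auto

lemma sq_weighted_mono: "sq_weighted n c \<Longrightarrow> m \<le> n \<Longrightarrow> sq_weighted m c"
proof (rule sq_weighted_dominated[of "n - m" m c _ 1])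
  show "\<bar>c k\<bar> \<le> 1 * (jap k ^ (n - m) * \<bar>c k\<bar>)" for k
    using mult_right_mono[OF one_le_power[OF jap_ge_1[of k], of "n - m"], of "\<bar>c k\<bar>"] by simp
qed simp

lemma sq_weighted_fst: "sq_weighted (Suc n) c \<Longrightarrow> sq_weighted n (\<lambda>k. real_of_int (fst k) / 2 * c k)"
  and sq_weighted_snd: "sq_weighted (Suc n) c \<Longrightarrow> sq_weighted n (\<lambda>k. real_of_int (snd k) / 2 * c k)"
proof -
  assume c: "sq_weighted (Suc n) c"
  have "\<bar>real_of_int (fst k) / 2 * c k\<bar> \<le> 1 * (jap k ^ 1 * \<bar>c k\<bar>)"
    "\<bar>real_of_int (snd k) / 2 * c k\<bar> \<le> 1 * (jap k ^ 1 * \<bar>c k\<bar>)" for k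
  proof -
    have "\<bar>real_of_int (fst k)\<bar> / 2 \<le> jap k" "\<bar>real_of_int (snd k)\<bar> / 2 \<le> jap k"
      using fst_le_jap[of k] snd_le_jap[of k] jap_ge_1[of k] by linarith+
    from this[THEN mult_right_mono, of "\<bar>c k\<bar>"]
    show "\<bar>real_of_int (fst k) / 2 * c k\<bar> \<le> 1 * (jap k ^ 1 * \<bar>c k\<bar>)"
      "\<bar>real_of_int (snd k) / 2 * c k\<bar> \<le> 1 * (jap k ^ 1 * \<bar>c k\<bar>)"
      by (simp_all add: abs_mult)
  qed
  then show "sq_weighted n (\<lambda>k. real_of_int (fst k) / 2 * c k)" "sq_weighted n (\<lambda>k. real_of_int (snd k) / 2 * c k)"
    using c by (auto intro!: sq_weighted_dominated[of 1 n c _ 1])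
qed

lemma sq_weighted_kap: "sq_weighted (Suc (Suc n)) c \<Longrightarrow> sq_weighted n (\<lambda>k. - kap k * c k)"
  by (rule sq_weighted_dominated[of 2 n c _ 1])
    (auto simp: abs_mult kap_nonneg intro!: mult_right_mono kap_le_jap)

lemma tsum_integrable: "integrable square_measure (tsum \<alpha> \<beta> c N)"
  unfolding tsum_def[abs_def]
  by (intro Bochner_Integration.integrable_sum integrable_mult_right)
    (rule integrable_square_bounded[OF tmode_measurable tmode_bound])

lemma continuous_tsum: "continuous_on A (tsum \<alpha> \<beta> c N)"
  unfolding tsum_def[abs_def] by (intro continuous_intros continuous_tmode)

lemma tmode_product_integrable: "integrable square_measure (\<lambda>z. tmode \<alpha> \<beta> k z * tmode \<alpha>' \<beta>' l z)"
  by (rule integrable_square_mult_bounded[OF integrable_square_bounded[OF tmode_measurable tmode_bound]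
        tmode_measurable tmode_bound])

lemma delta_pair_pos: "n \<ge> 1 \<Longrightarrow> m \<ge> 1 \<Longrightarrow> delta_pair \<alpha> n m = of_bool (n = m)"
  by (auto simp: delta_pair_def)

lemma integral_finite_sum_square:
  assumes F: "finite F" "F \<subseteq> {1..} \<times> {1..}"
  shows "integral\<^sup>L square_measure (\<lambda>z. (\<Sum>k\<in>F. c k * tmode \<alpha> \<beta> k z)\<^sup>2) = pi\<^sup>2 * (\<Sum>k\<in>F. (c k)\<^sup>2)"
    and "integrable square_measure (\<lambda>z. (\<Sum>k\<in>F. c k * tmode \<alpha> \<beta> k z)\<^sup>2)"
proof -
  have sq: "(\<Sum>k\<in>F. c k * tmode \<alpha> \<beta> k z)\<^sup>2
      = (\<Sum>k\<in>F. \<Sum>l\<in>F. (c k * c l) * (tmode \<alpha> \<beta> k z * tmode \<alpha> \<beta> l z))" for z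
    unfolding power2_eq_square sum_product by (simp add: algebra_simps)
  have i: "integrable square_measure (\<lambda>z. (c k * c l) * (tmode \<alpha> \<beta> k z * tmode \<alpha> \<beta> l z))" for k l
    by (intro integrable_mult_right tmode_product_integrable)
  show "integrable square_measure (\<lambda>z. (\<Sum>k\<in>F. c k * tmode \<alpha> \<beta> k z)\<^sup>2)"
    unfolding sq by (intro Bochner_Integration.integrable_sum i)
  have "integral\<^sup>L square_measure (\<lambda>z. (\<Sum>k\<in>F. c k * tmode \<alpha> \<beta> k z)\<^sup>2)
      = (\<Sum>k\<in>F. \<Sum>l\<in>F. (c k * c l) * (pi\<^sup>2 * (delta_pair \<alpha> (fst k) (fst l) * delta_pair \<beta> (snd k) (snd l))))"
    unfolding sq using i by (simp add: Bochner_Integration.integral_sum tmode_pairing)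
  also have "\<dots> = (\<Sum>k\<in>F. \<Sum>l\<in>F. if l = k then pi\<^sup>2 * (c k)\<^sup>2 else 0)"
  proof (intro sum.cong refl)
    fix k l assume "k \<in> F" "l \<in> F"
    then have "fst k \<ge> 1" "snd k \<ge> 1" "fst l \<ge> 1" "snd l \<ge> 1" using F(2) by force+
    then show "(c k * c l) * (pi\<^sup>2 * (delta_pair \<alpha> (fst k) (fst l) * delta_pair \<beta> (snd k) (snd l)))
        = (if l = k then pi\<^sup>2 * (c k)\<^sup>2 else 0)"
      by (cases k; cases l) (auto simp: delta_pair_pos power2_eq_square)
  qed
  also have "\<dots> = pi\<^sup>2 * (\<Sum>k\<in>F. (c k)\<^sup>2)" using F(1) by (simp add: sum_distrib_left)
  finally show "integral\<^sup>L square_measure (\<lambda>z. (\<Sum>k\<in>F. c k * tmode \<alpha> \<beta> k z)\<^sup>2) = pi\<^sup>2 * (\<Sum>k\<in>F. (c k)\<^sup>2)" .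
qed

text \<open>Parseval controls differences of partial sums in L2, and
  \<open>\<bar>t\<bar> \<le> \<eta> + t^2 / \<eta>\<close> turns this into a bound in L1 on the
  finite measure space.\<close>

lemma has_series_exists:
  assumes c: "sq_weighted 0 c" shows "\<exists>f. has_series \<alpha> \<beta> c f"
  unfolding has_series_def
proof (rule mean_limit_exists)
  let ?I = "integral\<^sup>L square_measure"
  show "integrable square_measure (tsum \<alpha> \<beta> c n)" for n by (rule tsum_integrable)
  fix e :: real assume "e > 0"
  define V where "V = measure square_measure Omega"
  have "V \<ge> 0" by (simp add: V_def)
  \<comment> \<open>Half of e goes to the constant \<eta> integrated over the square, the other half
    to the quadratic term, whose integral N makes at most \<open>\<eta> * e / 2\<close>.\<close>
  define \<eta> where "\<eta> = e / (2 * (V + 1))"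
  have \<eta>: "\<eta> > 0" "V * \<eta> \<le> e / 2"
    using \<open>e > 0\<close> \<open>V \<ge> 0\<close> by (auto simp: \<eta>_def field_simps)
  define S where "S N = (\<Sum>k\<in>mode_box N. (c k)\<^sup>2)" for N
  have cs: "(\<lambda>k. (c k)\<^sup>2) summable_on UNIV" using c by (simp add: sq_weighted_def)
  have mono: "incseq S" unfolding S_def
    by (intro incseq_SucI sum_mono2 mode_box_mono) auto
  have "S N \<le> (\<Sum>\<^sub>\<infinity>k. (c k)\<^sup>2)" for N
    unfolding S_def by (rule finite_sum_le_infsum[OF cs]) auto
  then have "convergent S" using mono incseq_convergent by (metis convergentI)
  then have "Cauchy S" by (rule convergent_Cauchy)
  moreover have "\<eta> * e / (2 * pi\<^sup>2) > 0" using \<eta> \<open>e > 0\<close> by simp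
  ultimately obtain N where N: "\<And>m n. m \<ge> N \<Longrightarrow> n \<ge> N \<Longrightarrow> \<bar>S m - S n\<bar> < \<eta> * e / (2 * pi\<^sup>2)"
    unfolding Cauchy_def dist_real_def by blast
  have half: "?I (\<lambda>z. \<bar>tsum \<alpha> \<beta> c n z - tsum \<alpha> \<beta> c m z\<bar>) \<le> e" if "N \<le> m" "m \<le> n" for m n
  proof -
    let ?F = "mode_box n - mode_box m"
    have sub: "mode_box m \<subseteq> mode_box n" by (rule mode_box_mono[OF that(2)])
    have F: "finite ?F" "?F \<subseteq> {1..} \<times> {1..}" by (auto simp: mode_box_def)
    define t where "t z = (\<Sum>k\<in>?F. c k * tmode \<alpha> \<beta> k z)" for z
    have t: "tsum \<alpha> \<beta> c n z - tsum \<alpha> \<beta> c m z = t z" for z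
      unfolding tsum_def t_def using sub by (simp add: sum_diff)
    have "(\<Sum>k\<in>?F. (c k)\<^sup>2) = S n - S m" unfolding S_def using sub by (simp add: sum_diff)
    also have "\<dots> \<le> \<eta> * e / (2 * pi\<^sup>2)" using N[of n m] that by auto
    finally have "pi\<^sup>2 * (\<Sum>k\<in>?F. (c k)\<^sup>2) \<le> \<eta> * e / 2" by (simp add: field_simps)
    then have It2: "?I (\<lambda>z. (t z)\<^sup>2) \<le> \<eta> * e / 2"
      unfolding t_def integral_finite_sum_square(1)[OF F] .
    have it2: "integrable square_measure (\<lambda>z. (t z)\<^sup>2)"
      unfolding t_def by (rule integral_finite_sum_square(2)[OF F])
    have it: "integrable square_measure t"
      unfolding t[symmetric, abs_def] by (intro Bochner_Integration.integrable_diff tsum_integrable)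
    have "?I (\<lambda>z. \<bar>t z\<bar>) \<le> ?I (\<lambda>z. \<eta> + (t z)\<^sup>2 / \<eta>)"
    proof (rule integral_mono)
      fix z
      have "\<bar>t z\<bar> * \<eta> \<le> \<eta>\<^sup>2 + (t z)\<^sup>2"
      proof -
        have "0 \<le> (\<bar>t z\<bar> - \<eta>)\<^sup>2" by simp
        then have "2 * (\<bar>t z\<bar> * \<eta>) \<le> (t z)\<^sup>2 + \<eta>\<^sup>2" by (simp add: power2_diff)
        moreover have "0 \<le> \<bar>t z\<bar> * \<eta>" using \<eta> by simp
        ultimately show ?thesis by linarith
      qed
      then show "\<bar>t z\<bar> \<le> \<eta> + (t z)\<^sup>2 / \<eta>" using \<eta>(1) by (simp add: field_simps power2_eq_square)
    qed (use it it2 in auto)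
    also have "\<dots> = V * \<eta> + ?I (\<lambda>z. (t z)\<^sup>2) / \<eta>"
      using it2 by (simp add: V_def)
    also have "\<dots> \<le> e / 2 + e / 2"
      using \<eta> It2 by (intro add_mono) (auto simp: field_simps)
    finally show ?thesis by (simp add: t)
  qed
  show "\<exists>N. \<forall>m\<ge>N. \<forall>n\<ge>N. ?I (\<lambda>z. \<bar>tsum \<alpha> \<beta> c m z - tsum \<alpha> \<beta> c n z\<bar>) \<le> e"
  proof (intro exI[of _ N] allI impI)
    fix m n assume "N \<le> m" "N \<le> n"
    then show "?I (\<lambda>z. \<bar>tsum \<alpha> \<beta> c m z - tsum \<alpha> \<beta> c n z\<bar>) \<le> e"
      using half[of m n] half[of n m] by (cases "m \<le> n") (auto simp: abs_minus_commute)
  qed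
qed

lemma reflecting_value:
  assumes "reflecting \<alpha> \<beta> c" "fst l \<noteq> 0" "snd l \<noteq> 0"
  shows "c l = (if fst l > 0 then 1 else - ((- 1) ^ \<alpha>)) * (if snd l > 0 then 1 else - ((- 1) ^ \<beta>))
    * c (\<bar>fst l\<bar>, \<bar>snd l\<bar>)"
proof -
  obtain i j where l: "l = (i, j)" by (cases l)
  have r: "c (- i, j) = - ((- 1) ^ \<alpha> * c (i, j))" "c (i, - j) = - ((- 1) ^ \<beta> * c (i, j))" for i j
    using assms(1) by (auto simp: reflecting_def)
  have s: "(- 1) ^ \<alpha> * ((- 1) ^ \<alpha> * x) = x" "(- 1) ^ \<beta> * ((- 1) ^ \<beta> * x) = x" for x :: real
    by (simp_all flip: mult.assoc power_mult_distrib)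
  show ?thesis using assms(2,3)
    by (cases "i > 0"; cases "j > 0") (auto simp: l abs_if r s mult.left_commute[of "(- 1) ^ \<beta>"])
qed

lemma tsum_pairing:
  assumes c: "reflecting \<alpha> \<beta> c"
  shows "integral\<^sup>L square_measure (\<lambda>z. tsum \<alpha> \<beta> c N z * tmode \<alpha> \<beta> l z) =
     pi\<^sup>2 * (if (\<bar>fst l\<bar>, \<bar>snd l\<bar>) \<in> mode_box N then c l else 0)"
proof -
  let ?l = "(\<bar>fst l\<bar>, \<bar>snd l\<bar>)"
  define s where "s = (if fst l > 0 then 1 else - ((- 1) ^ \<alpha>)) * (if snd l > 0 then 1 else - ((- 1) ^ \<beta>) :: real)"
  have "integral\<^sup>L square_measure (\<lambda>z. tsum \<alpha> \<beta> c N z * tmode \<alpha> \<beta> l z)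
      = integral\<^sup>L square_measure (\<lambda>z. \<Sum>k\<in>mode_box N. c k * (tmode \<alpha> \<beta> k z * tmode \<alpha> \<beta> l z))"
    by (simp add: tsum_def sum_distrib_right mult.assoc)
  also have "\<dots> = (\<Sum>k\<in>mode_box N. c k * (pi\<^sup>2 * (delta_pair \<alpha> (fst k) (fst l) * delta_pair \<beta> (snd k) (snd l))))"
    by (subst Bochner_Integration.integral_sum)
      (auto intro!: integrable_mult_right tmode_product_integrable simp: tmode_pairing)
  also have "\<dots> = (\<Sum>k\<in>mode_box N. if k = ?l then pi\<^sup>2 * (s * c ?l) else 0)"
  proof (intro sum.cong refl)
    fix k assume "k \<in> mode_box N"
    then have "fst k \<ge> 1" "snd k \<ge> 1" by (auto simp: mode_box_def)
    then show "c k * (pi\<^sup>2 * (delta_pair \<alpha> (fst k) (fst l) * delta_pair \<beta> (snd k) (snd l)))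
        = (if k = ?l then pi\<^sup>2 * (s * c ?l) else 0)"
      by (cases k) (auto simp: delta_pair_def s_def abs_if split: if_splits)
  qed
  also have "\<dots> = pi\<^sup>2 * (if ?l \<in> mode_box N then s * c ?l else 0)" by simp
  also have "(if ?l \<in> mode_box N then s * c ?l else 0) = (if ?l \<in> mode_box N then c l else 0)"
  proof (cases "?l \<in> mode_box N")
    case True
    then have "fst l \<noteq> 0" "snd l \<noteq> 0" by (auto simp: mode_box_def)
    then have "c l = s * c ?l" unfolding s_def by (rule reflecting_value[OF c])
    then show ?thesis by simp
  qed simp
  finally show ?thesis .
qed

lemma has_series_coeff:
  assumes f: "has_series \<alpha> \<beta> c f" and c: "reflecting \<alpha> \<beta> c"
  shows "integral\<^sup>L square_measure (\<lambda>z. f z * tmode \<alpha> \<beta> l z) = pi\<^sup>2 * c l"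
proof (rule LIMSEQ_unique)
  show "(\<lambda>N. integral\<^sup>L square_measure (\<lambda>z. tsum \<alpha> \<beta> c N z * tmode \<alpha> \<beta> l z))
      \<longlonglongrightarrow> integral\<^sup>L square_measure (\<lambda>z. f z * tmode \<alpha> \<beta> l z)"
    using f unfolding has_series_def by (rule mean_limit_integral[OF _ tmode_measurable tmode_bound])
  have "\<forall>\<^sub>F N in sequentially. (if (\<bar>fst l\<bar>, \<bar>snd l\<bar>) \<in> mode_box N then c l else 0) = c l"
    unfolding eventually_sequentially
  proof (intro exI[of _ "nat (max \<bar>fst l\<bar> \<bar>snd l\<bar>)"] allI impI)
    fix N assume "nat (max \<bar>fst l\<bar> \<bar>snd l\<bar>) \<le> N"
    then have N: "\<bar>fst l\<bar> \<le> int N" "\<bar>snd l\<bar> \<le> int N" by auto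
    show "(if (\<bar>fst l\<bar>, \<bar>snd l\<bar>) \<in> mode_box N then c l else 0) = c l"
    proof (cases "fst l = 0 \<or> snd l = 0")
      case True
      then have "c l = 0" using c by (cases l) (auto simp: reflecting_def)
      then show ?thesis by simp
    next
      case False
      then show ?thesis using N by (auto simp: mode_box_def)
    qed
  qed
  then show "(\<lambda>N. integral\<^sup>L square_measure (\<lambda>z. tsum \<alpha> \<beta> c N z * tmode \<alpha> \<beta> l z)) \<longlonglongrightarrow> pi\<^sup>2 * c l"
    unfolding tsum_pairing[OF c] by (intro tendsto_mult_left tendsto_eventually)
qed

section \<open>Differentiating series\<close>

text \<open>Integrating along e first, the fundamental theorem leaves on each line a difference of
  values of F at points outside Omega, where F is 0.\<close>

lemma integral_test_derivative:
  assumes t: "test_function F" and e: "e = (1, 0) \<or> e = (0, 1)"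
  shows "integral\<^sup>L square_measure (\<lambda>z. frechet_derivative F (at z) e) = 0"
proof -
  define D where "D z = frechet_derivative F (at z) e" for z
  have Dc: "continuous_on UNIV D" unfolding D_def by (rule test_function_props(2)[OF t])
  have D0: "z \<notin> Omega \<Longrightarrow> D z = 0" for z unfolding D_def by (rule test_function_props(4)[OF t])
  have F0: "z \<notin> Omega \<Longrightarrow> F z = 0" for z by (rule test_function_props(3)[OF t])
  obtain B where B: "\<And>z. \<bar>D z\<bar> \<le> B" unfolding D_def using test_function_props(6)[OF t] by blast
  have diff: "(F has_derivative frechet_derivative F (at z)) (at z)" for z
    using t unfolding test_function_def by (meson frechet_derivative_works)
  have lin: "frechet_derivative F (at z) (h *\<^sub>R e) = h * D z" for z h
    unfolding D_def using linear_scale[OF has_derivative_linear[OF diff[of z]], of h e] by simp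
  have "integrable square_measure D"
    by (rule integrable_square_bounded[OF _ B])
      (intro borel_measurable_square_measure borel_measurable_continuous_onI Dc)
  then have "integrable lborel (\<lambda>z. indicator Omega z * D z)"
    by (simp add: integrable_square_measure set_integrable_def)
  moreover have ind: "indicator Omega z * D z = D z" for z using D0[of z] by (cases "z \<in> Omega") auto
  ultimately have int: "integrable (lborel \<Otimes>\<^sub>M lborel) D" by (simp add: lborel_prod)
  have "integral\<^sup>L square_measure D = integral\<^sup>L lborel D"
    unfolding integral_square_measure[symmetric] set_lebesgue_integral_def by (simp add: ind)
  also have "\<dots> = integral\<^sup>L (lborel \<Otimes>\<^sub>M lborel) D" by (simp add: lborel_prod)
  also have "\<dots> = 0"
  proof (cases "e = (1, 0)")
    case True
    have "(\<integral>x. D (x, y) \<partial>lborel) = 0" for y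
    proof -
      have "(\<integral>x. D (x, y) * indicator {0..2 * pi} x \<partial>lborel) = F (2 * pi, y) - F (0, y)"
      proof (rule integral_FTC_Icc_real)
        show "DERIV (\<lambda>x. F (x, y)) x :> D (x, y)" for x
        proof -
          have "((\<lambda>x. F (x, y)) has_derivative (\<lambda>h. frechet_derivative F (at (x, y)) (h, 0))) (at x)"
            by (rule has_derivative_compose[OF _ diff, of "\<lambda>x. (x, y)" "\<lambda>h. (h, 0)"])
              (auto intro!: derivative_eq_intros)
          moreover have "frechet_derivative F (at (x, y)) (h, 0) = D (x, y) * h" for h
            using lin[of "(x, y)" h] True by (simp add: mult.commute)
          ultimately show ?thesis by (simp add: has_field_derivative_def)
        qed
        have "continuous_on UNIV (\<lambda>x. D (x, y))"
          by (intro continuous_on_compose2[OF Dc] continuous_intros) auto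
        then show "isCont (\<lambda>x. D (x, y)) x" for x by (simp add: continuous_on_eq_continuous_at)
      qed simp
      moreover have "D (x, y) * indicator {0..2 * pi} x = D (x, y)" for x
        using D0[of "(x, y)"] by (cases "x \<in> {0..2 * pi}") (auto simp: Omega_def)
      ultimately show ?thesis using F0 by (simp add: Omega_def)
    qed
    then show ?thesis using lborel_pair.integral_snd[of "\<lambda>x y. D (x, y)"] int by simp
  next
    case False
    then have e1: "e = (0, 1)" using e by simp
    have "(\<integral>y. D (x, y) \<partial>lborel) = 0" for x
    proof -
      have "(\<integral>y. D (x, y) * indicator {0..2 * pi} y \<partial>lborel) = F (x, 2 * pi) - F (x, 0)"
      proof (rule integral_FTC_Icc_real)
        show "DERIV (\<lambda>y. F (x, y)) y :> D (x, y)" for y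
        proof -
          have "((\<lambda>y. F (x, y)) has_derivative (\<lambda>h. frechet_derivative F (at (x, y)) (0, h))) (at y)"
            by (rule has_derivative_compose[OF _ diff, of "\<lambda>y. (x, y)" "\<lambda>h. (0, h)"])
              (auto intro!: derivative_eq_intros)
          moreover have "frechet_derivative F (at (x, y)) (0, h) = D (x, y) * h" for h
            using lin[of "(x, y)" h] e1 by (simp add: mult.commute)
          ultimately show ?thesis by (simp add: has_field_derivative_def)
        qed
        have "continuous_on UNIV (\<lambda>y. D (x, y))"
          by (intro continuous_on_compose2[OF Dc] continuous_intros) auto
        then show "isCont (\<lambda>y. D (x, y)) y" for y by (simp add: continuous_on_eq_continuous_at)
      qed simp
      moreover have "D (x, y) * indicator {0..2 * pi} y = D (x, y)" for y
        using D0[of "(x, y)"] by (cases "y \<in> {0..2 * pi}") (auto simp: Omega_def)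
      ultimately show ?thesis using F0 by (simp add: Omega_def)
    qed
    then show ?thesis using lborel_pair.integral_fst'[OF int] by simp
  qed
  finally show ?thesis by (simp add: D_def[abs_def])
qed

lemma tmode_has_derivative:
  "(tmode \<alpha> \<beta> k has_derivative (\<lambda>e. fst e * (real_of_int (fst k) / 2 * tmode (Suc \<alpha>) \<beta> k z)
     + snd e * (real_of_int (snd k) / 2 * tmode \<alpha> (Suc \<beta>) k z))) (at z)"
proof -
  have 1: "((\<lambda>z. wave \<alpha> (fst k) (fst z)) has_derivative
      (\<lambda>e. real_of_int (fst k) / 2 * wave (Suc \<alpha>) (fst k) (fst z) * fst e)) (at z)"
    using has_derivative_compose[OF has_derivative_fst[OF has_derivative_ident]
        wave_derivative[of \<alpha> "fst k", unfolded has_field_derivative_def], of z UNIV] by simp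
  have 2: "((\<lambda>z. wave \<beta> (snd k) (snd z)) has_derivative
      (\<lambda>e. real_of_int (snd k) / 2 * wave (Suc \<beta>) (snd k) (snd z) * snd e)) (at z)"
    using has_derivative_compose[OF has_derivative_snd[OF has_derivative_ident]
        wave_derivative[of \<beta> "snd k", unfolded has_field_derivative_def], of z UNIV] by simp
  show ?thesis unfolding tmode_def[abs_def]
    by (rule has_derivative_eq_rhs[OF has_derivative_mult[OF 1 2]]) (auto simp: algebra_simps)
qed

text \<open>The product of a mode and a test function is again a test function, so the integral of
  its derivative vanishes.\<close>

lemma tmode_by_parts:
  fixes \<alpha> \<beta> :: nat and k :: "int \<times> int"
  assumes t: "test_function \<eta>" and e: "e = (1, 0) \<or> e = (0, 1)"
  defines "D \<equiv> \<lambda>z. fst e * (real_of_int (fst k) / 2 * tmode (Suc \<alpha>) \<beta> k z)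
     + snd e * (real_of_int (snd k) / 2 * tmode \<alpha> (Suc \<beta>) k z)"
  shows "integral\<^sup>L square_measure (\<lambda>z. tmode \<alpha> \<beta> k z * frechet_derivative \<eta> (at z) e)
    = - integral\<^sup>L square_measure (\<lambda>z. D z * \<eta> z)"
proof -
  have diff: "(\<eta> has_derivative frechet_derivative \<eta> (at z)) (at z)" for z
    using t unfolding test_function_def by (meson frechet_derivative_works)
  define F where "F z = tmode \<alpha> \<beta> k z * \<eta> z" for z
  define T' where "T' z e = fst e * (real_of_int (fst k) / 2 * tmode (Suc \<alpha>) \<beta> k z)
     + snd e * (real_of_int (snd k) / 2 * tmode \<alpha> (Suc \<beta>) k z)" for z e
  have F': "(F has_derivative (\<lambda>e. tmode \<alpha> \<beta> k z * frechet_derivative \<eta> (at z) e + T' z e * \<eta> z)) (at z)" for z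
    unfolding F_def T'_def by (rule has_derivative_mult[OF tmode_has_derivative diff])
  have fF: "frechet_derivative F (at z) e = tmode \<alpha> \<beta> k z * frechet_derivative \<eta> (at z) e + T' z e * \<eta> z" for z e
    by (simp add: frechet_derivative_at[OF F', symmetric])
  have tF: "test_function F"
    unfolding test_function_def
  proof (intro conjI allI)
    show "F differentiable at z" for z using F' differentiable_def by blast
    show "continuous_on UNIV (\<lambda>z. frechet_derivative F (at z) e)" for e
      unfolding fF T'_def
      by (intro continuous_intros continuous_tmode test_function_props(1,2)[OF t])
    have sub: "closure {z. F z \<noteq> 0} \<subseteq> closure {z. \<eta> z \<noteq> 0}" by (intro closure_mono) (auto simp: F_def)
    have S: "compact (closure {z. \<eta> z \<noteq> 0})" "closure {z. \<eta> z \<noteq> 0} \<subseteq> Omega"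
      using t unfolding test_function_def by blast+
    show "closure {z. F z \<noteq> 0} \<subseteq> Omega" using sub S by blast
    show "compact (closure {z. F z \<noteq> 0})"
      using compact_Int_closed[OF S(1) closed_closure, of "{z. F z \<noteq> 0}"] sub by (simp only: Int_absorb1)
  qed
  obtain B where B: "\<And>z. \<bar>\<eta> z\<bar> \<le> B" using test_function_props(5)[OF t] by blast
  obtain B' where B': "\<And>z. \<bar>frechet_derivative \<eta> (at z) e\<bar> \<le> B'" using test_function_props(6)[OF t] by blast
  have m: "\<eta> \<in> borel_measurable square_measure" "(\<lambda>z. frechet_derivative \<eta> (at z) e) \<in> borel_measurable square_measure"
    by (intro borel_measurable_square_measure borel_measurable_continuous_onI test_function_props(1,2)[OF t])+
  note tm = integrable_square_bounded[OF tmode_measurable tmode_bound]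
  have "integrable square_measure D"
    unfolding D_def by (intro Bochner_Integration.integrable_add integrable_mult_right tm)
  then have i: "integrable square_measure (\<lambda>z. tmode \<alpha> \<beta> k z * frechet_derivative \<eta> (at z) e)"
    "integrable square_measure (\<lambda>z. D z * \<eta> z)"
    using integrable_square_mult_bounded[OF tm m(2) B'] integrable_square_mult_bounded[OF _ m(1) B] by auto
  have "0 = integral\<^sup>L square_measure (\<lambda>z. tmode \<alpha> \<beta> k z * frechet_derivative \<eta> (at z) e + D z * \<eta> z)"
    using integral_test_derivative[OF tF e] by (simp add: fF T'_def D_def)
  then show ?thesis using i by simp
qed

text \<open>Integration by parts holds for each mode and passes to the limit in mean, because a test
  function and its derivatives are bounded. The combination of \<open>fst e\<close> and
  \<open>snd e\<close> treats both coordinate directions at once.\<close>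

lemma has_weak_derivative_series:
  assumes f: "has_series \<alpha> \<beta> c f" and e: "e = (1, 0) \<or> e = (0, 1)"
    and g: "mean_limit (\<lambda>N z. fst e * tsum (Suc \<alpha>) \<beta> (\<lambda>k. real_of_int (fst k) / 2 * c k) N z
       + snd e * tsum \<alpha> (Suc \<beta>) (\<lambda>k. real_of_int (snd k) / 2 * c k) N z) g"
  shows "has_weak_derivative e f g"
  unfolding has_weak_derivative_def integral_square_measure
proof (intro conjI allI impI)
  show "locally_integrable f" "locally_integrable g"
    using f g by (auto simp: has_series_def mean_limit_def intro: locally_integrable_if_integrable)
  fix \<eta> assume t: "test_function \<eta>"
  obtain B where B: "\<And>z. \<bar>\<eta> z\<bar> \<le> B" using test_function_props(5)[OF t] by blast
  obtain B' where B': "\<And>z. \<bar>frechet_derivative \<eta> (at z) e\<bar> \<le> B'" using test_function_props(6)[OF t] by blast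
  have m: "\<eta> \<in> borel_measurable square_measure" "(\<lambda>z. frechet_derivative \<eta> (at z) e) \<in> borel_measurable square_measure"
    by (intro borel_measurable_square_measure borel_measurable_continuous_onI test_function_props(1,2)[OF t])+
  note tm = integrable_square_bounded[OF tmode_measurable tmode_bound]
  define D where "D k z = fst e * (real_of_int (fst k) / 2 * tmode (Suc \<alpha>) \<beta> k z)
     + snd e * (real_of_int (snd k) / 2 * tmode \<alpha> (Suc \<beta>) k z)" for k z
  have iD: "integrable square_measure (D k)" for k
    unfolding D_def by (intro Bochner_Integration.integrable_add integrable_mult_right tm)
  have i: "integrable square_measure (\<lambda>z. tmode \<alpha> \<beta> k z * frechet_derivative \<eta> (at z) e)"
    "integrable square_measure (\<lambda>z. D k z * \<eta> z)" for k
    using integrable_square_mult_bounded[OF tm m(2) B'] integrable_square_mult_bounded[OF iD m(1) B] by auto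
  have gN: "fst e * tsum (Suc \<alpha>) \<beta> (\<lambda>k. real_of_int (fst k) / 2 * c k) N z
       + snd e * tsum \<alpha> (Suc \<beta>) (\<lambda>k. real_of_int (snd k) / 2 * c k) N z = (\<Sum>k\<in>mode_box N. c k * D k z)" for N z
    by (simp add: tsum_def D_def sum_distrib_left sum.distrib[symmetric] algebra_simps)
  have "integral\<^sup>L square_measure (\<lambda>z. tsum \<alpha> \<beta> c N z * frechet_derivative \<eta> (at z) e)
      = - integral\<^sup>L square_measure (\<lambda>z. (\<Sum>k\<in>mode_box N. c k * D k z) * \<eta> z)" for N
  proof -
    have "integral\<^sup>L square_measure (\<lambda>z. tsum \<alpha> \<beta> c N z * frechet_derivative \<eta> (at z) e)
        = (\<Sum>k\<in>mode_box N. c k * integral\<^sup>L square_measure (\<lambda>z. tmode \<alpha> \<beta> k z * frechet_derivative \<eta> (at z) e))"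
      unfolding tsum_def sum_distrib_right mult.assoc using i by (subst Bochner_Integration.integral_sum) auto
    also have "\<dots> = (\<Sum>k\<in>mode_box N. - (c k * integral\<^sup>L square_measure (\<lambda>z. D k z * \<eta> z)))"
      by (simp add: tmode_by_parts[OF t e] D_def)
    also have "\<dots> = - integral\<^sup>L square_measure (\<lambda>z. (\<Sum>k\<in>mode_box N. c k * D k z) * \<eta> z)"
      unfolding sum_distrib_right mult.assoc using i by (subst Bochner_Integration.integral_sum) (auto simp: sum_negf)
    finally show ?thesis .
  qed
  moreover have "(\<lambda>N. integral\<^sup>L square_measure (\<lambda>z. tsum \<alpha> \<beta> c N z * frechet_derivative \<eta> (at z) e))
      \<longlonglongrightarrow> integral\<^sup>L square_measure (\<lambda>z. f z * frechet_derivative \<eta> (at z) e)"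
    using f unfolding has_series_def by (rule mean_limit_integral[OF _ m(2) B'])
  moreover have "(\<lambda>N. integral\<^sup>L square_measure (\<lambda>z. (\<Sum>k\<in>mode_box N. c k * D k z) * \<eta> z))
      \<longlonglongrightarrow> integral\<^sup>L square_measure (\<lambda>z. g z * \<eta> z)"
    using mean_limit_integral[OF g m(1) B] unfolding gN .
  ultimately show "integral\<^sup>L square_measure (\<lambda>z. f z * frechet_derivative \<eta> (at z) e)
      = - integral\<^sup>L square_measure (\<lambda>z. g z * \<eta> z)"
    using LIMSEQ_unique[OF _ tendsto_minus] by simp
qed

text \<open>The candidate is the mean limit of the differentiated series, which exists by square
  summability; uniqueness of weak derivatives carries the series over to
  \<open>partial_x f\<close>.\<close>

lemma series_partial_x:
  assumes f: "has_series \<alpha> \<beta> c f" and c: "sq_weighted 1 c"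
  shows "has_series (Suc \<alpha>) \<beta> (\<lambda>k. real_of_int (fst k) / 2 * c k) (partial_x f)"
proof -
  obtain g where g: "has_series (Suc \<alpha>) \<beta> (\<lambda>k. real_of_int (fst k) / 2 * c k) g"
    using has_series_exists[OF sq_weighted_fst[of 0 c]] c by auto
  have w: "has_weak_derivative (1, 0) f g"
    by (rule has_weak_derivative_series[OF f]) (use g in \<open>auto simp: has_series_def\<close>)
  show ?thesis
    unfolding has_series_def partial_x_def
    by (rule mean_limit_AE[OF g[unfolded has_series_def] weak_derivative_AE[OF w]])
qed

lemma series_partial_y:
  assumes f: "has_series \<alpha> \<beta> c f" and c: "sq_weighted 1 c"
  shows "has_series \<alpha> (Suc \<beta>) (\<lambda>k. real_of_int (snd k) / 2 * c k) (partial_y f)"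
proof -
  obtain g where g: "has_series \<alpha> (Suc \<beta>) (\<lambda>k. real_of_int (snd k) / 2 * c k) g"
    using has_series_exists[OF sq_weighted_snd[of 0 c]] c by auto
  have w: "has_weak_derivative (0, 1) f g"
    by (rule has_weak_derivative_series[OF f]) (use g in \<open>auto simp: has_series_def\<close>)
  show ?thesis
    unfolding has_series_def partial_y_def
    by (rule mean_limit_AE[OF g[unfolded has_series_def] weak_derivative_AE[OF w]])
qed

lemma has_series_add:
  assumes "has_series \<alpha> \<beta> c f" "has_series \<alpha> \<beta> d g"
  shows "has_series \<alpha> \<beta> (\<lambda>k. c k + d k) (\<lambda>z. f z + g z)"
proof -
  have "tsum \<alpha> \<beta> (\<lambda>k. c k + d k) = (\<lambda>N z. tsum \<alpha> \<beta> c N z + tsum \<alpha> \<beta> d N z)"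
    by (intro ext) (simp add: tsum_def distrib_right sum.distrib)
  then show ?thesis using mean_limit_add assms by (simp add: has_series_def)
qed

lemma has_series_cmult:
  assumes "has_series \<alpha> \<beta> c f" shows "has_series \<alpha> \<beta> (\<lambda>k. a * c k) (\<lambda>z. a * f z)"
proof -
  have "tsum \<alpha> \<beta> (\<lambda>k. a * c k) = (\<lambda>N z. a * tsum \<alpha> \<beta> c N z)"
    by (intro ext) (simp add: tsum_def sum_distrib_left mult.assoc)
  then show ?thesis using mean_limit_cmult assms by (simp add: has_series_def)
qed

lemma series_laplacian:
  assumes f: "has_series \<alpha> \<beta> c f" and c: "sq_weighted 2 c"
  shows "has_series \<alpha> \<beta> (\<lambda>k. - kap k * c k) (laplacian f)"
proof -
  have c1: "sq_weighted 1 c" by (rule sq_weighted_mono[OF c]) simp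
  have c2: "sq_weighted (Suc 1) c" using c by (simp add: numeral_2_eq_2)
  have neg: "tmode (Suc (Suc \<alpha>)) \<beta> k z = - tmode \<alpha> \<beta> k z" "tmode \<alpha> (Suc (Suc \<beta>)) k z = - tmode \<alpha> \<beta> k z" for k z
    by (simp_all add: tmode_def wave_Suc_Suc)
  have "has_series (Suc (Suc \<alpha>)) \<beta> (\<lambda>k. real_of_int (fst k) / 2 * (real_of_int (fst k) / 2 * c k)) (partial_x (partial_x f))"
    by (intro series_partial_x f c1 sq_weighted_fst c2)
  then have x: "has_series \<alpha> \<beta> (\<lambda>k. - (real_of_int (fst k) / 2 * (real_of_int (fst k) / 2 * c k))) (partial_x (partial_x f))"
    by (simp add: has_series_def tsum_def[abs_def] neg)
  have "has_series \<alpha> (Suc (Suc \<beta>)) (\<lambda>k. real_of_int (snd k) / 2 * (real_of_int (snd k) / 2 * c k)) (partial_y (partial_y f))"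
    by (intro series_partial_y f c1 sq_weighted_snd c2)
  then have y: "has_series \<alpha> \<beta> (\<lambda>k. - (real_of_int (snd k) / 2 * (real_of_int (snd k) / 2 * c k))) (partial_y (partial_y f))"
    by (simp add: has_series_def tsum_def[abs_def] neg)
  have eq: "- (real_of_int (fst k) / 2 * (real_of_int (fst k) / 2 * c k)) + - (real_of_int (snd k) / 2 * (real_of_int (snd k) / 2 * c k)) = - kap k * c k" for k
    by (simp add: kap_def power2_eq_square field_simps)
  show ?thesis using has_series_add[OF x y] unfolding eq laplacian_def[abs_def] .
qed

section \<open>Uniform sums of absolutely summable series\<close>

definition pos_modes :: "(int \<times> int) set" where
  "pos_modes = {1..} \<times> {1..}"

lemma mode_box_exhausts: "filterlim mode_box (finite_subsets_at_top pos_modes) sequentially"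
  unfolding filterlim_finite_subsets_at_top
proof (intro allI impI)
  fix X :: "(int \<times> int) set" assume X: "finite X \<and> X \<subseteq> pos_modes"
  define M where "M = (\<Sum>k\<in>X. nat (fst k) + nat (snd k))"
  have "X \<subseteq> mode_box N" if "M \<le> N" for N
  proof
    fix k assume k: "k \<in> X"
    have "nat (fst k) + nat (snd k) \<le> M"
      unfolding M_def using X k by (intro member_le_sum) auto
    moreover have "fst k \<ge> 1" "snd k \<ge> 1" using X k by (auto simp: pos_modes_def)
    ultimately show "k \<in> mode_box N" using that by (cases k) (auto simp: mode_box_def)
  qed
  then show "\<forall>\<^sub>F N in sequentially. finite (mode_box N) \<and> X \<subseteq> mode_box N \<and> mode_box N \<subseteq> pos_modes"
    unfolding eventually_sequentially by (intro exI[of _ M]) (auto simp: mode_box_def pos_modes_def)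
qed

text \<open>The tail of the sum of \<open>\<bar>c k\<bar>\<close> bounds the error uniformly. The
  limit is the pointwise sum and the limit in mean at once, which links elements of
  \<open>H4\<close>, defined everywhere, to derivatives defined almost everywhere.\<close>

lemma uniform_series:
  assumes c: "(\<lambda>k. \<bar>c k\<bar>) summable_on UNIV"
  obtains F e B where "continuous_on UNIV F" "\<And>z. ((\<lambda>k. c k * tmode \<alpha> \<beta> k z) has_sum F z) pos_modes"
    "has_series \<alpha> \<beta> c F" "\<And>N z. \<bar>tsum \<alpha> \<beta> c N z - F z\<bar> \<le> e N" "e \<longlonglongrightarrow> 0" "\<And>z. \<bar>F z\<bar> \<le> B"
proof -
  have cp: "(\<lambda>k. \<bar>c k\<bar>) summable_on pos_modes" by (rule summable_on_subset[OF c]) simp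
  define S where "S = (\<Sum>\<^sub>\<infinity>k\<in>pos_modes. \<bar>c k\<bar>)"
  define SN where "SN N = (\<Sum>k\<in>mode_box N. \<bar>c k\<bar>)" for N
  define e where "e N = S - SN N" for N
  have sub: "mode_box N \<subseteq> pos_modes" for N by (auto simp: mode_box_def pos_modes_def)
  have lim: "(\<lambda>N. sum g (mode_box N)) \<longlonglongrightarrow> x" if "(g has_sum x) pos_modes" for g :: "int \<times> int \<Rightarrow> real" and x
    using that unfolding has_sum_def by (rule filterlim_compose[OF _ mode_box_exhausts])
  have "((\<lambda>k. \<bar>c k\<bar>) has_sum S) pos_modes" using cp by (simp add: S_def)
  then have "SN \<longlonglongrightarrow> S" unfolding SN_def[abs_def] by (rule lim)
  then have e: "e \<longlonglongrightarrow> 0" unfolding e_def[abs_def] using tendsto_diff[OF tendsto_const, of SN S sequentially S] by simp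
  have le: "SN N \<le> S" for N unfolding SN_def S_def by (rule finite_sum_le_infsum[OF cp]) (use sub in auto)
  have tb: "\<bar>c k * tmode \<alpha> \<beta> k z\<bar> \<le> \<bar>c k\<bar>" for k z
    unfolding abs_mult using tmode_bound mult_left_le[of "\<bar>tmode \<alpha> \<beta> k z\<bar>" "\<bar>c k\<bar>"] by simp
  define F where "F z = (\<Sum>\<^sub>\<infinity>k\<in>pos_modes. c k * tmode \<alpha> \<beta> k z)" for z
  have hs: "((\<lambda>k. c k * tmode \<alpha> \<beta> k z) has_sum F z) pos_modes" for z
  proof -
    have "(\<lambda>k. norm (c k * tmode \<alpha> \<beta> k z)) summable_on pos_modes"
      by (rule summable_on_comparison_test[OF cp]) (use tb in auto)
    then show ?thesis unfolding F_def by (rule has_sum_infsum[OF abs_summable_summable])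
  qed
  have diff: "\<bar>tsum \<alpha> \<beta> c M z - tsum \<alpha> \<beta> c N z\<bar> \<le> e N" if "N \<le> M" for M N z
  proof -
    have bs: "mode_box N \<subseteq> mode_box M" by (rule mode_box_mono[OF that])
    have "tsum \<alpha> \<beta> c M z - tsum \<alpha> \<beta> c N z = (\<Sum>k\<in>mode_box M - mode_box N. c k * tmode \<alpha> \<beta> k z)"
      unfolding tsum_def using bs by (simp add: sum_diff)
    also have "\<bar>\<dots>\<bar> \<le> (\<Sum>k\<in>mode_box M - mode_box N. \<bar>c k\<bar>)"
      by (rule order_trans[OF sum_abs]) (intro sum_mono tb)
    also have "\<dots> = SN M - SN N" unfolding SN_def using bs by (simp add: sum_diff)
    also have "\<dots> \<le> e N" using le[of M] by (simp add: e_def)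
    finally show ?thesis .
  qed
  have unif: "\<bar>tsum \<alpha> \<beta> c N z - F z\<bar> \<le> e N" for N z
  proof -
    have "(\<lambda>M. \<bar>tsum \<alpha> \<beta> c M z - tsum \<alpha> \<beta> c N z\<bar>) \<longlonglongrightarrow> \<bar>F z - tsum \<alpha> \<beta> c N z\<bar>"
      using lim[OF hs[of z]] unfolding tsum_def by (intro tendsto_intros)
    then have "\<bar>F z - tsum \<alpha> \<beta> c N z\<bar> \<le> e N"
      by (rule tendsto_upperbound) (auto simp: eventually_sequentially intro!: exI[of _ N] diff)
    then show ?thesis by (simp add: abs_minus_commute)
  qed
  have "uniform_limit UNIV (tsum \<alpha> \<beta> c) F sequentially"
  proof (rule uniform_limitI)
    fix \<epsilon> :: real assume "\<epsilon> > 0"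
    then have "\<forall>\<^sub>F N in sequentially. e N < \<epsilon>" using e by (rule order_tendstoD(2)[rotated])
    then show "\<forall>\<^sub>F N in sequentially. \<forall>z\<in>UNIV. dist (tsum \<alpha> \<beta> c N z) (F z) < \<epsilon>"
    proof eventually_elim
      case (elim N)
      then show ?case using unif[of N] by (auto simp: dist_real_def intro: le_less_trans)
    qed
  qed
  then have cont: "continuous_on UNIV F"
    by (rule uniform_limit_theorem[rotated]) (auto simp: continuous_tsum)
  have "has_series \<alpha> \<beta> c F" unfolding has_series_def
    by (rule mean_limit_uniform[OF tsum_integrable _ unif e])
      (intro borel_measurable_square_measure borel_measurable_continuous_onI cont)
  moreover have "\<bar>F z\<bar> \<le> e 0" for z using unif[of 0 z] by (simp add: tsum_def mode_box_def)
  ultimately show ?thesis using that[OF cont hs _ unif e] by blast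
qed

text \<open>Cauchy-Schwarz against \<open>jap^-2\<close> costs two orders.\<close>

lemma sq_weighted_abs_summable:
  assumes "sq_weighted (n + 2) c" shows "(\<lambda>k. \<bar>jap k ^ n * c k\<bar>) summable_on UNIV"
proof -
  have "(\<lambda>k. (1 / (jap k)\<^sup>2) * (jap k ^ (n + 2) * c k)) summable_on UNIV"
    using assms unfolding sq_weighted_def by (intro summable_on_mult_squares summable_inverse_jap)
  moreover have "(1 / (jap k)\<^sup>2) * (jap k ^ (n + 2) * c k) = jap k ^ n * c k" for k
    using jap_ge_1[of k] by (simp add: power_add power2_eq_square)
  ultimately have "(\<lambda>k. jap k ^ n * c k) summable_on UNIV" by (simp only:)
  then show ?thesis by (subst (asm) summable_on_iff_abs_summable_on_real) simp
qed

section \<open>Completeness of the sine system\<close>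

text \<open>Finite combinations of the functions \<open>sin (n x / 2)\<close>, as an inductive set
  so that closure under multiplication by \<open>cos (x / 2)\<close> is an induction; it then
  contains \<open>sin (x / 2)\<close> times every polynomial in \<open>cos (x / 2)\<close>.\<close>

inductive_set sine_span :: "(real \<Rightarrow> real) set" where
  wave: "wave 0 n \<in> sine_span"
| add: "S \<in> sine_span \<Longrightarrow> T \<in> sine_span \<Longrightarrow> (\<lambda>x. S x + T x) \<in> sine_span"
| cmult: "S \<in> sine_span \<Longrightarrow> (\<lambda>x. c * S x) \<in> sine_span"

lemma sine_span_continuous: "S \<in> sine_span \<Longrightarrow> continuous_on UNIV S"
  by (induction rule: sine_span.induct) (auto intro!: continuous_intros continuous_wave)

lemma sine_span_bounded: "S \<in> sine_span \<Longrightarrow> \<exists>B. \<forall>x. \<bar>S x\<bar> \<le> B"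
proof (induction rule: sine_span.induct)
  case (wave n) then show ?case using wave_bound by blast
next
  case (add S T)
  then obtain B C where "\<And>x. \<bar>S x\<bar> \<le> B" "\<And>x. \<bar>T x\<bar> \<le> C" by blast
  then have "\<bar>S x + T x\<bar> \<le> B + C" for x by (meson abs_triangle_ineq add_mono order_trans)
  then show ?case by blast
next
  case (cmult S c)
  then obtain B where "\<And>x. \<bar>S x\<bar> \<le> B" by blast
  then have "\<bar>c * S x\<bar> \<le> \<bar>c\<bar> * B" for x by (simp add: abs_mult mult_left_mono)
  then show ?case by blast
qed

lemma sine_span_mult_cos: "S \<in> sine_span \<Longrightarrow> (\<lambda>x. S x * cos (x / 2)) \<in> sine_span"
proof (induction rule: sine_span.induct)
  case (wave n)
  have "wave 0 n x * cos (x / 2) = (1 / 2) * (wave 0 (n + 1) x + wave 0 (n - 1) x)" for x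
    using sin_times_cos[of "real_of_int n * x / 2" "x / 2"]
    by (simp add: wave_0 algebra_simps add_divide_distrib diff_divide_distrib)
  then have "(\<lambda>x. wave 0 n x * cos (x / 2)) = (\<lambda>x. (1 / 2) * (wave 0 (n + 1) x + wave 0 (n - 1) x))" by (rule ext)
  then show ?case by (simp only: sine_span.cmult sine_span.add sine_span.wave)
next
  case (add S T)
  then show ?case using sine_span.add by (simp add: distrib_right)
next
  case (cmult S c)
  then show ?case using sine_span.cmult[OF cmult.IH, of c] by (simp add: mult.assoc)
qed

lemma sine_span_mult_poly:
  fixes p :: "real \<Rightarrow> real"
  assumes "real_polynomial_function p"
  shows "S \<in> sine_span \<Longrightarrow> (\<lambda>x. S x * p (cos (x / 2))) \<in> sine_span"
  using assms
proof (induction p arbitrary: S rule: real_polynomial_function.induct)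
  case (linear f)
  have fl: "f y = y * f 1" for y
    using linear_scale[OF bounded_linear.linear[OF linear(1)], of y 1] by simp
  have "(\<lambda>x. S x * f (cos (x / 2))) = (\<lambda>x. f 1 * (S x * cos (x / 2)))"
    by (rule ext, subst fl) (simp only: ac_simps)
  then show ?case using sine_span.cmult[OF sine_span_mult_cos] linear by simp
next
  case (const c)
  then show ?case using sine_span.cmult[OF const, of c] by (simp add: mult.commute)
next
  case (add f g)
  then show ?case using sine_span.add by (simp add: distrib_left)
next
  case (mult f g)
  then show ?case using mult.IH(2)[OF mult.IH(1)[OF mult.prems]] by (simp add: mult.assoc)
qed

text \<open>A bump supported inside the open interval from 0 to 2 \<pi> is divisible by
  \<open>sin (x / 2)\<close>, and the quotient is a continuous function of
  \<open>cos (x / 2)\<close>, which Weierstrass approximates by polynomials.\<close>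

lemma bump_approx_sine:
  assumes ab: "0 < a" "a < b" "b < 2 * pi" and "\<epsilon> > 0"
  obtains S where "S \<in> sine_span" "\<And>x. 0 \<le> x \<Longrightarrow> x \<le> 2 * pi \<Longrightarrow> \<bar>bump a b n x - S x\<bar> \<le> \<epsilon>"
proof -
  have spos: "sin (x / 2) > 0" if "x \<in> {a..b}" for x using that ab by (intro sin_gt_zero) auto
  have "\<exists>x\<in>{a..b}. \<forall>y\<in>{a..b}. sin (x / 2) \<le> sin (y / 2)"
    using ab by (intro continuous_attains_inf continuous_intros) auto
  then obtain x0 where x0: "x0 \<in> {a..b}" "\<And>y. y \<in> {a..b} \<Longrightarrow> sin (x0 / 2) \<le> sin (y / 2)" by blast
  define s where "s = sin (x0 / 2)"
  have s: "s > 0" "\<And>y. y \<in> {a..b} \<Longrightarrow> s \<le> sin (y / 2)" using x0 spos by (auto simp: s_def)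
  \<comment> \<open>The maximum with s keeps the denominator away from 0 everywhere and equals
    \<open>sin (x / 2)\<close> on the support of the bump.\<close>
  define H where "H x = bump a b n x / max (sin (x / 2)) s" for x
  have mx: "max (sin (x / 2)) s \<noteq> 0" for x using s(1) by (simp add: max_def)
  have Hc: "continuous_on UNIV H" unfolding H_def
    using mx by (intro continuous_intros continuous_on_compose2[OF bump_continuous]) auto
  have Hs: "sin (x / 2) * H x = bump a b n x" for x
  proof (cases "x \<in> {a<..<b}")
    case True
    then have "s \<le> sin (x / 2)" using s(2)[of x] by auto
    then show ?thesis using s(1) by (simp add: H_def max_def)
  next
    case False
    then show ?thesis by (simp add: H_def bump_outside)
  qed
  \<comment> \<open>Substitution \<open>c = cos (x / 2)\<close>, which is injective for x from 0 to
    2 \<pi> with inverse \<open>2 * arccos c\<close>.\<close>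
  have "continuous_on {- 1..1} (\<lambda>c. H (2 * arccos c))"
    by (intro continuous_on_compose2[OF Hc] continuous_intros) auto
  then obtain p where p: "real_polynomial_function p" "\<And>c. c \<in> {- 1..1} \<Longrightarrow> \<bar>H (2 * arccos c) - p c\<bar> < \<epsilon>"
    using Stone_Weierstrass_real_polynomial_function[of "{- 1..1}" "\<lambda>c. H (2 * arccos c)" \<epsilon>] \<open>\<epsilon> > 0\<close> by auto
  show ?thesis
  proof (rule that)
    show "(\<lambda>x. wave 0 1 x * p (cos (x / 2))) \<in> sine_span"
      by (rule sine_span_mult_poly[OF p(1) sine_span.wave])
    fix x :: real assume x: "0 \<le> x" "x \<le> 2 * pi"
    then have "2 * arccos (cos (x / 2)) = x" using arccos_cos[of "x / 2"] by simp
    then have "\<bar>H x - p (cos (x / 2))\<bar> \<le> \<epsilon>" using p(2)[of "cos (x / 2)"] by (simp only:) simp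
    moreover have "bump a b n x - wave 0 1 x * p (cos (x / 2)) = sin (x / 2) * (H x - p (cos (x / 2)))"
      by (simp add: right_diff_distrib Hs wave_def)
    ultimately show "\<bar>bump a b n x - wave 0 1 x * p (cos (x / 2))\<bar> \<le> \<epsilon>"
      using mult_mono[of "\<bar>sin (x / 2)\<bar>" 1 "\<bar>H x - p (cos (x / 2))\<bar>" \<epsilon>] by (simp add: abs_mult)
  qed
qed

lemma product_measurable:
  fixes f g :: "real \<Rightarrow> real"
  assumes "continuous_on UNIV f" "continuous_on UNIV g"
  shows "(\<lambda>z. f (fst z) * g (snd z)) \<in> borel_measurable square_measure"
  by (intro borel_measurable_square_measure borel_measurable_continuous_onI continuous_intros
      continuous_on_compose2[OF assms(1)] continuous_on_compose2[OF assms(2)]) auto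

text \<open>As h is only integrable, approximation in L2 would not suffice: products of bumps are
  approximated uniformly on the square by products from \<open>sine_span\<close>, against which h
  integrates to 0.\<close>

lemma zero_AE_if_coefficients_zero:
  assumes h: "integrable square_measure h"
    and zero: "\<And>l. l \<in> pos_modes \<Longrightarrow> integral\<^sup>L square_measure (\<lambda>z. h z * tmode 0 0 l z) = 0"
  shows "AE z in square_measure. h z = 0"
proof (rule zero_AE_if_bump_integrals_zero[OF locally_integrable_if_integrable[OF h]])
  let ?I = "integral\<^sup>L square_measure"
  have int: "integrable square_measure (\<lambda>z. h z * (S (fst z) * T (snd z)))"
    if "continuous_on UNIV S" "continuous_on UNIV T" "\<And>x. \<bar>S x\<bar> \<le> B" "\<And>x. \<bar>T x\<bar> \<le> C" for S T :: "real \<Rightarrow> real" and B C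
  proof (rule integrable_square_mult_bounded[OF h product_measurable[OF that(1,2)]])
    show "\<bar>S (fst z) * T (snd z)\<bar> \<le> \<bar>B\<bar> * \<bar>C\<bar>" for z
      unfolding abs_mult using that(3)[of "fst z"] that(4)[of "snd z"] by (intro mult_mono) auto
  qed
  have intS: "integrable square_measure (\<lambda>z. h z * (S (fst z) * T (snd z)))" if "S \<in> sine_span" "T \<in> sine_span" for S T
    using int[OF that[THEN sine_span_continuous]] that[THEN sine_span_bounded] by blast
  have zero': "?I (\<lambda>z. h z * tmode 0 0 l z) = 0" for l
  proof -
    have "tmode 0 0 l z = sgn (real_of_int (fst l)) * sgn (real_of_int (snd l)) * tmode 0 0 (\<bar>fst l\<bar>, \<bar>snd l\<bar>) z" for z
      by (auto simp: tmode_def wave_def sgn_if abs_if)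
    then have "h z * tmode 0 0 l z = (sgn (real_of_int (fst l)) * sgn (real_of_int (snd l))) * (h z * tmode 0 0 (\<bar>fst l\<bar>, \<bar>snd l\<bar>) z)" for z
      by (simp only: mult_ac)
    then have "?I (\<lambda>z. h z * tmode 0 0 l z)
        = (sgn (real_of_int (fst l)) * sgn (real_of_int (snd l))) * ?I (\<lambda>z. h z * tmode 0 0 (\<bar>fst l\<bar>, \<bar>snd l\<bar>) z)"
      by (simp only: integral_mult_right_zero)
    moreover have "(\<bar>fst l\<bar>, \<bar>snd l\<bar>) \<in> pos_modes \<or> fst l = 0 \<or> snd l = 0" by (auto simp: pos_modes_def)
    ultimately show ?thesis using zero by auto
  qed
  have zS: "?I (\<lambda>z. h z * (S (fst z) * T (snd z))) = 0" if "S \<in> sine_span" "T \<in> sine_span" for S T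
    using that(1)
  proof (induction rule: sine_span.induct)
    case (wave n)
    show ?case using that(2)
    proof (induction rule: sine_span.induct)
      case (wave m)
      show ?case using zero'[of "(n, m)"] by (simp add: tmode_def)
    next
      case (add S T)
      then show ?case using intS[OF sine_span.wave[of n]] by (simp add: distrib_left)
    next
      case (cmult S c)
      have "?I (\<lambda>z. h z * (wave 0 n (fst z) * (c * S (snd z)))) = c * ?I (\<lambda>z. h z * (wave 0 n (fst z) * S (snd z)))"
        by (simp add: mult.left_commute)
      then show ?case using cmult.IH by simp
    qed
  next
    case (add S' T')
    then show ?case using intS[OF _ that(2)] by (simp add: distrib_left distrib_right)
  next
    case (cmult S' c)
    have "?I (\<lambda>z. h z * (c * S' (fst z) * T (snd z))) = c * ?I (\<lambda>z. h z * (S' (fst z) * T (snd z)))"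
      by (simp add: mult.assoc mult.left_commute)
    then show ?case using cmult.IH by simp
  qed
  fix a b c d :: real and n
  assume abcd: "0 < a" "b < 2 * pi" "0 < c" "d < 2 * pi"
  let ?B = "\<lambda>z. h z * (bump a b n (fst z) * bump c d n (snd z))"
  show "?I ?B = 0"
  proof (cases "a < b \<and> c < d")
    case False
    then have "bump a b n x = 0 \<or> bump c d n y = 0" for x y
      using bump_outside[of x a b n] bump_outside[of y c d n] by auto
    then have "bump a b n x * bump c d n y = 0" for x y by simp
    then show ?thesis by (simp only: mult_zero_right Bochner_Integration.integral_zero)
  next
    case True
    have b1: "\<bar>bump a b n x\<bar> \<le> 1" for a b x using bump_bounds[of a b n x] by simp
    have iB: "integrable square_measure ?B" by (rule int[OF bump_continuous bump_continuous b1 b1])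
    define V where "V = ?I (\<lambda>z. \<bar>h z\<bar>)"
    have "\<bar>?I ?B\<bar> \<le> V * (3 * \<epsilon>)" if eps: "0 < \<epsilon>" "\<epsilon> < 1" for \<epsilon>
    proof -
      obtain S where S: "S \<in> sine_span" "\<And>x. 0 \<le> x \<Longrightarrow> x \<le> 2 * pi \<Longrightarrow> \<bar>bump a b n x - S x\<bar> \<le> \<epsilon>"
        using bump_approx_sine[of a b \<epsilon> n] True abcd eps by blast
      obtain T where T: "T \<in> sine_span" "\<And>x. 0 \<le> x \<Longrightarrow> x \<le> 2 * pi \<Longrightarrow> \<bar>bump c d n x - T x\<bar> \<le> \<epsilon>"
        using bump_approx_sine[of c d \<epsilon> n] True abcd eps by blast
      have "?I ?B = ?I (\<lambda>z. ?B z - h z * (S (fst z) * T (snd z)))"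
        unfolding Bochner_Integration.integral_diff[OF iB intS[OF S(1) T(1)]] zS[OF S(1) T(1)] by simp
      then have "\<bar>?I ?B\<bar> \<le> ?I (\<lambda>z. \<bar>?B z - h z * (S (fst z) * T (snd z))\<bar>)"
        by (simp only: integral_abs_bound)
      also have "\<dots> \<le> ?I (\<lambda>z. \<bar>h z\<bar> * (3 * \<epsilon>))"
      proof (rule integral_mono)
        show "integrable square_measure (\<lambda>z. \<bar>?B z - h z * (S (fst z) * T (snd z))\<bar>)"
          by (intro integrable_abs Bochner_Integration.integrable_diff iB intS S(1) T(1))
        show "integrable square_measure (\<lambda>z. \<bar>h z\<bar> * (3 * \<epsilon>))" using h by auto
        fix z assume "z \<in> space square_measure"
        then have z: "0 \<le> fst z" "fst z \<le> 2 * pi" "0 \<le> snd z" "snd z \<le> 2 * pi" by (auto simp: Omega_def)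
        define p q where "p = bump a b n (fst z)" and "q = bump c d n (snd z)"
        have pS: "\<bar>p - S (fst z)\<bar> \<le> \<epsilon>" and qT: "\<bar>q - T (snd z)\<bar> \<le> \<epsilon>"
          using S(2) T(2) z by (auto simp: p_def q_def)
        have "p * q - S (fst z) * T (snd z) = (p - S (fst z)) * q + S (fst z) * (q - T (snd z))"
          by (simp add: algebra_simps)
        also have "\<bar>\<dots>\<bar> \<le> \<bar>p - S (fst z)\<bar> * \<bar>q\<bar> + \<bar>S (fst z)\<bar> * \<bar>q - T (snd z)\<bar>"
          by (metis abs_mult abs_triangle_ineq)
        \<comment> \<open>A bump is at most 1, so its approximation is at most
          \<open>1 + \<epsilon>\<close>, and \<epsilon> is below 1.\<close>
        also have "\<dots> \<le> \<epsilon> * 1 + 2 * \<epsilon>"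
        proof (intro add_mono mult_mono pS qT)
          show "\<bar>q\<bar> \<le> 1" unfolding q_def by (rule b1)
          have "\<bar>p\<bar> \<le> 1" unfolding p_def by (rule b1)
          then show "\<bar>S (fst z)\<bar> \<le> 2" using pS eps by linarith
        qed (use eps in auto)
        finally have "\<bar>p * q - S (fst z) * T (snd z)\<bar> \<le> 3 * \<epsilon>" by simp
        then have "\<bar>h z\<bar> * \<bar>p * q - S (fst z) * T (snd z)\<bar> \<le> \<bar>h z\<bar> * (3 * \<epsilon>)" by (intro mult_left_mono) auto
        then show "\<bar>?B z - h z * (S (fst z) * T (snd z))\<bar> \<le> \<bar>h z\<bar> * (3 * \<epsilon>)"
          by (simp add: p_def q_def abs_mult[symmetric] right_diff_distrib)
      qed
      also have "\<dots> = V * (3 * \<epsilon>)" by (simp add: V_def)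
      finally show ?thesis .
    qed
    moreover have "((\<lambda>\<epsilon>. V * (3 * \<epsilon>)) \<longlongrightarrow> V * (3 * 0)) (at_right 0)" by (intro tendsto_intros)
    ultimately have "\<bar>?I ?B\<bar> \<le> V * (3 * 0)"
      by (intro tendsto_lowerbound[of "\<lambda>\<epsilon>. V * (3 * \<epsilon>)" _ "at_right 0"])
        (auto simp: eventually_at_right_field intro!: exI[of _ 1])
    then show ?thesis by simp
  qed
qed

section \<open>Coefficients of the Jacobian\<close>

lemma sum_sym_int: "(\<Sum>i\<in>{- int N..int N}. f i) = f 0 + (\<Sum>i\<in>{1..int N}. f i + f (- i))" for f :: "int \<Rightarrow> real"
proof (induction N)
  case (Suc N)
  have "{- int (Suc N)..int (Suc N)} = insert (int (Suc N)) (insert (- int (Suc N)) {- int N..int N})"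
    "{1..int (Suc N)} = insert (int (Suc N)) {1..int N}" by auto
  then show ?case using Suc by simp
qed simp

text \<open>Convolutions run over the whole lattice and series over positive modes; folding by the
  four reflections links the two.\<close>

lemma sum_sym_box:
  fixes T :: "int \<times> int \<Rightarrow> real"
  assumes axis: "\<And>k. fst k = 0 \<or> snd k = 0 \<Longrightarrow> T k = 0"
  shows "(\<Sum>k\<in>{- int N..int N} \<times> {- int N..int N}. T k)
    = (\<Sum>k\<in>mode_box N. T (fst k, snd k) + T (- fst k, snd k) + T (fst k, - snd k) + T (- fst k, - snd k))"
proof -
  have "(\<Sum>k\<in>{- int N..int N} \<times> {- int N..int N}. T k)
      = (\<Sum>i\<in>{- int N..int N}. \<Sum>j\<in>{- int N..int N}. T (i, j))" by (simp add: sum.cartesian_product)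
  also have "\<dots> = (\<Sum>i\<in>{1..int N}. \<Sum>j\<in>{1..int N}. T (i, j) + T (i, - j) + (T (- i, j) + T (- i, - j)))"
    by (simp add: sum_sym_int axis sum.distrib)
  also have "\<dots> = (\<Sum>k\<in>mode_box N. T (fst k, snd k) + T (- fst k, snd k) + T (fst k, - snd k) + T (- fst k, - snd k))"
    unfolding mode_box_def sum.cartesian_product by (intro sum.cong) auto
  finally show ?thesis .
qed

lemma sym_box_exhausts: "filterlim (\<lambda>N. {- int N..int N} \<times> {- int N..int N}) (finite_subsets_at_top UNIV) sequentially"
  unfolding filterlim_finite_subsets_at_top
proof (intro allI impI)
  fix X :: "(int \<times> int) set" assume X: "finite X \<and> X \<subseteq> UNIV"
  define M where "M = (\<Sum>k\<in>X. nat \<bar>fst k\<bar> + nat \<bar>snd k\<bar>)"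
  have "X \<subseteq> {- int N..int N} \<times> {- int N..int N}" if "M \<le> N" for N
  proof
    fix k assume k: "k \<in> X"
    have "nat \<bar>fst k\<bar> + nat \<bar>snd k\<bar> \<le> M"
      unfolding M_def using X k by (intro member_le_sum) auto
    then show "k \<in> {- int N..int N} \<times> {- int N..int N}" using that by (cases k) auto
  qed
  then show "\<forall>\<^sub>F N in sequentially. finite ({- int N..int N} \<times> {- int N..int N})
      \<and> X \<subseteq> {- int N..int N} \<times> {- int N..int N} \<and> {- int N..int N} \<times> {- int N..int N} \<subseteq> UNIV"
    unfolding eventually_sequentially by (intro exI[of _ M]) auto
qed

lemma tmode_products:
  "tmode (Suc 0) 0 p z * tmode 0 0 l z = (1 / 4) *
     (tmode 0 (Suc 0) (fst l + fst p, snd l - snd p) z + tmode 0 (Suc 0) (fst l - fst p, snd l - snd p) z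
      - tmode 0 (Suc 0) (fst l + fst p, snd l + snd p) z - tmode 0 (Suc 0) (fst l - fst p, snd l + snd p) z)"
  "tmode 0 (Suc 0) p z * tmode 0 0 l z = (1 / 4) *
     (tmode (Suc 0) 0 (fst l - fst p, snd l + snd p) z + tmode (Suc 0) 0 (fst l - fst p, snd l - snd p) z
      - tmode (Suc 0) 0 (fst l + fst p, snd l + snd p) z - tmode (Suc 0) 0 (fst l + fst p, snd l - snd p) z)"
proof -
  have cs: "wave (Suc 0) p x * wave 0 l x = (wave 0 (l + p) x + wave 0 (l - p) x) / 2" for p l x
    unfolding wave_0 wave_1
    using sin_times_cos[of "real_of_int l * x / 2" "real_of_int p * x / 2"]
    by (simp add: algebra_simps add_divide_distrib diff_divide_distrib)
  have ss: "wave 0 p x * wave 0 l x = (wave (Suc 0) (l - p) x - wave (Suc 0) (l + p) x) / 2" for p l x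
    unfolding wave_0 wave_1
    using sin_times_sin[of "real_of_int l * x / 2" "real_of_int p * x / 2"]
    by (simp add: algebra_simps add_divide_distrib diff_divide_distrib)
  have "tmode (Suc 0) 0 p z * tmode 0 0 l z = (wave (Suc 0) (fst p) (fst z) * wave 0 (fst l) (fst z))
      * (wave 0 (snd p) (snd z) * wave 0 (snd l) (snd z))" by (simp add: tmode_def)
  then show "tmode (Suc 0) 0 p z * tmode 0 0 l z = (1 / 4) *
     (tmode 0 (Suc 0) (fst l + fst p, snd l - snd p) z + tmode 0 (Suc 0) (fst l - fst p, snd l - snd p) z
      - tmode 0 (Suc 0) (fst l + fst p, snd l + snd p) z - tmode 0 (Suc 0) (fst l - fst p, snd l + snd p) z)"
    unfolding cs ss by (simp add: tmode_def algebra_simps)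
  have "tmode 0 (Suc 0) p z * tmode 0 0 l z = (wave 0 (fst p) (fst z) * wave 0 (fst l) (fst z))
      * (wave (Suc 0) (snd p) (snd z) * wave 0 (snd l) (snd z))" by (simp add: tmode_def)
  then show "tmode 0 (Suc 0) p z * tmode 0 0 l z = (1 / 4) *
     (tmode (Suc 0) 0 (fst l - fst p, snd l + snd p) z + tmode (Suc 0) 0 (fst l - fst p, snd l - snd p) z
      - tmode (Suc 0) 0 (fst l + fst p, snd l + snd p) z - tmode (Suc 0) 0 (fst l + fst p, snd l - snd p) z)"
    unfolding cs ss by (simp add: tmode_def algebra_simps)
qed

lemma mean_limit_mult_uniform:
  assumes g: "integrable square_measure g" and s: "\<And>n. continuous_on UNIV (s n)" and F: "continuous_on UNIV F" "\<And>z. \<bar>F z\<bar> \<le> B"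
    and u: "\<And>n z. \<bar>s n z - F z\<bar> \<le> e n" "e \<longlonglongrightarrow> 0"
  shows "mean_limit (\<lambda>n z. s n z * g z) (\<lambda>z. F z * g z)"
proof -
  let ?I = "integral\<^sup>L square_measure"
  have m: "f \<in> borel_measurable square_measure" if "continuous_on UNIV f" for f :: plane_fun
    using that by (intro borel_measurable_square_measure borel_measurable_continuous_onI)
  have iF: "integrable square_measure (\<lambda>z. F z * g z)"
    using integrable_square_mult_bounded[OF g m[OF F(1)] F(2)] by (simp add: mult.commute)
  have sb: "\<bar>s n z\<bar> \<le> B + e n" for n z using u(1)[of n z] F(2)[of z] by linarith
  have iS: "integrable square_measure (\<lambda>z. s n z * g z)" for n
    using integrable_square_mult_bounded[OF g m[OF s] sb] by (simp add: mult.commute)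
  have "(\<lambda>n. ?I (\<lambda>z. \<bar>s n z * g z - F z * g z\<bar>)) \<longlonglongrightarrow> 0"
  proof (rule Lim_null_comparison)
    show "(\<lambda>n. e n * ?I (\<lambda>z. \<bar>g z\<bar>)) \<longlonglongrightarrow> 0" using tendsto_mult_right[OF u(2)] by auto
    have "?I (\<lambda>z. \<bar>s n z * g z - F z * g z\<bar>) \<le> ?I (\<lambda>z. e n * \<bar>g z\<bar>)" for n
    proof (rule integral_mono)
      show "\<bar>s n z * g z - F z * g z\<bar> \<le> e n * \<bar>g z\<bar>" for z
        using mult_right_mono[OF u(1)[of n z], of "\<bar>g z\<bar>"] by (simp add: abs_mult[symmetric] left_diff_distrib)
    qed (use iS iF g in auto)
    then show "\<forall>\<^sub>F n in sequentially. norm (?I (\<lambda>z. \<bar>s n z * g z - F z * g z\<bar>)) \<le> e n * ?I (\<lambda>z. \<bar>g z\<bar>)"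
      by (auto simp: integral_nonneg_AE)
  qed
  then show ?thesis using iS iF by (simp add: mean_limit_def)
qed

lemma reflecting_0_0: "reflecting 0 0 c \<longleftrightarrow> odd2 c"
proof
  assume c: "odd2 c"
  have "c (0, i) = 0" "c (i, 0) = 0" for i
    using odd2_axis[OF c, of "(0, i)"] odd2_axis[OF c, of "(i, 0)"] by simp_all
  then show "reflecting 0 0 c" using c by (simp add: reflecting_def odd2_def)
qed (auto simp: reflecting_def odd2_def)

text \<open>The gradient of \<phi> is absolutely summable and converges uniformly, that of \<omega>
  only in mean. Partial sums of the former times the full latter therefore converge in mean; their
  coefficients are finite sums by the product formulas, with a lattice sum as limit. The orders 3
  and 1 fit a function in \<open>H4\<close> and its Laplacian.\<close>

lemma Jacobian_series:
  assumes \<phi>: "has_series 0 0 a \<phi>" "odd2 a" "sq_weighted 3 a"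
    and \<omega>: "has_series 0 0 b \<omega>" "odd2 b" "sq_weighted 1 b"
  shows "integrable square_measure (Jacobian \<phi> \<omega>)"
    and "integral\<^sup>L square_measure (\<lambda>z. Jacobian \<phi> \<omega> z * tmode 0 0 l z) = pi\<^sup>2 * conv_coeff a b l"
proof -
  let ?I = "integral\<^sup>L square_measure"
  define a1 where "a1 k = real_of_int (fst k) / 2 * a k" for k
  define a2 where "a2 k = real_of_int (snd k) / 2 * a k" for k
  define b1 where "b1 k = real_of_int (fst k) / 2 * b k" for k
  define b2 where "b2 k = real_of_int (snd k) / 2 * b k" for k
  have w1: "sq_weighted 1 a" by (rule sq_weighted_mono[OF \<phi>(3)]) simp
  have w2: "sq_weighted 2 a1" "sq_weighted 2 a2"
    unfolding a1_def[abs_def] a2_def[abs_def] using \<phi>(3) by (intro sq_weighted_fst sq_weighted_snd; simp add: numeral_3_eq_3 numeral_2_eq_2)+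
  then have as: "(\<lambda>k. \<bar>a1 k\<bar>) summable_on UNIV" "(\<lambda>k. \<bar>a2 k\<bar>) summable_on UNIV"
    using sq_weighted_abs_summable[of 0] by (simp_all add: numeral_2_eq_2)
  have px: "has_series (Suc 0) 0 a1 (partial_x \<phi>)" and py: "has_series 0 (Suc 0) a2 (partial_y \<phi>)"
    unfolding a1_def[abs_def] a2_def[abs_def] by (rule series_partial_x[OF \<phi>(1) w1] series_partial_y[OF \<phi>(1) w1])+
  have qx: "has_series (Suc 0) 0 b1 (partial_x \<omega>)" and qy: "has_series 0 (Suc 0) b2 (partial_y \<omega>)"
    unfolding b1_def[abs_def] b2_def[abs_def] by (rule series_partial_x[OF \<omega>(1,3)] series_partial_y[OF \<omega>(1,3)])+
  have iq: "integrable square_measure (partial_x \<omega>)" "integrable square_measure (partial_y \<omega>)"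
    using qx qy by (auto simp: has_series_def mean_limit_def)
  obtain F1 e1 B1 where F1: "continuous_on UNIV F1" "has_series (Suc 0) 0 a1 F1"
      "\<And>N z. \<bar>tsum (Suc 0) 0 a1 N z - F1 z\<bar> \<le> e1 N" "e1 \<longlonglongrightarrow> 0" "\<And>z. \<bar>F1 z\<bar> \<le> B1"
    by (rule uniform_series[OF as(1), where \<alpha> = "Suc 0" and \<beta> = 0]) (rule that)
  obtain F2 e2 B2 where F2: "continuous_on UNIV F2" "has_series 0 (Suc 0) a2 F2"
      "\<And>N z. \<bar>tsum 0 (Suc 0) a2 N z - F2 z\<bar> \<le> e2 N" "e2 \<longlonglongrightarrow> 0" "\<And>z. \<bar>F2 z\<bar> \<le> B2"
    by (rule uniform_series[OF as(2), where \<alpha> = 0 and \<beta> = "Suc 0"]) (rule that)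
  define s where "s N z = tsum (Suc 0) 0 a1 N z * partial_y \<omega> z + (- 1) * (tsum 0 (Suc 0) a2 N z * partial_x \<omega> z)" for N z
  have "mean_limit s (\<lambda>z. F1 z * partial_y \<omega> z + (- 1) * (F2 z * partial_x \<omega> z))"
    unfolding s_def[abs_def]
    by (intro mean_limit_add mean_limit_cmult mean_limit_mult_uniform[OF iq(2) continuous_tsum F1(1,5,3,4)]
        mean_limit_mult_uniform[OF iq(1) continuous_tsum F2(1,5,3,4)])
  moreover have "AE z in square_measure. Jacobian \<phi> \<omega> z = F1 z * partial_y \<omega> z + (- 1) * (F2 z * partial_x \<omega> z)"
    using mean_limit_unique[OF px[unfolded has_series_def] F1(2)[unfolded has_series_def]]
      mean_limit_unique[OF py[unfolded has_series_def] F2(2)[unfolded has_series_def]]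
    by eventually_elim (simp add: Jacobian_def)
  moreover have "Jacobian \<phi> \<omega> \<in> borel_measurable square_measure"
  proof -
    have "partial_x \<phi> \<in> borel_measurable square_measure" "partial_y \<phi> \<in> borel_measurable square_measure"
      "partial_x \<omega> \<in> borel_measurable square_measure" "partial_y \<omega> \<in> borel_measurable square_measure"
      using px py iq unfolding has_series_def mean_limit_def by (blast intro: borel_measurable_integrable)+
    then show ?thesis unfolding Jacobian_def[abs_def] by (intro borel_measurable_diff borel_measurable_times)
  qed
  ultimately have J: "mean_limit s (Jacobian \<phi> \<omega>)" by (rule mean_limit_AE)
  then show "integrable square_measure (Jacobian \<phi> \<omega>)" by (simp add: mean_limit_def)
  have rb: "reflecting (Suc 0) 0 b1" "reflecting 0 (Suc 0) b2"
    using \<omega>(2) odd2_axis[OF \<omega>(2)] by (auto simp: reflecting_def b1_def b2_def odd2_def)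
  have cx: "?I (\<lambda>z. partial_x \<omega> z * tmode (Suc 0) 0 m z) = pi\<^sup>2 * b1 m" for m by (rule has_series_coeff[OF qx rb(1)])
  have cy: "?I (\<lambda>z. partial_y \<omega> z * tmode 0 (Suc 0) m z) = pi\<^sup>2 * b2 m" for m by (rule has_series_coeff[OF qy rb(2)])
  have ix: "integrable square_measure (\<lambda>z. partial_x \<omega> z * tmode \<alpha> \<beta> m z)"
    and iy: "integrable square_measure (\<lambda>z. partial_y \<omega> z * tmode \<alpha> \<beta> m z)" for \<alpha> \<beta> m
    by (rule integrable_square_mult_bounded[OF iq(1) tmode_measurable tmode_bound]
        integrable_square_mult_bounded[OF iq(2) tmode_measurable tmode_bound])+
  \<comment> \<open>Up to the factor \<pi> squared, the coefficient at l of
    \<open>partial_y \<omega>\<close> times the wave that the x-derivative of mode p produces; Y is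
    the counterpart with the roles of x and y exchanged.\<close>
  define X where "X p = (1 / 4) * (b2 (fst l + fst p, snd l - snd p) + b2 (fst l - fst p, snd l - snd p)
      - b2 (fst l + fst p, snd l + snd p) - b2 (fst l - fst p, snd l + snd p))" for p
  define Y where "Y p = (1 / 4) * (b1 (fst l - fst p, snd l + snd p) + b1 (fst l - fst p, snd l - snd p)
      - b1 (fst l + fst p, snd l + snd p) - b1 (fst l + fst p, snd l - snd p))" for p
  have IX: "?I (\<lambda>z. partial_y \<omega> z * (tmode (Suc 0) 0 p z * tmode 0 0 l z)) = pi\<^sup>2 * X p"
    "integrable square_measure (\<lambda>z. partial_y \<omega> z * (tmode (Suc 0) 0 p z * tmode 0 0 l z))" for p
  proof -
    have eq: "partial_y \<omega> z * (tmode (Suc 0) 0 p z * tmode 0 0 l z) = (1 / 4) *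
     (partial_y \<omega> z * tmode 0 (Suc 0) (fst l + fst p, snd l - snd p) z + partial_y \<omega> z * tmode 0 (Suc 0) (fst l - fst p, snd l - snd p) z
      - partial_y \<omega> z * tmode 0 (Suc 0) (fst l + fst p, snd l + snd p) z - partial_y \<omega> z * tmode 0 (Suc 0) (fst l - fst p, snd l + snd p) z)" for z
      unfolding tmode_products by (simp add: algebra_simps)
    show "?I (\<lambda>z. partial_y \<omega> z * (tmode (Suc 0) 0 p z * tmode 0 0 l z)) = pi\<^sup>2 * X p"
      unfolding eq by (simp add: iy cy X_def algebra_simps)
    show "integrable square_measure (\<lambda>z. partial_y \<omega> z * (tmode (Suc 0) 0 p z * tmode 0 0 l z))"
      unfolding eq by (intro integrable_mult_right Bochner_Integration.integrable_add Bochner_Integration.integrable_diff iy)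
  qed
  have IY: "?I (\<lambda>z. partial_x \<omega> z * (tmode 0 (Suc 0) p z * tmode 0 0 l z)) = pi\<^sup>2 * Y p"
    "integrable square_measure (\<lambda>z. partial_x \<omega> z * (tmode 0 (Suc 0) p z * tmode 0 0 l z))" for p
  proof -
    have eq: "partial_x \<omega> z * (tmode 0 (Suc 0) p z * tmode 0 0 l z) = (1 / 4) *
     (partial_x \<omega> z * tmode (Suc 0) 0 (fst l - fst p, snd l + snd p) z + partial_x \<omega> z * tmode (Suc 0) 0 (fst l - fst p, snd l - snd p) z
      - partial_x \<omega> z * tmode (Suc 0) 0 (fst l + fst p, snd l + snd p) z - partial_x \<omega> z * tmode (Suc 0) 0 (fst l + fst p, snd l - snd p) z)" for z
      unfolding tmode_products by (simp add: algebra_simps)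
    show "?I (\<lambda>z. partial_x \<omega> z * (tmode 0 (Suc 0) p z * tmode 0 0 l z)) = pi\<^sup>2 * Y p"
      unfolding eq by (simp add: ix cx Y_def algebra_simps)
    show "integrable square_measure (\<lambda>z. partial_x \<omega> z * (tmode 0 (Suc 0) p z * tmode 0 0 l z))"
      unfolding eq by (intro integrable_mult_right Bochner_Integration.integrable_add Bochner_Integration.integrable_diff ix)
  qed
  define T where "T p = real_of_int (fst p * snd l - snd p * fst l) / 16 * (a p * b (l - p))" for p
  \<comment> \<open>The four sums and differences of frequencies in X and Y come from the four
    reflections of p in the convolution; oddness of a supplies the signs.\<close>
  have quad: "a1 p * X p - a2 p * Y p = T (fst p, snd p) + T (- fst p, snd p) + T (fst p, - snd p) + T (- fst p, - snd p)" for p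
  proof -
    obtain i j where p: "p = (i, j)" by (cases p)
    obtain m n where l: "l = (m, n)" by (cases l)
    have n: "a (- i, j) = - a (i, j)" "a (i, - j) = - a (i, j)" "a (- i, - j) = a (i, j)" for i j
      using \<phi>(2) by (auto simp: odd2_def)
    show ?thesis
      by (simp add: p l T_def X_def Y_def a1_def a2_def b1_def b2_def n field_simps)
  qed
  have "?I (\<lambda>z. s N z * tmode 0 0 l z) = pi\<^sup>2 * (\<Sum>p\<in>mode_box N. a1 p * X p - a2 p * Y p)" for N
  proof -
    have "s N z * tmode 0 0 l z = (\<Sum>p\<in>mode_box N. a1 p * (partial_y \<omega> z * (tmode (Suc 0) 0 p z * tmode 0 0 l z))
        - a2 p * (partial_x \<omega> z * (tmode 0 (Suc 0) p z * tmode 0 0 l z)))" for z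
      unfolding s_def tsum_def sum_distrib_left sum_distrib_right sum.distrib[symmetric]
      by (intro sum.cong refl) (simp add: algebra_simps)
    then have "?I (\<lambda>z. s N z * tmode 0 0 l z) = (\<Sum>p\<in>mode_box N. a1 p * (pi\<^sup>2 * X p) - a2 p * (pi\<^sup>2 * Y p))"
      using IX IY by (simp add: Bochner_Integration.integral_sum)
    then show ?thesis by (simp add: sum_distrib_left algebra_simps)
  qed
  moreover have "(\<lambda>N. \<Sum>p\<in>mode_box N. a1 p * X p - a2 p * Y p) \<longlonglongrightarrow> conv_coeff a b l"
  proof -
    have T0: "T k = 0" if "fst k = 0 \<or> snd k = 0" for k using odd2_axis[OF \<phi>(2) that] by (simp add: T_def)
    have "(\<lambda>k. (b k)\<^sup>2) summable_on UNIV" using sq_weighted_mono[OF \<omega>(3), of 0] by (simp add: sq_weighted_def)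
    then obtain C where C: "\<And>k. (b k)\<^sup>2 \<le> C"
      using finite_sum_le_infsum[of "\<lambda>k. (b k)\<^sup>2" UNIV "{_}"] by fastforce
    have C': "\<bar>b k\<bar> \<le> sqrt C" for k using C[of k] real_le_rsqrt by (metis power2_abs)
    have "(\<lambda>k. \<bar>jap k * a k\<bar>) summable_on UNIV"
      using sq_weighted_abs_summable[of 1 a] \<phi>(3) by (simp add: numeral_3_eq_3)
    then have "(\<lambda>k. (jap l * sqrt C) * \<bar>jap k * a k\<bar>) summable_on UNIV" by (rule summable_on_cmult_right)
    then have "(\<lambda>k. norm (T k)) summable_on UNIV"
    proof (rule summable_on_comparison_test)
      fix p
      have j: "jap p \<ge> 0" "jap l \<ge> 0" using jap_ge_1[of p] jap_ge_1[of l] by auto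
      have "\<bar>real_of_int (fst p * snd l - snd p * fst l)\<bar> \<le> \<bar>real_of_int (fst p)\<bar> * \<bar>real_of_int (snd l)\<bar> + \<bar>real_of_int (snd p)\<bar> * \<bar>real_of_int (fst l)\<bar>"
        by (simp add: abs_mult[symmetric] abs_triangle_ineq4)
      also have "\<dots> \<le> jap p * jap l + jap p * jap l"
        using fst_le_jap snd_le_jap j by (intro add_mono mult_mono) auto
      finally have c: "\<bar>real_of_int (fst p * snd l - snd p * fst l) / 16\<bar> \<le> jap p * jap l"
      proof -
        have "x / 16 \<le> y" if "x \<le> y + y" "0 \<le> y" for x y :: real using that by simp
        then show "\<bar>real_of_int (fst p * snd l - snd p * fst l)\<bar> \<le> jap p * jap l + jap p * jap l \<Longrightarrow> ?thesis"
          using mult_nonneg_nonneg[OF j] unfolding abs_divide abs_numeral by blast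
      qed
      have "norm (T p) = \<bar>real_of_int (fst p * snd l - snd p * fst l) / 16\<bar> * (\<bar>a p\<bar> * \<bar>b (l - p)\<bar>)"
        by (simp add: T_def abs_mult)
      also have "\<dots> \<le> (jap p * jap l) * (\<bar>a p\<bar> * sqrt C)"
        using c C' j by (intro mult_mono mult_left_mono) auto
      also have "\<dots> = (jap l * sqrt C) * \<bar>jap p * a p\<bar>" using j by (simp add: abs_mult)
      finally show "norm (T p) \<le> (jap l * sqrt C) * \<bar>jap p * a p\<bar>" .
    qed simp
    then have "(T has_sum conv_coeff a b l) UNIV"
      unfolding conv_coeff_def T_def[symmetric] by (rule has_sum_infsum[OF abs_summable_summable])
    then have "(\<lambda>N. sum T ({- int N..int N} \<times> {- int N..int N})) \<longlonglongrightarrow> conv_coeff a b l"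
      unfolding has_sum_def by (rule filterlim_compose[OF _ sym_box_exhausts])
    then show ?thesis by (simp only: quad sum_sym_box[OF T0])
  qed
  ultimately have "(\<lambda>N. ?I (\<lambda>z. s N z * tmode 0 0 l z)) \<longlonglongrightarrow> pi\<^sup>2 * conv_coeff a b l"
    by (simp add: tendsto_mult_left)
  moreover have "(\<lambda>N. ?I (\<lambda>z. s N z * tmode 0 0 l z)) \<longlonglongrightarrow> ?I (\<lambda>z. Jacobian \<phi> \<omega> z * tmode 0 0 l z)"
    by (rule mean_limit_integral[OF J tmode_measurable tmode_bound])
  ultimately show "?I (\<lambda>z. Jacobian \<phi> \<omega> z * tmode 0 0 l z) = pi\<^sup>2 * conv_coeff a b l"
    by (rule LIMSEQ_unique[rotated])
qed

section \<open>Functions in \<open>H4\<close> and their coefficients\<close>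

text \<open>The sine expansion moved to the integer lattice: c is the odd extension of the
  coefficients, while the pointwise sum still runs over positive modes.\<close>

definition expands :: "(int \<times> int \<Rightarrow> real) \<Rightarrow> plane_fun \<Rightarrow> bool" where
  "expands c \<psi> \<longleftrightarrow> odd2 c \<and> sq_weighted 4 c \<and>
     (\<forall>z. ((\<lambda>k. c k * tmode 0 0 k z) has_sum \<psi> z) pos_modes)"

lemma bij_modes: "bij_betw (map_prod int int) modes pos_modes"
  unfolding modes_def pos_modes_def
  by (rule bij_betwI[of _ _ _ "map_prod nat nat"]) auto

lemma sine_mode_eq: "sine_mode k = tmode 0 0 (map_prod int int k)"
  by (auto simp: sine_mode_def tmode_def wave_def split: prod.splits)

lemma H4_weight_eq: "H4_weight k = 1 + (kap (map_prod int int k))\<^sup>2"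
  by (auto simp: H4_weight_def kap_def split: prod.splits)

lemma H4_weight_jap: "jap k ^ 4 \<le> 1024 * (1 + (kap k)\<^sup>2)" "1 + (kap k)\<^sup>2 \<le> 2 * jap k ^ 4"
proof -
  have j: "1 \<le> jap k ^ 4" by (intro one_le_power jap_ge_1)
  have j4: "jap k ^ 4 = ((jap k)\<^sup>2)\<^sup>2" by simp
  have "(kap k)\<^sup>2 \<le> jap k ^ 4" unfolding j4 by (intro power_mono kap_le_jap kap_nonneg)
  then show "1 + (kap k)\<^sup>2 \<le> 2 * jap k ^ 4" using j by linarith
  show "jap k ^ 4 \<le> 1024 * (1 + (kap k)\<^sup>2)"
  proof (cases "k = 0")
    case False
    have "jap k ^ 4 \<le> (32 * kap k)\<^sup>2" unfolding j4 by (intro power_mono jap_le_kap False) simp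
    then show ?thesis by (simp add: power_mult_distrib)
  qed (simp add: jap_def kap_def)
qed

lemma summable_even_extension:
  fixes g :: "int \<times> int \<Rightarrow> real"
  assumes "g summable_on pos_modes" "\<And>i j. g (- i, j) = g (i, j)" "\<And>i j. g (i, - j) = g (i, j)"
    and "\<And>k. fst k = 0 \<or> snd k = 0 \<Longrightarrow> g k = 0"
  shows "g summable_on UNIV"
proof -
  have im: "g summable_on (f ` pos_modes)" if "inj_on f pos_modes" "\<And>k. g (f k) = g k" for f
    using assms(1) that by (subst summable_on_reindex) (auto simp: o_def)
  let ?U = "(\<lambda>k. k) ` pos_modes \<union> (\<lambda>k. (- fst k, snd k)) ` pos_modes
    \<union> (\<lambda>k. (fst k, - snd k)) ` pos_modes \<union> (\<lambda>k. (- fst k, - snd k)) ` pos_modes"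
  have "g summable_on ?U"
    by (intro summable_on_union im) (auto simp: inj_on_def assms(2,3) prod_eq_iff)
  moreover have "g k = 0" if "k \<notin> ?U" for k
  proof (rule assms(4), rule ccontr)
    assume n: "\<not> (fst k = 0 \<or> snd k = 0)"
    have p: "(\<bar>fst k\<bar>, \<bar>snd k\<bar>) \<in> pos_modes" using n by (auto simp: pos_modes_def)
    have "k \<in> ?U"
      using p by (cases "fst k > 0"; cases "snd k > 0"; cases k)
        (auto simp: image_iff intro!: bexI[OF _ p])
    then show False using that by simp
  qed
  ultimately show ?thesis by (subst summable_on_cong_neutral[of ?U UNIV g g]) auto
qed

definition odd_ext :: "(nat \<times> nat \<Rightarrow> real) \<Rightarrow> int \<times> int \<Rightarrow> real" where
  "odd_ext a k = sgn (real_of_int (fst k)) * sgn (real_of_int (snd k)) * a (nat \<bar>fst k\<bar>, nat \<bar>snd k\<bar>)"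

lemma odd2_odd_ext: "odd2 (odd_ext a)"
  by (simp add: odd2_def odd_ext_def sgn_minus)

lemma odd_ext_modes: "k \<in> modes \<Longrightarrow> odd_ext a (map_prod int int k) = a k"
  by (cases k) (auto simp: odd_ext_def modes_def)

lemma expands_if_sine_expansion:
  assumes "sine_expansion \<psi> a" shows "expands (odd_ext a) \<psi>"
  unfolding expands_def
proof (intro conjI allI odd2_odd_ext)
  let ?c = "odd_ext a"
  have s: "(\<lambda>k. (H4_weight k)\<^sup>2 * \<bar>a k\<bar>\<^sup>2) summable_on modes"
    and hs: "\<And>z. ((\<lambda>k. a k * sine_mode k z) has_sum \<psi> z) modes"
    using assms by (auto simp: sine_expansion_def)
  have "(\<lambda>k. (\<lambda>k. (1 + (kap k)\<^sup>2)\<^sup>2 * (?c k)\<^sup>2) (map_prod int int k)) summable_on modes"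
    using s by (subst summable_on_cong) (auto simp: H4_weight_eq odd_ext_modes)
  then have "(\<lambda>k. (1 + (kap k)\<^sup>2)\<^sup>2 * (?c k)\<^sup>2) summable_on pos_modes"
    by (subst (asm) summable_on_reindex_bij_betw[OF bij_modes])
  then have "(\<lambda>k. 1024\<^sup>2 * ((1 + (kap k)\<^sup>2)\<^sup>2 * (?c k)\<^sup>2)) summable_on pos_modes"
    by (rule summable_on_cmult_right)
  then have "(\<lambda>k. (jap k ^ 4 * ?c k)\<^sup>2) summable_on pos_modes"
  proof (rule summable_on_comparison_test)
    fix k
    have "(jap k ^ 4)\<^sup>2 \<le> (1024 * (1 + (kap k)\<^sup>2))\<^sup>2"
      by (intro power_mono H4_weight_jap) (use jap_ge_1[of k] in auto)
    then have "(jap k ^ 4)\<^sup>2 * (?c k)\<^sup>2 \<le> (1024 * (1 + (kap k)\<^sup>2))\<^sup>2 * (?c k)\<^sup>2"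
      by (intro mult_right_mono) auto
    then show "(jap k ^ 4 * ?c k)\<^sup>2 \<le> 1024\<^sup>2 * ((1 + (kap k)\<^sup>2)\<^sup>2 * (?c k)\<^sup>2)"
      by (simp only: power_mult_distrib mult.assoc)
  qed simp
  then show "sq_weighted 4 ?c" unfolding sq_weighted_def
  proof (rule summable_even_extension)
    show "(jap (- i, j) ^ 4 * ?c (- i, j))\<^sup>2 = (jap (i, j) ^ 4 * ?c (i, j))\<^sup>2"
      "(jap (i, - j) ^ 4 * ?c (i, - j))\<^sup>2 = (jap (i, j) ^ 4 * ?c (i, j))\<^sup>2" for i j
      using odd2_odd_ext[of a] by (simp_all add: odd2_def jap_def)
    show "(jap k ^ 4 * ?c k)\<^sup>2 = 0" if "fst k = 0 \<or> snd k = 0" for k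
      using odd2_axis[OF odd2_odd_ext that] by simp
  qed
  fix z
  have "((\<lambda>k. (\<lambda>k. ?c k * tmode 0 0 k z) (map_prod int int k)) has_sum \<psi> z) modes"
    using hs[of z] by (subst has_sum_cong) (auto simp: sine_mode_eq odd_ext_modes)
  then show "((\<lambda>k. ?c k * tmode 0 0 k z) has_sum \<psi> z) pos_modes"
    by (subst (asm) has_sum_reindex_bij_betw[OF bij_modes])
qed

lemma sine_expansion_if_expands:
  assumes "expands c \<psi>" shows "sine_expansion \<psi> (\<lambda>k. c (map_prod int int k))"
  unfolding sine_expansion_def
proof
  have c: "sq_weighted 4 c" and hs: "\<And>z. ((\<lambda>k. c k * tmode 0 0 k z) has_sum \<psi> z) pos_modes"
    using assms by (auto simp: expands_def)
  have "(\<lambda>k. 2\<^sup>2 * (jap k ^ 4 * c k)\<^sup>2) summable_on pos_modes"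
    using c unfolding sq_weighted_def by (intro summable_on_cmult_right) (rule summable_on_subset, auto)
  then have "(\<lambda>k. (1 + (kap k)\<^sup>2)\<^sup>2 * \<bar>c k\<bar>\<^sup>2) summable_on pos_modes"
  proof (rule summable_on_comparison_test)
    fix k
    have "(1 + (kap k)\<^sup>2)\<^sup>2 \<le> (2 * jap k ^ 4)\<^sup>2" by (intro power_mono H4_weight_jap) auto
    then have "(1 + (kap k)\<^sup>2)\<^sup>2 * (c k)\<^sup>2 \<le> (2 * jap k ^ 4)\<^sup>2 * (c k)\<^sup>2" by (intro mult_right_mono) auto
    then show "(1 + (kap k)\<^sup>2)\<^sup>2 * \<bar>c k\<bar>\<^sup>2 \<le> 2\<^sup>2 * (jap k ^ 4 * c k)\<^sup>2"
      by (simp only: power_mult_distrib mult.assoc power2_abs)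
  qed simp
  then show "(\<lambda>k. (H4_weight k)\<^sup>2 * \<bar>c (map_prod int int k)\<bar>\<^sup>2) summable_on modes"
    by (subst (asm) summable_on_reindex_bij_betw[OF bij_modes, symmetric]) (simp add: H4_weight_eq)
  show "\<forall>z. ((\<lambda>k. c (map_prod int int k) * sine_mode k z) has_sum \<psi> z) modes"
  proof
    fix z show "((\<lambda>k. c (map_prod int int k) * sine_mode k z) has_sum \<psi> z) modes"
      using hs[of z] by (subst (asm) has_sum_reindex_bij_betw[OF bij_modes, symmetric]) (simp add: sine_mode_eq)
  qed
qed

lemma H4_iff_expands: "\<psi> \<in> H4 \<longleftrightarrow> (\<exists>c. expands c \<psi>)"
  unfolding H4_def using expands_if_sine_expansion sine_expansion_if_expands by blast

lemma sq_weighted_2_abs_summable: "sq_weighted 2 c \<Longrightarrow> (\<lambda>k. \<bar>c k\<bar>) summable_on UNIV"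
  using sq_weighted_abs_summable[of 0 c] by (simp add: numeral_2_eq_2)

lemma expands_uniform:
  assumes "expands c \<psi>"
  shows "has_series 0 0 c \<psi>" "continuous_on UNIV \<psi>" "\<exists>B. \<forall>z. \<bar>\<psi> z\<bar> \<le> B"
proof -
  have c: "sq_weighted 4 c" and hs: "\<And>z. ((\<lambda>k. c k * tmode 0 0 k z) has_sum \<psi> z) pos_modes"
    using assms by (auto simp: expands_def)
  have s: "(\<lambda>k. \<bar>c k\<bar>) summable_on UNIV"
    by (intro sq_weighted_2_abs_summable sq_weighted_mono[OF c]) simp
  obtain F e B where F: "continuous_on UNIV F" "\<And>z. ((\<lambda>k. c k * tmode 0 0 k z) has_sum F z) pos_modes"
    "has_series 0 0 c F" "\<And>z. \<bar>F z\<bar> \<le> B"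
    by (rule uniform_series[OF s, where \<alpha> = 0 and \<beta> = 0]) (rule that)
  have "\<psi> = F" by (rule ext) (rule has_sum_unique[OF hs F(2)])
  then show "has_series 0 0 c \<psi>" "continuous_on UNIV \<psi>" "\<exists>B. \<forall>z. \<bar>\<psi> z\<bar> \<le> B" using F by auto
qed

lemma expands_coeff:
  assumes "expands c \<psi>" shows "integral\<^sup>L square_measure (\<lambda>z. \<psi> z * tmode 0 0 l z) = pi\<^sup>2 * c l"
  using assms by (intro has_series_coeff expands_uniform) (auto simp: reflecting_0_0 expands_def)

lemma expands_unique: "expands c \<psi> \<Longrightarrow> expands d \<psi> \<Longrightarrow> c = d"
  by (rule ext) (use expands_coeff[of c \<psi>] expands_coeff[of d \<psi>] in simp)

lemma expands_exists:
  assumes "odd2 c" "sq_weighted 4 c" shows "\<exists>\<psi>. expands c \<psi>"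
proof -
  have s: "(\<lambda>k. \<bar>c k\<bar>) summable_on UNIV"
    by (intro sq_weighted_2_abs_summable sq_weighted_mono[OF assms(2)]) simp
  show ?thesis
    by (rule uniform_series[OF s, where \<alpha> = 0 and \<beta> = 0]) (use assms in \<open>auto simp: expands_def\<close>)
qed

lemma sq_weighted_add: "sq_weighted n c \<Longrightarrow> sq_weighted n d \<Longrightarrow> sq_weighted n (\<lambda>k. c k + d k)"
  unfolding sq_weighted_def distrib_left by (rule summable_on_square_add)

lemma sq_weighted_cmult: "sq_weighted n c \<Longrightarrow> sq_weighted n (\<lambda>k. a * c k)"
  by (rule sq_weighted_dominated[of 0 n c _ "\<bar>a\<bar>"]) (auto simp: abs_mult)

lemma expands_add: "expands c \<psi> \<Longrightarrow> expands d \<phi> \<Longrightarrow> expands (\<lambda>k. c k + d k) (\<lambda>z. \<psi> z + \<phi> z)"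
  unfolding expands_def by (auto simp: odd2_def distrib_right intro!: sq_weighted_add has_sum_add)

lemma expands_cmult: "expands c \<psi> \<Longrightarrow> expands (\<lambda>k. a * c k) (\<lambda>z. a * \<psi> z)"
  unfolding expands_def by (auto simp: odd2_def mult.assoc intro!: sq_weighted_cmult has_sum_cmult_right)

lemma expands_zero: "expands c (\<lambda>_. 0) \<longleftrightarrow> c = (\<lambda>_. 0)"
proof
  have "expands (\<lambda>_. 0) (\<lambda>_. 0)" by (auto simp: expands_def odd2_def sq_weighted_def)
  then show "expands c (\<lambda>_. 0) \<Longrightarrow> c = (\<lambda>_. 0)" "c = (\<lambda>_. 0) \<Longrightarrow> expands c (\<lambda>_. 0)"
    using expands_unique by blast+
qed

text \<open>Uniqueness of coefficients fixes the choice behind \<open>sine_coeff\<close> on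
  \<open>modes\<close>.\<close>

lemma sine_coeff_expands:
  assumes "expands c \<psi>" "k \<in> modes" shows "sine_coeff \<psi> k = c (map_prod int int k)"
proof -
  have "sine_expansion \<psi> (sine_coeff \<psi>)"
    unfolding sine_coeff_def by (rule someI[where P = "sine_expansion \<psi>", OF sine_expansion_if_expands[OF assms(1)]])
  then have "odd_ext (sine_coeff \<psi>) = c"
    using expands_unique[OF expands_if_sine_expansion assms(1)] by blast
  then show ?thesis using odd_ext_modes[OF assms(2), of "sine_coeff \<psi>"] by simp
qed

lemma sine_coeff_support:
  assumes c: "expands c \<psi>" and P: "\<And>k. P (\<bar>fst k\<bar>, \<bar>snd k\<bar>) \<longleftrightarrow> P k"
  shows "(\<forall>k\<in>modes. sine_coeff \<psi> k \<noteq> 0 \<longrightarrow> P (map_prod int int k)) \<longleftrightarrow> (\<forall>k. c k \<noteq> 0 \<longrightarrow> P k)"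
proof
  assume L: "\<forall>k\<in>modes. sine_coeff \<psi> k \<noteq> 0 \<longrightarrow> P (map_prod int int k)"
  show "\<forall>k. c k \<noteq> 0 \<longrightarrow> P k"
  proof (intro allI impI)
    fix k assume ck: "c k \<noteq> 0"
    have odd: "odd2 c" using c by (simp add: expands_def)
    let ?k = "(nat \<bar>fst k\<bar>, nat \<bar>snd k\<bar>)"
    have "fst k \<noteq> 0" "snd k \<noteq> 0" using odd2_axis[OF odd, of k] ck by auto
    then have m: "?k \<in> modes" and e: "map_prod int int ?k = (\<bar>fst k\<bar>, \<bar>snd k\<bar>)"
      by (auto simp: modes_def)
    have "c (\<bar>fst k\<bar>, \<bar>snd k\<bar>) \<noteq> 0" using odd2_orbit[OF odd, of k] ck by auto
    then show "P k" using L m sine_coeff_expands[OF c m] P[of k] e by auto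
  qed
next
  assume "\<forall>k. c k \<noteq> 0 \<longrightarrow> P k"
  then show "\<forall>k\<in>modes. sine_coeff \<psi> k \<noteq> 0 \<longrightarrow> P (map_prod int int k)"
    using sine_coeff_expands[OF c] by auto
qed

lemma E_iff:
  assumes c: "expands c \<psi>"
  shows "\<psi> \<in> E1 \<longleftrightarrow> (\<forall>k. c k \<noteq> 0 \<longrightarrow> odd (fst k) \<and> odd (snd k))"
    "\<psi> \<in> E2 \<longleftrightarrow> (\<forall>k. c k \<noteq> 0 \<longrightarrow> odd (fst k) \<and> even (snd k))"
    "\<psi> \<in> E3 \<longleftrightarrow> (\<forall>k. c k \<noteq> 0 \<longrightarrow> even (fst k) \<and> odd (snd k))"
proof -
  have H: "\<psi> \<in> H4" using c H4_iff_expands by blast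
  show "\<psi> \<in> E1 \<longleftrightarrow> (\<forall>k. c k \<noteq> 0 \<longrightarrow> odd (fst k) \<and> odd (snd k))"
    using sine_coeff_support[OF c, of "\<lambda>k. odd (fst k) \<and> odd (snd k)"] H by (auto simp: E1_def)
  show "\<psi> \<in> E2 \<longleftrightarrow> (\<forall>k. c k \<noteq> 0 \<longrightarrow> odd (fst k) \<and> even (snd k))"
    using sine_coeff_support[OF c, of "\<lambda>k. odd (fst k) \<and> even (snd k)"] H by (auto simp: E2_def)
  show "\<psi> \<in> E3 \<longleftrightarrow> (\<forall>k. c k \<noteq> 0 \<longrightarrow> even (fst k) \<and> odd (snd k))"
    using sine_coeff_support[OF c, of "\<lambda>k. even (fst k) \<and> odd (snd k)"] H by (auto simp: E3_def)
qed

text \<open>Brings a bound on the unknown in l2 back to a bound in \<open>H4\<close>; it is applied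
  with a multiplier that gains four orders between the two.\<close>

lemma H4_norm_le:
  assumes c: "expands c \<psi>" and "0 \<le> K" and u: "\<And>k. (1 + (kap k)\<^sup>2) * \<bar>c k\<bar> \<le> K * \<bar>coord u k\<bar>"
  shows "H4_norm \<psi> \<le> K * norm u"
proof -
  have s: "(\<lambda>k. (coord u k)\<^sup>2) summable_on pos_modes"
    by (rule summable_on_subset[OF summable_coord_square]) simp
  have le: "((1 + (kap k)\<^sup>2)\<^sup>2 * \<bar>c k\<bar>\<^sup>2) \<le> K\<^sup>2 * (coord u k)\<^sup>2" for k
    using power_mono[OF u[of k], of 2] by (simp add: power_mult_distrib)
  have "(\<Sum>\<^sub>\<infinity>k\<in>modes. (H4_weight k)\<^sup>2 * \<bar>sine_coeff \<psi> k\<bar>\<^sup>2)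
      = (\<Sum>\<^sub>\<infinity>k\<in>modes. (\<lambda>k. (1 + (kap k)\<^sup>2)\<^sup>2 * \<bar>c k\<bar>\<^sup>2) (map_prod int int k))"
    by (intro infsum_cong) (simp add: sine_coeff_expands[OF c] H4_weight_eq)
  also have "\<dots> = (\<Sum>\<^sub>\<infinity>k\<in>pos_modes. (1 + (kap k)\<^sup>2)\<^sup>2 * \<bar>c k\<bar>\<^sup>2)"
    by (rule infsum_reindex_bij_betw[OF bij_modes])
  also have "\<dots> \<le> (\<Sum>\<^sub>\<infinity>k\<in>pos_modes. K\<^sup>2 * (coord u k)\<^sup>2)"
    by (intro infsum_mono le summable_on_cmult_right s
        summable_on_comparison_test[OF summable_on_cmult_right[OF s, of "K\<^sup>2"] le]) auto
  also have "\<dots> \<le> (\<Sum>\<^sub>\<infinity>k. K\<^sup>2 * (coord u k)\<^sup>2)"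
    by (intro infsum_mono2 summable_on_cmult_right s summable_coord_square) auto
  also have "\<dots> = (K * norm u)\<^sup>2" by (simp add: infsum_cmult_right' norm_l2_square power_mult_distrib)
  finally show ?thesis unfolding H4_norm_def using \<open>0 \<le> K\<close> by (intro real_le_lsqrt) auto
qed

lemma expands_decays:
  assumes d: "decays 4 d" and e: "even2 d" and u: "odd2 (coord u)"
  shows "odd2 (\<lambda>k. d k * coord u k)" "sq_weighted 4 (\<lambda>k. d k * coord u k)"
proof -
  show "odd2 (\<lambda>k. d k * coord u k)" by (rule odd2_mult[OF e u])
  have "decays 0 (\<lambda>k. jap k ^ 4 * d k)"
    by (rule decays_reduce[of 4 0 d _ 1]) (use d jap_ge_1 order_trans[OF zero_le_one jap_ge_1] in auto)
  then obtain C where C: "\<And>k. \<bar>jap k ^ 4 * d k\<bar> \<le> C"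
    by (rule decays_0_bound) (rule that)
  have "(\<lambda>k. C\<^sup>2 * (coord u k)\<^sup>2) summable_on UNIV" by (intro summable_on_cmult_right summable_coord_square)
  then show "sq_weighted 4 (\<lambda>k. d k * coord u k)" unfolding sq_weighted_def
  proof (rule summable_on_comparison_test)
    fix k
    have "(jap k ^ 4 * (d k * coord u k))\<^sup>2 = \<bar>jap k ^ 4 * d k\<bar>\<^sup>2 * (coord u k)\<^sup>2"
      by (simp add: power_mult_distrib)
    also have "\<dots> \<le> C\<^sup>2 * (coord u k)\<^sup>2" by (intro mult_right_mono power_mono C) auto
    finally show "(jap k ^ 4 * (d k * coord u k))\<^sup>2 \<le> C\<^sup>2 * (coord u k)\<^sup>2" .
  qed auto
qed

text \<open>The inner product is normalised so that the sine modes are orthonormal. Each positive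
  mode has four lattice images with the same product of coefficients, whence the quarter.\<close>

lemma L2_inner_expands:
  assumes c: "expands c \<psi>" and d: "expands d \<phi>"
  shows "L2_inner \<psi> \<phi> = (\<Sum>\<^sub>\<infinity>k. c k * d k) / 4"
proof -
  let ?I = "integral\<^sup>L square_measure"
  obtain B where B: "\<And>z. \<bar>\<phi> z\<bar> \<le> B" using expands_uniform(3)[OF d] by blast
  have m: "\<phi> \<in> borel_measurable square_measure"
    by (intro borel_measurable_square_measure borel_measurable_continuous_onI expands_uniform(2)[OF d])
  have i: "integrable square_measure (\<lambda>z. tmode 0 0 k z * \<phi> z)" for k
    by (rule integrable_square_mult_bounded[OF integrable_square_bounded[OF tmode_measurable tmode_bound] m B])
  have I: "?I (\<lambda>z. tsum 0 0 c N z * \<phi> z) = pi\<^sup>2 * (\<Sum>k\<in>mode_box N. c k * d k)" for N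
  proof -
    have "?I (\<lambda>z. tsum 0 0 c N z * \<phi> z) = (\<Sum>k\<in>mode_box N. c k * ?I (\<lambda>z. tmode 0 0 k z * \<phi> z))"
      unfolding tsum_def sum_distrib_right mult.assoc using i by (subst Bochner_Integration.integral_sum) auto
    also have "\<dots> = (\<Sum>k\<in>mode_box N. c k * (pi\<^sup>2 * d k))"
      using expands_coeff[OF d] by (simp add: mult.commute)
    finally show ?thesis by (simp add: sum_distrib_left mult.left_commute)
  qed
  have lim1: "(\<lambda>N. ?I (\<lambda>z. tsum 0 0 c N z * \<phi> z)) \<longlonglongrightarrow> ?I (\<lambda>z. \<psi> z * \<phi> z)"
    using expands_uniform(1)[OF c] unfolding has_series_def by (rule mean_limit_integral[OF _ m B])
  have lim2: "(\<lambda>N. \<Sum>k\<in>mode_box N. c k * d k) \<longlonglongrightarrow> (\<Sum>\<^sub>\<infinity>k. c k * d k) / 4"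
  proof -
    have odd: "odd2 c" "odd2 d" using c d by (auto simp: expands_def)
    have "(\<lambda>k. c k * d k) summable_on UNIV"
      using sq_weighted_mono[of 4 c 0] sq_weighted_mono[of 4 d 0] c d
      by (intro summable_on_mult_squares) (auto simp: expands_def sq_weighted_def)
    then have "(\<lambda>N. \<Sum>k\<in>{- int N..int N} \<times> {- int N..int N}. c k * d k) \<longlonglongrightarrow> (\<Sum>\<^sub>\<infinity>k. c k * d k)"
      using filterlim_compose[OF _ sym_box_exhausts] has_sum_infsum unfolding has_sum_def by blast
    moreover have "(\<Sum>k\<in>{- int N..int N} \<times> {- int N..int N}. c k * d k) = 4 * (\<Sum>k\<in>mode_box N. c k * d k)" for N
    proof -
      have "(\<Sum>k\<in>{- int N..int N} \<times> {- int N..int N}. c k * d k)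
        = (\<Sum>k\<in>mode_box N. c (fst k, snd k) * d (fst k, snd k) + c (- fst k, snd k) * d (- fst k, snd k)
          + c (fst k, - snd k) * d (fst k, - snd k) + c (- fst k, - snd k) * d (- fst k, - snd k))"
        by (rule sum_sym_box) (simp add: odd2_axis[OF odd(1)])
      also have "\<dots> = (\<Sum>k\<in>mode_box N. 4 * (c k * d k))"
        using odd by (intro sum.cong refl) (simp add: odd2_def)
      finally show ?thesis by (simp add: sum_distrib_left)
    qed
    ultimately have "(\<lambda>N. 4 * (\<Sum>k\<in>mode_box N. c k * d k)) \<longlonglongrightarrow> (\<Sum>\<^sub>\<infinity>k. c k * d k)" by simp
    then have "(\<lambda>N. 4 * (\<Sum>k\<in>mode_box N. c k * d k) / 4) \<longlonglongrightarrow> (\<Sum>\<^sub>\<infinity>k. c k * d k) / 4"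
      by (intro tendsto_divide tendsto_const) auto
    then show ?thesis by simp
  qed
  have "?I (\<lambda>z. \<psi> z * \<phi> z) = pi\<^sup>2 * ((\<Sum>\<^sub>\<infinity>k. c k * d k) / 4)"
    by (rule LIMSEQ_unique[OF lim1[unfolded I] tendsto_mult_left[OF lim2]])
  then show ?thesis unfolding L2_inner_def integral_square_measure by simp
qed

section \<open>The equations in terms of coefficients\<close>

text \<open>Completeness of the sines gives one direction, integration against a mode the
  other.\<close>

lemma AE_zero_iff_coefficients:
  assumes h: "integrable square_measure h"
    and g: "\<And>l. integral\<^sup>L square_measure (\<lambda>z. h z * tmode 0 0 l z) = pi\<^sup>2 * g l"
  shows "(AE z in lborel. z \<in> Omega \<longrightarrow> h z = 0) \<longleftrightarrow> (\<forall>l. g l = 0)"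
proof
  assume "AE z in lborel. z \<in> Omega \<longrightarrow> h z = 0"
  then have ae: "AE z in square_measure. h z = 0" by (simp add: AE_square_measure)
  show "\<forall>l. g l = 0"
  proof
    fix l
    have "integral\<^sup>L square_measure (\<lambda>z. h z * tmode 0 0 l z) = 0"
      by (rule integral_eq_zero_AE) (use ae in eventually_elim, simp)
    then show "g l = 0" using g[of l] by simp
  qed
next
  assume Z: "\<forall>l. g l = 0"
  have "AE z in square_measure. h z = 0"
  proof (rule zero_AE_if_coefficients_zero[OF h])
    fix l
    have "g l = 0" using Z by blast
    then show "integral\<^sup>L square_measure (\<lambda>z. h z * tmode 0 0 l z) = 0" using g[of l] by simp
  qed
  then show "AE z in lborel. z \<in> Omega \<longrightarrow> h z = 0" by (simp add: AE_square_measure)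
qed

lemma has_series_coeff_integrable:
  assumes "has_series 0 0 c f" "odd2 c"
  shows "integrable square_measure f" "integrable square_measure (\<lambda>z. f z * tmode 0 0 l z)"
    "integral\<^sup>L square_measure (\<lambda>z. f z * tmode 0 0 l z) = pi\<^sup>2 * c l"
proof -
  show i: "integrable square_measure f" using assms by (simp add: has_series_def mean_limit_def)
  show "integrable square_measure (\<lambda>z. f z * tmode 0 0 l z)"
    by (rule integrable_square_mult_bounded[OF i tmode_measurable tmode_bound])
  show "integral\<^sup>L square_measure (\<lambda>z. f z * tmode 0 0 l z) = pi\<^sup>2 * c l"
    using assms by (intro has_series_coeff) (simp_all add: reflecting_0_0)
qed

lemma expands_laplacian:
  assumes "expands c \<psi>"
  shows "has_series 0 0 (\<lambda>k. - kap k * c k) (laplacian \<psi>)" "odd2 (\<lambda>k. - kap k * c k)"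
    "sq_weighted 2 (\<lambda>k. - kap k * c k)"
    "has_series 0 0 (\<lambda>k. - kap k * (- kap k * c k)) (laplacian (laplacian \<psi>))"
    "odd2 (\<lambda>k. - kap k * (- kap k * c k))"
proof -
  have c: "odd2 c" "sq_weighted 4 c" using assms by (auto simp: expands_def)
  have e: "even2 (\<lambda>k. - kap k)" using even2_kap by (simp add: even2_def)
  show o: "odd2 (\<lambda>k. - kap k * c k)" by (rule odd2_mult[OF e c(1)])
  show "odd2 (\<lambda>k. - kap k * (- kap k * c k))" by (rule odd2_mult[OF e o])
  show s: "sq_weighted 2 (\<lambda>k. - kap k * c k)"
    by (rule sq_weighted_kap) (use c(2) in \<open>simp add: numeral_2_eq_2 eval_nat_numeral\<close>)
  show l: "has_series 0 0 (\<lambda>k. - kap k * c k) (laplacian \<psi>)"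
    by (intro series_laplacian expands_uniform(1)[OF assms] sq_weighted_mono[OF c(2)]) simp
  show "has_series 0 0 (\<lambda>k. - kap k * (- kap k * c k)) (laplacian (laplacian \<psi>))"
    by (rule series_laplacian[OF l s])
qed

lemma psi0_expands: "expands (odd_delta (2, 2)) psi0"
  unfolding expands_def
proof (intro conjI allI odd2_odd_delta)
  have "{k. odd_delta (2, 2) k \<noteq> 0} \<subseteq> {- 2..2} \<times> {- 2..2}"
    by (auto simp: odd_delta_def abs_if split: if_splits)
  then show "sq_weighted 4 (odd_delta (2, 2))"
    unfolding sq_weighted_def by (intro finite_nonzero_values_imp_summable_on) (auto intro: finite_subset)
  fix z
  have "((\<lambda>k. odd_delta (2, 2) k * tmode 0 0 k z) has_sum psi0 z) {(2, 2)}"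
    by (rule has_sum_finiteI) (cases z; simp add: odd_delta_def tmode_def wave_def psi0_def)+
  then show "((\<lambda>k. odd_delta (2, 2) k * tmode 0 0 k z) has_sum psi0 z) pos_modes"
    by (subst has_sum_cong_neutral[of "{(2, 2)}" pos_modes]) (auto simp: odd_delta_def pos_modes_def)
qed

lemma spectral_equation_iff:
  assumes c: "expands c \<psi>"
  shows "spectral_equation lam \<nu> \<mu> \<psi> \<longleftrightarrow>
    (\<forall>l. ((lam + \<mu>) * kap l + \<nu> * (kap l)\<^sup>2) * c l + vort_coeff (\<lambda>k. (2 - kap k) * c k) l = 0)"
proof -
  let ?I = "integral\<^sup>L square_measure"
  note L = expands_laplacian[OF c]
  have oc: "odd2 c" "sq_weighted 4 c" using c by (auto simp: expands_def)
  define w where "w k = 2 * c k + (- kap k * c k)" for k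
  have w: "has_series 0 0 w (\<lambda>w. 2 * \<psi> w + laplacian \<psi> w)"
    unfolding w_def[abs_def] by (intro has_series_add has_series_cmult expands_uniform(1)[OF c] L(1))
  have ow: "odd2 w" using oc(1) L(2) by (simp add: w_def[abs_def] odd2_def)
  have "sq_weighted 2 w" unfolding w_def[abs_def]
    by (intro sq_weighted_add sq_weighted_cmult L(3) sq_weighted_mono[OF oc(2)]) simp
  then have sw: "sq_weighted 1 w" by (rule sq_weighted_mono) simp
  have p: "sq_weighted 3 (odd_delta (2, 2))"
    using psi0_expands by (auto simp: expands_def intro: sq_weighted_mono)
  note J = Jacobian_series[OF expands_uniform(1)[OF psi0_expands] odd2_odd_delta p w ow sw]
  define J0 where "J0 = Jacobian psi0 (\<lambda>w. 2 * \<psi> w + laplacian \<psi> w)"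
  have iJ: "integrable square_measure (\<lambda>z. J0 z * tmode 0 0 l z)" for l
    unfolding J0_def by (rule integrable_square_mult_bounded[OF J(1) tmode_measurable tmode_bound])
  note l1 = has_series_coeff_integrable[OF L(1,2)] and l2 = has_series_coeff_integrable[OF L(4,5)]
  define h where "h z = (lam + \<mu>) * laplacian \<psi> z - \<nu> * laplacian (laplacian \<psi>) z - J0 z" for z
  have "spectral_equation lam \<nu> \<mu> \<psi> \<longleftrightarrow> (AE z in lborel. z \<in> Omega \<longrightarrow> h z = 0)"
    unfolding spectral_equation_def h_def J0_def
    by (intro arg_cong[where f = "\<lambda>P. AE z in lborel. P z"] ext) (auto simp: algebra_simps)
  \<comment> \<open>The overall minus sign is due to the way h collects the terms: the Laplacian
    acts as \<open>- kap\<close>, and the other two terms are subtracted.\<close>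
  also have "\<dots> \<longleftrightarrow> (\<forall>l. - (((lam + \<mu>) * kap l + \<nu> * (kap l)\<^sup>2) * c l + vort_coeff (\<lambda>k. (2 - kap k) * c k) l) = 0)"
  proof (rule AE_zero_iff_coefficients)
    show "integrable square_measure h"
      unfolding h_def[abs_def] using l1(1) l2(1) J(1) by (simp add: J0_def)
    fix l
    have "?I (\<lambda>z. h z * tmode 0 0 l z) = (lam + \<mu>) * ?I (\<lambda>z. laplacian \<psi> z * tmode 0 0 l z)
        - \<nu> * ?I (\<lambda>z. laplacian (laplacian \<psi>) z * tmode 0 0 l z) - ?I (\<lambda>z. J0 z * tmode 0 0 l z)"
    proof -
      have "h z * tmode 0 0 l z = (lam + \<mu>) * (laplacian \<psi> z * tmode 0 0 l z)
        - \<nu> * (laplacian (laplacian \<psi>) z * tmode 0 0 l z) - J0 z * tmode 0 0 l z" for z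
        by (simp add: h_def algebra_simps)
      then show ?thesis using l1(2)[of l] l2(2)[of l] iJ[of l] by simp
    qed
    also have "\<dots> = (lam + \<mu>) * (pi\<^sup>2 * (- kap l * c l)) - \<nu> * (pi\<^sup>2 * (- kap l * (- kap l * c l)))
        - pi\<^sup>2 * vort_coeff w l"
      unfolding l1(3) l2(3) J0_def J(2) conv_coeff_odd_delta ..
    also have "w = (\<lambda>k. (2 - kap k) * c k)" by (rule ext) (simp add: w_def algebra_simps)
    finally show "?I (\<lambda>z. h z * tmode 0 0 l z) = pi\<^sup>2 *
        - (((lam + \<mu>) * kap l + \<nu> * (kap l)\<^sup>2) * c l + vort_coeff (\<lambda>k. (2 - kap k) * c k) l)"
      by (simp add: algebra_simps power2_eq_square)
  qed
  finally show ?thesis by (simp only: neg_equal_0_iff_equal)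
qed

lemma tmode_boundary: "z \<in> frontier Omega \<Longrightarrow> tmode 0 0 k z = 0"
proof -
  assume z: "z \<in> frontier Omega"
  have "(pi, pi) \<in> box (0, 0) (2 * pi, 2 * pi)" by (simp add: mem_box Basis_prod_def)
  then have "closure Omega = cbox (0, 0) (2 * pi, 2 * pi)"
    unfolding Omega_box by (intro closure_box) blast
  then have "z \<in> cbox (0, 0) (2 * pi, 2 * pi)" "z \<notin> Omega"
    using z open_Omega by (auto simp: frontier_def interior_open)
  then have "fst z = 0 \<or> fst z = 2 * pi \<or> snd z = 0 \<or> snd z = 2 * pi"
    by (cases z) (auto simp: Omega_def cbox_Pair_eq)
  moreover have "wave 0 n 0 = 0" "wave 0 n (2 * pi) = 0" for n
    using sin_npi_int[of n] by (simp_all add: wave_def mult.commute)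
  ultimately show ?thesis by (auto simp: tmode_def)
qed

text \<open>The continuous representative is the uniform sum of the series, each term of which
  vanishes on the boundary.\<close>

lemma vanishes_on_boundary_series:
  assumes f: "has_series 0 0 c f" and c: "sq_weighted 2 c"
  shows "vanishes_on_boundary f"
proof -
  obtain F e B where F: "continuous_on UNIV F" "\<And>z. ((\<lambda>k. c k * tmode 0 0 k z) has_sum F z) pos_modes"
    "has_series 0 0 c F"
    by (rule uniform_series[OF sq_weighted_2_abs_summable[OF c], where \<alpha> = 0 and \<beta> = 0]) (rule that)
  have "AE z in square_measure. F z = f z"
    using mean_limit_unique F(3) f by (auto simp: has_series_def)
  moreover have "F z = 0" if "z \<in> frontier Omega" for z
    using F(2)[of z] tmode_boundary[OF that] has_sum_unique[OF F(2)[of z], of 0] by simp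
  ultimately show ?thesis
    unfolding vanishes_on_boundary_def using continuous_on_subset[OF F(1)]
    by (intro exI[of _ F]) (auto simp: AE_square_measure)
qed

lemma steady_stateI:
  assumes c: "expands c \<psi>"
    and eq: "\<And>l. conv_coeff c (\<lambda>k. - kap k * c k) l + (\<mu> * kap l + \<nu> * (kap l)\<^sup>2) * (c l - odd_delta (2, 2) l) = 0"
  shows "steady_state \<nu> \<mu> \<psi>"
proof -
  let ?I = "integral\<^sup>L square_measure"
  note L = expands_laplacian[OF c]
  have oc: "odd2 c" "sq_weighted 4 c" using c by (auto simp: expands_def)
  define p where "p k = c k + (- 1) * odd_delta (2, 2) k" for k
  have "expands p (\<lambda>z. \<psi> z + (- 1) * psi0 z)"
    unfolding p_def[abs_def] by (intro expands_add expands_cmult c psi0_expands)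
  then have p: "expands p (\<lambda>w. \<psi> w - psi0 w)" by simp
  note M = expands_laplacian[OF p]
  note J = Jacobian_series[OF expands_uniform(1)[OF c] oc(1) sq_weighted_mono[OF oc(2)] L(1,2) sq_weighted_mono[OF L(3)]]
  have iJ: "integrable square_measure (\<lambda>z. Jacobian \<psi> (laplacian \<psi>) z * tmode 0 0 l z)" for l
    by (rule integrable_square_mult_bounded[OF J(1) tmode_measurable tmode_bound]) auto
  note m1 = has_series_coeff_integrable[OF M(1,2)] and m2 = has_series_coeff_integrable[OF M(4,5)]
  define h where "h z = Jacobian \<psi> (laplacian \<psi>) z + (- \<mu> * laplacian (\<lambda>w. \<psi> w - psi0 w) z
           + \<nu> * laplacian (laplacian (\<lambda>w. \<psi> w - psi0 w)) z)" for z
  have "(AE z in lborel. z \<in> Omega \<longrightarrow> h z = 0) \<longleftrightarrow>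
      (\<forall>l. conv_coeff c (\<lambda>k. - kap k * c k) l + (\<mu> * kap l + \<nu> * (kap l)\<^sup>2) * p l = 0)"
  proof (rule AE_zero_iff_coefficients)
    show "integrable square_measure h"
      unfolding h_def[abs_def] using m1(1) m2(1) J(1) by simp
    fix l
    have "?I (\<lambda>z. h z * tmode 0 0 l z) = ?I (\<lambda>z. Jacobian \<psi> (laplacian \<psi>) z * tmode 0 0 l z)
        + (- \<mu> * ?I (\<lambda>z. laplacian (\<lambda>w. \<psi> w - psi0 w) z * tmode 0 0 l z)
        + \<nu> * ?I (\<lambda>z. laplacian (laplacian (\<lambda>w. \<psi> w - psi0 w)) z * tmode 0 0 l z))"
    proof -
      have "h z * tmode 0 0 l z = Jacobian \<psi> (laplacian \<psi>) z * tmode 0 0 l z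
        + (- \<mu> * (laplacian (\<lambda>w. \<psi> w - psi0 w) z * tmode 0 0 l z)
        + \<nu> * (laplacian (laplacian (\<lambda>w. \<psi> w - psi0 w)) z * tmode 0 0 l z))" for z
        by (simp add: h_def algebra_simps)
      then show ?thesis using m1(2)[of l] m2(2)[of l] iJ[of l] by simp
    qed
    also have "\<dots> = pi\<^sup>2 * conv_coeff c (\<lambda>k. - kap k * c k) l
        + (- \<mu> * (pi\<^sup>2 * (- kap l * p l)) + \<nu> * (pi\<^sup>2 * (- kap l * (- kap l * p l))))"
      unfolding m1(3) m2(3) using J(2)[of l] by simp
    finally show "?I (\<lambda>z. h z * tmode 0 0 l z) =
        pi\<^sup>2 * (conv_coeff c (\<lambda>k. - kap k * c k) l + (\<mu> * kap l + \<nu> * (kap l)\<^sup>2) * p l)"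
      by (simp add: algebra_simps power2_eq_square)
  qed
  moreover have "conv_coeff c (\<lambda>k. - kap k * c k) l + (\<mu> * kap l + \<nu> * (kap l)\<^sup>2) * p l = 0" for l
    using eq[of l] by (simp add: p_def)
  ultimately have "AE z in lborel. z \<in> Omega \<longrightarrow> h z = 0" by blast
  moreover have "vanishes_on_boundary \<psi>"
    by (rule vanishes_on_boundary_series[OF expands_uniform(1)[OF c] sq_weighted_mono[OF oc(2)]]) simp
  moreover have "vanishes_on_boundary (laplacian \<psi>)"
    by (rule vanishes_on_boundary_series[OF L(1,3)])
  moreover have "\<psi> \<in> H4" using c H4_iff_expands by blast
  ultimately show ?thesis unfolding steady_state_def h_def by blast
qed

section \<open>Uniqueness of eigenfunctions in each parity class\<close>

text \<open>\<open>lam'\<close> stands for the sum of \<lambda> and \<mu>, the only combination in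
  which the two enter.\<close>

definition coefficient_equation :: "real \<Rightarrow> real \<Rightarrow> (int \<times> int \<Rightarrow> real) \<Rightarrow> bool" where
  "coefficient_equation lam' \<nu> c \<longleftrightarrow>
     (\<forall>l. (lam' * kap l + \<nu> * (kap l)\<^sup>2) * c l + vort_coeff (\<lambda>k. (2 - kap k) * c k) l = 0)"

lemma kap_half: "fst k \<noteq> 0 \<Longrightarrow> snd k \<noteq> 0 \<Longrightarrow> 1 / 2 \<le> kap k"
proof -
  assume "fst k \<noteq> 0" "snd k \<noteq> 0"
  then have "1 \<le> \<bar>fst k\<bar>\<^sup>2" "1 \<le> \<bar>snd k\<bar>\<^sup>2" by (intro one_le_power; linarith)+
  then have "1 \<le> (real_of_int (fst k))\<^sup>2" "1 \<le> (real_of_int (snd k))\<^sup>2"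
    by (metis of_int_1_le_iff of_int_power power2_abs)+
  then show ?thesis by (simp add: kap_def)
qed

text \<open>After \<open>kap\<close> is factored out, the rest is at least
  \<open>lam' + \<nu> / 2\<close>, because \<open>kap\<close> is at least 1/2 off the axes. This is
  the origin of the hypothesis on \<lambda> + \<mu> + \<nu>/2.\<close>

lemma dissipation_pos:
  assumes "0 < \<nu>" "0 < lam' + \<nu> / 2" and "1 / 2 \<le> kap k"
  shows "0 < lam' * kap k + \<nu> * (kap k)\<^sup>2"
proof -
  have "\<nu> / 2 \<le> \<nu> * kap k" using assms(1,3) by simp
  then have "0 < lam' + \<nu> * kap k" using assms(2) by linarith
  then have "0 < kap k * (lam' + \<nu> * kap k)" using assms(3) by simp
  then show ?thesis by (simp add: algebra_simps power2_eq_square)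
qed

text \<open>Testing the equation with \<open>(2 + \<Delta>)\<psi>\<close> removes the skew term; what remains has one sign
  away from the modes with \<open>kap < 2\<close>.\<close>

lemma energy_identity:
  assumes c: "odd2 c" "sq_weighted 4 c" and eq: "coefficient_equation lam' \<nu> c"
    and pos: "0 < \<nu>" "0 < lam' + \<nu> / 2"
    and low: "\<And>k. kap k < 2 \<Longrightarrow> c k = 0" and k: "kap k \<noteq> 2"
  shows "c k = 0"
proof (rule ccontr)
  assume ck: "c k \<noteq> 0"
  \<comment> \<open>The weight \<open>jap^4\<close> takes the place of \<open>diss\<close>: as
    \<open>lam'\<close> may be negative, the dissipation can vanish at modes on the axes.\<close>
  define d where "d = (\<lambda>k. (2 - kap k) * (1 / jap k ^ 4))"
  define u where "u = Abs_l2 (\<lambda>k. jap k ^ 4 * c k)"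
  have u: "coord u = (\<lambda>k. jap k ^ 4 * c k)"
    unfolding u_def by (rule coord_Abs_l2) (use c(2) in \<open>simp add: sq_weighted_def\<close>)
  have "\<bar>2 - kap k\<bar> \<le> 3 * jap k ^ 2" for k
    using kap_le_jap[of k] kap_nonneg[of k] one_le_power[OF jap_ge_1[of k], of 2] by linarith
  then have d2: "decays 2 d" unfolding d_def
    using decays_inverse_jap[of 4] by (intro decays_reduce[of 2 2 _ _ 3]) auto
  have d1: "decays 1 d" and d0: "decays 0 d" by (rule decays_mono[OF d2]; simp)+
  have du: "d k * coord u k = (2 - kap k) * c k" for k
    using jap_ge_1[of k] by (simp add: d_def u)
  define F where "F l = (lam' * kap l + \<nu> * (kap l)\<^sup>2) * (kap l - 2) * (c l)\<^sup>2" for l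
  have F: "coord (vort_op d u) l * coord (mult_op d u) l = F l" for l
  proof -
    have "coord (vort_op d u) l = - (lam' * kap l + \<nu> * (kap l)\<^sup>2) * c l"
      using eq[unfolded coefficient_equation_def, rule_format, of l] unfolding coord_vort_op[OF d1] du by linarith
    moreover have "coord (mult_op d u) l = (2 - kap l) * c l" by (simp add: coord_mult_op[OF d0] du)
    ultimately show ?thesis
      unfolding F_def by (simp only:) (simp add: power2_eq_square algebra_simps)
  qed
  have "inner (vort_op d u) (mult_op d u) = 0" using inner_vort_op_skew[OF d1, of u u] by simp
  then have sum0: "(\<Sum>\<^sub>\<infinity>l. F l) = 0" by (simp add: inner_l2_def F)
  have summ: "F summable_on UNIV"
    using summable_coord_mult[of "vort_op d u" "mult_op d u"] by (simp add: F)
  have axis: "fst l \<noteq> 0 \<and> snd l \<noteq> 0" if "c l \<noteq> 0" for l using odd2_axis[OF c(1), of l] that by blast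
  have dis: "0 < lam' * kap l + \<nu> * (kap l)\<^sup>2" if "c l \<noteq> 0" for l
    using axis[OF that] by (intro dissipation_pos pos kap_half) auto
  have "0 \<le> F l" for l
  proof (cases "c l = 0")
    case False
    then have "2 \<le> kap l" using low[of l] by (cases "kap l < 2") auto
    then show ?thesis unfolding F_def using dis[OF False] by (intro mult_nonneg_nonneg) auto
  qed (simp add: F_def)
  then have "F k = 0" using sum0 summ by (intro nonneg_infsum_le_0D[of F UNIV]) auto
  then show False using dis[OF ck] ck k by (simp add: F_def)
qed

definition parity_part :: "bool \<times> bool \<Rightarrow> (int \<times> int \<Rightarrow> real) \<Rightarrow> int \<times> int \<Rightarrow> real" where
  "parity_part p c k = (if (odd (fst k), odd (snd k)) = p then c k else 0)"

lemma odd2_parity_part: "odd2 c \<Longrightarrow> odd2 (parity_part p c)"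
  by (simp add: odd2_def parity_part_def)

lemma sq_weighted_parity_part: "sq_weighted n c \<Longrightarrow> sq_weighted n (parity_part p c)"
  by (rule sq_weighted_dominated[of 0 n c _ 1]) (auto simp: parity_part_def)

text \<open>All steps have even entries, so \<open>J(psi0, .)\<close> does not mix parities.\<close>

lemma vort_coeff_parity_part: "vort_coeff (parity_part p g) l = parity_part p (vort_coeff g) l"
proof -
  have "parity_part p g (l - h) = (if (odd (fst l), odd (snd l)) = p then g (l - h) else 0)" if "h \<in> diag_steps" for h
    using that by (auto simp: parity_part_def diag_steps_def)
  then show ?thesis unfolding vort_coeff_def by (simp add: parity_part_def[of p "\<lambda>l. \<Sum>h\<in>diag_steps. _ h l"])
qed

lemma coefficient_equation_parity_part:
  assumes "coefficient_equation lam' \<nu> c" shows "coefficient_equation lam' \<nu> (parity_part p c)"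
  unfolding coefficient_equation_def
proof
  fix l
  have "(\<lambda>k. (2 - kap k) * parity_part p c k) = parity_part p (\<lambda>k. (2 - kap k) * c k)"
    by (auto simp: parity_part_def)
  moreover have "(lam' * kap l + \<nu> * (kap l)\<^sup>2) * c l + vort_coeff (\<lambda>k. (2 - kap k) * c k) l = 0"
    using assms unfolding coefficient_equation_def by (rule spec)
  ultimately show "(lam' * kap l + \<nu> * (kap l)\<^sup>2) * parity_part p c l
      + vort_coeff (\<lambda>k. (2 - kap k) * parity_part p c k) l = 0"
    by (simp only: vort_coeff_parity_part) (simp add: parity_part_def)
qed

lemma coefficient_equation_linear:
  assumes "coefficient_equation lam' \<nu> c" "coefficient_equation lam' \<nu> d"
  shows "coefficient_equation lam' \<nu> (\<lambda>k. c k + a * d k)"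
  unfolding coefficient_equation_def
proof
  fix l
  have "vort_coeff (\<lambda>k. (2 - kap k) * (c k + a * d k)) l
      = vort_coeff (\<lambda>k. (2 - kap k) * c k) l + a * vort_coeff (\<lambda>k. (2 - kap k) * d k) l"
    unfolding vort_coeff_linear[symmetric] by (simp add: algebra_simps)
  moreover have "(lam' * kap l + \<nu> * (kap l)\<^sup>2) * c l + vort_coeff (\<lambda>k. (2 - kap k) * c k) l = 0"
    using assms(1) unfolding coefficient_equation_def by (rule spec)
  moreover have "(lam' * kap l + \<nu> * (kap l)\<^sup>2) * d l + vort_coeff (\<lambda>k. (2 - kap k) * d k) l = 0"
    using assms(2) unfolding coefficient_equation_def by (rule spec)
  then have "a * ((lam' * kap l + \<nu> * (kap l)\<^sup>2) * d l + vort_coeff (\<lambda>k. (2 - kap k) * d k) l) = 0"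
    by (simp only: mult_zero_right)
  ultimately show "(lam' * kap l + \<nu> * (kap l)\<^sup>2) * (c l + a * d l)
      + vort_coeff (\<lambda>k. (2 - kap k) * (c k + a * d k)) l = 0"
    by (simp add: algebra_simps)
qed

lemma low_mode_parity:
  assumes "fst k \<noteq> 0" "snd k \<noteq> 0" "kap k < 2"
  shows "(\<bar>fst k\<bar>, \<bar>snd k\<bar>) = (if odd (fst k) then 1 else 2, if odd (snd k) then 1 else 2)"
    "odd (fst k) \<or> odd (snd k)"
proof -
  have c: "(\<bar>fst k\<bar>, \<bar>snd k\<bar>) \<in> {(1,1), (1,2), (2,1), (2,2)}" using assms by (intro low_mode_cases) auto
  have n: "(\<bar>fst k\<bar>, \<bar>snd k\<bar>) \<noteq> (2, 2)"
  proof
    assume "(\<bar>fst k\<bar>, \<bar>snd k\<bar>) = (2, 2)"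
    then have "kap k = kap (2, 2)" using kap_abs[of k] by simp
    then show False using assms(3) by (simp add: kap_def)
  qed
  have "(a, b) = (if odd a then 1 else 2, if odd b then 1 else 2) \<and> (odd a \<or> odd b)"
    if "(a, b) \<in> {(1,1), (1,2), (2,1), (2,2)}" "(a, b) \<noteq> (2, 2)" for a b :: int
    using that by auto
  note 1 = this[OF c n]
  have o: "odd (fst k) \<longleftrightarrow> odd \<bar>fst k\<bar>" "odd (snd k) \<longleftrightarrow> odd \<bar>snd k\<bar>" by simp_all
  show "(\<bar>fst k\<bar>, \<bar>snd k\<bar>) = (if odd (fst k) then 1 else 2, if odd (snd k) then 1 else 2)"
    "odd (fst k) \<or> odd (snd k)"
    unfolding o using 1 by blast+
qed

text \<open>Without its low mode, c is concentrated on \<open>kap = 2\<close> by the energy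
  identity; then \<open>(2 - kap) c\<close> is 0, the skew term disappears, and the dissipation
  alone forces c to vanish. The (even, even) class has no low mode, so nothing is assumed
  there.\<close>

lemma parity_part_zero:
  assumes c: "odd2 c" "sq_weighted 4 c" and eq: "coefficient_equation lam' \<nu> c"
    and pos: "0 < \<nu>" "0 < lam' + \<nu> / 2"
    and supp: "\<And>k. c k \<noteq> 0 \<Longrightarrow> (odd (fst k), odd (snd k)) = p"
    and k0: "p \<noteq> (False, False) \<Longrightarrow> c (if fst p then 1 else 2, if snd p then 1 else 2) = 0"
  shows "c k = 0"
proof -
  have axis: "fst l \<noteq> 0" "snd l \<noteq> 0" if "c l \<noteq> 0" for l using odd2_axis[OF c(1), of l] that by auto
  have low: "c l = 0" if "kap l < 2" for l
  proof (rule ccontr)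
    assume cl: "c l \<noteq> 0"
    note lp = low_mode_parity[OF axis[OF cl] that]
    have p: "p = (odd (fst l), odd (snd l))" using supp[OF cl] by simp
    have "c (\<bar>fst l\<bar>, \<bar>snd l\<bar>) = 0" using k0 lp p by auto
    then show False using odd2_orbit[OF c(1), of l] cl by simp
  qed
  have not2: "c l = 0" if "kap l \<noteq> 2" for l by (rule energy_identity[OF c eq pos low that])
  show ?thesis
  proof (rule ccontr)
    assume ck: "c k \<noteq> 0"
    have "(\<lambda>l. (2 - kap l) * c l) = (\<lambda>_. 0)" using not2 by (intro ext) force
    then have "(lam' * kap k + \<nu> * (kap k)\<^sup>2) * c k + vort_coeff (\<lambda>_. 0) k = 0"
      using eq unfolding coefficient_equation_def by metis
    then have "(lam' * kap k + \<nu> * (kap k)\<^sup>2) * c k = 0" by (simp add: vort_coeff_def)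
    moreover have "0 < lam' * kap k + \<nu> * (kap k)\<^sup>2"
      by (intro dissipation_pos pos kap_half axis ck)
    ultimately show False using ck by simp
  qed
qed

lemma expands_sum_unique:
  assumes "expands c \<psi>" "expands c \<phi>" shows "\<psi> = \<phi>"
proof
  fix z
  show "\<psi> z = \<phi> z" using assms unfolding expands_def by (blast intro: has_sum_unique)
qed

lemma expands_zero_coeff: "expands (\<lambda>_. 0) \<psi> \<Longrightarrow> \<psi> = (\<lambda>_. 0)"
  using expands_sum_unique expands_zero by blast

lemma eigenfunction_iff:
  assumes "expands c \<psi>"
  shows "eigenfunction lam \<nu> \<mu> \<psi> \<longleftrightarrow> c \<noteq> (\<lambda>_. 0) \<and> coefficient_equation (lam + \<mu>) \<nu> c"
proof -
  have "\<psi> \<in> H4" using assms H4_iff_expands by blast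
  moreover have "\<psi> = (\<lambda>_. 0) \<longleftrightarrow> c = (\<lambda>_. 0)"
  proof
    assume "\<psi> = (\<lambda>_. 0)" then show "c = (\<lambda>_. 0)" using assms expands_zero by blast
  next
    assume "c = (\<lambda>_. 0)"
    then show "\<psi> = (\<lambda>_. 0)" using assms expands_zero_coeff by blast
  qed
  ultimately show ?thesis
    unfolding eigenfunction_def coefficient_equation_def spectral_equation_iff[OF assms] by blast
qed

text \<open>Two solutions of one class have a combination without low mode, which is 0; so each of
  the three classes contributes at most one dimension, and the (even, even) part of an eigenfunction
  vanishes.\<close>

lemma eigenfunctions_spanned:
  assumes pos: "0 < \<nu>" "0 < lam + \<mu> + \<nu> / 2"
  shows "\<exists>T. finite T \<and> card T \<le> 3 \<and> {\<psi>. eigenfunction lam \<nu> \<mu> \<psi>} \<subseteq> plane_vs.span T"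
    and "{\<psi>. eigenfunction lam \<nu> \<mu> \<psi>} \<subseteq> plane_vs.span ({\<psi>. eigenfunction lam \<nu> \<mu> \<psi>} \<inter> (E1 \<union> E2 \<union> E3))"
proof -
  let ?eq = "coefficient_equation (lam + \<mu>) \<nu>"
  \<comment> \<open>The zero function is included, so that the parity parts of an eigenfunction
    always belong to these sets.\<close>
  define W where "W p = {\<psi>. \<exists>c. expands c \<psi> \<and> ?eq c \<and> (\<forall>k. c k \<noteq> 0 \<longrightarrow> (odd (fst k), odd (snd k)) = p)}" for p
  have one_dim: "\<exists>e. W p \<subseteq> plane_vs.span {e}" if p: "p \<noteq> (False, False)" for p
  proof -
    let ?k0 = "(if fst p then 1 else 2, if snd p then 1 else 2) :: int \<times> int"
    have nz: "c = (\<lambda>_. 0)" if "expands c \<psi>" "?eq c" "\<And>k. c k \<noteq> 0 \<Longrightarrow> (odd (fst k), odd (snd k)) = p" "c ?k0 = 0" for c \<psi>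
      using parity_part_zero[OF _ _ that(2) pos that(3)] that(1,4) by (auto simp: expands_def)
    show ?thesis
    proof (cases "\<exists>e c. expands c e \<and> ?eq c \<and> (\<forall>k. c k \<noteq> 0 \<longrightarrow> (odd (fst k), odd (snd k)) = p) \<and> c ?k0 \<noteq> 0")
      case True
      then obtain e c where e: "expands c e" "?eq c" "\<And>k. c k \<noteq> 0 \<Longrightarrow> (odd (fst k), odd (snd k)) = p" "c ?k0 \<noteq> 0"
        by blast
      have "\<psi> \<in> plane_vs.span {e}" if \<psi>: "\<psi> \<in> W p" for \<psi>
      proof -
        obtain d where d: "expands d \<psi>" "?eq d" "\<And>k. d k \<noteq> 0 \<Longrightarrow> (odd (fst k), odd (snd k)) = p"
          using \<psi> unfolding W_def by blast
        \<comment> \<open>Chosen to cancel the coefficient of the low mode.\<close>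
        define t where "t = d ?k0 / c ?k0"
        have x: "expands (\<lambda>k. d k + (- t) * c k) (\<lambda>z. \<psi> z + (- t) * e z)"
          by (intro expands_add expands_cmult d e)
        have "(\<lambda>k. d k + (- t) * c k) = (\<lambda>_. 0)"
        proof (rule nz[OF x coefficient_equation_linear[OF d(2) e(2)]])
          show "(odd (fst k), odd (snd k)) = p" if "d k + - t * c k \<noteq> 0" for k
            using that d(3)[of k] e(3)[of k] by (cases "d k = 0") auto
          show "d ?k0 + - t * c ?k0 = 0" using e(4) by (simp add: t_def)
        qed
        then have "d = (\<lambda>k. t * c k)" by (auto simp: fun_eq_iff)
        then have "expands (\<lambda>k. t * c k) \<psi>" using d(1) by simp
        then have "\<psi> = (\<lambda>z. t * e z)" by (rule expands_sum_unique[OF _ expands_cmult[OF e(1)]])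
        then show ?thesis using plane_vs.span_scale[OF plane_vs.span_base[of e "{e}"], of t] by simp
      qed
      then show ?thesis by blast
    next
      case False
      have "\<psi> = 0" if \<psi>: "\<psi> \<in> W p" for \<psi>
      proof -
        obtain d where d: "expands d \<psi>" "?eq d" "\<And>k. d k \<noteq> 0 \<Longrightarrow> (odd (fst k), odd (snd k)) = p"
          using \<psi> unfolding W_def by blast
        then have "d = (\<lambda>_. 0)" using False nz[OF d] by blast
        then have "\<psi> = (\<lambda>_. 0)" using d(1) expands_zero_coeff by blast
        then show "\<psi> = 0" by (simp add: fun_eq_iff)
      qed
      then show ?thesis using plane_vs.span_zero by blast
    qed
  qed
  have split: "\<exists>\<psi>1\<in>W (True, True). \<exists>\<psi>2\<in>W (True, False). \<exists>\<psi>3\<in>W (False, True). \<psi> = \<psi>1 + \<psi>2 + \<psi>3"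
    if \<psi>: "eigenfunction lam \<nu> \<mu> \<psi>" for \<psi>
  proof -
    obtain c where c: "expands c \<psi>" using \<psi> H4_iff_expands by (auto simp: eigenfunction_def)
    have eq: "?eq c" using \<psi> eigenfunction_iff[OF c] by blast
    have oc: "odd2 c" "sq_weighted 4 c" using c by (auto simp: expands_def)
    have supp: "parity_part p c k \<noteq> 0 \<Longrightarrow> (odd (fst k), odd (snd k)) = p" for p k
      by (auto simp: parity_part_def split: if_splits)
    have ex: "\<exists>\<phi>. expands (parity_part p c) \<phi>" for p
      by (intro expands_exists odd2_parity_part sq_weighted_parity_part oc)
    obtain \<psi>1 where 1: "expands (parity_part (True, True) c) \<psi>1" using ex by blast
    obtain \<psi>2 where 2: "expands (parity_part (True, False) c) \<psi>2" using ex by blast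
    obtain \<psi>3 where 3: "expands (parity_part (False, True) c) \<psi>3" using ex by blast
    have "parity_part (False, False) c k = 0" for k
      by (rule parity_part_zero[OF odd2_parity_part[OF oc(1)] sq_weighted_parity_part[OF oc(2)]
            coefficient_equation_parity_part[OF eq] pos supp]) blast+
    then have "c k = parity_part (True, True) c k + parity_part (True, False) c k + parity_part (False, True) c k" for k
      by (force simp: parity_part_def split: if_splits)
    then have "c = (\<lambda>k. parity_part (True, True) c k + parity_part (True, False) c k + parity_part (False, True) c k)"
      by (rule ext)
    moreover have "expands (\<lambda>k. parity_part (True, True) c k + parity_part (True, False) c k + parity_part (False, True) c k)
        (\<lambda>z. \<psi>1 z + \<psi>2 z + \<psi>3 z)" by (intro expands_add 1 2 3)
    ultimately have "expands c (\<lambda>z. \<psi>1 z + \<psi>2 z + \<psi>3 z)" by (simp only:)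
    then have "\<psi> = (\<lambda>z. \<psi>1 z + \<psi>2 z + \<psi>3 z)" by (rule expands_sum_unique[OF c])
    then have "\<psi> = \<psi>1 + \<psi>2 + \<psi>3" by (simp add: plus_fun_def)
    moreover have "\<psi>1 \<in> W (True, True)" "\<psi>2 \<in> W (True, False)" "\<psi>3 \<in> W (False, True)"
      using 1 2 3 coefficient_equation_parity_part[OF eq] supp unfolding W_def by blast+
    ultimately show ?thesis by blast
  qed
  obtain e1 e2 e3 where e: "W (True, True) \<subseteq> plane_vs.span {e1}" "W (True, False) \<subseteq> plane_vs.span {e2}"
    "W (False, True) \<subseteq> plane_vs.span {e3}" using one_dim by (metis prod.inject)
  have m: "plane_vs.span {e1} \<subseteq> plane_vs.span {e1, e2, e3}" "plane_vs.span {e2} \<subseteq> plane_vs.span {e1, e2, e3}"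
     "plane_vs.span {e3} \<subseteq> plane_vs.span {e1, e2, e3}" by (rule plane_vs.span_mono; simp)+
  have "{\<psi>. eigenfunction lam \<nu> \<mu> \<psi>} \<subseteq> plane_vs.span {e1, e2, e3}"
  proof
    fix \<psi> assume "\<psi> \<in> {\<psi>. eigenfunction lam \<nu> \<mu> \<psi>}"
    then obtain \<psi>1 \<psi>2 \<psi>3 where "\<psi>1 \<in> W (True, True)" "\<psi>2 \<in> W (True, False)" "\<psi>3 \<in> W (False, True)"
      and s: "\<psi> = \<psi>1 + \<psi>2 + \<psi>3" using split by blast
    then have "\<psi>1 \<in> plane_vs.span {e1, e2, e3}" "\<psi>2 \<in> plane_vs.span {e1, e2, e3}" "\<psi>3 \<in> plane_vs.span {e1, e2, e3}"
      using e m by blast+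
    then show "\<psi> \<in> plane_vs.span {e1, e2, e3}" unfolding s by (intro plane_vs.span_add)
  qed
  moreover have "card {e1, e2, e3} \<le> 3" by (simp add: card_insert_if)
  ultimately show "\<exists>T. finite T \<and> card T \<le> 3 \<and> {\<psi>. eigenfunction lam \<nu> \<mu> \<psi>} \<subseteq> plane_vs.span T"
    by (intro exI[of _ "{e1, e2, e3}"]) simp
  let ?V = "{\<psi>. eigenfunction lam \<nu> \<mu> \<psi>} \<inter> (E1 \<union> E2 \<union> E3)"
  have WV: "\<psi> \<in> plane_vs.span ?V" if \<psi>: "\<psi> \<in> W p" and p: "p \<noteq> (False, False)" for \<psi> p
  proof -
    obtain c where c: "expands c \<psi>" "?eq c" "\<And>k. c k \<noteq> 0 \<Longrightarrow> (odd (fst k), odd (snd k)) = p"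
      using \<psi> unfolding W_def by blast
    show ?thesis
    proof (cases "c = (\<lambda>_. 0)")
      case True
      then have "\<psi> = (\<lambda>_. 0)" using c(1) expands_zero_coeff by blast
      then have "\<psi> = 0" by (simp add: fun_eq_iff)
      then show ?thesis by (simp add: plane_vs.span_zero)
    next
      case False
      then have "eigenfunction lam \<nu> \<mu> \<psi>" using eigenfunction_iff[OF c(1)] c(2) by blast
      moreover have "\<psi> \<in> E1 \<union> E2 \<union> E3"
        using p c(3) unfolding Un_iff E_iff[OF c(1)] by (cases p) (metis (full_types) Pair_inject)
      ultimately show ?thesis by (intro plane_vs.span_base) blast
    qed
  qed
  show "{\<psi>. eigenfunction lam \<nu> \<mu> \<psi>} \<subseteq> plane_vs.span ?V"
  proof
    fix \<psi> assume "\<psi> \<in> {\<psi>. eigenfunction lam \<nu> \<mu> \<psi>}"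
    then obtain \<psi>1 \<psi>2 \<psi>3 where w: "\<psi>1 \<in> W (True, True)" "\<psi>2 \<in> W (True, False)" "\<psi>3 \<in> W (False, True)"
      and s: "\<psi> = \<psi>1 + \<psi>2 + \<psi>3" using split by blast
    show "\<psi> \<in> plane_vs.span ?V"
      unfolding s using WV[OF w(1)] WV[OF w(2)] WV[OF w(3)] by (intro plane_vs.span_add) simp_all
  qed
qed

section \<open>The bifurcating branch\<close>

lemma diss_decay_bound:
  assumes "0 \<le> \<mu>" "0 < \<nu>" shows "\<bar>diss \<mu> \<nu> k\<bar> \<le> (\<mu> + \<nu>) * jap k ^ 4"
proof -
  have j: "1 \<le> (jap k)\<^sup>2" by (intro one_le_power jap_ge_1)
  have k2: "kap k \<le> (jap k)\<^sup>2" "0 \<le> kap k" by (rule kap_le_jap kap_nonneg)+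
  have "(jap k)\<^sup>2 * 1 \<le> (jap k)\<^sup>2 * (jap k)\<^sup>2" by (rule mult_left_mono[OF j]) simp
  then have "kap k \<le> (jap k)\<^sup>2 * (jap k)\<^sup>2" using k2 by linarith
  moreover have "(kap k)\<^sup>2 \<le> (jap k)\<^sup>2 * (jap k)\<^sup>2" unfolding power2_eq_square[of "kap k"] using k2 by (intro mult_mono) auto
  moreover have "(jap k)\<^sup>2 * (jap k)\<^sup>2 = jap k ^ 4" by (simp flip: power_add)
  ultimately have "\<mu> * kap k + \<nu> * (kap k)\<^sup>2 \<le> \<mu> * jap k ^ 4 + \<nu> * jap k ^ 4"
    using assms by (intro add_mono mult_left_mono) auto
  moreover have "0 \<le> diss \<mu> \<nu> k" by (rule diss_nonneg[OF assms])
  ultimately show ?thesis by (simp add: diss_def distrib_right)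
qed

text \<open>Passage to the unknown \<open>diss * c\<close>. At the origin the inverse multiplier is
  0, in agreement with the vanishing of odd sequences there.\<close>

lemma lift_to_l2:
  assumes mn: "0 \<le> \<mu>" "0 < \<nu>" and c: "odd2 c" "sq_weighted 4 c"
  obtains u where "coord u = (\<lambda>k. diss \<mu> \<nu> k * c k)" "\<And>k. 1 / diss \<mu> \<nu> k * coord u k = c k" "odd2 (coord u)"
proof -
  have "sq_weighted 0 (\<lambda>k. diss \<mu> \<nu> k * c k)"
    by (rule sq_weighted_dominated[of 4 0 c _ "\<mu> + \<nu>"])
      (use c(2) diss_decay_bound[OF mn] in \<open>auto simp: abs_mult mult.assoc[symmetric] intro!: mult_right_mono\<close>)
  then have u: "coord (Abs_l2 (\<lambda>k. diss \<mu> \<nu> k * c k)) = (\<lambda>k. diss \<mu> \<nu> k * c k)"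
    by (intro coord_Abs_l2) (simp add: sq_weighted_def)
  have "1 / diss \<mu> \<nu> k * (diss \<mu> \<nu> k * c k) = c k" for k
  proof (cases "k = 0")
    case True then show ?thesis using odd2_axis[OF c(1), of k] by simp
  next
    case False then show ?thesis using diss_pos[OF mn False] by simp
  qed
  moreover have "odd2 (\<lambda>k. diss \<mu> \<nu> k * c k)"
    by (rule odd2_mult[OF _ c(1)]) (use even2_kap in \<open>simp add: even2_def diss_def\<close>)
  ultimately show ?thesis using that[of "Abs_l2 (\<lambda>k. diss \<mu> \<nu> k * c k)"] by (simp only: u)
qed

lemma conv_coeff_cmult: "conv_coeff a (\<lambda>k. r * b k) l = r * conv_coeff a b l"
proof -
  have "conv_coeff a (\<lambda>k. r * b k) l = (\<Sum>\<^sub>\<infinity>p. r * (real_of_int (fst p * snd l - snd p * fst l) / 16 * (a p * b (l - p))))"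
    unfolding conv_coeff_def by (intro infsum_cong) (simp only: mult.left_commute)
  then show ?thesis by (simp only: infsum_cmult_right' conv_coeff_def)
qed

lemma odd_delta_kap: "- kap k * odd_delta (2, 2) k = (- 2) * odd_delta (2, 2) k"
proof (cases "(\<bar>fst k\<bar>, \<bar>snd k\<bar>) = (2, 2)")
  case True
  then have "kap k = kap (2, 2)" using kap_abs[of k] by simp
  then show ?thesis by (simp add: kap_def)
qed (auto simp: odd_delta_def)

text \<open>The Laplacian multiplies psi0 by -2, so \<open>J(psi0, \<Delta> psi0)\<close> is 0 and
  the two cross terms combine to \<open>J(psi0, (2 + \<Delta>) w)\<close>, the operator of the
  spectral problem; the rest is quadratic in w.\<close>

lemma quadratic_term_expansion:
  fixes w :: "(int \<times> int) l2"
  assumes mn: "0 \<le> \<mu>" "0 < \<nu>"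
  defines "d \<equiv> \<lambda>k. 1 / diss \<mu> \<nu> k" and "e \<equiv> \<lambda>k. - kap k / diss \<mu> \<nu> k"
  shows "conv_coeff (\<lambda>k. odd_delta (2, 2) k + \<epsilon> * (d k * coord w k)) (\<lambda>k. - kap k * (odd_delta (2, 2) k + \<epsilon> * (d k * coord w k))) l
    = \<epsilon> * coord (vort_op (resp \<mu> \<nu>) w) l + \<epsilon>\<^sup>2 * coord (conv_op d e w w) l"
proof -
  have d3: "decays 3 d" unfolding d_def by (rule decays_mono[OF decays_inverse_diss[OF mn]]) simp
  have e1: "decays 1 e" unfolding e_def
    by (rule decays_mono[OF decays_kap_bounded[OF mn, of uminus]]) simp_all
  have r1: "decays 1 (resp \<mu> \<nu>)" by (rule decays_mono[OF decays_resp[OF mn]]) simp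
  have e: "e k = - kap k * d k" for k by (simp add: d_def e_def)
  \<comment> \<open>psi0 itself is lifted to l2, so that the expansion becomes bilinearity of
    \<open>conv_op\<close>.\<close>
  obtain v where v: "\<And>k. d k * coord v k = odd_delta (2, 2) k"
    unfolding d_def using lift_to_l2[OF mn odd2_odd_delta] psi0_expands by (metis expands_def)
  have ev: "e k * coord v k = (- 2) * odd_delta (2, 2) k" for k
    unfolding e mult.assoc v by (rule odd_delta_kap)
  interpret Q: bounded_bilinear "conv_op d e" by (rule bounded_bilinear_conv_op[OF d3 e1])
  note Qc = coord_conv_op[OF d3 e1]
  have "conv_coeff (\<lambda>k. odd_delta (2, 2) k + \<epsilon> * (d k * coord w k)) (\<lambda>k. - kap k * (odd_delta (2, 2) k + \<epsilon> * (d k * coord w k))) l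
      = coord (conv_op d e (v + \<epsilon> *\<^sub>R w) (v + \<epsilon> *\<^sub>R w)) l"
  proof -
    have 1: "(\<lambda>k. odd_delta (2, 2) k + \<epsilon> * (d k * coord w k)) = (\<lambda>k. d k * coord (v + \<epsilon> *\<^sub>R w) k)"
      by (rule ext) (simp add: v[symmetric] algebra_simps)
    have 2: "(\<lambda>k. - kap k * (odd_delta (2, 2) k + \<epsilon> * (d k * coord w k))) = (\<lambda>k. e k * coord (v + \<epsilon> *\<^sub>R w) k)"
      by (rule ext) (simp add: e v[symmetric] algebra_simps)
    show ?thesis unfolding 2 Qc unfolding 1 ..
  qed
  also have "\<dots> = coord (conv_op d e v v) l + \<epsilon> * (coord (conv_op d e v w) l + coord (conv_op d e w v) l)
      + \<epsilon>\<^sup>2 * coord (conv_op d e w w) l"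
    by (simp add: Q.add_left Q.add_right Q.scaleR_left Q.scaleR_right power2_eq_square algebra_simps)
  also have "coord (conv_op d e v v) l = 0"
    using conv_coeff_anti[of "odd_delta (2, 2)" "odd_delta (2, 2)" l] unfolding Qc v ev conv_coeff_cmult by simp
  also have "coord (conv_op d e v w) l + coord (conv_op d e w v) l = coord (vort_op (resp \<mu> \<nu>) w) l"
  proof -
    have "coord (conv_op d e v w) l = vort_coeff (\<lambda>k. e k * coord w k) l"
      unfolding Qc v conv_coeff_odd_delta ..
    moreover have "coord (conv_op d e w v) l = 2 * vort_coeff (\<lambda>k. d k * coord w k) l"
      unfolding Qc ev conv_coeff_cmult conv_coeff_odd_delta[symmetric]
      using conv_coeff_anti[of "\<lambda>k. d k * coord w k" "odd_delta (2, 2)" l] by simp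
    ultimately have "coord (conv_op d e v w) l + coord (conv_op d e w v) l
        = vort_coeff (\<lambda>k. e k * coord w k + 2 * (d k * coord w k)) l" by (simp add: vort_coeff_linear)
    also have "(\<lambda>k. e k * coord w k + 2 * (d k * coord w k)) = (\<lambda>k. resp \<mu> \<nu> k * coord w k)"
      by (rule ext) (simp add: e d_def resp_def diff_divide_distrib algebra_simps)
    finally show ?thesis by (simp add: coord_vort_op[OF r1])
  qed
  finally show ?thesis by simp
qed

text \<open>Scaling both parameters by \<open>1 + \<epsilon> \<delta>\<close> multiplies the
  dissipation of the deviation from psi0 by this factor, so the steady-state equation is
  \<open>\<epsilon>^2\<close> times the one solved by
  \<open>bifurcating_coefficients\<close>.\<close>

lemma bifurcation:
  assumes crit: "critical_solution \<nu> \<mu> \<psi>c" and mn: "0 < \<nu>" "0 \<le> \<mu>" and E: "\<psi>c \<in> E1 \<union> E2 \<union> E3"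
  shows "\<exists>\<epsilon>0>0. \<exists>(\<Psi> :: real \<Rightarrow> plane_fun) (\<delta> :: real \<Rightarrow> real) (C :: real).
    \<forall>\<epsilon>. 0 < \<epsilon> \<and> \<epsilon> < \<epsilon>0 \<longrightarrow>
      \<Psi> \<epsilon> \<in> H4 \<and> L2_inner (\<Psi> \<epsilon>) \<psi>c = 0 \<and> H4_norm (\<Psi> \<epsilon>) \<le> C \<and> \<bar>\<delta> \<epsilon>\<bar> \<le> C \<and>
      steady_state (\<nu> + \<epsilon> * \<delta> \<epsilon> * \<nu>) (\<mu> + \<epsilon> * \<delta> \<epsilon> * \<mu>) (\<lambda>z. psi0 z + \<epsilon> * \<psi>c z + \<epsilon>\<^sup>2 * \<Psi> \<epsilon> z)"
proof -
  define d where "d = (\<lambda>k. 1 / diss \<mu> \<nu> k)"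
  define e where "e = (\<lambda>k. - kap k / diss \<mu> \<nu> k)"
  obtain c where c: "expands c \<psi>c" using crit H4_iff_expands by (auto simp: critical_solution_def eigenfunction_def)
  have ceq: "c \<noteq> (\<lambda>_. 0)" "coefficient_equation \<mu> \<nu> c"
    using crit eigenfunction_iff[OF c, of 0 \<nu> \<mu>] by (auto simp: critical_solution_def)
  have oc: "odd2 c" "sq_weighted 4 c" using c by (auto simp: expands_def)
  obtain uc where uc: "coord uc = (\<lambda>k. diss \<mu> \<nu> k * c k)" "\<And>k. d k * coord uc k = c k" "odd2 (coord uc)"
    unfolding d_def using lift_to_l2[OF mn(2,1) oc] by blast
  have d4: "decays 4 d" unfolding d_def by (rule decays_inverse_diss[OF mn(2,1)])
  have d0: "decays 0 d" by (rule decays_mono[OF d4]) simp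
  have ed: "even2 d" unfolding d_def using even2_diss[of "\<lambda>_. 1" \<mu> \<nu>] by simp
  have r1: "decays 1 (resp \<mu> \<nu>)" by (rule decays_mono[OF decays_resp[OF mn(2,1)]]) simp
  obtain s t where st: "(s, t) \<in> {(1, 1), (0, 1), (1, 0)}" "\<And>k. c k \<noteq> 0 \<Longrightarrow> even (s * fst k + t * snd k)"
    and ee: "\<And>k. even (fst k) \<Longrightarrow> even (snd k) \<Longrightarrow> c k = 0"
  proof -
    \<comment> \<open>The pair (s, t) names the combination of indices that is even in the class: n
      + m, m and n respectively.\<close>
    consider "\<psi>c \<in> E1" | "\<psi>c \<in> E2" | "\<psi>c \<in> E3" using E by blast
    then show ?thesis
    proof cases
      case 1
      then have p: "c k \<noteq> 0 \<Longrightarrow> odd (fst k) \<and> odd (snd k)" for k using E_iff(1)[OF c] by blast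
      show ?thesis
      proof (rule that[of 1 1])
        show "even (1 * fst k + 1 * snd k)" if "c k \<noteq> 0" for k using p[OF that] by simp
        show "c k = 0" if "even (fst k)" "even (snd k)" for k using p[of k] that by blast
      qed simp
    next
      case 2
      then have p: "c k \<noteq> 0 \<Longrightarrow> odd (fst k) \<and> even (snd k)" for k using E_iff(2)[OF c] by blast
      show ?thesis
      proof (rule that[of 0 1])
        show "even (0 * fst k + 1 * snd k)" if "c k \<noteq> 0" for k using p[OF that] by simp
        show "c k = 0" if "even (fst k)" "even (snd k)" for k using p[of k] that by blast
      qed simp
    next
      case 3
      then have p: "c k \<noteq> 0 \<Longrightarrow> even (fst k) \<and> odd (snd k)" for k using E_iff(3)[OF c] by blast
      show ?thesis
      proof (rule that[of 1 0])
        show "even (1 * fst k + 0 * snd k)" if "c k \<noteq> 0" for k using p[OF that] by simp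
        show "c k = 0" if "even (fst k)" "even (snd k)" for k using p[of k] that by blast
      qed simp
    qed
  qed
  have ucV: "uc \<in> parity_space s t"
  proof -
    have "coord uc k = 0" if "odd (s * fst k + t * snd k)" for k
      using st(2)[of k] that unfolding uc(1) by (cases "c k = 0") simp_all
    then show ?thesis using uc(3) unfolding parity_space_def by blast
  qed
  have rc: "resp \<mu> \<nu> k * coord uc k = (2 - kap k) * c k" for k
  proof -
    have "resp \<mu> \<nu> k = (2 - kap k) * d k" by (simp add: resp_def d_def)
    then show ?thesis by (simp add: mult.assoc uc(2))
  qed
  have uc0: "uc + vort_op (resp \<mu> \<nu>) uc = 0"
  proof (rule l2_eqI)
    fix k
    have "(\<mu> * kap k + \<nu> * (kap k)\<^sup>2) * c k + vort_coeff (\<lambda>k. (2 - kap k) * c k) k = 0"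
      using ceq(2) unfolding coefficient_equation_def by (rule spec)
    then show "coord (uc + vort_op (resp \<mu> \<nu>) uc) k = coord 0 k"
      by (simp add: coord_vort_op[OF r1] rc) (simp add: uc(1) diss_def)
  qed
  have "uc \<noteq> 0"
  proof
    assume "uc = 0"
    then have "c k = 0" for k using uc(2)[of k] by simp
    then show False using ceq(1) by blast
  qed
  then have "\<exists>e0>0. \<exists>C. \<forall>\<epsilon>. 0 < \<epsilon> \<and> \<epsilon> < e0 \<longrightarrow> (\<exists>u\<in>parity_space s t. \<exists>\<delta>. norm u \<le> C \<and> \<bar>\<delta>\<bar> \<le> C \<and>
    inner (mult_op d u) (mult_op d uc) = 0 \<and>
    u + vort_op (resp \<mu> \<nu>) u + \<delta> *\<^sub>R (uc + \<epsilon> *\<^sub>R u) + conv_op d e (uc + \<epsilon> *\<^sub>R u) (uc + \<epsilon> *\<^sub>R u) = 0)"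
    unfolding d_def e_def
    by (rule bifurcating_coefficients[OF mn(2,1) st(1) ucV uc0]) (simp add: uc(1) ee)
  then obtain e0 C where e0: "e0 > 0" and ex: "\<And>\<epsilon>. 0 < \<epsilon> \<Longrightarrow> \<epsilon> < e0 \<Longrightarrow>
    \<exists>u\<in>parity_space s t. \<exists>\<delta>. norm u \<le> C \<and> \<bar>\<delta>\<bar> \<le> C \<and>
    inner (mult_op d u) (mult_op d uc) = 0 \<and>
    u + vort_op (resp \<mu> \<nu>) u + \<delta> *\<^sub>R (uc + \<epsilon> *\<^sub>R u) + conv_op d e (uc + \<epsilon> *\<^sub>R u) (uc + \<epsilon> *\<^sub>R u) = 0"
    by blast
  \<comment> \<open>The \<open>H4\<close> weight grows with the same fourth order with which d
    decays.\<close>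
  obtain K where K: "K \<ge> 0" "\<And>k. (1 + (kap k)\<^sup>2) * \<bar>d k\<bar> \<le> K"
  proof -
    obtain B where B: "\<And>k. jap k ^ 4 * \<bar>d k\<bar> \<le> B" using d4 by (auto simp: decays_def)
    have le: "(1 + (kap k)\<^sup>2) * \<bar>d k\<bar> \<le> 2 * B" for k
    proof -
      have "(1 + (kap k)\<^sup>2) * \<bar>d k\<bar> \<le> (2 * jap k ^ 4) * \<bar>d k\<bar>" by (intro mult_right_mono H4_weight_jap) auto
      then show ?thesis using B[of k] by simp
    qed
    moreover have "0 \<le> 2 * B" by (rule order_trans[OF _ le[of 0]]) simp
    ultimately show ?thesis using that by blast
  qed
  \<comment> \<open>One constant has to serve both bounds: \<open>K + 1\<close> dominates K for the
    \<open>H4\<close> norm and 1 for \<delta>.\<close>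
  have main: "\<exists>\<Psi> \<delta>. \<Psi> \<in> H4 \<and> L2_inner \<Psi> \<psi>c = 0 \<and> H4_norm \<Psi> \<le> (K + 1) * C \<and> \<bar>\<delta>\<bar> \<le> (K + 1) * C \<and>
      steady_state (\<nu> + \<epsilon> * \<delta> * \<nu>) (\<mu> + \<epsilon> * \<delta> * \<mu>) (\<lambda>z. psi0 z + \<epsilon> * \<psi>c z + \<epsilon>\<^sup>2 * \<Psi> z)"
    if eps: "0 < \<epsilon>" "\<epsilon> < e0" for \<epsilon>
  proof -
    obtain u \<delta> where u: "u \<in> parity_space s t" "norm u \<le> C" "\<bar>\<delta>\<bar> \<le> C" "inner (mult_op d u) (mult_op d uc) = 0"
      "u + vort_op (resp \<mu> \<nu>) u + \<delta> *\<^sub>R (uc + \<epsilon> *\<^sub>R u) + conv_op d e (uc + \<epsilon> *\<^sub>R u) (uc + \<epsilon> *\<^sub>R u) = 0"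
      using ex[OF eps] by blast
    have C0: "0 \<le> C" using u(3) by linarith
    have "odd2 (coord u)" using u(1) by (simp add: parity_space_def)
    then obtain \<Psi> where \<Psi>: "expands (\<lambda>k. d k * coord u k) \<Psi>"
      using expands_exists[OF expands_decays[OF d4 ed]] by blast
    define w where "w = uc + \<epsilon> *\<^sub>R u"
    define q where "q = (\<lambda>k. odd_delta (2, 2) k + \<epsilon> * (d k * coord w k))"
    have "expands (\<lambda>k. odd_delta (2, 2) k + \<epsilon> * c k + \<epsilon>\<^sup>2 * (d k * coord u k)) (\<lambda>z. psi0 z + \<epsilon> * \<psi>c z + \<epsilon>\<^sup>2 * \<Psi> z)"
      by (intro expands_add expands_cmult psi0_expands c \<Psi>)
    moreover have "(\<lambda>k. odd_delta (2, 2) k + \<epsilon> * c k + \<epsilon>\<^sup>2 * (d k * coord u k)) = q"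
      by (rule ext) (simp add: q_def w_def uc(2)[symmetric] power2_eq_square algebra_simps)
    ultimately have q: "expands q (\<lambda>z. psi0 z + \<epsilon> * \<psi>c z + \<epsilon>\<^sup>2 * \<Psi> z)" by simp
    have dw: "diss \<mu> \<nu> k * (d k * coord w k) = coord w k" for k
    proof (cases "k = 0")
      case True
      have "odd2 (coord w)" using ucV u(1) by (auto simp: w_def parity_space_def odd2_def)
      then show ?thesis using True odd2_axis[of "coord w" k] by simp
    next
      case False then show ?thesis using diss_pos[OF mn(2,1) False] by (simp add: d_def)
    qed
    have "steady_state (\<nu> + \<epsilon> * \<delta> * \<nu>) (\<mu> + \<epsilon> * \<delta> * \<mu>) (\<lambda>z. psi0 z + \<epsilon> * \<psi>c z + \<epsilon>\<^sup>2 * \<Psi> z)"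
    proof (rule steady_stateI[OF q])
      fix l
      interpret B: bounded_linear "vort_op (resp \<mu> \<nu>)" by (rule bounded_linear_vort_op[OF r1])
      have lin: "coord w l + coord (vort_op (resp \<mu> \<nu>) w) l = \<epsilon> * coord (u + vort_op (resp \<mu> \<nu>) u) l"
      proof -
        have "w + vort_op (resp \<mu> \<nu>) w = (uc + vort_op (resp \<mu> \<nu>) uc) + \<epsilon> *\<^sub>R (u + vort_op (resp \<mu> \<nu>) u)"
          by (simp add: w_def B.add B.scaleR algebra_simps)
        then have "coord (w + vort_op (resp \<mu> \<nu>) w) l = coord (\<epsilon> *\<^sub>R (u + vort_op (resp \<mu> \<nu>) u)) l"
          by (simp only: uc0 add_0_left)
        then show ?thesis by simp
      qed
      have zero: "coord (u + vort_op (resp \<mu> \<nu>) u) l + \<delta> * coord w l + coord (conv_op d e w w) l = 0"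
      proof -
        have "coord (u + vort_op (resp \<mu> \<nu>) u + \<delta> *\<^sub>R w + conv_op d e w w) l = 0"
          using u(5) by (simp only: w_def coord_simps(1))
        then show ?thesis by simp
      qed
      have damping: "((\<mu> + \<epsilon> * \<delta> * \<mu>) * kap l + (\<nu> + \<epsilon> * \<delta> * \<nu>) * (kap l)\<^sup>2) * (q l - odd_delta (2, 2) l)
          = (1 + \<epsilon> * \<delta>) * (\<epsilon> * coord w l)"
      proof -
        have "((\<mu> + \<epsilon> * \<delta> * \<mu>) * kap l + (\<nu> + \<epsilon> * \<delta> * \<nu>) * (kap l)\<^sup>2) * (q l - odd_delta (2, 2) l)
          = (1 + \<epsilon> * \<delta>) * (\<epsilon> * (diss \<mu> \<nu> l * (d l * coord w l)))"
          by (simp add: q_def diss_def algebra_simps)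
        then show ?thesis by (simp only: dw)
      qed
      have quad: "conv_coeff q (\<lambda>k. - kap k * q k) l
          = \<epsilon> * coord (vort_op (resp \<mu> \<nu>) w) l + \<epsilon>\<^sup>2 * coord (conv_op d e w w) l"
        unfolding q_def d_def e_def by (rule quadratic_term_expansion[OF mn(2,1)])
      have "conv_coeff q (\<lambda>k. - kap k * q k) l
          + ((\<mu> + \<epsilon> * \<delta> * \<mu>) * kap l + (\<nu> + \<epsilon> * \<delta> * \<nu>) * (kap l)\<^sup>2) * (q l - odd_delta (2, 2) l)
          = \<epsilon> * (coord w l + coord (vort_op (resp \<mu> \<nu>) w) l) + \<epsilon> * \<epsilon> * (\<delta> * coord w l)
            + \<epsilon> * \<epsilon> * coord (conv_op d e w w) l"
        unfolding damping quad by (simp add: power2_eq_square algebra_simps)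
      also have "\<dots> = \<epsilon> * \<epsilon> * (coord (u + vort_op (resp \<mu> \<nu>) u) l + \<delta> * coord w l + coord (conv_op d e w w) l)"
        by (simp only: lin distrib_left mult.assoc)
      also have "\<dots> = 0" by (simp only: zero mult_zero_right)
      finally show "conv_coeff q (\<lambda>k. - kap k * q k) l
          + ((\<mu> + \<epsilon> * \<delta> * \<mu>) * kap l + (\<nu> + \<epsilon> * \<delta> * \<nu>) * (kap l)\<^sup>2) * (q l - odd_delta (2, 2) l) = 0" .
    qed
    moreover have "\<Psi> \<in> H4" using \<Psi> H4_iff_expands by blast
    moreover have "L2_inner \<Psi> \<psi>c = 0"
      using u(4) unfolding L2_inner_expands[OF \<Psi> c] by (simp add: inner_l2_def coord_mult_op[OF d0] uc(2))
    moreover have "H4_norm \<Psi> \<le> (K + 1) * C"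
    proof -
      have "H4_norm \<Psi> \<le> K * norm u"
      proof (rule H4_norm_le[OF \<Psi> K(1)])
        fix k show "(1 + (kap k)\<^sup>2) * \<bar>d k * coord u k\<bar> \<le> K * \<bar>coord u k\<bar>"
          using mult_right_mono[OF K(2)[of k], of "\<bar>coord u k\<bar>"] by (simp add: abs_mult mult.assoc)
      qed
      also have "\<dots> \<le> (K + 1) * C" using u(2) K(1) C0 by (intro mult_mono) auto
      finally show ?thesis .
    qed
    moreover have "\<bar>\<delta>\<bar> \<le> (K + 1) * C"
      using u(3) K(1) C0 mult_right_mono[of 1 "K + 1" C] by simp
    ultimately show ?thesis by blast
  qed
  define good where "good \<epsilon> \<Psi> \<delta> \<longleftrightarrow> \<Psi> \<in> H4 \<and> L2_inner \<Psi> \<psi>c = 0 \<and> H4_norm \<Psi> \<le> (K + 1) * C \<and>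
      \<bar>\<delta>\<bar> \<le> (K + 1) * C \<and> steady_state (\<nu> + \<epsilon> * \<delta> * \<nu>) (\<mu> + \<epsilon> * \<delta> * \<mu>)
        (\<lambda>z. psi0 z + \<epsilon> * \<psi>c z + \<epsilon>\<^sup>2 * \<Psi> z)" for \<epsilon> \<delta> :: real and \<Psi>
  have "\<exists>\<Psi> \<delta>. good \<epsilon> \<Psi> \<delta>" if "0 < \<epsilon>" "\<epsilon> < e0" for \<epsilon>
    unfolding good_def by (rule main[OF that])
  \<comment> \<open>With the range of \<epsilon> inside the existential quantifiers, the choice
    yields functions on all reals.\<close>
  then have "\<forall>\<epsilon>. \<exists>\<Psi> \<delta>. 0 < \<epsilon> \<and> \<epsilon> < e0 \<longrightarrow> good \<epsilon> \<Psi> \<delta>" by blast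
  then obtain \<Psi> \<delta> where g: "\<forall>\<epsilon>. 0 < \<epsilon> \<and> \<epsilon> < e0 \<longrightarrow> good \<epsilon> (\<Psi> \<epsilon>) (\<delta> \<epsilon>)" by metis
  show ?thesis
    by (rule exI[of _ e0], rule conjI[OF e0], rule exI[of _ \<Psi>], rule exI[of _ \<delta>], rule exI[of _ "(K + 1) * C"])
      (rule g[unfolded good_def])
qed

text \<open>Eigenfunctions of different classes with the same parameters add up to eigenfunctions
  outside \<open>E1 \<union> E2 \<union> E3\<close>, so the containment in part (i) is expressed by
  a basis of the eigenspace. In part (ii) the constant C, fixed before \<epsilon>, expresses uniform
  boundedness.\<close>

theorem theorem1p1:
  shows "(\<forall>lam \<nu> \<mu> :: real. \<nu> > 0 \<and> \<mu> \<ge> 0 \<and> lam + \<mu> + \<nu> / 2 > 0 \<longrightarrow>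
            (\<forall>B. B \<subseteq> {\<psi>. eigenfunction lam \<nu> \<mu> \<psi>} \<and> plane_vs.independent B
                 \<longrightarrow> finite B \<and> card B \<le> 3) \<and>
            (\<exists>B. B \<subseteq> {\<psi>. eigenfunction lam \<nu> \<mu> \<psi>} \<and> plane_vs.independent B \<and>
                 {\<psi>. eigenfunction lam \<nu> \<mu> \<psi>} \<subseteq> plane_vs.span B \<and>
                 B \<subseteq> E1 \<union> E2 \<union> E3))
       \<and>
         (\<forall>(\<nu>c::real) (\<mu>c::real) \<psi>c.
            critical_solution \<nu>c \<mu>c \<psi>c \<and> \<nu>c > 0 \<and> \<mu>c \<ge> 0 \<and> \<psi>c \<in> E1 \<union> E2 \<union> E3 \<longrightarrow>
            (\<exists>\<epsilon>0 > 0. \<exists>(\<Psi> :: real \<Rightarrow> plane_fun) (\<delta> :: real \<Rightarrow> real) (C :: real).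
               \<forall>\<epsilon>. 0 < \<epsilon> \<and> \<epsilon> < \<epsilon>0 \<longrightarrow>
                 \<Psi> \<epsilon> \<in> H4 \<and> L2_inner (\<Psi> \<epsilon>) \<psi>c = 0 \<and>
                 H4_norm (\<Psi> \<epsilon>) \<le> C \<and> \<bar>\<delta> \<epsilon>\<bar> \<le> C \<and>
                 steady_state (\<nu>c + \<epsilon> * \<delta> \<epsilon> * \<nu>c) (\<mu>c + \<epsilon> * \<delta> \<epsilon> * \<mu>c)
                   (\<lambda>z. psi0 z + \<epsilon> * \<psi>c z + \<epsilon>\<^sup>2 * \<Psi> \<epsilon> z)))"
proof (intro conjI allI impI)
  fix lam \<nu> \<mu> :: real and B :: "plane_fun set"
  assume p: "\<nu> > 0 \<and> \<mu> \<ge> 0 \<and> lam + \<mu> + \<nu> / 2 > 0"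
    and B: "B \<subseteq> {\<psi>. eigenfunction lam \<nu> \<mu> \<psi>} \<and> plane_vs.independent B"
  obtain T where T: "finite T" "card T \<le> 3" "{\<psi>. eigenfunction lam \<nu> \<mu> \<psi>} \<subseteq> plane_vs.span T"
    using eigenfunctions_spanned(1)[of \<nu> lam \<mu>] p by blast
  have "finite B \<and> card B \<le> card T"
    by (rule plane_vs.independent_span_bound[OF T(1)]) (use B T(3) in auto)
  then show "finite B" "card B \<le> 3" using T(2) by auto
next
  fix lam \<nu> \<mu> :: real
  assume p: "\<nu> > 0 \<and> \<mu> \<ge> 0 \<and> lam + \<mu> + \<nu> / 2 > 0"
  let ?S = "{\<psi>. eigenfunction lam \<nu> \<mu> \<psi>}"
  \<comment> \<open>Maximal independence is taken among the eigenfunctions that already lie in a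
    class, because these span the whole eigenspace.\<close>
  obtain B where B: "B \<subseteq> ?S \<inter> (E1 \<union> E2 \<union> E3)" "plane_vs.independent B"
    "?S \<inter> (E1 \<union> E2 \<union> E3) \<subseteq> plane_vs.span B"
    using plane_vs.maximal_independent_subset[of "?S \<inter> (E1 \<union> E2 \<union> E3)"] by blast
  have "plane_vs.span (?S \<inter> (E1 \<union> E2 \<union> E3)) \<subseteq> plane_vs.span B"
    by (rule plane_vs.span_minimal[OF B(3) plane_vs.subspace_span])
  then have "?S \<subseteq> plane_vs.span B" using eigenfunctions_spanned(2)[of \<nu> lam \<mu>] p by blast
  then show "\<exists>B. B \<subseteq> ?S \<and> plane_vs.independent B \<and> ?S \<subseteq> plane_vs.span B \<and> B \<subseteq> E1 \<union> E2 \<union> E3"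
    using B(1,2) by (intro exI[of _ B]) blast
next
  fix \<nu>c \<mu>c :: real and \<psi>c
  assume "critical_solution \<nu>c \<mu>c \<psi>c \<and> \<nu>c > 0 \<and> \<mu>c \<ge> 0 \<and> \<psi>c \<in> E1 \<union> E2 \<union> E3"
  then show "\<exists>\<epsilon>0>0. \<exists>(\<Psi> :: real \<Rightarrow> plane_fun) (\<delta> :: real \<Rightarrow> real) (C :: real).
               \<forall>\<epsilon>. 0 < \<epsilon> \<and> \<epsilon> < \<epsilon>0 \<longrightarrow>
                 \<Psi> \<epsilon> \<in> H4 \<and> L2_inner (\<Psi> \<epsilon>) \<psi>c = 0 \<and>
                 H4_norm (\<Psi> \<epsilon>) \<le> C \<and> \<bar>\<delta> \<epsilon>\<bar> \<le> C \<and>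
                 steady_state (\<nu>c + \<epsilon> * \<delta> \<epsilon> * \<nu>c) (\<mu>c + \<epsilon> * \<delta> \<epsilon> * \<mu>c)
                   (\<lambda>z. psi0 z + \<epsilon> * \<psi>c z + \<epsilon>\<^sup>2 * \<Psi> \<epsilon> z)"
    by (intro bifurcation) auto
qed

end
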